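(* Let $n\ge 4$, $2\le r\le n-2$, $e\ge 1$, and let $a_1\ge\cdots\ge a_r\ge 0$ and $0\le b_1\le\cdots\le b_{n-r}$ be integers with $a_1+\cdots+a_r=b_1+\cdots+b_{n-r}=e$. Then the intersection of the loci $M(b_\bullet)$ and $M'(a_\bullet)$ in $\mathrm{Mor}_e(\mathbb{P}^1,G(r,n))$ is nonempty and generically transverse. Furthermore, if either of the splitting types $\{a_\bullet\}$ or $\{b_\bullet\}$ is balanced, then the intersection is transverse.
   Context: $\mathbb{K}$ is an algebraically closed field of characteristic zero and $\mathbb{P}^1=\mathbb{P}^1_{\mathbb{K}}$. $G(r,n)$ is the Grassmannian of $r$-dimensional subspaces of an $n$-dimensional $\mathbb{K}$-vector space, with universal sub-bundle $\mathcal{S}$ and universal quotient bundle $\mathcal{Q}$ fitting in $0\to\mathcal{S}\to\mathcal{O}^{\oplus n}\to\mathcal{Q}\to 0$. $M=\mathrm{Mor}_e(\mathbb{P}^1,G(r,n))$ is the (smooth) scheme parametrizing degree $e$ morphisms $\mathbb{P}^1\to G(r,n)$. $M(b_\bullet)\subset M$ is the (smooth, locally closed) locus of morphisms $f$ with $f^*\mathcal{Q}\cong\mathcal{O}(b_1)\oplus\cdots\oplus\mathcal{O}(b_{n-r})$, and $M'(a_\bullet)\subset M$ is the (smooth, locally closed) locus of morphisms $f$ with $f^*\mathcal{S}\cong\mathcal{O}(-a_1)\oplus\cdots\oplus\mathcal{O}(-a_r)$. A splitting type $\{\alpha_1,\dots,\alpha_\nu\}$ is balanced if $\alpha_j-\alpha_i\le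 1$ for all $i,j$. The intersection is transverse at a point $f\in M(b_\bullet)\cap M'(a_\bullet)$ if $T_fM(b_\bullet)+T_fM'(a_\bullet)=T_fM$; it is transverse if this holds at every point of the intersection. Generic transversality is used in the sense that there is a point of $M(b_\bullet)\cap M'(a_\bullet)$ at which the intersection is transverse (hence it is transverse along a nonempty open subset of the intersection). *)

theory Defs
  imports
    "Jordan_Normal_Form.VS_Connect"
    "Jordan_Normal_Form.DL_Submatrix"
    "Jordan_Normal_Form.Determinant"
    "HOL-Computational_Algebra.Polynomial"
    "HOL-Library.Poly_Mapping"
    "HOL-Library.FuncSet"
begin

section \<open>The projective line and its line bundles\<close>

text \<open>
  Points of the projective line are given by homogeneous coordinates \<open>(s, t) \<noteq> (0, 0)\<close>, and a
  subset of the line by the set of all homogeneous coordinates of its points, that is, by a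
  scaling-invariant set of nonzero vectors.
\<close>

definition binary_form :: "nat \<Rightarrow> ('k::field \<times> 'k \<Rightarrow> 'k) \<Rightarrow> bool" where
  "binary_form d h \<longleftrightarrow> (\<exists>c. h = (\<lambda>(s, t). \<Sum>k\<le>d. c k * s ^ k * t ^ (d - k)))"

definition P1 :: "('k::field \<times> 'k) set" where
  "P1 = UNIV - {(0, 0)}"

definition P1_open :: "('k::field \<times> 'k) set \<Rightarrow> bool" where
  "P1_open U \<longleftrightarrow>
     (\<exists>H. (\<forall>h\<in>H. \<exists>d. binary_form d h) \<and> U = {v\<in>P1. \<exists>h\<in>H. h v \<noteq> 0})"

text \<open>
  Sections of \<open>\<O>(d)\<close> over \<open>U\<close>: functions on the cone over \<open>U\<close> that are locally quotients \<open>g / h\<close>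
  of forms with \<open>deg g - deg h = d\<close>. The open sets \<open>h \<noteq> 0\<close> form a basis, so it is enough to
  let the neighbourhoods be of this shape.
\<close>

definition line_bundle_sections :: "int \<Rightarrow> ('k::field \<times> 'k) set \<Rightarrow> ('k \<times> 'k \<Rightarrow> 'k) set" where
  "line_bundle_sections d U =
     {\<phi> \<in> extensional U. \<forall>v\<in>U. \<exists>i j g h.
        binary_form i g \<and> binary_form j h \<and> int i - int j = d \<and> h v \<noteq> 0 \<and>
        (\<forall>u\<in>U. h u \<noteq> 0 \<longrightarrow> \<phi> u = g u / h u)}"


section \<open>Sheaves of modules on the projective line\<close>

text \<open>
  All sheaves of modules needed here are sheaves of sections of a vector bundle, so a section
  over \<open>U\<close> is a function on \<open>U\<close>, and restriction is restriction of functions. The module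
  operations are given pointwise, by an addition and a scalar multiplication in the fibre at
  each point.
\<close>

record ('k, 'x) sheaf_of_modules =
  sections :: "('k \<times> 'k) set \<Rightarrow> ('k \<times> 'k \<Rightarrow> 'x) set"
  fibre_add :: "'k \<times> 'k \<Rightarrow> 'x \<Rightarrow> 'x \<Rightarrow> 'x"
  fibre_scale :: "'k \<times> 'k \<Rightarrow> 'k \<Rightarrow> 'x \<Rightarrow> 'x"

definition sheaf_iso ::
  "('k::field, 'x) sheaf_of_modules \<Rightarrow> ('k, 'y) sheaf_of_modules \<Rightarrow> bool" where
  "sheaf_iso F G \<longleftrightarrow> (\<exists>\<psi>. \<forall>U. P1_open U \<longrightarrow>
     bij_betw (\<psi> U) (sections F U) (sections G U) \<and>
     (\<forall>\<sigma>\<in>sections F U. \<forall>\<tau>\<in>sections F U.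
        \<psi> U (\<lambda>v\<in>U. fibre_add F v (\<sigma> v) (\<tau> v)) = (\<lambda>v\<in>U. fibre_add G v (\<psi> U \<sigma> v) (\<psi> U \<tau> v))) \<and>
     (\<forall>c\<in>line_bundle_sections 0 U. \<forall>\<sigma>\<in>sections F U.
        \<psi> U (\<lambda>v\<in>U. fibre_scale F v (c v) (\<sigma> v)) = (\<lambda>v\<in>U. fibre_scale G v (c v) (\<psi> U \<sigma> v))) \<and>
     (\<forall>V. P1_open V \<longrightarrow> V \<subseteq> U \<longrightarrow>
        (\<forall>\<sigma>\<in>sections F U. \<psi> V (restrict \<sigma> V) = restrict (\<psi> U \<sigma>) V)))"

text \<open>The bundle \<open>\<O>(d\<^sub>1) \<oplus> \<dots> \<oplus> \<O>(d\<^sub>m)\<close> for \<open>ds = [d\<^sub>1, \<dots>, d\<^sub>m]\<close>.\<close>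

definition sum_line_bundles :: "int list \<Rightarrow> ('k::field, 'k vec) sheaf_of_modules" where
  "sum_line_bundles ds =
     \<lparr>sections = (\<lambda>U. {\<sigma> \<in> extensional U.
        (\<forall>v\<in>U. \<sigma> v \<in> carrier_vec (length ds)) \<and>
        (\<forall>i<length ds. (\<lambda>v\<in>U. \<sigma> v $ i) \<in> line_bundle_sections (ds ! i) U)}),
      fibre_add = (\<lambda>v x y. x + y),
      fibre_scale = (\<lambda>v c x. c \<cdot>\<^sub>v x)\<rparr>"

abbreviation trivial_bundle :: "nat \<Rightarrow> ('k::field, 'k vec) sheaf_of_modules" where
  "trivial_bundle n \<equiv> sum_line_bundles (replicate n 0)"


section \<open>Morphisms to the Grassmannian\<close>

definition Grassmannian :: "nat \<Rightarrow> nat \<Rightarrow> 'k::field vec set set" where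
  "Grassmannian r n =
     {W. VectorSpace.subspace class_ring W (module_vec TYPE('k) n) \<and>
         vectorspace.dim class_ring ((module_vec TYPE('k) n)\<lparr>carrier := W\<rparr>) = r}"

text \<open>
  Pluecker coordinates are indexed by the \<open>r\<close>-element subsets of \<open>{0..<n}\<close>. The vector \<open>p\<close>
  represents \<open>W\<close> if it consists of the maximal minors of a matrix whose columns form a
  basis of \<open>W\<close>; over all bases these are exactly the nonzero multiples of one vector.
\<close>

definition pluecker_indices :: "nat \<Rightarrow> nat \<Rightarrow> nat set set" where
  "pluecker_indices r n = {I. I \<subseteq> {..<n} \<and> card I = r}"

definition pluecker :: "nat \<Rightarrow> nat \<Rightarrow> 'k::field vec set \<Rightarrow> (nat set \<Rightarrow> 'k) \<Rightarrow> bool" where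
  "pluecker r n W p \<longleftrightarrow>
     (\<exists>A\<in>carrier_mat n r. vec_space.col_space n A = W \<and>
        (\<forall>I\<in>pluecker_indices r n. p I = det (submatrix A I UNIV)))"

text \<open>
  A morphism from the projective line to the Grassmannian is represented by the function \<open>f\<close>
  sending homogeneous coordinates of a point to its image. It has degree \<open>e\<close> if its composite
  with the Pluecker embedding is given by forms of degree \<open>e\<close> without common zero. A tuple of such
  forms is represented by the family \<open>P\<close> of its coefficients, \<open>P (I, k)\<close> being the coefficient of
  \<open>s\<^sup>k t\<^sup>e\<^sup>-\<^sup>k\<close> in the form indexed by \<open>I\<close>. It is determined by \<open>f\<close> up to a nonzero scalar, so
  it gives homogeneous coordinates of \<open>f\<close> as a point of the projective space of tuples of forms;
  the scheme of morphisms is a locally closed subscheme of this projective space. Absence of common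
  zeros is automatic from the last clause.
\<close>

type_synonym 'k form_tuple = "nat set \<times> nat \<Rightarrow> 'k"

type_synonym 'k grass_map = "'k \<times> 'k \<Rightarrow> 'k vec set"

definition eval_forms :: "nat \<Rightarrow> 'k::field form_tuple \<Rightarrow> 'k \<times> 'k \<Rightarrow> nat set \<Rightarrow> 'k" where
  "eval_forms e P = (\<lambda>(s, t) I. \<Sum>k\<le>e. P (I, k) * s ^ k * t ^ (e - k))"

definition coordinates ::
  "nat \<Rightarrow> nat \<Rightarrow> nat \<Rightarrow> 'k::field grass_map \<Rightarrow> 'k form_tuple \<Rightarrow> bool" where
  "coordinates e r n f P \<longleftrightarrow>
     (\<forall>x. x \<notin> pluecker_indices r n \<times> {..e} \<longrightarrow> P x = 0) \<and>
     (\<forall>v\<in>P1. f v \<in> Grassmannian r n \<and> pluecker r n (f v) (eval_forms e P v))"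

definition Mor :: "nat \<Rightarrow> nat \<Rightarrow> nat \<Rightarrow> 'k::field grass_map set" where
  "Mor e r n = {f \<in> extensional P1. \<exists>P. coordinates e r n f P}"


section \<open>Pullbacks of the universal bundles and splitting loci\<close>

definition pullback_sub :: "nat \<Rightarrow> 'k::field grass_map \<Rightarrow> ('k, 'k vec) sheaf_of_modules" where
  "pullback_sub n f =
     (trivial_bundle n)
       \<lparr>sections := (\<lambda>U. {\<sigma> \<in> sections (trivial_bundle n) U. \<forall>v\<in>U. \<sigma> v \<in> f v})\<rparr>"

definition vec_coset :: "'k::field vec \<Rightarrow> 'k vec set \<Rightarrow> 'k vec set" where
  "vec_coset x W = {x + w |w. w \<in> W}"

text \<open>
  The fibre of the pullback of the universal quotient bundle at \<open>v\<close> consists of the cosets of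
  \<open>f v\<close>, and a section is a family of cosets that locally lifts to a section of the trivial
  bundle. In the scalar multiplication the summand \<open>w\<close> matters only for the scalar \<open>0\<close>.
\<close>

definition pullback_quot :: "nat \<Rightarrow> 'k::field grass_map \<Rightarrow> ('k, 'k vec set) sheaf_of_modules" where
  "pullback_quot n f =
     \<lparr>sections = (\<lambda>U. {q \<in> extensional U. \<forall>v\<in>U. \<exists>V. P1_open V \<and> v \<in> V \<and> V \<subseteq> U \<and>
        (\<exists>\<sigma>\<in>sections (trivial_bundle n) V. \<forall>u\<in>V. q u = vec_coset (\<sigma> u) (f u))}),
      fibre_add = (\<lambda>v X Y. {x + y |x y. x \<in> X \<and> y \<in> Y}),
      fibre_scale = (\<lambda>v c X. {c \<cdot>\<^sub>v x + w |x w. x \<in> X \<and> w \<in> f v})\<rparr>"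

definition locus_quot :: "nat \<Rightarrow> nat \<Rightarrow> nat \<Rightarrow> nat list \<Rightarrow> 'k::field grass_map set" where
  "locus_quot e r n b =
     {f \<in> Mor e r n. sheaf_iso (pullback_quot n f) (sum_line_bundles (map int b))}"

definition locus_sub :: "nat \<Rightarrow> nat \<Rightarrow> nat \<Rightarrow> nat list \<Rightarrow> 'k::field grass_map set" where
  "locus_sub e r n a =
     {f \<in> Mor e r n. sheaf_iso (pullback_sub n f) (sum_line_bundles (map (\<lambda>i. - int i) a))}"

definition balanced :: "nat list \<Rightarrow> bool" where
  "balanced xs \<longleftrightarrow> (\<forall>x\<in>set xs. \<forall>y\<in>set xs. int y - int x \<le> 1)"


section \<open>Tangent spaces and transversality\<close>

text \<open>
  Polynomials in variables from \<open>'x\<close>, evaluated in an algebra with structure map \<open>\<iota>\<close>. The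
  derivative of \<open>F\<close> at \<open>p\<close> in direction \<open>w\<close> is the linear coefficient of \<open>F (p + T w)\<close> as a
  polynomial in \<open>T\<close>.
\<close>

definition mpoly_eval ::
  "('a::zero \<Rightarrow> 'b::comm_semiring_1) \<Rightarrow> (('x \<Rightarrow>\<^sub>0 nat) \<Rightarrow>\<^sub>0 'a) \<Rightarrow> ('x \<Rightarrow> 'b) \<Rightarrow> 'b" where
  "mpoly_eval \<iota> F g =
     (\<Sum>m\<in>Poly_Mapping.keys F. \<iota> (Poly_Mapping.lookup F m) *
        (\<Prod>x\<in>Poly_Mapping.keys m. g x ^ Poly_Mapping.lookup m x))"

definition directional_deriv ::
  "(('x \<Rightarrow>\<^sub>0 nat) \<Rightarrow>\<^sub>0 'k::field) \<Rightarrow> ('x \<Rightarrow> 'k) \<Rightarrow> ('x \<Rightarrow> 'k) \<Rightarrow> 'k" where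
  "directional_deriv F p w = poly.coeff (mpoly_eval (\<lambda>c. [:c:]) F (\<lambda>x. [:p x, w x:])) 1"

text \<open>
  The Zariski tangent space, at the point with homogeneous coordinates \<open>P\<close>, of the locally
  closed set \<open>Z\<close> of morphisms with its reduced structure (the loci in question being smooth,
  this is their scheme structure). It is given as the tangent space of the affine cone over
  \<open>Z\<close>: this contains \<open>P\<close>, and the tangent space of \<open>Z\<close> itself is its quotient by the line
  spanned by \<open>P\<close>. Since that line lies in all the spaces involved, equations between sums of tangent
  spaces can be tested on the cones.
\<close>

definition tangent_space ::
  "nat \<Rightarrow> nat \<Rightarrow> nat \<Rightarrow> 'k::field grass_map set \<Rightarrow> 'k form_tuple \<Rightarrow> 'k form_tuple set" where
  "tangent_space e r n Z P =
     {w. \<forall>F. (\<forall>f\<in>Z. \<forall>R. coordinates e r n f R \<longrightarrow> mpoly_eval (\<lambda>c. c) F R = 0)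
           \<longrightarrow> directional_deriv F P w = 0}"

definition transverse_at ::
  "nat \<Rightarrow> nat \<Rightarrow> nat \<Rightarrow> 'k::field grass_map set \<Rightarrow> 'k grass_map set \<Rightarrow> 'k grass_map \<Rightarrow> bool" where
  "transverse_at e r n Y Z f \<longleftrightarrow>
     (\<forall>P. coordinates e r n f P \<longrightarrow>
        {(\<lambda>x. u x + w x) |u w. u \<in> tangent_space e r n Y P \<and> w \<in> tangent_space e r n Z P}
          = tangent_space e r n (Mor e r n) P)"

definition transverse ::
  "nat \<Rightarrow> nat \<Rightarrow> nat \<Rightarrow> 'k::field grass_map set \<Rightarrow> 'k grass_map set \<Rightarrow> bool" where
  "transverse e r n Y Z \<longleftrightarrow> (\<forall>f\<in>Y \<inter> Z. transverse_at e r n Y Z f)"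

definition generically_transverse ::
  "nat \<Rightarrow> nat \<Rightarrow> nat \<Rightarrow> 'k::field grass_map set \<Rightarrow> 'k grass_map set \<Rightarrow> bool" where
  "generically_transverse e r n Y Z \<longleftrightarrow> (\<exists>f\<in>Y \<inter> Z. transverse_at e r n Y Z f)"

end

theory Submission
  imports Defs "Jordan_Normal_Form.DL_Rank"
begin

text \<open>
  Write \<open>m = n - r\<close>. A morphism \<open>f\<close> in the intersection of the two loci is the same as a pair of matrices of
  forms: the composite of an isomorphism of \<open>\<O>(-a\<^sub>1) \<oplus> \<dots> \<oplus> \<O>(-a\<^sub>r)\<close> with the
  pullback of \<open>\<S>\<close> and of the inclusion into the trivial bundle is an \<open>n \<times> r\<close> matrix \<open>A\<close> whose column \<open>j\<close> consists of
  forms of degree \<open>a\<^sub>j\<close>, and the composite of the projection to the pullback of \<open>\<Q>\<close> and of an isomorphism with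
  \<open>\<O>(b\<^sub>1) \<oplus> \<dots> \<oplus> \<O>(b\<^sub>m)\<close> is an \<open>m \<times> n\<close> matrix \<open>B\<close> whose row \<open>i\<close> consists of forms of
  degree \<open>b\<^sub>i\<close>. At every point \<open>v\<close> the space \<open>f v\<close> is the image of \<open>A v\<close> and the kernel of \<open>B v\<close>
  (\<open>locus_sub_matrix\<close>, \<open>locus_quot_matrix\<close>), and conversely matrices of this kind that form an exact sequence at every point
  define a morphism in the loci (\<open>locus_subI\<close>, \<open>locus_quotI\<close>).

  The deformations of \<open>f\<close> are the global sections of the bundle of homomorphisms from the pullback of \<open>\<S>\<close> to that of \<open>\<Q>\<close>,
  hence are given by \<open>m \<times> r\<close> matrices \<open>C\<close> with an entry of degree \<open>b\<^sub>i + a\<^sub>j\<close> in place \<open>(i, j)\<close>. Moving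
  \<open>A\<close> to \<open>A + T A'\<close> keeps \<open>f\<close> in the locus of type \<open>a\<close> and is the deformation \<open>B A'\<close>; moving \<open>B\<close> to \<open>B + T B'\<close> keeps
  \<open>f\<close> in the locus of type \<open>b\<close> and is the deformation \<open>- B' A\<close>. So the intersection is transverse at \<open>f\<close> as soon as every
  \<open>C\<close> can be written as \<open>B A' + B' A\<close> (\<open>transverse_at_criterion\<close>). To relate this to Zariski tangent spaces in Pluecker
  coordinates, two facts are needed. A tangent vector to the space of all morphisms satisfies the linearised Pluecker
  relations at each point, so at each point it comes from a first order change \<open>A'\<close> of the matrix; the entries of \<open>B A'\<close>
  are independent of the choice of \<open>A'\<close>, hence regular, hence forms (\<open>tangent_Mor_representation\<close>,
  \<open>normal_direction_formula\<close>, \<open>regular_imp_form\<close>). Conversely the curve \<open>A + T A'\<close> remains in its locus for all but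
  finitely many values of \<open>T\<close>, so a polynomial that vanishes on the locus vanishes identically on the curve, and the
  derivative of the curve is a tangent vector (\<open>no_common_zero_open\<close>, \<open>tangent_locus_sub\<close>, \<open>tangent_locus_quot\<close>).

  If \<open>a\<close> is balanced, then \<open>C = B A'\<close> can be solved: the obstruction lies in the first cohomology of a sum of line bundles
  \<open>\<O>(a\<^sub>j - a\<^sub>i)\<close>, all of degree at least \<open>-1\<close>. Concretely, the equation has a polynomial solution on the affine line, and
  as long as its degree is too large, its leading coefficient is killed by \<open>B\<close>, hence is in the image of \<open>A\<close> at infinity and
  can be removed (\<open>solve_column\<close>). The case of balanced \<open>b\<close> follows by transposing all matrices.

  For arbitrary \<open>a\<close> and \<open>b\<close> a suitable point is given by monomial matrices, constructed by recursion in the manner of the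
  Euclidean algorithm (\<open>special_pair_step\<close>). They have an echelon shape with the entries \<open>t ^ b\<^sub>i\<close> of \<open>B\<close> and
  \<open>s ^ a\<^sub>j\<close> of \<open>A\<close> as pivots. As every form of degree \<open>b\<^sub>i + a\<^sub>j\<close> is a combination of \<open>t ^ b\<^sub>i\<close> and
  \<open>s ^ a\<^sub>j\<close>, elimination writes any \<open>C\<close> as \<open>B A' + B' A\<close> (\<open>decomposition_triangular\<close>).
\<close>

section \<open>Forms and regular functions on the projective line\<close>

text \<open>
  Forms of degree \<open>d\<close>, forms with coefficients in another ring, and sections of \<open>\<O>(d)\<close> over an open set
  all obey the same rules for sums and products. The locale makes degree computations for minors available for all of them at once.
\<close>

locale graded_functions =
  fixes P :: "'d::comm_monoid_add \<Rightarrow> ('v \<Rightarrow> 'b::comm_ring_1) \<Rightarrow> bool"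
  assumes zero: "P d (\<lambda>v. 0)"
    and one: "P 0 (\<lambda>v. 1)"
    and add: "P d f \<Longrightarrow> P d g \<Longrightarrow> P d (\<lambda>v. f v + g v)"
    and uminus: "P d f \<Longrightarrow> P d (\<lambda>v. - f v)"
    and mult: "P d f \<Longrightarrow> P d' g \<Longrightarrow> P (d + d') (\<lambda>v. f v * g v)"
begin

lemma sum: "(\<And>a. a \<in> S \<Longrightarrow> P d (f a)) \<Longrightarrow> P d (\<lambda>v. \<Sum>a\<in>S. f a v)"
  by (induction S rule: infinite_finite_induct) (auto simp: zero add)

lemma prod: "(\<And>a. a \<in> S \<Longrightarrow> P (d a) (f a)) \<Longrightarrow> P (\<Sum>a\<in>S. d a) (\<lambda>v. \<Prod>a\<in>S. f a v)"
  by (induction S rule: infinite_finite_induct) (auto simp: one mult)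

lemma det:
  assumes M: "\<And>v. M v \<in> carrier_mat N N"
    and deg: "\<And>i j. i < N \<Longrightarrow> j < N \<Longrightarrow> P (d i + g j) (\<lambda>v. M v $$ (i, j))"
  shows "P ((\<Sum>i<N. d i) + (\<Sum>j<N. g j)) (\<lambda>v. det (M v))"
proof -
  have summand: "P ((\<Sum>i<N. d i) + (\<Sum>j<N. g j)) (\<lambda>v. signof p * (\<Prod>i = 0..<N. M v $$ (i, p i)))"
    if p: "p permutes {0..<N}" for p
  proof -
    have "P (\<Sum>i = 0..<N. d i + g (p i)) (\<lambda>v. \<Prod>i = 0..<N. M v $$ (i, p i))"
      using p by (intro prod deg) (auto dest: permutes_in_image[of p "{0..<N}"])
    moreover have "(\<Sum>i = 0..<N. d i + g (p i)) = (\<Sum>i<N. d i) + (\<Sum>j<N. g j)"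
      using sum.permute[OF p, of g] by (simp add: sum.distrib atLeast0LessThan comp_def)
    ultimately have "P ((\<Sum>i<N. d i) + (\<Sum>j<N. g j)) (\<lambda>v. \<Prod>i = 0..<N. M v $$ (i, p i))"
      by simp
    then show ?thesis
      using uminus by (cases "evenperm p") (auto simp: sign_def)
  qed
  have "P ((\<Sum>i<N. d i) + (\<Sum>j<N. g j))
      (\<lambda>v. \<Sum>p | p permutes {0..<N}. signof p * (\<Prod>i = 0..<N. M v $$ (i, p i)))"
    by (rule sum) (use summand in auto)
  then show ?thesis
    by (simp add: det_def'[OF M])
qed

end

text \<open>
  Binary forms with coefficients in an algebra over the ground field with structure map \<open>\<iota>\<close>; the variables
  still take values in the ground field. With coefficients in \<open>\<K>[T]\<close> these are one-parameter families of forms.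
\<close>

definition form_over :: "('k::field \<Rightarrow> 'b::comm_ring_1) \<Rightarrow> nat \<Rightarrow> ('k \<times> 'k \<Rightarrow> 'b) \<Rightarrow> bool" where
  "form_over \<iota> d h \<longleftrightarrow> (\<exists>c. h = (\<lambda>(s, t). \<Sum>k\<le>d. c k * \<iota> (s ^ k * t ^ (d - k))))"

lemma form_over_id: "form_over (\<lambda>x. x) = binary_form"
  by (intro ext) (simp add: form_over_def binary_form_def mult.assoc)

lemma form_over_monomial:
  assumes "k \<le> d" shows "form_over \<iota> d (\<lambda>(s, t). c * \<iota> (s ^ k * t ^ (d - k)))"
  unfolding form_over_def
  by (rule exI[of _ "\<lambda>l. if l = k then c else 0"])
    (use assms in \<open>auto simp: fun_eq_iff if_distrib[of "\<lambda>x. x * _"] sum.delta cong: if_cong\<close>)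

lemma form_over_zero: "form_over \<iota> d (\<lambda>v. 0)"
  unfolding form_over_def by (rule exI[of _ "\<lambda>l. 0"]) auto

lemma form_over_add:
  assumes "form_over \<iota> d f" "form_over \<iota> d g" shows "form_over \<iota> d (\<lambda>v. f v + g v)"
proof -
  obtain c c' where "f = (\<lambda>(s, t). \<Sum>k\<le>d. c k * \<iota> (s ^ k * t ^ (d - k)))"
    "g = (\<lambda>(s, t). \<Sum>k\<le>d. c' k * \<iota> (s ^ k * t ^ (d - k)))"
    using assms unfolding form_over_def by blast
  then show ?thesis
    unfolding form_over_def
    by (intro exI[of _ "\<lambda>k. c k + c' k"]) (auto simp: fun_eq_iff sum.distrib distrib_right)
qed

lemma form_over_cmult:
  assumes "form_over \<iota> d f" shows "form_over \<iota> d (\<lambda>v. b * f v)"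
proof -
  obtain c where "f = (\<lambda>(s, t). \<Sum>k\<le>d. c k * \<iota> (s ^ k * t ^ (d - k)))"
    using assms unfolding form_over_def by blast
  then show ?thesis
    unfolding form_over_def
    by (intro exI[of _ "\<lambda>k. b * c k"]) (auto simp: fun_eq_iff sum_distrib_left mult.assoc)
qed

lemma form_over_sum:
  "(\<And>a. a \<in> S \<Longrightarrow> form_over \<iota> d (f a)) \<Longrightarrow> form_over \<iota> d (\<lambda>v. \<Sum>a\<in>S. f a v)"
  by (induction S rule: infinite_finite_induct) (auto simp: form_over_zero form_over_add)

lemma form_over_mult:
  fixes \<iota> :: "'k::field \<Rightarrow> 'b::comm_ring_1"
  assumes hom: "\<And>x y. \<iota> (x * y) = \<iota> x * \<iota> y"
    and "form_over \<iota> d f" "form_over \<iota> d' g"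
  shows "form_over \<iota> (d + d') (\<lambda>v. f v * g v)"
proof -
  obtain c c' where f: "f = (\<lambda>(s, t). \<Sum>k\<le>d. c k * \<iota> (s ^ k * t ^ (d - k)))"
    and g: "g = (\<lambda>(s, t). \<Sum>k\<le>d'. c' k * \<iota> (s ^ k * t ^ (d' - k)))"
    using assms unfolding form_over_def by blast
  have "form_over \<iota> (d + d') (\<lambda>v. \<Sum>k\<le>d. \<Sum>l\<le>d'. (\<lambda>(s, t).
      (c k * c' l) * \<iota> (s ^ (k + l) * t ^ (d + d' - (k + l)))) v)"
    by (intro form_over_sum form_over_monomial) auto
  moreover have "(\<lambda>v. \<Sum>k\<le>d. \<Sum>l\<le>d'. (\<lambda>(s, t).
      (c k * c' l) * \<iota> (s ^ (k + l) * t ^ (d + d' - (k + l)))) v) = (\<lambda>v. f v * g v)"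
  proof (rule ext)
    fix v :: "'k \<times> 'k"
    obtain s t where v: "v = (s, t)" by (cases v)
    have "(c k * c' l) * \<iota> (s ^ (k + l) * t ^ (d + d' - (k + l)))
        = (c k * \<iota> (s ^ k * t ^ (d - k))) * (c' l * \<iota> (s ^ l * t ^ (d' - l)))"
      if "k \<le> d" "l \<le> d'" for k l
    proof -
      have "d + d' - (k + l) = (d - k) + (d' - l)" using that by simp
      then have "s ^ (k + l) * t ^ (d + d' - (k + l)) = (s ^ k * t ^ (d - k)) * (s ^ l * t ^ (d' - l))"
        by (simp add: power_add mult.assoc mult.left_commute)
      then show ?thesis by (simp add: hom mult.assoc mult.left_commute)
    qed
    then show "(\<Sum>k\<le>d. \<Sum>l\<le>d'. (\<lambda>(s, t).
        (c k * c' l) * \<iota> (s ^ (k + l) * t ^ (d + d' - (k + l)))) v) = f v * g v"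
      unfolding f g v by (simp add: sum_product)
  qed
  ultimately show ?thesis by simp
qed

lemma form_over_graded:
  fixes \<iota> :: "'a::field \<Rightarrow> 'b::comm_ring_1"
  assumes "\<iota> 1 = 1" "\<And>x y. \<iota> (x * y) = \<iota> x * \<iota> y"
  shows "graded_functions (form_over \<iota>)"
proof
  fix d d' :: nat and f g :: "'a \<times> 'a \<Rightarrow> 'b"
  show "form_over \<iota> d (\<lambda>v. 0)" by (rule form_over_zero)
  show "form_over \<iota> 0 (\<lambda>v. 1)"
    using form_over_monomial[of 0 0 \<iota> 1] assms(1) by (simp add: case_prod_unfold)
  show "form_over \<iota> d (\<lambda>v. f v + g v)" if "form_over \<iota> d f" "form_over \<iota> d g"
    using that by (rule form_over_add)
  show "form_over \<iota> d (\<lambda>v. - f v)" if "form_over \<iota> d f"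
    using form_over_cmult[OF that, of "-1"] by simp
  show "form_over \<iota> (d + d') (\<lambda>v. f v * g v)" if "form_over \<iota> d f" "form_over \<iota> d' g"
    using form_over_mult[OF assms(2)] that by blast
qed

interpretation form: graded_functions binary_form
  using form_over_graded[of "\<lambda>x. x"] by (simp add: form_over_id)

lemma form_cmult: "binary_form d h \<Longrightarrow> binary_form d (\<lambda>v. b * h v)"
  using form_over_cmult[of "\<lambda>x. x"] by (simp add: form_over_id)

lemma form_const: "binary_form 0 (\<lambda>v. b)"
  using form_cmult[OF form.one, of b] by simp

lemma form_monomial: "k \<le> d \<Longrightarrow> binary_form d (\<lambda>(s, t). c * (s ^ k * t ^ (d - k)))"
  using form_over_monomial[of k d "\<lambda>x. x"] by (simp add: form_over_id)

lemma form_fst_power: "binary_form d (\<lambda>v. fst v ^ d)"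
  using form_monomial[of d d 1] by (simp add: case_prod_unfold)

lemma form_snd_power: "binary_form d (\<lambda>v. snd v ^ d)"
  using form_monomial[of 0 d 1] by (simp add: case_prod_unfold)

lemma form_fst: "binary_form 1 fst"
  using form_fst_power[of 1] by simp

lemma form_snd: "binary_form 1 snd"
  using form_snd_power[of 1] by simp

lemma form_power: "binary_form d h \<Longrightarrow> binary_form (m * d) (\<lambda>v. h v ^ m)"
proof (induction m)
  case 0
  then show ?case using form.one by simp
next
  case (Suc m)
  then show ?case using form.mult[of d h "m * d"] by (simp add: add.commute)
qed

lemma form_homogeneous:
  assumes "binary_form d h" shows "h (c * s, c * t) = c ^ d * h (s, t)"
proof -
  obtain a where h: "h = (\<lambda>(s, t). \<Sum>k\<le>d. a k * s ^ k * t ^ (d - k))"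
    using assms unfolding binary_form_def by blast
  have "a k * (c * s) ^ k * (c * t) ^ (d - k) = c ^ d * (a k * s ^ k * t ^ (d - k))" if "k \<le> d" for k
  proof -
    have "c ^ d = c ^ k * c ^ (d - k)" using that by (simp flip: power_add)
    then show ?thesis by (simp add: power_mult_distrib mult_ac)
  qed
  then have "(\<Sum>k\<le>d. a k * (c * s) ^ k * (c * t) ^ (d - k))
      = (\<Sum>k\<le>d. c ^ d * (a k * s ^ k * t ^ (d - k)))"
    by (intro sum.cong) auto
  then show ?thesis unfolding h by (simp add: sum_distrib_left)
qed

lemma form_swap:
  assumes "binary_form d h" shows "binary_form d (\<lambda>v. h (prod.swap v))"
proof -
  obtain a where h: "h = (\<lambda>(s, t). \<Sum>k\<le>d. a k * s ^ k * t ^ (d - k))"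
    using assms unfolding binary_form_def by blast
  have "binary_form d (\<lambda>v. \<Sum>k\<le>d. (\<lambda>(s, t). a k * (s ^ (d - k) * t ^ (d - (d - k)))) v)"
    by (intro form.sum form_monomial) auto
  moreover have "(\<lambda>v. \<Sum>k\<le>d. (\<lambda>(s, t). a k * (s ^ (d - k) * t ^ (d - (d - k)))) v) = (\<lambda>v. h (prod.swap v))"
  proof (rule ext)
    fix v :: "'a \<times> 'a"
    show "(\<Sum>k\<le>d. (\<lambda>(s, t). a k * (s ^ (d - k) * t ^ (d - (d - k)))) v) = h (prod.swap v)"
      unfolding h by (cases v) (auto intro!: sum.cong simp: mult_ac)
  qed
  ultimately show ?thesis by simp
qed

definition homogenize :: "nat \<Rightarrow> 'k::field poly \<Rightarrow> 'k \<times> 'k \<Rightarrow> 'k" where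
  "homogenize d p = (\<lambda>(s, t). \<Sum>k\<le>d. poly.coeff p k * s ^ k * t ^ (d - k))"

lemma homogenize_form: "binary_form d (homogenize d p)"
  unfolding binary_form_def homogenize_def by blast

lemma form_dehomogenize:
  assumes "binary_form d h"
  obtains p where "degree p \<le> d" "h = homogenize d p"
proof -
  obtain a where h: "h = (\<lambda>(s, t). \<Sum>k\<le>d. a k * s ^ k * t ^ (d - k))"
    using assms unfolding binary_form_def by blast
  let ?p = "\<Sum>k\<le>d. Polynomial.monom (a k) k"
  have "poly.coeff ?p k = (if k \<le> d then a k else 0)" for k
    by (simp add: coeff_sum)
  then have "h = homogenize d ?p" "degree ?p \<le> d"
    unfolding h homogenize_def by (auto intro!: degree_le sum.cong simp: fun_eq_iff)
  then show thesis using that by blast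
qed

lemma homogenize_affine:
  assumes "degree p \<le> d" shows "homogenize d p (x, 1) = poly p x"
proof -
  have "poly p x = (\<Sum>k\<le>d. poly.coeff p k * x ^ k)"
    unfolding poly_altdef
    by (rule sum.mono_neutral_left) (use assms in \<open>auto intro: coeff_eq_0\<close>)
  then show ?thesis by (simp add: homogenize_def)
qed

lemma homogenize_infinity: "homogenize d p (1, 0) = poly.coeff p d"
proof -
  have "homogenize d p (1, 0) = (\<Sum>k\<le>d. if k = d then poly.coeff p k else 0)"
    unfolding homogenize_def prod.case by (rule sum.cong) (auto simp: power_0_left)
  then show ?thesis by simp
qed

lemma P1_iff: "(s, t) \<in> P1 \<longleftrightarrow> s \<noteq> 0 \<or> t \<noteq> 0"
  by (auto simp: P1_def)

lemma form_coefficients_unique: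
  fixes c c' :: "nat \<Rightarrow> 'k::field_char_0"
  assumes "\<And>x. (\<Sum>k\<le>d. c k * x ^ k * 1 ^ (d - k)) = (\<Sum>k\<le>d. c' k * x ^ k * 1 ^ (d - k))"
    and "k \<le> d"
  shows "c k = c' k"
proof -
  let ?p = "\<lambda>c. \<Sum>k\<le>d. Polynomial.monom (c k :: 'k) k"
  have "poly (?p c) x = poly (?p c') x" for x
    using assms(1)[of x] by (simp add: poly_sum poly_monom)
  then have "?p c = ?p c'" by (simp flip: poly_eq_poly_eq_iff add: fun_eq_iff)
  then have "poly.coeff (?p c) k = poly.coeff (?p c') k" by simp
  then show ?thesis using assms(2) by (simp add: coeff_sum)
qed

text \<open>
  The defining condition for sections of \<open>\<O>(d)\<close>, without the requirement that values outside of \<open>U\<close> be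
  \<open>undefined\<close>; so it can be applied to unrestricted functions.
\<close>

definition regular :: "int \<Rightarrow> ('k::field \<times> 'k) set \<Rightarrow> ('k \<times> 'k \<Rightarrow> 'k) \<Rightarrow> bool" where
  "regular d U \<phi> \<longleftrightarrow> (\<forall>v\<in>U. \<exists>i j g h. binary_form i g \<and> binary_form j h \<and> int i - int j = d \<and>
     h v \<noteq> 0 \<and> (\<forall>u\<in>U. h u \<noteq> 0 \<longrightarrow> \<phi> u = g u / h u))"

lemma line_bundle_sections_iff:
  "\<phi> \<in> line_bundle_sections d U \<longleftrightarrow> \<phi> \<in> extensional U \<and> regular d U \<phi>"
  by (simp add: line_bundle_sections_def regular_def)

lemma regular_cong: "(\<And>v. v \<in> U \<Longrightarrow> \<phi> v = \<psi> v) \<Longrightarrow> regular d U \<phi> \<longleftrightarrow> regular d U \<psi>"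
  unfolding regular_def by (intro ball_cong ex_cong1 conj_cong) auto

lemma regularI:
  assumes "\<And>v. v \<in> U \<Longrightarrow> \<exists>i j g h. binary_form i g \<and> binary_form j h \<and> int i - int j = d \<and>
     h v \<noteq> 0 \<and> (\<forall>u\<in>U. h u \<noteq> 0 \<longrightarrow> \<phi> u = g u / h u)"
  shows "regular d U \<phi>"
  using assms unfolding regular_def by blast

lemma fractionI:
  assumes "binary_form i g" "binary_form j h" "int i - int j = d" "h v \<noteq> 0"
    "\<And>u. u \<in> U \<Longrightarrow> h u \<noteq> 0 \<Longrightarrow> \<phi> u = g u / h u"
  shows "\<exists>i j g h. binary_form i g \<and> binary_form j h \<and> int i - int j = d \<and>
     h v \<noteq> 0 \<and> (\<forall>u\<in>U. h u \<noteq> 0 \<longrightarrow> \<phi> u = g u / h u)"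
  using assms by (intro exI conjI ballI impI)

lemma regular_subset:
  assumes "regular d U \<phi>" "V \<subseteq> U" shows "regular d V \<phi>"
proof (rule regularI)
  fix v assume "v \<in> V"
  then have "v \<in> U" using assms(2) by blast
  with assms(1) obtain i g j h where gh: "binary_form i g" "binary_form j h" "int i - int j = d" "h v \<noteq> 0"
    "\<And>u. u \<in> U \<Longrightarrow> h u \<noteq> 0 \<Longrightarrow> \<phi> u = g u / h u"
    unfolding regular_def by blast
  then show "\<exists>i j g h. binary_form i g \<and> binary_form j h \<and> int i - int j = d \<and>
     h v \<noteq> 0 \<and> (\<forall>u\<in>V. h u \<noteq> 0 \<longrightarrow> \<phi> u = g u / h u)"
    using assms(2) by (intro fractionI[OF gh(1,2)]) auto
qed

lemma regular_form: "binary_form i g \<Longrightarrow> regular (int i) U g"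
  by (rule regularI, rule fractionI[OF _ form.one]) auto

lemma regular_local:
  assumes "\<And>v. v \<in> U \<Longrightarrow> \<exists>l k. binary_form l k \<and> k v \<noteq> 0 \<and> regular d {u \<in> U. k u \<noteq> 0} \<phi>"
  shows "regular d U \<phi>"
proof (rule regularI)
  fix v assume v: "v \<in> U"
  then obtain l k where k: "binary_form l k" "k v \<noteq> 0" "regular d {u \<in> U. k u \<noteq> 0} \<phi>"
    using assms by blast
  have "v \<in> {u \<in> U. k u \<noteq> 0}" using v k by simp
  with k(3) obtain i g j h where gh: "binary_form i g" "binary_form j h" "int i - int j = d" "h v \<noteq> 0"
    "\<And>u. u \<in> {u \<in> U. k u \<noteq> 0} \<Longrightarrow> h u \<noteq> 0 \<Longrightarrow> \<phi> u = g u / h u"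
    unfolding regular_def by blast
  show "\<exists>i j g h. binary_form i g \<and> binary_form j h \<and> int i - int j = d \<and>
     h v \<noteq> 0 \<and> (\<forall>u\<in>U. h u \<noteq> 0 \<longrightarrow> \<phi> u = g u / h u)"
    using gh k by (intro fractionI[OF form.mult[OF gh(1) k(1)] form.mult[OF gh(2) k(1)]]) auto
qed

lemma regular_divide:
  assumes "regular d U \<phi>" "regular d' U \<psi>" "\<And>v. v \<in> U \<Longrightarrow> \<psi> v \<noteq> 0"
  shows "regular (d - d') U (\<lambda>v. \<phi> v / \<psi> v)"
proof (rule regularI)
  fix v assume v: "v \<in> U"
  from assms(1) v obtain i g j h where gh: "binary_form i g" "binary_form j h" "int i - int j = d" "h v \<noteq> 0"
    "\<And>u. u \<in> U \<Longrightarrow> h u \<noteq> 0 \<Longrightarrow> \<phi> u = g u / h u"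
    unfolding regular_def by blast
  from assms(2) v obtain i' g' j' h' where gh': "binary_form i' g'" "binary_form j' h'" "int i' - int j' = d'"
    "h' v \<noteq> 0" "\<And>u. u \<in> U \<Longrightarrow> h' u \<noteq> 0 \<Longrightarrow> \<psi> u = g' u / h' u"
    unfolding regular_def by blast
  have nz: "g' v \<noteq> 0" using gh'(5)[OF v gh'(4)] assms(3)[OF v] by auto
  show "\<exists>i j g h. binary_form i g \<and> binary_form j h \<and> int i - int j = d - d' \<and>
     h v \<noteq> 0 \<and> (\<forall>u\<in>U. h u \<noteq> 0 \<longrightarrow> \<phi> u / \<psi> u = g u / h u)"
    using gh gh' nz
    by (intro fractionI[OF form.mult[OF form.mult[OF gh(1) gh'(2)] gh'(2)]
          form.mult[OF form.mult[OF gh(2) gh'(2)] gh'(1)]]) auto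
qed

lemma regular_graded:
  assumes U: "U \<subseteq> P1" shows "graded_functions (\<lambda>d. regular d U)"
proof
  fix d d' :: int and f g :: "'a \<times> 'a \<Rightarrow> 'a"
  show "regular d U (\<lambda>v. 0)"
  proof (rule regularI)
    fix v assume "v \<in> U"
    then have "fst v \<noteq> 0 \<or> snd v \<noteq> 0" using U P1_iff[of "fst v" "snd v"] by auto
    then obtain h where "binary_form (nat (- d)) h" "h v \<noteq> 0"
      using form_fst_power[of "nat (-d)"] form_snd_power[of "nat (-d)"] by force
    then show "\<exists>i j g h. binary_form i g \<and> binary_form j h \<and> int i - int j = d \<and>
      h v \<noteq> 0 \<and> (\<forall>u\<in>U. h u \<noteq> 0 \<longrightarrow> (0::'a) = g u / h u)"
      by (intro fractionI[OF form.zero[of "nat d"]]) auto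
  qed
  show "regular 0 U (\<lambda>v. 1)" using regular_form[OF form.one] by simp
  show "regular d U (\<lambda>v. f v + g v)" if f: "regular d U f" and g: "regular d U g"
  proof (rule regularI)
    fix v assume v: "v \<in> U"
    from f v obtain i p j h where gh: "binary_form i p" "binary_form j h" "int i - int j = d" "h v \<noteq> 0"
      "\<And>u. u \<in> U \<Longrightarrow> h u \<noteq> 0 \<Longrightarrow> f u = p u / h u" unfolding regular_def by blast
    from g v obtain i' p' j' h' where gh': "binary_form i' p'" "binary_form j' h'" "int i' - int j' = d"
      "h' v \<noteq> 0" "\<And>u. u \<in> U \<Longrightarrow> h' u \<noteq> 0 \<Longrightarrow> g u = p' u / h' u" unfolding regular_def by blast
    have deg: "i + j' = i' + j" using gh gh' by simp
    have "binary_form (i + j') (\<lambda>v. p v * h' v + p' v * h v)"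
      using form.add[OF form.mult[OF gh(1) gh'(2)]] form.mult[OF gh'(1) gh(2)] deg by simp
    then show "\<exists>i j q h. binary_form i q \<and> binary_form j h \<and> int i - int j = d \<and>
      h v \<noteq> 0 \<and> (\<forall>u\<in>U. h u \<noteq> 0 \<longrightarrow> f u + g u = q u / h u)"
      using gh gh' by (intro fractionI[OF _ form.mult[OF gh(2) gh'(2)]]) (auto simp: add_frac_eq)
  qed
  show "regular d U (\<lambda>v. - f v)" if f: "regular d U f"
  proof (rule regularI)
    fix v assume v: "v \<in> U"
    from f v obtain i p j h where gh: "binary_form i p" "binary_form j h" "int i - int j = d" "h v \<noteq> 0"
      "\<And>u. u \<in> U \<Longrightarrow> h u \<noteq> 0 \<Longrightarrow> f u = p u / h u" unfolding regular_def by blast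
    then show "\<exists>i j q h. binary_form i q \<and> binary_form j h \<and> int i - int j = d \<and>
      h v \<noteq> 0 \<and> (\<forall>u\<in>U. h u \<noteq> 0 \<longrightarrow> - f u = q u / h u)"
      by (intro fractionI[OF form.uminus[OF gh(1)] gh(2)]) auto
  qed
  show "regular (d + d') U (\<lambda>v. f v * g v)" if f: "regular d U f" and g: "regular d' U g"
  proof (rule regularI)
    fix v assume v: "v \<in> U"
    from f v obtain i p j h where gh: "binary_form i p" "binary_form j h" "int i - int j = d" "h v \<noteq> 0"
      "\<And>u. u \<in> U \<Longrightarrow> h u \<noteq> 0 \<Longrightarrow> f u = p u / h u" unfolding regular_def by blast
    from g v obtain i' p' j' h' where gh': "binary_form i' p'" "binary_form j' h'" "int i' - int j' = d'"
      "h' v \<noteq> 0" "\<And>u. u \<in> U \<Longrightarrow> h' u \<noteq> 0 \<Longrightarrow> g u = p' u / h' u" unfolding regular_def by blast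
    show "\<exists>i j q h. binary_form i q \<and> binary_form j h \<and> int i - int j = d + d' \<and>
      h v \<noteq> 0 \<and> (\<forall>u\<in>U. h u \<noteq> 0 \<longrightarrow> f u * g u = q u / h u)"
      using gh gh' by (intro fractionI[OF form.mult[OF gh(1) gh'(1)] form.mult[OF gh(2) gh'(2)]]) auto
  qed
qed

text \<open>
  The Nullstellensatz on the affine line: a nonzero element of least degree in an ideal divides all others, so its
  roots are common zeros of the ideal.
\<close>

lemma poly_ideal_without_zeros:
  fixes I :: "'k::alg_closed_field poly set"
  assumes add: "\<And>p q. p \<in> I \<Longrightarrow> q \<in> I \<Longrightarrow> p + q \<in> I"
    and mult: "\<And>p q. q \<in> I \<Longrightarrow> p * q \<in> I"
    and nz: "\<And>x. \<exists>p\<in>I. poly p x \<noteq> 0"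
  shows "1 \<in> I"
proof -
  have "\<exists>p. p \<in> I \<and> p \<noteq> 0" using nz[of 0] by fastforce
  then obtain p where p: "p \<in> I" "p \<noteq> 0"
    and least: "\<And>q. q \<in> I \<Longrightarrow> q \<noteq> 0 \<Longrightarrow> degree p \<le> degree q"
    using arg_min_nat_lemma[of "\<lambda>p. p \<in> I \<and> p \<noteq> 0" _ degree] by blast
  have "p dvd q" if "q \<in> I" for q
  proof (rule ccontr)
    assume "\<not> p dvd q"
    then have "q mod p \<noteq> 0" by (simp add: dvd_eq_mod_eq_0)
    moreover have "q mod p = q + (- (q div p)) * p" by (simp add: minus_div_mult_eq_mod[symmetric])
    then have "q mod p \<in> I" using add[OF that mult[OF p(1), of "- (q div p)"]] by simp
    moreover have "degree (q mod p) < degree p" using \<open>q mod p \<noteq> 0\<close> p(2) degree_mod_less by blast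
    ultimately show False using least by fastforce
  qed
  then have "poly p x \<noteq> 0" for x using nz[of x] by (metis dvdE mult_eq_0_iff poly_mult)
  then have "degree p = 0" using alg_closed_imp_poly_has_root by blast
  then obtain c where c: "p = [:c:]" using degree_eq_zeroE by blast
  then have "[:inverse c:] * p = 1" using p(2) by simp
  then show ?thesis using mult[OF p(1), of "[:inverse c:]"] by simp
qed

text \<open>
  On the affine line the possible denominators of \<open>\<phi>\<close> form an ideal. It has no zeros because \<open>\<phi>\<close> is locally a
  quotient, so it contains \<open>1\<close>.
\<close>

lemma regular_affine_poly:
  fixes \<phi> :: "'k::alg_closed_field \<times> 'k \<Rightarrow> 'k"
  assumes "regular d P1 \<phi>" shows "\<exists>p. \<forall>x. \<phi> (x, 1) = poly p x"
proof -
  define I where "I = {H. \<exists>q. \<forall>x. poly H x * \<phi> (x, 1) = poly q x}"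
  have "1 \<in> I"
  proof (rule poly_ideal_without_zeros)
    show "p + q \<in> I" if p: "p \<in> I" and q: "q \<in> I" for p q
    proof -
      obtain p' q' where "\<forall>x. poly p x * \<phi> (x, 1) = poly p' x" "\<forall>x. poly q x * \<phi> (x, 1) = poly q' x"
        using p q I_def by auto
      then have "\<forall>x. poly (p + q) x * \<phi> (x, 1) = poly (p' + q') x" by (simp add: distrib_right)
      then show ?thesis unfolding I_def by blast
    qed
    show "p * q \<in> I" if q: "q \<in> I" for p q
    proof -
      obtain q' where "\<forall>x. poly q x * \<phi> (x, 1) = poly q' x" using q I_def by auto
      then have "\<forall>x. poly (p * q) x * \<phi> (x, 1) = poly (p * q') x" by (simp add: mult.assoc)
      then show ?thesis unfolding I_def by blast
    qed
    fix x :: 'k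
    have "(x, 1) \<in> P1" by (simp add: P1_iff)
    with assms(1) obtain i g j h where gh: "binary_form i g" "binary_form j h" "int i - int j = d" "h (x, 1) \<noteq> 0"
      "\<And>u. u \<in> P1 \<Longrightarrow> h u \<noteq> 0 \<Longrightarrow> \<phi> u = g u / h u" unfolding regular_def by blast
    obtain p where p: "\<And>x. g (x, 1) = poly p x" using form_dehomogenize[OF gh(1)] homogenize_affine by metis
    obtain q where q: "\<And>x. h (x, 1) = poly q x" using form_dehomogenize[OF gh(2)] homogenize_affine by metis
    \<comment> \<open>the square absorbs the points with \<open>q y = 0\<close>, where the value of \<open>\<phi>\<close> is not controlled\<close>
    have "poly (q * q) y * \<phi> (y, 1) = poly (p * q) y" for y
      using gh(5)[of "(y, 1)"] p[of y] q[of y] by (cases "poly q y = 0") (auto simp: P1_iff)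
    then have "q * q \<in> I" unfolding I_def by blast
    moreover have "poly (q * q) x \<noteq> 0" using gh(4) q by simp
    ultimately show "\<exists>p\<in>I. poly p x \<noteq> 0" by blast
  qed
  then show ?thesis unfolding I_def by auto
qed

lemma regular_swap:
  assumes "regular d P1 \<phi>" shows "regular d P1 (\<lambda>v. \<phi> (prod.swap v))"
proof (rule regularI)
  fix v :: "'a \<times> 'a" assume "v \<in> P1"
  have swapP1: "prod.swap u \<in> P1 \<longleftrightarrow> u \<in> P1" for u :: "'a \<times> 'a" by (cases u) (auto simp: P1_iff)
  with \<open>v \<in> P1\<close> have "prod.swap v \<in> P1" by simp
  with assms(1) obtain i g j h where gh: "binary_form i g" "binary_form j h" "int i - int j = d"
    "h (prod.swap v) \<noteq> 0" "\<And>u. u \<in> P1 \<Longrightarrow> h u \<noteq> 0 \<Longrightarrow> \<phi> u = g u / h u"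
    unfolding regular_def by blast
  then show "\<exists>i j g h. binary_form i g \<and> binary_form j h \<and> int i - int j = d \<and>
     h v \<noteq> 0 \<and> (\<forall>u\<in>P1. h u \<noteq> 0 \<longrightarrow> \<phi> (prod.swap u) = g u / h u)"
    using swapP1 by (intro fractionI[OF form_swap[OF gh(1)] form_swap[OF gh(2)]]) (simp_all add: gh)
qed

lemma regular_homogeneous:
  assumes "regular (int d) U \<phi>" "(s, t) \<in> U" "(c * s, c * t) \<in> U" "c \<noteq> 0"
  shows "\<phi> (c * s, c * t) = c ^ d * \<phi> (s, t)"
proof -
  from assms(1,2) obtain i g j h where gh: "binary_form i g" "binary_form j h" "int i - int j = int d"
    "h (s, t) \<noteq> 0" "\<And>u. u \<in> U \<Longrightarrow> h u \<noteq> 0 \<Longrightarrow> \<phi> u = g u / h u" unfolding regular_def by blast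
  have "i = d + j" using gh by simp
  have "\<phi> (c * s, c * t) = g (c * s, c * t) / h (c * s, c * t)"
    using assms gh(4) form_homogeneous[OF gh(2)] by (intro gh(5)) auto
  also have "\<dots> = c ^ d * (g (s, t) / h (s, t))"
    using \<open>i = d + j\<close> assms(4) by (simp add: form_homogeneous[OF gh(1)] form_homogeneous[OF gh(2)] power_add)
  finally show ?thesis using gh(5)[OF assms(2) gh(4)] by simp
qed

text \<open>
  Global sections of \<open>\<O>(d)\<close> are forms: \<open>\<phi>\<close> is polynomial on both affine charts, and the transition
  function \<open>x ^ d\<close> bounds the degree on one of them by \<open>d\<close>.
\<close>

lemma regular_imp_form:
  fixes \<phi> :: "'k::{alg_closed_field, field_char_0} \<times> 'k \<Rightarrow> 'k"
  assumes "regular (int d) P1 \<phi>"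
  obtains h where "binary_form d h" "\<And>v. v \<in> P1 \<Longrightarrow> \<phi> v = h v"
proof -
  obtain p where p: "\<And>x. \<phi> (x, 1) = poly p x" using regular_affine_poly[OF assms] by blast
  obtain q where q: "\<And>x. \<phi> (1, x) = poly q x" using regular_affine_poly[OF regular_swap[OF assms]] by auto
  let ?m = "degree q"
  have eq: "poly (Polynomial.monom 1 (Suc ?m) * p) x = poly (Polynomial.monom 1 (Suc d) * reflect_poly q) x" for x
  proof (cases "x = 0")
    case False
    have "\<phi> (x * 1, x * inverse x) = x ^ d * \<phi> (1, inverse x)"
      using False by (intro regular_homogeneous[OF assms]) (auto simp: P1_iff)
    then have "poly p x = x ^ d * poly q (inverse x)" using p q False by simp
    then show ?thesis using False by (simp add: poly_monom poly_reflect_poly_nz mult_ac)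
  qed (simp add: poly_monom)
  then have eq: "Polynomial.monom 1 (Suc ?m) * p = Polynomial.monom 1 (Suc d) * reflect_poly q"
    by (simp flip: poly_eq_poly_eq_iff add: fun_eq_iff)
  have deg: "degree p \<le> d"
  proof (cases "p = 0")
    case False
    then have "Suc ?m + degree p = degree (Polynomial.monom 1 (Suc d) * reflect_poly q)"
      by (simp add: eq[symmetric] degree_mult_eq monom_eq_0_iff degree_monom_eq)
    also have "\<dots> \<le> Suc d + ?m"
      by (rule order.trans[OF degree_mult_le]) (simp add: degree_monom_eq degree_reflect_poly_le)
    finally show ?thesis by simp
  qed simp
  have lead: "poly.coeff p d = poly.coeff q 0"
  proof -
    have "poly.coeff p d = poly.coeff (Polynomial.monom 1 (Suc ?m) * p) (Suc ?m + d)"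
      by (simp add: coeff_monom_mult)
    also have "\<dots> = poly.coeff (reflect_poly q) ?m"
      unfolding eq by (simp add: coeff_monom_mult)
    finally show ?thesis by (simp add: coeff_reflect_poly)
  qed
  have "\<phi> v = homogenize d p v" if "v \<in> P1" for v
  proof -
    obtain s t where v: "v = (s, t)" by (cases v)
    show ?thesis
    proof (cases "t = 0")
      case False
      have "\<phi> (t * (s / t), t * 1) = t ^ d * \<phi> (s / t, 1)"
        using False by (intro regular_homogeneous[OF assms]) (auto simp: P1_iff)
      moreover have "homogenize d p (t * (s / t), t * 1) = t ^ d * homogenize d p (s / t, 1)"
        by (rule form_homogeneous[OF homogenize_form])
      ultimately show ?thesis using False v p homogenize_affine[OF deg] by simp
    next
      case True
      have "s \<noteq> 0" using that v True by (simp add: P1_iff)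
      have "\<phi> (s * 1, s * 0) = s ^ d * \<phi> (1, 0)"
        using \<open>s \<noteq> 0\<close> by (intro regular_homogeneous[OF assms]) (auto simp: P1_iff)
      moreover have "homogenize d p (s * 1, s * 0) = s ^ d * homogenize d p (1, 0)"
        by (rule form_homogeneous[OF homogenize_form])
      ultimately show ?thesis using True v q[of 0] homogenize_infinity[of d p] lead by (simp add: poly_0_coeff_0)
    qed
  qed
  then show thesis using that homogenize_form by blast
qed

section \<open>Grassmannians, minors and split exact sequences of matrices\<close>

definition mat_image :: "'k::field mat \<Rightarrow> 'k vec set" where
  "mat_image A = {A *\<^sub>v y | y. y \<in> carrier_vec (dim_col A)}"

definition mat_injective :: "'k::field mat \<Rightarrow> bool" where
  "mat_injective A \<longleftrightarrow>
     (\<forall>y\<in>carrier_vec (dim_col A). A *\<^sub>v y = 0\<^sub>v (dim_row A) \<longrightarrow> y = 0\<^sub>v (dim_col A))"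

lemma mat_image_eq: "A \<in> carrier_mat n r \<Longrightarrow> mat_image A = (\<lambda>y. A *\<^sub>v y) ` carrier_vec r"
  by (auto simp: mat_image_def)

lemma mat_injectiveD:
  assumes "mat_injective A" "A \<in> carrier_mat n r" "y \<in> carrier_vec r" "A *\<^sub>v y = 0\<^sub>v n"
  shows "y = 0\<^sub>v r"
  using assms by (auto simp: mat_injective_def)

lemma mat_injectiveI:
  assumes "A \<in> carrier_mat n r" "\<And>y. y \<in> carrier_vec r \<Longrightarrow> A *\<^sub>v y = 0\<^sub>v n \<Longrightarrow> y = 0\<^sub>v r"
  shows "mat_injective A"
  using assms by (auto simp: mat_injective_def)

lemma col_space_mat_image:
  assumes "A \<in> carrier_mat n r" shows "vec_space.col_space n A = mat_image A"
  using assms unfolding vec_space.col_space_eq[OF assms] mat_image_def by auto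

lemma mat_mult_zero_vec:
  fixes A :: "'b::comm_ring_1 mat"
  assumes "A \<in> carrier_mat n r" shows "A *\<^sub>v 0\<^sub>v r = 0\<^sub>v n"
  using assms by (intro eq_vecI) auto

lemma mat_mult_unit_vec:
  fixes A :: "'b::comm_ring_1 mat"
  assumes "A \<in> carrier_mat n r" "j < r" shows "A *\<^sub>v unit_vec r j = col A j"
  using assms by (intro eq_vecI) auto

lemma mat_injective_distinct_cols:
  assumes A: "A \<in> carrier_mat n r" and inj: "mat_injective A" shows "distinct (cols A)"
proof -
  have False if ij: "i < r" "j < r" "i \<noteq> j" "col A i = col A j" for i j
  proof -
    let ?y = "unit_vec r i - unit_vec r j :: 'a vec"
    have "A *\<^sub>v ?y = A *\<^sub>v unit_vec r i - A *\<^sub>v unit_vec r j"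
      using A by (intro mult_minus_distrib_mat_vec) auto
    also have "\<dots> = 0\<^sub>v n" using A ij by (simp add: mat_mult_unit_vec)
    finally have "A *\<^sub>v ?y = 0\<^sub>v n" .
    moreover have "?y \<in> carrier_vec r" by (intro minus_carrier_vec unit_vec_carrier)
    ultimately have "?y = 0\<^sub>v r" using mat_injectiveD[OF inj A] by blast
    then have "?y $ i = 0" using ij by simp
    then show False using ij by simp
  qed
  then show ?thesis using A by (auto simp: distinct_conv_nth)
qed

lemma mat_injective_rank:
  assumes A: "A \<in> carrier_mat n r" and inj: "mat_injective A" shows "vec_space.rank n A = r"
proof -
  interpret vec_space "TYPE('a)" n .
  have "lin_indpt (set (cols A))"
  proof
    assume "lin_dep (set (cols A))"
    then obtain v where "v \<in> carrier_vec r" "v \<noteq> 0\<^sub>v r" "A *\<^sub>v v = 0\<^sub>v n"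
      using lin_depE[OF A _ mat_injective_distinct_cols[OF A inj]] by blast
    then show False using mat_injectiveD[OF inj A] by blast
  qed
  then show ?thesis using lin_indpt_full_rank[OF A mat_injective_distinct_cols[OF A inj]] by simp
qed

lemma rank_mat_injective:
  assumes A: "A \<in> carrier_mat n r" and rank: "vec_space.rank n A = r" shows "mat_injective A"
proof -
  interpret vec_space "TYPE('a)" n .
  obtain S where S: "maximal S (\<lambda>T. T \<subseteq> set (cols A) \<and> lin_indpt T)"
    using maximal_exists[of "(\<lambda>T. T \<subseteq> set (cols A) \<and> lin_indpt T)" "card (set (cols A))" "{}"]
    by (meson List.finite_set card_mono empty_iff empty_subsetI finite_lin_indpt2 rev_finite_subset)
  then have "card S \<le> card (set (cols A))" by (simp add: card_mono maximal_def)
  then have "length (cols A) \<le> card (set (cols A))"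
    using rank_card_indpt[OF A S] rank A by simp
  then have "distinct (cols A)" by (metis card_distinct card_length le_antisym)
  then show ?thesis
    using full_rank_lin_indpt[OF A rank] lin_depI[OF A] by (intro mat_injectiveI[OF A]) blast
qed

lemma mat_image_Grassmannian:
  assumes A: "A \<in> carrier_mat n r" and inj: "mat_injective A" shows "mat_image A \<in> Grassmannian r n"
proof -
  interpret vec_space "TYPE('a)" n .
  have cols: "set (cols A) \<subseteq> carrier_vec n" using A cols_dim by blast
  have "VectorSpace.subspace class_ring (span (set (cols A))) V"
    using span_is_subspace cols by simp
  moreover have "vectorspace.dim class_ring (V\<lparr>carrier := span (set (cols A))\<rparr>) = r"
    using mat_injective_rank[OF A inj] unfolding rank_def by simp
  ultimately show ?thesis
    unfolding Grassmannian_def col_space_mat_image[OF A, symmetric] col_space_def by simp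
qed

lemma Grassmannian_mat_injective:
  assumes A: "A \<in> carrier_mat n r" and "mat_image A \<in> Grassmannian r n" shows "mat_injective A"
proof -
  interpret vec_space "TYPE('a)" n .
  have "vectorspace.dim class_ring (V\<lparr>carrier := span (set (cols A))\<rparr>) = r"
    using assms(2) unfolding Grassmannian_def col_space_mat_image[OF A, symmetric] col_space_def by simp
  then have "rank A = r" unfolding rank_def by simp
  then show ?thesis by (rule rank_mat_injective[OF A])
qed

lemma mat_factor:
  assumes A: "A \<in> carrier_mat n r" and X: "X \<in> carrier_mat n q"
    and cols: "\<And>j. j < q \<Longrightarrow> col X j \<in> mat_image A"
  obtains G where "G \<in> carrier_mat r q" "X = A * G"
proof -
  have "\<exists>y. y \<in> carrier_vec r \<and> col X j = A *\<^sub>v y" if "j < q" for j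
    using cols[OF that] A by (auto simp: mat_image_def)
  then obtain y where y: "\<And>j. j < q \<Longrightarrow> y j \<in> carrier_vec r" "\<And>j. j < q \<Longrightarrow> col X j = A *\<^sub>v y j"
    by metis
  let ?G = "mat r q (\<lambda>(i, j). y j $ i)"
  have "X = A * ?G"
  proof (rule eq_matI)
    fix i j assume ij: "i < dim_row (A * ?G)" "j < dim_col (A * ?G)"
    then have ij: "i < n" "j < q" using A by auto
    have "X $$ (i, j) = col X j $ i" using ij X by simp
    also have "\<dots> = row A i \<bullet> y j" using y(2) ij A by simp
    also have "y j = col ?G j" using y(1) ij by (intro eq_vecI) auto
    finally show "X $$ (i, j) = (A * ?G) $$ (i, j)" using ij A by simp
  qed (use A X in auto)
  then show thesis using that[of ?G] by simp
qed

text \<open>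
  The rows are chosen by an arbitrary function instead of a subset. So rows can be exchanged one at a time,
  without sorting; the minor is then alternating in \<open>\<kappa>\<close>.
\<close>

definition minor :: "nat \<Rightarrow> 'b::comm_ring_1 mat \<Rightarrow> (nat \<Rightarrow> nat) \<Rightarrow> 'b" where
  "minor r A \<kappa> = det (mat r r (\<lambda>(i, j). A $$ (\<kappa> i, j)))"

lemma minor_mult:
  assumes A: "A \<in> carrier_mat n r" and G: "G \<in> carrier_mat r r" and \<kappa>: "\<And>i. i < r \<Longrightarrow> \<kappa> i < n"
  shows "minor r (A * G) \<kappa> = minor r A \<kappa> * det G"
proof -
  have "mat r r (\<lambda>(i, j). (A * G) $$ (\<kappa> i, j)) = mat r r (\<lambda>(i, j). A $$ (\<kappa> i, j)) * G"
  proof (rule eq_matI)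
    fix i j assume "i < dim_row (mat r r (\<lambda>(i, j). A $$ (\<kappa> i, j)) * G)"
      "j < dim_col (mat r r (\<lambda>(i, j). A $$ (\<kappa> i, j)) * G)"
    then have ij: "i < r" "j < r" using G by auto
    have "row A (\<kappa> i) = row (mat r r (\<lambda>(i, j). A $$ (\<kappa> i, j))) i"
      using A \<kappa> ij by (intro eq_vecI) auto
    then show "mat r r (\<lambda>(i, j). (A * G) $$ (\<kappa> i, j)) $$ (i, j)
        = (mat r r (\<lambda>(i, j). A $$ (\<kappa> i, j)) * G) $$ (i, j)"
      using ij A G \<kappa> by simp
  qed (use A G in auto)
  then show ?thesis using G by (simp add: minor_def det_mult[of _ r])
qed

lemma minor_not_inj:
  assumes "\<not> inj_on \<kappa> {..<r}" shows "minor r A \<kappa> = 0"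
proof -
  obtain i j where "i < r" "j < r" "i \<noteq> j" "\<kappa> i = \<kappa> j" using assms by (auto simp: inj_on_def)
  then show ?thesis unfolding minor_def
    by (intro det_identical_rows[of _ r i j] eq_vecI) auto
qed

text \<open>
  Induction on the number of columns: an index function with nonzero minor of the first \<open>r\<close> columns extends by one more row,
  since Laplace expansion along the new row exhibits all the extended minors as the coordinates of the image of
  one vector, whose last coordinate is the old minor.
\<close>

lemma mat_injective_minor:
  assumes "A \<in> carrier_mat n r" "mat_injective A"
  obtains \<kappa> where "\<And>i. i < r \<Longrightarrow> \<kappa> i < n" "minor r A \<kappa> \<noteq> 0"
proof -
  have "\<exists>\<kappa>. (\<forall>i<r. \<kappa> i < n) \<and> minor r A \<kappa> \<noteq> 0" using assms
  proof (induction r arbitrary: A)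
    case 0
    then show ?case by (auto simp: minor_def)
  next
    case (Suc r)
    let ?A = "mat n r (\<lambda>(i, j). A $$ (i, j))"
    have "mat_injective ?A"
    proof (unfold mat_injective_def, intro ballI impI)
      fix y assume y: "y \<in> carrier_vec (dim_col ?A)" "?A *\<^sub>v y = 0\<^sub>v (dim_row ?A)"
      let ?z = "vec (Suc r) (\<lambda>j. if j < r then y $ j else 0)"
      have "A *\<^sub>v ?z = ?A *\<^sub>v y"
        using Suc.prems y(1) by (intro eq_vecI) (simp_all add: scalar_prod_def)
      moreover have "?A *\<^sub>v y = 0\<^sub>v n" using y(2) by simp
      ultimately have "A *\<^sub>v ?z = 0\<^sub>v n" by (rule trans)
      with mat_injectiveD[OF Suc.prems(2,1), of ?z] have "?z = 0\<^sub>v (Suc r)" by simp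
      then have "?z $ j = 0" if "j < Suc r" for j using that by simp
      from this[OF less_SucI] show "y = 0\<^sub>v (dim_col ?A)"
        using y(1) by (intro eq_vecI) force+
    qed
    then obtain \<kappa> where \<kappa>: "\<And>i. i < r \<Longrightarrow> \<kappa> i < n" "minor r ?A \<kappa> \<noteq> 0"
      using Suc.IH[of ?A] by auto
    let ?M = "\<lambda>k. mat (Suc r) (Suc r) (\<lambda>(i, j). A $$ ((\<kappa>(r := k)) i, j))"
    \<comment> \<open>expanding along the added row: the cofactors do not depend on \<open>k\<close>, and not all vanish\<close>
    define c where "c = vec (Suc r) (\<lambda>j. cofactor (?M 0) r j)"
    have cof: "cofactor (?M k) r j = c $ j" if "j < Suc r" for k j
    proof -
      have "mat_delete (?M k) r j = mat_delete (?M 0) r j"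
        using that by (intro eq_matI) (auto simp: mat_delete_def)
      then show ?thesis using that by (simp add: c_def cofactor_def)
    qed
    have expand: "minor (Suc r) A (\<kappa>(r := k)) = (A *\<^sub>v c) $ k" if "k < n" for k
    proof -
      have "det (?M k) = (\<Sum>j<Suc r. ?M k $$ (r, j) * cofactor (?M k) r j)"
        by (intro laplace_expansion_row) auto
      also have "\<dots> = (\<Sum>j<Suc r. A $$ (k, j) * c $ j)"
        using cof by (intro sum.cong) auto
      also have "\<dots> = (A *\<^sub>v c) $ k"
        using that Suc.prems by (auto simp: scalar_prod_def c_def atLeast0LessThan intro!: sum.cong)
      finally show ?thesis by (simp add: minor_def)
    qed
    have "c $ r = minor r ?A \<kappa>"
    proof -
      have "mat_delete (?M 0) r r = mat r r (\<lambda>(i, j). ?A $$ (\<kappa> i, j))"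
        using \<kappa>(1) by (intro eq_matI) (auto simp: mat_delete_def)
      then show ?thesis by (simp add: c_def cofactor_def minor_def)
    qed
    then have "c \<noteq> 0\<^sub>v (Suc r)" using \<kappa>(2) by auto
    moreover have "c \<in> carrier_vec (Suc r)" by (simp add: c_def)
    ultimately have "A *\<^sub>v c \<noteq> 0\<^sub>v n" using mat_injectiveD[of A n "Suc r" c] Suc.prems by blast
    then obtain k where "k < n" "(A *\<^sub>v c) $ k \<noteq> 0" using Suc.prems by (metis carrier_matD(1) dim_mult_mat_vec eq_vecI index_zero_vec)
    then have "minor (Suc r) A (\<kappa>(r := k)) \<noteq> 0" using expand by simp
    moreover have "\<forall>i<Suc r. (\<kappa>(r := k)) i < n" using \<kappa>(1) \<open>k < n\<close> by (auto simp: less_Suc_eq)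
    ultimately show ?case by blast
  qed
  then show thesis using that by blast
qed

lemma minor_mat_injective:
  assumes A: "A \<in> carrier_mat n r" and \<kappa>: "\<And>i. i < r \<Longrightarrow> \<kappa> i < n" and "minor r A \<kappa> \<noteq> 0"
  shows "mat_injective A"
proof (unfold mat_injective_def, intro ballI impI)
  fix y assume y: "y \<in> carrier_vec (dim_col A)" "A *\<^sub>v y = 0\<^sub>v (dim_row A)"
  let ?M = "mat r r (\<lambda>(i, j). A $$ (\<kappa> i, j))"
  have "?M *\<^sub>v y = 0\<^sub>v r"
  proof (rule eq_vecI)
    fix i assume i: "i < dim_vec (0\<^sub>v r)"
    have "row ?M i = row A (\<kappa> i)" using i \<kappa> A by (intro eq_vecI) auto
    then have "(?M *\<^sub>v y) $ i = (A *\<^sub>v y) $ \<kappa> i" using i \<kappa> A by simp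
    then show "(?M *\<^sub>v y) $ i = 0\<^sub>v r $ i" using y i \<kappa> A by simp
  qed simp
  then show "y = 0\<^sub>v (dim_col A)"
    using assms(3) det_0_iff_vec_prod_zero_field[of ?M r] y A unfolding minor_def by auto
qed

subsection \<open>Pluecker coordinates along index functions\<close>

lemma pluecker_indices_pick:
  assumes "I \<in> pluecker_indices r n"
  shows "finite I" "card I = r" "\<And>i. i < r \<Longrightarrow> pick I i \<in> I" "\<And>i. i < r \<Longrightarrow> pick I i < n"
    "bij_betw (pick I) {..<r} I"
proof -
  show fin: "finite I" and card: "card I = r"
    using assms finite_subset[of I "{..<n}"] by (auto simp: pluecker_indices_def)
  show mem: "pick I i \<in> I" if "i < r" for i using pick_in_set[of i I] card that by simp
  then show "\<And>i. i < r \<Longrightarrow> pick I i < n" using assms by (auto simp: pluecker_indices_def)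
  have "inj_on (pick I) {..<r}"
    using pick_mono[of _ I] card by (intro inj_onI) (metis lessThan_iff less_irrefl linorder_neqE_nat)
  moreover have "pick I ` {..<r} \<subseteq> I" using mem by auto
  ultimately show "bij_betw (pick I) {..<r} I"
    unfolding bij_betw_def using card_image[of "pick I" "{..<r}"] card card_subset_eq[OF fin] by auto
qed

lemma det_submatrix:
  assumes A: "A \<in> carrier_mat n r" and I: "I \<in> pluecker_indices r n"
  shows "det (submatrix A I UNIV) = minor r A (pick I)"
proof -
  have "{i. i < n \<and> i \<in> I} = I" using I by (auto simp: pluecker_indices_def)
  then have "submatrix A I UNIV = mat r r (\<lambda>(i, j). A $$ (pick I i, j))"
    using A pluecker_indices_pick(2)[OF I] by (simp add: submatrix_def pick_UNIV)
  then show ?thesis by (simp add: minor_def)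
qed

text \<open>
  The sign of the permutation that sorts the values of \<open>\<kappa>\<close>, and \<open>0\<close> if there are repetitions; this extends a
  function on \<open>r\<close>-element subsets to an alternating function on sequences.
\<close>

definition sorting_sign :: "nat \<Rightarrow> (nat \<Rightarrow> nat) \<Rightarrow> int" where
  "sorting_sign r \<kappa> = (if inj_on \<kappa> {..<r} then
     sign (SOME \<pi>. \<pi> permutes {0..<r} \<and> (\<forall>i<r. \<kappa> i = pick (\<kappa> ` {..<r}) (\<pi> i))) else 0)"

definition alternating :: "nat \<Rightarrow> (nat set \<Rightarrow> 'b::comm_ring_1) \<Rightarrow> (nat \<Rightarrow> nat) \<Rightarrow> 'b" where
  "alternating r p \<kappa> = of_int (sorting_sign r \<kappa>) * p (\<kappa> ` {..<r})"

lemma inj_image_pluecker_indices: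
  assumes "inj_on \<kappa> {..<r}" "\<And>i. i < r \<Longrightarrow> \<kappa> i < n"
  shows "\<kappa> ` {..<r} \<in> pluecker_indices r n"
  using assms by (auto simp: pluecker_indices_def card_image)

lemma minor_sort:
  assumes A: "A \<in> carrier_mat n r" and \<kappa>: "\<And>i. i < r \<Longrightarrow> \<kappa> i < n"
  shows "minor r A \<kappa> = of_int (sorting_sign r \<kappa>) * minor r A (pick (\<kappa> ` {..<r}))"
proof (cases "inj_on \<kappa> {..<r}")
  case True
  let ?I = "\<kappa> ` {..<r}"
  let ?P = "\<lambda>\<pi>. \<pi> permutes {0..<r} \<and> (\<forall>i<r. \<kappa> i = pick ?I (\<pi> i))"
  note pick = pluecker_indices_pick[OF inj_image_pluecker_indices[OF True \<kappa>]]
  have bij: "bij_betw (inv_into {..<r} (pick ?I) \<circ> \<kappa>) {..<r} {..<r}"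
    using True bij_betw_inv_into[OF pick(5)] by (intro bij_betw_trans) (auto simp: bij_betw_def)
  define \<pi> where "\<pi> = (\<lambda>i. if i < r then inv_into {..<r} (pick ?I) (\<kappa> i) else i)"
  have "bij_betw \<pi> {0..<r} {0..<r}"
    using bij by (subst bij_betw_cong[of _ _ "inv_into {..<r} (pick ?I) \<circ> \<kappa>"]) (auto simp: \<pi>_def atLeast0LessThan)
  then have "\<pi> permutes {0..<r}" by (rule bij_imp_permutes) (simp add: \<pi>_def)
  moreover have "\<kappa> i = pick ?I (\<pi> i)" if "i < r" for i
    using that bij_betw_inv_into_right[OF pick(5), of "\<kappa> i"] by (simp add: \<pi>_def)
  ultimately have "?P \<pi>" by blast
  then have \<sigma>: "?P (SOME \<pi>. ?P \<pi>)" by (rule someI[of ?P])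
  define \<sigma> where "\<sigma> = (SOME \<pi>. ?P \<pi>)"
  have \<sigma>: "\<sigma> permutes {0..<r}" "\<And>i. i < r \<Longrightarrow> \<kappa> i = pick ?I (\<sigma> i)" using \<sigma> unfolding \<sigma>_def by blast+
  let ?M = "mat r r (\<lambda>(i, j). A $$ (pick ?I i, j))"
  have "mat r r (\<lambda>(i, j). A $$ (\<kappa> i, j)) = mat r r (\<lambda>(i, j). ?M $$ (\<sigma> i, j))"
    using \<sigma>(2) permutes_in_image[OF \<sigma>(1)] by (intro eq_matI) auto
  then have "minor r A \<kappa> = signof \<sigma> * det ?M"
    unfolding minor_def using det_permute_rows[of ?M r \<sigma>] \<sigma>(1) by simp
  then show ?thesis using True by (simp add: sorting_sign_def \<sigma>_def minor_def)
qed (simp add: minor_not_inj sorting_sign_def)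

lemma alternating_minor:
  assumes A: "A \<in> carrier_mat n r" and \<kappa>: "\<And>i. i < r \<Longrightarrow> \<kappa> i < n"
    and p: "\<And>I. I \<in> pluecker_indices r n \<Longrightarrow> p I = minor r A (pick I)"
  shows "alternating r p \<kappa> = minor r A \<kappa>"
  using minor_sort[OF A \<kappa>] p[OF inj_image_pluecker_indices[OF _ \<kappa>]]
  by (cases "inj_on \<kappa> {..<r}") (auto simp: alternating_def sorting_sign_def)

lemma minor_pick_nonzero:
  assumes A: "A \<in> carrier_mat n r" and \<kappa>: "\<And>i. i < r \<Longrightarrow> \<kappa> i < n" and "minor r A \<kappa> \<noteq> 0"
  shows "\<exists>I\<in>pluecker_indices r n. minor r A (pick I) \<noteq> 0"
proof -
  have "inj_on \<kappa> {..<r}" using assms(3) minor_not_inj by blast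
  then have "\<kappa> ` {..<r} \<in> pluecker_indices r n" using inj_image_pluecker_indices \<kappa> by blast
  moreover have "minor r A (pick (\<kappa> ` {..<r})) \<noteq> 0" using assms(3) minor_sort[OF A, of \<kappa>] \<kappa> by auto
  ultimately show ?thesis by blast
qed

lemma pluecker_mat_image:
  assumes A: "A \<in> carrier_mat n r"
    and "\<And>I. I \<in> pluecker_indices r n \<Longrightarrow> p I = minor r A (pick I)"
  shows "pluecker r n (mat_image A) p"
  unfolding pluecker_def using assms col_space_mat_image[OF A] det_submatrix[OF A] by (intro bexI[OF _ A]) auto

lemma pluecker_matE:
  assumes "pluecker r n W p" "W \<in> Grassmannian r n"
  obtains A where "A \<in> carrier_mat n r" "mat_image A = W" "mat_injective A"
    "\<And>I. I \<in> pluecker_indices r n \<Longrightarrow> p I = minor r A (pick I)"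
proof -
  obtain A where A: "A \<in> carrier_mat n r" "vec_space.col_space n A = W"
    "\<forall>I\<in>pluecker_indices r n. p I = det (submatrix A I UNIV)"
    using assms(1) unfolding pluecker_def by blast
  then show thesis
    using that[of A] Grassmannian_mat_injective[OF A(1)] assms(2) det_submatrix[OF A(1)]
      col_space_mat_image[OF A(1)] by auto
qed

text \<open>
  Two bases of one subspace differ by an invertible square matrix, whose determinant is the common ratio of the minors.
\<close>

lemma mat_image_same_minors:
  assumes A: "A \<in> carrier_mat n r" and A': "A' \<in> carrier_mat n r"
    and inj: "mat_injective A'" and im: "mat_image A' = mat_image A"
  obtains c where "c \<noteq> 0" "\<And>\<kappa>. (\<And>i. i < r \<Longrightarrow> \<kappa> i < n) \<Longrightarrow> minor r A' \<kappa> = c * minor r A \<kappa>"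
proof -
  have "col A' j \<in> mat_image A" if "j < r" for j
  proof -
    have "col A' j = A' *\<^sub>v unit_vec r j" using A' that by (simp add: mat_mult_unit_vec)
    then have "col A' j \<in> mat_image A'" using A' unfolding mat_image_def by force
    then show ?thesis using im by simp
  qed
  then obtain G where G: "G \<in> carrier_mat r r" "A' = A * G" using mat_factor[OF A A'] by blast
  obtain \<kappa> where \<kappa>: "\<And>i. i < r \<Longrightarrow> \<kappa> i < n" "minor r A' \<kappa> \<noteq> 0"
    using mat_injective_minor[OF A' inj] by blast
  then have "det G \<noteq> 0" using minor_mult[OF A G(1)] G(2) by auto
  then show thesis using that[of "det G"] minor_mult[OF A G(1)] G(2) by (simp add: mult.commute)
qed

lemma mat_image_mult_invertible:
  assumes A: "A \<in> carrier_mat n r" and G: "G \<in> carrier_mat r r" "det G \<noteq> 0"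
  shows "mat_image (A * G) = mat_image A"
proof -
  obtain H where H: "H \<in> carrier_mat r r" "G * H = 1\<^sub>m r"
    using det_non_zero_imp_unit[OF G(1,2), of "()"] unfolding Units_def by (auto simp: ring_mat_simps)
  have "A * G *\<^sub>v y = A *\<^sub>v (G *\<^sub>v y)" if "y \<in> carrier_vec r" for y
    using A G that by (intro assoc_mult_mat_vec) auto
  moreover have "A *\<^sub>v y = A * G *\<^sub>v (H *\<^sub>v y)" if "y \<in> carrier_vec r" for y
  proof -
    have "A *\<^sub>v y = A *\<^sub>v (G * H *\<^sub>v y)" using H that by simp
    also have "\<dots> = A *\<^sub>v (G *\<^sub>v (H *\<^sub>v y))" using assoc_mult_mat_vec[OF G(1) H(1) that] by simp
    also have "\<dots> = A * G *\<^sub>v (H *\<^sub>v y)" using H that by (intro assoc_mult_mat_vec[symmetric, OF A G(1)]) auto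
    finally show ?thesis .
  qed
  ultimately have AG: "\<And>y. y \<in> carrier_vec r \<Longrightarrow> A * G *\<^sub>v y = A *\<^sub>v (G *\<^sub>v y)"
    "\<And>y. y \<in> carrier_vec r \<Longrightarrow> A *\<^sub>v y = A * G *\<^sub>v (H *\<^sub>v y)" by blast+
  have im: "mat_image (A * G) = (\<lambda>y. A * G *\<^sub>v y) ` carrier_vec r" "mat_image A = (\<lambda>y. A *\<^sub>v y) ` carrier_vec r"
    using mat_image_eq[of "A * G" n r] mat_image_eq[OF A] A G by auto
  show ?thesis unfolding im
  proof (intro equalityI image_subsetI)
    fix y :: "'a vec" assume y: "y \<in> carrier_vec r"
    show "A * G *\<^sub>v y \<in> (\<lambda>y. A *\<^sub>v y) ` carrier_vec r"
      unfolding AG(1)[OF y] by (rule imageI[OF mult_mat_vec_carrier[OF G(1) y]])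
    show "A *\<^sub>v y \<in> (\<lambda>y. A * G *\<^sub>v y) ` carrier_vec r"
      unfolding AG(2)[OF y] by (rule imageI[OF mult_mat_vec_carrier[OF H(1) y]])
  qed
qed

text \<open>
  Scaling one column of the matrix of a basis scales all maximal minors; this requires that there is a column.
\<close>

lemma pluecker_scale:
  assumes "pluecker r n W p" "r > 0" "c \<noteq> 0" shows "pluecker r n W (\<lambda>I. c * p I)"
proof -
  obtain A where A: "A \<in> carrier_mat n r" "mat_image A = W"
    "\<And>I. I \<in> pluecker_indices r n \<Longrightarrow> p I = minor r A (pick I)"
    using assms(1) unfolding pluecker_def by (metis col_space_mat_image det_submatrix)
  let ?D = "multrow_mat r 0 c"
  have D: "?D \<in> carrier_mat r r" "det ?D = c" using assms(2) by (auto simp: det_multrow_mat)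
  have "pluecker r n (mat_image (A * ?D)) (\<lambda>I. c * p I)"
    using A D minor_mult[OF A(1) D(1)] pluecker_indices_pick(4)
    by (intro pluecker_mat_image) (auto simp: mult.commute)
  then show ?thesis using mat_image_mult_invertible[OF A(1) D(1)] D(2) assms(3) A(2) by simp
qed

subsection \<open>Split exact sequences\<close>

lemma mult_mat_vec_zero:
  fixes B :: "'b::comm_ring_1 mat"
  assumes "B \<in> carrier_mat m n" "A \<in> carrier_mat n r" "B * A = 0\<^sub>m m r" "y \<in> carrier_vec r"
  shows "B *\<^sub>v (A *\<^sub>v y) = 0\<^sub>v m"
proof -
  have "B *\<^sub>v (A *\<^sub>v y) = 0\<^sub>m m r *\<^sub>v y" using assoc_mult_mat_vec[OF assms(1,2,4)] assms(3) by simp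
  also have "\<dots> = 0\<^sub>v m" using assms(4) by (intro eq_vecI) auto
  finally show ?thesis .
qed

text \<open>
  Exactness of \<open>0 \<rightarrow> K\<^sup>r \<rightarrow> K\<^sup>n \<rightarrow> K\<^sup>m \<rightarrow> 0\<close> with maps \<open>A\<close> and \<open>B\<close>, in the form of a splitting. This form consists of matrix
  identities and is evidently stable under transposition, which exchanges subspaces and quotients.
\<close>

definition split_exact :: "nat \<Rightarrow> nat \<Rightarrow> nat \<Rightarrow> 'k::field mat \<Rightarrow> 'k mat \<Rightarrow> bool" where
  "split_exact n m r B A \<longleftrightarrow> n = m + r \<and> B \<in> carrier_mat m n \<and> A \<in> carrier_mat n r \<and>
     (\<exists>R\<in>carrier_mat n m. \<exists>L\<in>carrier_mat r n.
        B * R = 1\<^sub>m m \<and> L * A = 1\<^sub>m r \<and> B * A = 0\<^sub>m m r \<and> R * B + A * L = 1\<^sub>m n)"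

lemma split_exact_transpose:
  assumes "split_exact n m r B A" shows "split_exact n r m A\<^sup>T B\<^sup>T"
proof -
  obtain R L where c: "n = m + r" "B \<in> carrier_mat m n" "A \<in> carrier_mat n r" "R \<in> carrier_mat n m"
    "L \<in> carrier_mat r n" and e: "B * R = 1\<^sub>m m" "L * A = 1\<^sub>m r" "B * A = 0\<^sub>m m r" "R * B + A * L = 1\<^sub>m n"
    using assms unfolding split_exact_def by blast
  have "A\<^sup>T * L\<^sup>T = 1\<^sub>m r" using transpose_mult[OF c(5,3)] e(2) by (metis transpose_one)
  moreover have "R\<^sup>T * B\<^sup>T = 1\<^sub>m m" using transpose_mult[OF c(2,4)] e(1) by (metis transpose_one)
  moreover have "A\<^sup>T * B\<^sup>T = 0\<^sub>m r m" using transpose_mult[OF c(2,3)] e(3) by (metis zero_transpose_mat)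
  moreover have "L\<^sup>T * A\<^sup>T + B\<^sup>T * R\<^sup>T = 1\<^sub>m n"
  proof -
    have "(R * B + A * L)\<^sup>T = (R * B)\<^sup>T + (A * L)\<^sup>T" using c by (intro transpose_add[of _ n n]) auto
    also have "\<dots> = B\<^sup>T * R\<^sup>T + L\<^sup>T * A\<^sup>T" using transpose_mult[OF c(4,2)] transpose_mult[OF c(3,5)] by simp
    also have "\<dots> = L\<^sup>T * A\<^sup>T + B\<^sup>T * R\<^sup>T" using c by (intro comm_add_mat[of _ n n]) auto
    finally show ?thesis using e(4) by (metis transpose_one)
  qed
  ultimately show ?thesis unfolding split_exact_def using c
    by (intro conjI bexI[of _ "L\<^sup>T"] bexI[of _ "R\<^sup>T"]) auto
qed

lemma split_exact_kernel:
  assumes "split_exact n m r B A"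
  shows "mat_image A = {x \<in> carrier_vec n. B *\<^sub>v x = 0\<^sub>v m}"
proof -
  obtain R L where c: "n = m + r" "B \<in> carrier_mat m n" "A \<in> carrier_mat n r" "R \<in> carrier_mat n m"
    "L \<in> carrier_mat r n" and e: "B * R = 1\<^sub>m m" "L * A = 1\<^sub>m r" "B * A = 0\<^sub>m m r" "R * B + A * L = 1\<^sub>m n"
    using assms unfolding split_exact_def by blast
  have "B *\<^sub>v (A *\<^sub>v y) = 0\<^sub>v m" if "y \<in> carrier_vec r" for y
    using mult_mat_vec_zero[OF c(2,3) e(3) that] .
  moreover have "\<exists>y\<in>carrier_vec r. x = A *\<^sub>v y" if x: "x \<in> carrier_vec n" "B *\<^sub>v x = 0\<^sub>v m" for x
  proof -
    have "x = (R * B + A * L) *\<^sub>v x" using e(4) x by simp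
    also have "\<dots> = R * B *\<^sub>v x + A * L *\<^sub>v x" using c x by (intro add_mult_distrib_mat_vec[of _ n n]) auto
    also have "\<dots> = R *\<^sub>v (B *\<^sub>v x) + A *\<^sub>v (L *\<^sub>v x)"
      using assoc_mult_mat_vec[OF c(4,2) x(1)] assoc_mult_mat_vec[OF c(3,5) x(1)] by simp
    also have "\<dots> = A *\<^sub>v (L *\<^sub>v x)"
      using x c mat_mult_zero_vec[OF c(4)] mult_mat_vec_carrier[OF c(3) mult_mat_vec_carrier[OF c(5)]] by simp
    finally show ?thesis using c x by (intro bexI[of _ "L *\<^sub>v x"]) auto
  qed
  ultimately show ?thesis using c unfolding mat_image_def by auto
qed

lemma left_inverse_mat_injective:
  assumes "L \<in> carrier_mat r n" "A \<in> carrier_mat n r" "L * A = 1\<^sub>m r" shows "mat_injective A"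
proof (rule mat_injectiveI[OF assms(2)])
  fix y :: "'a vec" assume y: "y \<in> carrier_vec r" "A *\<^sub>v y = 0\<^sub>v n"
  have "y = L * A *\<^sub>v y" using assms(3) y by simp
  also have "\<dots> = 0\<^sub>v r" using assoc_mult_mat_vec[OF assms(1,2) y(1)] y(2) mat_mult_zero_vec[OF assms(1)] by simp
  finally show "y = 0\<^sub>v r" .
qed

lemma split_exact_mat_injective: "split_exact n m r B A \<Longrightarrow> mat_injective A"
  unfolding split_exact_def using left_inverse_mat_injective by blast

lemma split_exactI:
  assumes n: "n = m + r" and B: "B \<in> carrier_mat m n" and A: "A \<in> carrier_mat n r"
    and R: "R \<in> carrier_mat n m" "B * R = 1\<^sub>m m" and inj: "mat_injective A"
    and ker: "mat_image A = {x \<in> carrier_vec n. B *\<^sub>v x = 0\<^sub>v m}"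
  shows "split_exact n m r B A"
proof -
  have BA: "B * A = 0\<^sub>m m r"
  proof (rule eq_matI)
    fix i j assume ij: "i < dim_row (0\<^sub>m m r :: 'a mat)" "j < dim_col (0\<^sub>m m r :: 'a mat)"
    have "A *\<^sub>v unit_vec r j \<in> mat_image A" using A unfolding mat_image_def by auto
    then have "B *\<^sub>v col A j = 0\<^sub>v m" using ker A ij by (simp add: mat_mult_unit_vec)
    moreover have "(B * A) $$ (i, j) = (B *\<^sub>v col A j) $ i" using A B ij by simp
    ultimately show "(B * A) $$ (i, j) = 0\<^sub>m m r $$ (i, j)" using ij by simp
  qed (use A B in auto)
  let ?X = "1\<^sub>m n - R * B"
  have X: "?X \<in> carrier_mat n n" using R B by auto
  have "B * ?X = 0\<^sub>m m n"
  proof -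
    have "B * ?X = B * 1\<^sub>m n - B * (R * B)" using B R by (intro mult_minus_distrib_mat[of _ m n]) auto
    also have "B * (R * B) = B" using assoc_mult_mat[OF B R(1) B] R(2) B by simp
    finally show ?thesis using B by simp
  qed
  then have "B *\<^sub>v col ?X j = 0\<^sub>v m" if "j < n" for j
    using that col_mult2[OF B X that] by simp
  then have "col ?X j \<in> mat_image A" if "j < n" for j using ker X that by auto
  then obtain L where L: "L \<in> carrier_mat r n" "?X = A * L" using mat_factor[OF A X] by metis
  have RBAL: "R * B + A * L = 1\<^sub>m n"
    unfolding L(2)[symmetric] using R B by (intro eq_matI) auto
  have ALA: "A * (L * A) = A"
  proof -
    have "A = (R * B + A * L) * A" using RBAL A by simp
    also have "\<dots> = R * B * A + A * L * A" using R B A L by (intro add_mult_distrib_mat[of _ n n]) auto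
    also have "R * B * A = R * (B * A)" using R B A by (intro assoc_mult_mat) auto
    finally show ?thesis using BA R L A by (simp add: assoc_mult_mat[OF A L(1) A])
  qed
  have "L * A = 1\<^sub>m r"
  proof (rule eq_matI)
    fix i j assume ij: "i < dim_row (1\<^sub>m r :: 'a mat)" "j < dim_col (1\<^sub>m r :: 'a mat)"
    let ?y = "col (L * A) j - unit_vec r j"
    have cLA: "col (L * A) j \<in> carrier_vec r" by (rule carrier_vecI) (use L in simp)
    have "A *\<^sub>v ?y = A *\<^sub>v col (L * A) j - A *\<^sub>v unit_vec r j"
      by (rule mult_minus_distrib_mat_vec[OF A cLA unit_vec_carrier])
    also have "A *\<^sub>v col (L * A) j = col A j"
      using col_mult2[OF A, of "L * A" r j] ALA ij L A by auto
    finally have "A *\<^sub>v ?y = 0\<^sub>v n" using A ij by (simp add: mat_mult_unit_vec)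
    moreover have "?y \<in> carrier_vec r"
      by (rule minus_carrier_vec[OF cLA unit_vec_carrier])
    ultimately have "?y = 0\<^sub>v r" using mat_injectiveD[OF inj A] by blast
    then have "?y $ i = 0" using ij by simp
    then show "(L * A) $$ (i, j) = 1\<^sub>m r $$ (i, j)" using ij A L by (auto split: if_splits)
  qed (use A L in auto)
  then show ?thesis unfolding split_exact_def using n B A R L(1) BA RBAL by blast
qed

definition beside :: "'b mat \<Rightarrow> 'b mat \<Rightarrow> 'b mat" where
  "beside R A = mat (dim_row A) (dim_col R + dim_col A)
     (\<lambda>(k, l). if l < dim_col R then R $$ (k, l) else A $$ (k, l - dim_col R))"

lemma split_exact_square:
  assumes n: "n = m + r" and B: "B \<in> carrier_mat m n" and A: "A \<in> carrier_mat n r"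
    and R: "R \<in> carrier_mat n m" "B * R = 1\<^sub>m m" and inj: "mat_injective A" and BA: "B * A = 0\<^sub>m m r"
  shows "split_exact n m r B A"
proof (rule split_exactI[OF n B A R inj])
  have RA: "beside R A *\<^sub>v z = R *\<^sub>v vec m (\<lambda>i. z $ i) + A *\<^sub>v vec r (\<lambda>i. z $ (m + i))"
    if z: "z \<in> carrier_vec n" for z
  proof (rule eq_vecI)
    fix k assume k: "k < dim_vec (R *\<^sub>v vec m (\<lambda>i. z $ i) + A *\<^sub>v vec r (\<lambda>i. z $ (m + i)))"
    then have k: "k < n" using A by simp
    let ?f = "\<lambda>l. beside R A $$ (k, l) * z $ l"
    have "(beside R A *\<^sub>v z) $ k = sum ?f {0..<m + r}"
      using k z R A n by (simp add: beside_def scalar_prod_def)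
    also have "\<dots> = sum ?f {0..<m} + sum ?f {m..<m + r}" by (simp add: sum.atLeastLessThan_concat)
    also have "sum ?f {m..<m + r} = (\<Sum>l\<in>{0..<r}. ?f (m + l))"
      using sum.shift_bounds_nat_ivl[of ?f 0 m r] by (simp add: add.commute)
    finally show "(beside R A *\<^sub>v z) $ k = (R *\<^sub>v vec m (\<lambda>i. z $ i) + A *\<^sub>v vec r (\<lambda>i. z $ (m + i))) $ k"
      using k R A n by (simp add: beside_def scalar_prod_def)
  qed (use A in \<open>auto simp: beside_def\<close>)
  have BRA: "B *\<^sub>v (R *\<^sub>v y + A *\<^sub>v w) = y" if y: "y \<in> carrier_vec m" and w: "w \<in> carrier_vec r" for y w
  proof -
    have "B *\<^sub>v (R *\<^sub>v y + A *\<^sub>v w) = B *\<^sub>v (R *\<^sub>v y) + B *\<^sub>v (A *\<^sub>v w)"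
      using A B R y w by (intro mult_add_distrib_mat_vec) auto
    also have "B *\<^sub>v (R *\<^sub>v y) = y"
      using assoc_mult_mat_vec[OF B R(1) y] R(2) y by simp
    finally show ?thesis using mult_mat_vec_zero[OF B A BA w] y by simp
  qed
  have N: "beside R A \<in> carrier_mat n n" using R A n by (auto simp: beside_def)
  have "det (beside R A) \<noteq> 0"
  proof
    assume "det (beside R A) = 0"
    then obtain z where z: "z \<in> carrier_vec n" "z \<noteq> 0\<^sub>v n" "beside R A *\<^sub>v z = 0\<^sub>v n"
      using det_0_iff_vec_prod_zero_field[OF N] by blast
    let ?y = "vec m (\<lambda>i. z $ i)" and ?w = "vec r (\<lambda>i. z $ (m + i))"
    have "?y = B *\<^sub>v (beside R A *\<^sub>v z)" using RA[OF z(1)] BRA[of ?y ?w] by simp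
    then have y: "?y = 0\<^sub>v m" using z(3) mat_mult_zero_vec[OF B] by simp
    then have "A *\<^sub>v ?w = 0\<^sub>v n"
      using RA[OF z(1)] z(3) mat_mult_zero_vec[OF R(1)] mult_mat_vec_carrier[OF A, of ?w] by simp
    then have w: "?w = 0\<^sub>v r" by (intro mat_injectiveD[OF inj A]) auto
    have "z $ i = 0" if "i < n" for i
    proof (cases "i < m")
      case True
      then show ?thesis using arg_cong[OF y, of "\<lambda>x. x $ i"] by simp
    next
      case False
      then show ?thesis using arg_cong[OF w, of "\<lambda>x. x $ (i - m)"] that n by simp
    qed
    then show False using z by (metis carrier_vecD eq_vecI index_zero_vec)
  qed
  then obtain N' where N': "N' \<in> carrier_mat n n" "beside R A * N' = 1\<^sub>m n"
    using det_non_zero_imp_unit[OF N, of "()"] unfolding Units_def by (auto simp: ring_mat_simps)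
  have "x \<in> mat_image A" if x: "x \<in> carrier_vec n" "B *\<^sub>v x = 0\<^sub>v m" for x
  proof -
    define z where "z = N' *\<^sub>v x"
    have z: "z \<in> carrier_vec n" "beside R A *\<^sub>v z = x"
      using N' x assoc_mult_mat_vec[OF N N'(1) x(1)] by (auto simp: z_def)
    let ?y = "vec m (\<lambda>i. z $ i)" and ?w = "vec r (\<lambda>i. z $ (m + i))"
    have "?y = 0\<^sub>v m" using BRA[of ?y ?w] RA[OF z(1)] z(2) x(2) by simp
    then have "x = A *\<^sub>v ?w"
      using RA[OF z(1)] z(2) mat_mult_zero_vec[OF R(1)] mult_mat_vec_carrier[OF A, of ?w] by simp
    then show ?thesis using A unfolding mat_image_def by auto
  qed
  moreover have "B *\<^sub>v (A *\<^sub>v w) = 0\<^sub>v m" if "w \<in> carrier_vec r" for w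
    using mult_mat_vec_zero[OF B A BA that] .
  ultimately show "mat_image A = {x \<in> carrier_vec n. B *\<^sub>v x = 0\<^sub>v m}"
    using A unfolding mat_image_def by auto
qed

definition over :: "'b mat \<Rightarrow> 'b mat \<Rightarrow> 'b mat" where
  "over B L = mat (dim_row B + dim_row L) (dim_col B)
     (\<lambda>(k, l). if k < dim_row B then B $$ (k, l) else L $$ (k - dim_row B, l))"

lemma over_beside:
  fixes B :: "'b::comm_ring_1 mat"
  assumes "B \<in> carrier_mat m n" "L \<in> carrier_mat q n" "R \<in> carrier_mat n m'" "A \<in> carrier_mat n r"
  shows "over B L * beside R A = four_block_mat (B * R) (B * A) (L * R) (L * A)"
proof (rule eq_matI)
  fix i j assume "i < dim_row (four_block_mat (B * R) (B * A) (L * R) (L * A))"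
    "j < dim_col (four_block_mat (B * R) (B * A) (L * R) (L * A))"
  then have ij: "i < m + q" "j < m' + r" using assms by auto
  have "row (over B L) i = (if i < m then row B i else row L (i - m))"
    using ij assms by (intro eq_vecI) (auto simp: over_def)
  moreover have "col (beside R A) j = (if j < m' then col R j else col A (j - m'))"
    using ij assms by (intro eq_vecI) (auto simp: beside_def)
  moreover have "dim_row (over B L) = m + q" "dim_col (beside R A) = m' + r"
    using assms by (auto simp: over_def beside_def)
  ultimately show "(over B L * beside R A) $$ (i, j) = four_block_mat (B * R) (B * A) (L * R) (L * A) $$ (i, j)"
    using ij assms by auto
qed (use assms in \<open>auto simp: over_def beside_def\<close>)

definition coordinate_rows :: "nat \<Rightarrow> nat \<Rightarrow> (nat \<Rightarrow> nat) \<Rightarrow> 'b::comm_ring_1 mat" where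
  "coordinate_rows r n \<kappa> = mat r n (\<lambda>(i, k). if k = \<kappa> i then 1 else 0)"

text \<open>
  The determinant of \<open>B\<close> completed to a square matrix by the \<open>\<kappa>\<close>-th coordinate functions, that is up to sign the
  maximal minor of \<open>B\<close> in the complementary columns. No complements of index sets have to be enumerated.
\<close>

definition dual_minor :: "nat \<Rightarrow> 'b::comm_ring_1 mat \<Rightarrow> (nat \<Rightarrow> nat) \<Rightarrow> 'b" where
  "dual_minor r B \<kappa> = det (over B (coordinate_rows r (dim_col B) \<kappa>))"

lemma coordinate_rows_mult:
  assumes A: "A \<in> carrier_mat n q" and \<kappa>: "\<And>i. i < r \<Longrightarrow> \<kappa> i < n"
  shows "coordinate_rows r n \<kappa> * A = mat r q (\<lambda>(i, j). A $$ (\<kappa> i, j))"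
proof (rule eq_matI)
  fix i j assume ij: "i < dim_row (mat r q (\<lambda>(i, j). A $$ (\<kappa> i, j)))" "j < dim_col (mat r q (\<lambda>(i, j). A $$ (\<kappa> i, j)))"
  then have "(coordinate_rows r n \<kappa> * A) $$ (i, j) = (\<Sum>k<n. (if k = \<kappa> i then 1 else 0) * A $$ (k, j))"
    using A by (auto simp: coordinate_rows_def scalar_prod_def atLeast0LessThan intro!: sum.cong)
  also have "\<dots> = (\<Sum>k<n. if k = \<kappa> i then A $$ (k, j) else 0)" by (intro sum.cong) auto
  also have "\<dots> = A $$ (\<kappa> i, j)" using \<kappa> ij by simp
  finally show "(coordinate_rows r n \<kappa> * A) $$ (i, j) = mat r q (\<lambda>(i, j). A $$ (\<kappa> i, j)) $$ (i, j)"
    using ij by simp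
qed (use A in \<open>auto simp: coordinate_rows_def\<close>)

text \<open>
  Multiplying the completed matrix by the matrix with the blocks \<open>R\<close> and \<open>A\<close> gives a block triangular matrix; compare determinants.
\<close>

lemma dual_minor_minor:
  fixes B :: "'b::idom mat"
  assumes B: "B \<in> carrier_mat m (m + r)" and R: "R \<in> carrier_mat (m + r) m" and A: "A \<in> carrier_mat (m + r) r"
    and BA: "B * A = 0\<^sub>m m r" and \<kappa>: "\<And>i. i < r \<Longrightarrow> \<kappa> i < m + r"
  shows "dual_minor r B \<kappa> * det (beside R A) = det (B * R) * minor r A \<kappa>"
proof -
  let ?E = "coordinate_rows r (m + r) \<kappa> :: 'b mat"
  have E: "?E \<in> carrier_mat r (m + r)" by (simp add: coordinate_rows_def)
  have "det (over B ?E * beside R A) = det (over B ?E) * det (beside R A)"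
    using B R A E by (intro det_mult[of _ "m + r"]) (auto simp: over_def beside_def)
  moreover have "det (over B ?E * beside R A) = det (B * R) * det (?E * A)"
    unfolding over_beside[OF B E R A] BA
    using B R A E by (intro det_four_block_mat_upper_right_zero[of _ m _ r]) auto
  ultimately show ?thesis
    using B coordinate_rows_mult[OF A \<kappa>] by (simp add: dual_minor_def minor_def)
qed

text \<open>
  The maximal minors of a basis of the kernel of \<open>B\<close> are proportional to the complementary minors of \<open>B\<close>.
\<close>

lemma split_exact_dual_minor:
  assumes "split_exact n m r B A"
  obtains R c where "R \<in> carrier_mat n m" "B * R = 1\<^sub>m m" "c = det (beside R A)" "c \<noteq> 0"
    "\<And>\<kappa>. (\<And>i. i < r \<Longrightarrow> \<kappa> i < n) \<Longrightarrow> minor r A \<kappa> = c * dual_minor r B \<kappa>"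
proof -
  obtain R L where c: "n = m + r" "B \<in> carrier_mat m n" "A \<in> carrier_mat n r" "R \<in> carrier_mat n m"
    "L \<in> carrier_mat r n" and e: "B * R = 1\<^sub>m m" "L * A = 1\<^sub>m r" "B * A = 0\<^sub>m m r" "R * B + A * L = 1\<^sub>m n"
    using assms unfolding split_exact_def by blast
  have "det (over B L * beside R A) = det (over B L) * det (beside R A)"
    using c by (intro det_mult[of _ "m + r"]) (auto simp: over_def beside_def)
  moreover have "det (over B L * beside R A) = det (B * R) * det (L * A)"
    unfolding over_beside[OF c(2,5,4,3)] e(3)
    using c by (intro det_four_block_mat_upper_right_zero[of _ m _ r]) auto
  ultimately have "det (beside R A) \<noteq> 0" using e by auto
  moreover have "minor r A \<kappa> = det (beside R A) * dual_minor r B \<kappa>" if "\<And>i. i < r \<Longrightarrow> \<kappa> i < n" for \<kappa>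
    using dual_minor_minor[of B m r R A \<kappa>] c e that by (simp add: mult.commute)
  ultimately show thesis using that c e by blast
qed

text \<open>
  The inverse of the completed square matrix contains both a right inverse of \<open>B\<close> and a basis of its kernel.
\<close>

lemma dual_minor_split_exact:
  fixes B :: "'k::field mat"
  assumes B: "B \<in> carrier_mat m n" and n: "n = m + r"
    and \<kappa>: "\<And>i. i < r \<Longrightarrow> \<kappa> i < n" and nz: "dual_minor r B \<kappa> \<noteq> 0"
  obtains A where "split_exact n m r B A"
proof -
  let ?E = "coordinate_rows r n \<kappa> :: 'k mat"
  have E: "?E \<in> carrier_mat r n" by (simp add: coordinate_rows_def)
  have S: "over B ?E \<in> carrier_mat n n" using B E n by (auto simp: over_def)
  then obtain N where N: "N \<in> carrier_mat n n" "over B ?E * N = 1\<^sub>m n" "N * over B ?E = 1\<^sub>m n"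
    using det_non_zero_imp_unit[OF S, of "()"] nz B unfolding Units_def dual_minor_def
    by (auto simp: ring_mat_simps)
  define R where "R = mat n m (\<lambda>(k, l). N $$ (k, l))"
  define A where "A = mat n r (\<lambda>(k, l). N $$ (k, m + l))"
  have R: "R \<in> carrier_mat n m" and A: "A \<in> carrier_mat n r" by (auto simp: R_def A_def)
  have "beside R A = N" using N n by (intro eq_matI) (auto simp: beside_def R_def A_def)
  then have prod: "four_block_mat (B * R) (B * A) (?E * R) (?E * A) = 1\<^sub>m n"
    using over_beside[OF B E R A] N(2) by simp
  have entry: "four_block_mat (B * R) (B * A) (?E * R) (?E * A) $$ (i, j) = 1\<^sub>m n $$ (i, j)" for i j
    using prod by simp
  have "B * R = 1\<^sub>m m"
  proof (rule eq_matI)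
    fix i j assume "i < dim_row (1\<^sub>m m :: 'k mat)" "j < dim_col (1\<^sub>m m :: 'k mat)"
    then show "(B * R) $$ (i, j) = 1\<^sub>m m $$ (i, j)" using entry[of i j] B R E A n by simp
  qed (use R B in auto)
  moreover have "B * A = 0\<^sub>m m r"
  proof (rule eq_matI)
    fix i j assume "i < dim_row (0\<^sub>m m r :: 'k mat)" "j < dim_col (0\<^sub>m m r :: 'k mat)"
    then show "(B * A) $$ (i, j) = 0\<^sub>m m r $$ (i, j)" using entry[of i "m + j"] B R E A n by simp
  qed (use A B in auto)
  moreover have "?E * A = 1\<^sub>m r"
  proof (rule eq_matI)
    fix i j assume "i < dim_row (1\<^sub>m r :: 'k mat)" "j < dim_col (1\<^sub>m r :: 'k mat)"
    then show "(?E * A) $$ (i, j) = 1\<^sub>m r $$ (i, j)" using entry[of "m + i" "m + j"] B R E A n by simp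
  qed (use A E in auto)
  moreover have "R * B + A * ?E = 1\<^sub>m n"
  proof (rule eq_matI)
    fix i j assume "i < dim_row (1\<^sub>m n :: 'k mat)" "j < dim_col (1\<^sub>m n :: 'k mat)"
    then have ij: "i < n" "j < n" by auto
    have "(N * over B ?E) $$ (i, j) = (\<Sum>l\<in>{0..<m + r}. N $$ (i, l) * over B ?E $$ (l, j))"
      using ij N(1) S n by (simp add: scalar_prod_def)
    also have "\<dots> = (\<Sum>l\<in>{0..<m}. N $$ (i, l) * over B ?E $$ (l, j)) + (\<Sum>l\<in>{m..<m + r}. N $$ (i, l) * over B ?E $$ (l, j))"
      by (simp add: sum.atLeastLessThan_concat)
    also have "(\<Sum>l\<in>{m..<m + r}. N $$ (i, l) * over B ?E $$ (l, j))
        = (\<Sum>l\<in>{0..<r}. N $$ (i, m + l) * over B ?E $$ (m + l, j))"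
      using sum.shift_bounds_nat_ivl[of "\<lambda>l. N $$ (i, l) * over B ?E $$ (l, j)" 0 m r] by (simp add: add.commute)
    also have "(\<Sum>l\<in>{0..<m}. N $$ (i, l) * over B ?E $$ (l, j)) = (R * B) $$ (i, j)"
      using ij R B E by (auto simp: scalar_prod_def R_def over_def intro!: sum.cong)
    also have "(\<Sum>l\<in>{0..<r}. N $$ (i, m + l) * over B ?E $$ (m + l, j)) = (A * ?E) $$ (i, j)"
      using ij A B E by (auto simp: scalar_prod_def A_def over_def intro!: sum.cong)
    finally show "(R * B + A * ?E) $$ (i, j) = 1\<^sub>m n $$ (i, j)" using N(3) ij A B R E by simp
  qed (use A B R E in auto)
  ultimately have "split_exact n m r B A" unfolding split_exact_def using n B A R E by blast
  then show thesis by (rule that)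
qed

section \<open>Splittings of the pulled back bundles as matrices of forms\<close>

definition form_matrix :: "nat \<Rightarrow> nat \<Rightarrow> (nat \<Rightarrow> nat \<Rightarrow> nat) \<Rightarrow> ('k::field \<times> 'k \<Rightarrow> 'k mat) \<Rightarrow> bool" where
  "form_matrix n r deg A \<longleftrightarrow> (\<forall>v. A v \<in> carrier_mat n r) \<and>
     (\<forall>k<n. \<forall>j<r. binary_form (deg k j) (\<lambda>v. A v $$ (k, j)))"

lemma form_matrixD:
  assumes "form_matrix n r deg A"
  shows "A v \<in> carrier_mat n r" "k < n \<Longrightarrow> j < r \<Longrightarrow> binary_form (deg k j) (\<lambda>v. A v $$ (k, j))"
  using assms unfolding form_matrix_def by blast+

lemma P1_open_subset: "P1_open U \<Longrightarrow> U \<subseteq> P1"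
  by (auto simp: P1_open_def)

lemma P1_open_basic: "binary_form d h \<Longrightarrow> P1_open {v \<in> P1. h v \<noteq> 0}"
  unfolding P1_open_def by (intro exI[of _ "{h}"]) auto

lemma P1_open_P1: "P1_open P1"
  using P1_open_basic[OF form.one] by simp

lemma P1_openE:
  assumes "P1_open U" "v \<in> U"
  obtains d h where "binary_form d h" "h v \<noteq> 0" "{u \<in> P1. h u \<noteq> 0} \<subseteq> U"
  using assms unfolding P1_open_def by blast

lemma regular_open_local:
  assumes U: "U \<subseteq> P1" and loc: "\<And>v. v \<in> U \<Longrightarrow> \<exists>V. P1_open V \<and> v \<in> V \<and> regular d V \<phi>"
  shows "regular d U \<phi>"
proof (rule regular_local)
  fix v assume "v \<in> U"
  then obtain V where V: "P1_open V" "v \<in> V" "regular d V \<phi>" using loc by blast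
  obtain l k where k: "binary_form l k" "k v \<noteq> 0" "{u \<in> P1. k u \<noteq> 0} \<subseteq> V" using P1_openE[OF V(1,2)] .
  have "{u \<in> U. k u \<noteq> 0} \<subseteq> V" using k(3) U by blast
  then have "regular d {u \<in> U. k u \<noteq> 0} \<phi>" by (rule regular_subset[OF V(3)])
  then show "\<exists>l k. binary_form l k \<and> k v \<noteq> 0 \<and> regular d {u \<in> U. k u \<noteq> 0} \<phi>" using k by blast
qed

lemma P1_chart:
  assumes "v \<in> P1" obtains q where "q = fst \<or> q = snd" "q v \<noteq> (0::'k::field)" "binary_form 1 q"
proof -
  have "fst v \<noteq> 0 \<or> snd v \<noteq> 0" using assms P1_iff[of "fst v" "snd v"] by simp
  then show thesis using that form_fst form_snd by blast
qed

lemma sum_sections_iff: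
  "\<sigma> \<in> sections (sum_line_bundles ds) U \<longleftrightarrow> \<sigma> \<in> extensional U \<and>
     (\<forall>v\<in>U. \<sigma> v \<in> carrier_vec (length ds)) \<and> (\<forall>i<length ds. regular (ds ! i) U (\<lambda>v. \<sigma> v $ i))"
proof -
  have "(\<lambda>v\<in>U. \<sigma> v $ i) \<in> line_bundle_sections (ds ! i) U \<longleftrightarrow> regular (ds ! i) U (\<lambda>v. \<sigma> v $ i)" for i
    unfolding line_bundle_sections_iff using regular_cong[of U "\<lambda>v\<in>U. \<sigma> v $ i" "\<lambda>v. \<sigma> v $ i"] by simp
  then show ?thesis by (simp add: sum_line_bundles_def)
qed

lemma trivial_sections_iff:
  "\<sigma> \<in> sections (trivial_bundle n) U \<longleftrightarrow> \<sigma> \<in> extensional U \<and>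
     (\<forall>v\<in>U. \<sigma> v \<in> carrier_vec n) \<and> (\<forall>i<n. regular 0 U (\<lambda>v. \<sigma> v $ i))"
  by (simp add: sum_sections_iff)

text \<open>
  A chosen form that represents a global section; a choice function spares the handling of families of existential statements.
\<close>

definition global_form :: "nat \<Rightarrow> ('k::field \<times> 'k \<Rightarrow> 'k) \<Rightarrow> 'k \<times> 'k \<Rightarrow> 'k" where
  "global_form d \<phi> = (SOME h. binary_form d h \<and> (\<forall>v\<in>P1. \<phi> v = h v))"

lemma global_form:
  fixes \<phi> :: "'k::{alg_closed_field, field_char_0} \<times> 'k \<Rightarrow> 'k"
  assumes "regular (int d) P1 \<phi>"
  shows "binary_form d (global_form d \<phi>)" "v \<in> P1 \<Longrightarrow> global_form d \<phi> v = \<phi> v"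
proof -
  have "\<exists>h. binary_form d h \<and> (\<forall>v\<in>P1. \<phi> v = h v)"
  proof (rule regular_imp_form[OF assms])
    fix h assume "binary_form d h" "\<And>v. v \<in> P1 \<Longrightarrow> \<phi> v = h v"
    then show ?thesis by (intro exI[of _ h]) simp
  qed
  from someI_ex[OF this, folded global_form_def]
  show "binary_form d (global_form d \<phi>)" "v \<in> P1 \<Longrightarrow> global_form d \<phi> v = \<phi> v" by auto
qed

lemma sheaf_isoE:
  assumes "sheaf_iso F G"
  obtains \<psi> where "\<And>U. P1_open U \<Longrightarrow> bij_betw (\<psi> U) (sections F U) (sections G U)"
    "\<And>U \<sigma> \<tau>. P1_open U \<Longrightarrow> \<sigma> \<in> sections F U \<Longrightarrow> \<tau> \<in> sections F U \<Longrightarrow>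
        \<psi> U (\<lambda>v\<in>U. fibre_add F v (\<sigma> v) (\<tau> v)) = (\<lambda>v\<in>U. fibre_add G v (\<psi> U \<sigma> v) (\<psi> U \<tau> v))"
    "\<And>U c \<sigma>. P1_open U \<Longrightarrow> c \<in> line_bundle_sections 0 U \<Longrightarrow> \<sigma> \<in> sections F U \<Longrightarrow>
        \<psi> U (\<lambda>v\<in>U. fibre_scale F v (c v) (\<sigma> v)) = (\<lambda>v\<in>U. fibre_scale G v (c v) (\<psi> U \<sigma> v))"
    "\<And>U V \<sigma>. P1_open U \<Longrightarrow> P1_open V \<Longrightarrow> V \<subseteq> U \<Longrightarrow> \<sigma> \<in> sections F U \<Longrightarrow>
        \<psi> V (restrict \<sigma> V) = restrict (\<psi> U \<sigma>) V"
proof -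
  obtain \<psi> where \<psi>: "\<forall>U. P1_open U \<longrightarrow>
     bij_betw (\<psi> U) (sections F U) (sections G U) \<and>
     (\<forall>\<sigma>\<in>sections F U. \<forall>\<tau>\<in>sections F U.
        \<psi> U (\<lambda>v\<in>U. fibre_add F v (\<sigma> v) (\<tau> v)) = (\<lambda>v\<in>U. fibre_add G v (\<psi> U \<sigma> v) (\<psi> U \<tau> v))) \<and>
     (\<forall>c\<in>line_bundle_sections 0 U. \<forall>\<sigma>\<in>sections F U.
        \<psi> U (\<lambda>v\<in>U. fibre_scale F v (c v) (\<sigma> v)) = (\<lambda>v\<in>U. fibre_scale G v (c v) (\<psi> U \<sigma> v))) \<and>
     (\<forall>V. P1_open V \<longrightarrow> V \<subseteq> U \<longrightarrow>
        (\<forall>\<sigma>\<in>sections F U. \<psi> V (restrict \<sigma> V) = restrict (\<psi> U \<sigma>) V))"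
    using assms unfolding sheaf_iso_def by (rule exE)
  note at = \<psi>[THEN spec, THEN mp]
  show thesis
    by (rule that[of \<psi>])
      (rule at[THEN conjunct1] at[THEN conjunct2, THEN conjunct1, THEN bspec, THEN bspec]
         at[THEN conjunct2, THEN conjunct2, THEN conjunct1, THEN bspec, THEN bspec]
         at[THEN conjunct2, THEN conjunct2, THEN conjunct2, THEN spec, THEN mp, THEN mp, THEN bspec]; assumption)+
qed

lemma mat_imageI:
  assumes "A \<in> carrier_mat n r" "y \<in> carrier_vec r" shows "A *\<^sub>v y \<in> mat_image A"
  unfolding mat_image_eq[OF assms(1)] by (rule imageI[OF assms(2)])

lemma mat_imageE:
  assumes "x \<in> mat_image A" "A \<in> carrier_mat n r"
  obtains y where "y \<in> carrier_vec r" "x = A *\<^sub>v y"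
  using assms(1) unfolding mat_image_eq[OF assms(2)] by (elim imageE)

lemma mat_image_closed:
  assumes A: "A \<in> carrier_mat n r"
  shows "x \<in> mat_image A \<Longrightarrow> x \<in> carrier_vec n" "0\<^sub>v n \<in> mat_image A"
    "x \<in> mat_image A \<Longrightarrow> y \<in> mat_image A \<Longrightarrow> x + y \<in> mat_image A"
    "x \<in> mat_image A \<Longrightarrow> c \<cdot>\<^sub>v x \<in> mat_image A"
proof -
  show "x \<in> carrier_vec n" if x: "x \<in> mat_image A"
  proof -
    obtain y where y: "y \<in> carrier_vec r" "x = A *\<^sub>v y" using mat_imageE[OF x A] .
    show ?thesis unfolding y(2) by (rule mult_mat_vec_carrier[OF A y(1)])
  qed
  show "0\<^sub>v n \<in> mat_image A"
    using mat_imageI[OF A zero_carrier_vec] mat_mult_zero_vec[OF A] by simp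
  show "x + y \<in> mat_image A" if xy: "x \<in> mat_image A" "y \<in> mat_image A"
  proof -
    obtain w where w: "w \<in> carrier_vec r" "x = A *\<^sub>v w" using mat_imageE[OF xy(1) A] .
    obtain z where z: "z \<in> carrier_vec r" "y = A *\<^sub>v z" using mat_imageE[OF xy(2) A] .
    have "x + y = A *\<^sub>v (w + z)" using w z by (simp add: mult_add_distrib_mat_vec[OF A])
    then show ?thesis using mat_imageI[OF A add_carrier_vec[OF w(1) z(1)]] by simp
  qed
  show "c \<cdot>\<^sub>v x \<in> mat_image A" if x: "x \<in> mat_image A"
  proof -
    obtain w where w: "w \<in> carrier_vec r" "x = A *\<^sub>v w" using mat_imageE[OF x A] .
    have "c \<cdot>\<^sub>v x = A *\<^sub>v (c \<cdot>\<^sub>v w)" using w by (simp add: mult_mat_vec[OF A])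
    then show ?thesis using mat_imageI[OF A, of "c \<cdot>\<^sub>v w"] w by simp
  qed
qed

lemma mat_image_subset:
  assumes A: "A \<in> carrier_mat n r" and X: "X \<in> carrier_mat n q"
    and cols: "\<And>j. j < q \<Longrightarrow> col X j \<in> mat_image A"
  shows "mat_image X \<subseteq> mat_image A"
proof -
  obtain G where G: "G \<in> carrier_mat r q" "X = A * G" using mat_factor[OF A X cols] by blast
  show ?thesis
  proof
    fix x assume "x \<in> mat_image X"
    then obtain y where y: "y \<in> carrier_vec q" "x = X *\<^sub>v y" using X by (rule mat_imageE)
    have "x = A *\<^sub>v (G *\<^sub>v y)" unfolding y(2) G(2) by (rule assoc_mult_mat_vec[OF A G(1) y(1)])
    then show "x \<in> mat_image A" using mat_imageI[OF A mult_mat_vec_carrier[OF G(1) y(1)]] by simp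
  qed
qed

text \<open>
  Cramer's rule. Multiplication by the adjugate normalises \<open>A\<close> so that its \<open>\<kappa>\<close>-rows form a multiple of the identity
  matrix; then the entries are the minors in which one row is exchanged.
\<close>

lemma minor_replace:
  assumes A: "A \<in> carrier_mat n r" and kj: "k < n" "j < r"
  shows "minor r A (\<kappa>(j := k)) = (A * adj_mat (mat r r (\<lambda>(i, l). A $$ (\<kappa> i, l)))) $$ (k, j)"
proof -
  let ?T = "mat r r (\<lambda>(i, l). A $$ (\<kappa> i, l))" and ?M = "mat r r (\<lambda>(i, l). A $$ ((\<kappa>(j := k)) i, l))"
  have adj: "adj_mat ?T \<in> carrier_mat r r" by (rule adj_mat) simp
  have cof: "cofactor ?M j l = cofactor ?T j l" if "l < r" for l
  proof -
    have "mat_delete ?M j l = mat_delete ?T j l" by (intro eq_matI) (auto simp: mat_delete_def)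
    then show ?thesis by (simp add: cofactor_def)
  qed
  have "minor r A (\<kappa>(j := k)) = (\<Sum>l<r. ?M $$ (j, l) * cofactor ?M j l)"
    unfolding minor_def using kj by (intro laplace_expansion_row) auto
  also have "\<dots> = (\<Sum>l<r. A $$ (k, l) * adj_mat ?T $$ (l, j))"
    using cof kj by (intro sum.cong) (auto simp: adj_mat_def)
  also have "\<dots> = (A * adj_mat ?T) $$ (k, j)"
    using A adj kj by (simp add: scalar_prod_def atLeast0LessThan)
  finally show ?thesis .
qed

lemma eval_forms_binary_form: "binary_form e (\<lambda>v. eval_forms e P v I)"
  unfolding binary_form_def eval_forms_def by (rule exI[of _ "\<lambda>k. P (I, k)"]) (simp add: case_prod_unfold)

lemma coordinates_matrix:
  assumes "coordinates e r n f P" "v \<in> P1"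
  obtains A where "A \<in> carrier_mat n r" "mat_image A = f v" "mat_injective A"
    "\<And>I. I \<in> pluecker_indices r n \<Longrightarrow> eval_forms e P v I = minor r A (pick I)"
  using assms pluecker_matE[of r n "f v" "eval_forms e P v"] unfolding coordinates_def by blast

text \<open>
  Every vector of a fibre extends to a local section of the pullback of \<open>\<S>\<close>. Near \<open>v\<close> some Pluecker coordinate does not
  vanish; then a vector of \<open>f u\<close> is determined by its coordinates in the corresponding \<open>r\<close> places, and it depends on them
  through ratios of Pluecker coordinates. The section is the one with constant coordinates in these places.
\<close>

lemma Mor_local_section:
  fixes f :: "'k::field grass_map"
  assumes co: "coordinates e r n f P" and v: "v \<in> P1" and x: "x \<in> f v"
  obtains d h \<sigma> where "binary_form d h" "h v \<noteq> 0" "\<sigma> v = x"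
    "\<And>u. u \<in> P1 \<Longrightarrow> h u \<noteq> 0 \<Longrightarrow> \<sigma> u \<in> f u"
    "\<And>k. k < n \<Longrightarrow> regular 0 {u \<in> P1. h u \<noteq> 0} (\<lambda>u. \<sigma> u $ k)"
proof -
  obtain A0 where A0: "A0 \<in> carrier_mat n r" "mat_image A0 = f v" "mat_injective A0"
    "\<And>I. I \<in> pluecker_indices r n \<Longrightarrow> eval_forms e P v I = minor r A0 (pick I)"
    using coordinates_matrix[OF co v] by blast
  obtain I where I: "I \<in> pluecker_indices r n" "minor r A0 (pick I) \<noteq> 0"
    using mat_injective_minor[OF A0(1,3)] minor_pick_nonzero[OF A0(1)] by metis
  note \<kappa> = pluecker_indices_pick(4)[OF I(1)]
  define h where "h u = eval_forms e P u I" for u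
  define c where "c = vec r (\<lambda>i. x $ pick I i)"
  define \<sigma> where "\<sigma> u = vec n (\<lambda>k. (\<Sum>j<r. alternating r (eval_forms e P u) ((pick I)(j := k)) * c $ j) / h u)" for u
  have h: "binary_form e h" unfolding h_def by (rule eval_forms_binary_form)
  have c: "c \<in> carrier_vec r" by (simp add: c_def)
  have \<sigma>_eq: "\<sigma> u = A *\<^sub>v ((1 / h u) \<cdot>\<^sub>v (adj_mat (mat r r (\<lambda>(i, l). A $$ (pick I i, l))) *\<^sub>v c))"
    if A: "A \<in> carrier_mat n r"
      "\<And>I. I \<in> pluecker_indices r n \<Longrightarrow> eval_forms e P u I = minor r A (pick I)" for u A
  proof -
    let ?T = "mat r r (\<lambda>(i, l). A $$ (pick I i, l))"
    have adj: "adj_mat ?T \<in> carrier_mat r r" by (rule adj_mat) simp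
    have alt: "alternating r (eval_forms e P u) ((pick I)(j := k)) = (A * adj_mat ?T) $$ (k, j)" if "k < n" "j < r" for k j
      using alternating_minor[OF A(1) _ A(2), of "(pick I)(j := k)"] minor_replace[OF A(1) that, of "pick I"] \<kappa> that by auto
    have "\<sigma> u = (1 / h u) \<cdot>\<^sub>v (A * adj_mat ?T *\<^sub>v c)"
    proof (rule eq_vecI)
      fix k assume "k < dim_vec ((1 / h u) \<cdot>\<^sub>v (A * adj_mat ?T *\<^sub>v c))"
      then have k: "k < n" using A by simp
      have "(A * adj_mat ?T *\<^sub>v c) $ k = row (A * adj_mat ?T) k \<bullet> c" using k A(1) by simp
      also have "\<dots> = (\<Sum>j<r. (A * adj_mat ?T) $$ (k, j) * c $ j)"
        unfolding scalar_prod_def using k A(1) adj c by (intro sum.cong) (auto simp: atLeast0LessThan)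
      also have "\<dots> = (\<Sum>j<r. alternating r (eval_forms e P u) ((pick I)(j := k)) * c $ j)"
        using alt k by (intro sum.cong) auto
      finally show "\<sigma> u $ k = ((1 / h u) \<cdot>\<^sub>v (A * adj_mat ?T *\<^sub>v c)) $ k" using k A(1) by (simp add: \<sigma>_def)
    qed (use A in \<open>simp add: \<sigma>_def\<close>)
    also have "A * adj_mat ?T *\<^sub>v c = A *\<^sub>v (adj_mat ?T *\<^sub>v c)" by (rule assoc_mult_mat_vec[OF A(1) adj c])
    also have "(1 / h u) \<cdot>\<^sub>v (A *\<^sub>v (adj_mat ?T *\<^sub>v c)) = A *\<^sub>v ((1 / h u) \<cdot>\<^sub>v (adj_mat ?T *\<^sub>v c))"
      by (rule mult_mat_vec[symmetric, OF A(1) mult_mat_vec_carrier[OF adj c]])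
    finally show ?thesis .
  qed
  show thesis
  proof (rule that[OF h])
    show "h v \<noteq> 0" using I A0(4)[OF I(1)] by (simp add: h_def)
    show "\<sigma> u \<in> f u" if u: "u \<in> P1" "h u \<noteq> 0" for u
    proof -
      obtain A where A: "A \<in> carrier_mat n r" "mat_image A = f u" "mat_injective A"
        "\<And>I. I \<in> pluecker_indices r n \<Longrightarrow> eval_forms e P u I = minor r A (pick I)"
        using coordinates_matrix[OF co u(1)] by blast
      have adj: "adj_mat (mat r r (\<lambda>(i, l). A $$ (pick I i, l))) \<in> carrier_mat r r" by (rule adj_mat) simp
      have "(1 / h u) \<cdot>\<^sub>v (adj_mat (mat r r (\<lambda>(i, l). A $$ (pick I i, l))) *\<^sub>v c) \<in> carrier_vec r"
        by (rule smult_carrier_vec[THEN iffD2, OF mult_mat_vec_carrier[OF adj c]])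
      then show ?thesis using \<sigma>_eq[OF A(1,4)] mat_imageI[OF A(1)] A(2) by simp
    qed
    show "\<sigma> v = x"
    proof -
      let ?T = "mat r r (\<lambda>(i, l). A0 $$ (pick I i, l))"
      have T: "?T \<in> carrier_mat r r" by simp
      have "x \<in> mat_image A0" using x A0(2) by simp
      then obtain y where y: "y \<in> carrier_vec r" "x = A0 *\<^sub>v y" using A0(1) by (rule mat_imageE)
      have "c = ?T *\<^sub>v y"
      proof (rule eq_vecI)
        fix i assume "i < dim_vec (?T *\<^sub>v y)"
        then have i: "i < r" by simp
        have "row A0 (pick I i) = row ?T i" using i \<kappa> A0(1) by (intro eq_vecI) auto
        then show "c $ i = (?T *\<^sub>v y) $ i" using i \<kappa> A0(1) y by (simp add: c_def)
      qed (simp add: c_def)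
      then have "adj_mat ?T *\<^sub>v c = adj_mat ?T * ?T *\<^sub>v y"
        using assoc_mult_mat_vec[OF adj_mat(1)[OF T] T y(1)] by simp
      also have "\<dots> = det ?T \<cdot>\<^sub>v y" unfolding adj_mat(3)[OF T] using y(1) by (intro eq_vecI) auto
      finally have "(1 / h v) \<cdot>\<^sub>v (adj_mat ?T *\<^sub>v c) = y"
        using I(2) A0(4)[OF I(1)] y(1) by (intro eq_vecI) (auto simp: h_def minor_def)
      then show ?thesis using \<sigma>_eq[OF A0(1,4)] y by simp
    qed
    show "regular 0 {u \<in> P1. h u \<noteq> 0} (\<lambda>u. \<sigma> u $ k)" if k: "k < n" for k
    proof -
      have "binary_form e (\<lambda>u. \<Sum>j<r. alternating r (eval_forms e P u) ((pick I)(j := k)) * c $ j)"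
        unfolding alternating_def
        by (intro form.sum) (simp only: mult.assoc mult.commute[of _ "c $ _"] mult.left_commute[of _ "c $ _"],
            intro form_cmult eval_forms_binary_form)
      then have "regular (int e - int e) {u \<in> P1. h u \<noteq> 0}
          (\<lambda>u. (\<Sum>j<r. alternating r (eval_forms e P u) ((pick I)(j := k)) * c $ j) / h u)"
        by (intro regular_divide regular_form h) auto
      then show ?thesis using k by (simp add: \<sigma>_def)
    qed
  qed
qed

lemma pullback_sub_sections_iff:
  assumes "f \<in> Mor e r n" "U \<subseteq> P1"
  shows "\<sigma> \<in> sections (pullback_sub n f) U \<longleftrightarrow> \<sigma> \<in> extensional U \<and> (\<forall>v\<in>U. \<sigma> v \<in> f v) \<and>
     (\<forall>i<n. regular 0 U (\<lambda>v. \<sigma> v $ i))"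
proof -
  obtain P where co: "coordinates e r n f P" using assms(1) by (auto simp: Mor_def)
  have "x \<in> carrier_vec n" if v: "v \<in> U" and x: "x \<in> f v" for v x
  proof -
    have "v \<in> P1" using v assms(2) by blast
    then obtain A where "A \<in> carrier_mat n r" "mat_image A = f v" by (rule coordinates_matrix[OF co])
    then show ?thesis using mat_image_closed(1) x by blast
  qed
  then show ?thesis unfolding pullback_sub_def by (auto simp: trivial_sections_iff)
qed

lemma Mor_fibre:
  assumes "f \<in> Mor e r n" "v \<in> P1"
  obtains A where "A \<in> carrier_mat n r" "mat_image A = f v" "mat_injective A" "f v \<in> Grassmannian r n"
proof -
  obtain P where co: "coordinates e r n f P" using assms(1) by (auto simp: Mor_def)
  moreover have "f v \<in> Grassmannian r n" using co assms by (auto simp: coordinates_def)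
  ultimately show thesis using that coordinates_matrix[OF co assms(2)] by metis
qed

text \<open>
  The isomorphism of sheaves is only known to respect sums of two sections and multiplication by one function; this is
  the consequence for linear combinations, in terms of components.
\<close>

lemma pullback_sub_combination:
  fixes f :: "'k::field grass_map" and N :: nat
  assumes f: "f \<in> Mor e r n" and U: "P1_open U"
    and sec: "\<And>j. \<sigma> j \<in> sections (pullback_sub n f) U"
    and c: "\<And>j. c j \<in> line_bundle_sections 0 U"
    and \<psi>: "\<And>\<sigma>. \<sigma> \<in> sections (pullback_sub n f) U \<Longrightarrow> \<psi> \<sigma> \<in> sections (sum_line_bundles ds) U"
      "\<And>\<sigma> \<tau>. \<sigma> \<in> sections (pullback_sub n f) U \<Longrightarrow> \<tau> \<in> sections (pullback_sub n f) U \<Longrightarrow>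
        \<psi> (\<lambda>v\<in>U. \<sigma> v + \<tau> v) = (\<lambda>v\<in>U. \<psi> \<sigma> v + \<psi> \<tau> v)"
      "\<And>c \<sigma>. c \<in> line_bundle_sections 0 U \<Longrightarrow> \<sigma> \<in> sections (pullback_sub n f) U \<Longrightarrow>
        \<psi> (\<lambda>v\<in>U. c v \<cdot>\<^sub>v \<sigma> v) = (\<lambda>v\<in>U. c v \<cdot>\<^sub>v \<psi> \<sigma> v)"
    and N: "N > 0"
  shows "(\<lambda>v\<in>U. vec n (\<lambda>k. \<Sum>j<N. c j v * \<sigma> j v $ k)) \<in> sections (pullback_sub n f) U \<and>
    \<psi> (\<lambda>v\<in>U. vec n (\<lambda>k. \<Sum>j<N. c j v * \<sigma> j v $ k))
      = (\<lambda>v\<in>U. vec (length ds) (\<lambda>k. \<Sum>j<N. c j v * \<psi> (\<sigma> j) v $ k))"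
proof -
  note UP = P1_open_subset[OF U]
  interpret reg: graded_functions "\<lambda>d. regular d U" by (rule regular_graded[OF UP])
  note iff = pullback_sub_sections_iff[OF f UP]
  have closed: "x \<in> carrier_vec n" "y \<in> f v \<Longrightarrow> x + y \<in> f v" "b \<cdot>\<^sub>v x \<in> f v" if v: "v \<in> U" and x: "x \<in> f v" for v x y b
  proof -
    have "v \<in> P1" using v UP by blast
    then obtain A where A: "A \<in> carrier_mat n r" "mat_image A = f v" by (rule Mor_fibre[OF f])
    show "x \<in> carrier_vec n" "y \<in> f v \<Longrightarrow> x + y \<in> f v" "b \<cdot>\<^sub>v x \<in> f v"
      using mat_image_closed[OF A(1)] x unfolding A(2) by blast+
  qed
  have inf: "\<tau> v \<in> f v" "\<tau> v \<in> carrier_vec n" if "\<tau> \<in> sections (pullback_sub n f) U" "v \<in> U" for \<tau> v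
    using that closed(1) iff by blast+
  have reg: "regular 0 U (\<lambda>v. \<tau> v $ k)" if "\<tau> \<in> sections (pullback_sub n f) U" "k < n" for \<tau> k
    using that iff by blast
  have carr: "\<psi> \<tau> v \<in> carrier_vec (length ds)" if "\<tau> \<in> sections (pullback_sub n f) U" "v \<in> U" for \<tau> v
    using \<psi>(1)[OF that(1)] that(2) by (auto simp: sum_sections_iff)
  have infd: "dim_vec (\<tau> v) = n" if "\<tau> \<in> sections (pullback_sub n f) U" "v \<in> U" for \<tau> v
    using inf(2)[OF that] by simp
  have carrd: "dim_vec (\<psi> \<tau> v) = length ds" if "\<tau> \<in> sections (pullback_sub n f) U" "v \<in> U" for \<tau> v
    using carr[OF that] by simp
  have scale: "(\<lambda>v\<in>U. b v \<cdot>\<^sub>v \<tau> v) \<in> sections (pullback_sub n f) U"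
    if b: "b \<in> line_bundle_sections 0 U" and \<tau>: "\<tau> \<in> sections (pullback_sub n f) U" for b \<tau>
    unfolding iff
  proof (intro conjI ballI allI impI)
    fix k assume k: "k < n"
    have "regular (0 + 0) U (\<lambda>v. b v * \<tau> v $ k)"
      using reg.mult b reg[OF \<tau> k] unfolding line_bundle_sections_iff by blast
    then show "regular 0 U (\<lambda>v. (\<lambda>v\<in>U. b v \<cdot>\<^sub>v \<tau> v) v $ k)"
      using infd[OF \<tau>] k by (subst regular_cong[of U _ "\<lambda>v. b v * \<tau> v $ k"]) auto
  qed (use inf[OF \<tau>] closed in auto)
  have add: "(\<lambda>v\<in>U. \<rho> v + \<tau> v) \<in> sections (pullback_sub n f) U"
    if \<rho>: "\<rho> \<in> sections (pullback_sub n f) U" and \<tau>: "\<tau> \<in> sections (pullback_sub n f) U" for \<rho> \<tau>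
    unfolding iff
  proof (intro conjI ballI allI impI)
    fix k assume k: "k < n"
    have "regular 0 U (\<lambda>v. \<rho> v $ k + \<tau> v $ k)" using reg.add reg[OF \<rho> k] reg[OF \<tau> k] by blast
    then show "regular 0 U (\<lambda>v. (\<lambda>v\<in>U. \<rho> v + \<tau> v) v $ k)"
      using infd[OF \<tau>] infd[OF \<rho>] k by (subst regular_cong[of U _ "\<lambda>v. \<rho> v $ k + \<tau> v $ k"]) auto
  qed (use inf[OF \<tau>] inf[OF \<rho>] closed in auto)
  show ?thesis using N
  proof (induction N rule: nat_induct_non_zero)
    case 1
    have eq1: "(\<lambda>v\<in>U. vec n (\<lambda>k. \<Sum>j<1. c j v * \<sigma> j v $ k)) = (\<lambda>v\<in>U. c 0 v \<cdot>\<^sub>v \<sigma> 0 v)"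
      using infd[OF sec] by (intro restrict_ext eq_vecI) auto
    have eq2: "(\<lambda>v\<in>U. vec (length ds) (\<lambda>k. \<Sum>j<1. c j v * \<psi> (\<sigma> j) v $ k)) = (\<lambda>v\<in>U. c 0 v \<cdot>\<^sub>v \<psi> (\<sigma> 0) v)"
      using carrd[OF sec] by (intro restrict_ext eq_vecI) auto
    show ?case unfolding eq1 eq2 by (intro conjI scale[OF c sec] \<psi>(3)[OF c sec])
  next
    case (Suc N)
    let ?S = "\<lambda>v\<in>U. vec n (\<lambda>k. \<Sum>j<N. c j v * \<sigma> j v $ k)" and ?T = "\<lambda>v\<in>U. c N v \<cdot>\<^sub>v \<sigma> N v"
    have S: "?S \<in> sections (pullback_sub n f) U" and T: "?T \<in> sections (pullback_sub n f) U"
      using Suc.IH scale[OF c sec] by blast+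
    have eq: "(\<lambda>v\<in>U. vec n (\<lambda>k. \<Sum>j<Suc N. c j v * \<sigma> j v $ k)) = (\<lambda>v\<in>U. ?S v + ?T v)"
      using infd[OF sec] by (intro restrict_ext eq_vecI) auto
    have "\<psi> (\<lambda>v\<in>U. ?S v + ?T v) = (\<lambda>v\<in>U. \<psi> ?S v + \<psi> ?T v)" by (rule \<psi>(2)[OF S T])
    also have "\<dots> = (\<lambda>v\<in>U. vec (length ds) (\<lambda>k. \<Sum>j<Suc N. c j v * \<psi> (\<sigma> j) v $ k))"
      unfolding conjunct2[OF Suc.IH] \<psi>(3)[OF c sec]
      using carrd[OF sec] by (intro restrict_ext eq_vecI) auto
    finally show ?case unfolding eq using add[OF S T] by blast
  qed
qed

text \<open>
  Column \<open>j\<close> of \<open>A\<close> is the image of the generator of the summand \<open>\<O>(-a\<^sub>j)\<close> under the inverse of the given isomorphism. This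
  generator exists only on the charts, as \<open>q ^ (- a\<^sub>j)\<close> with \<open>q\<close> one of the two coordinates; multiplied with
  \<open>q ^ a\<^sub>j\<close>, its images on the two charts glue to a vector of forms of degree \<open>a\<^sub>j\<close>. As the isomorphism is
  onto, every local section is a combination of the columns.
\<close>

lemma locus_sub_matrix:
  fixes f :: "'k::{alg_closed_field, field_char_0} grass_map"
  assumes f: "f \<in> locus_sub e r n a" and r: "length a = r" "r > 0"
  obtains A where "form_matrix n r (\<lambda>k j. a ! j) A" "\<And>v. v \<in> P1 \<Longrightarrow> f v = mat_image (A v)"
    "\<And>v. v \<in> P1 \<Longrightarrow> mat_injective (A v)"
proof -
  let ?F = "pullback_sub n f" and ?G = "sum_line_bundles (map (\<lambda>i. - int i) a) :: ('k, 'k vec) sheaf_of_modules"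
  have Mor: "f \<in> Mor e r n" and iso: "sheaf_iso ?F ?G" using f by (auto simp: locus_sub_def)
  obtain P where co: "coordinates e r n f P" using Mor by (auto simp: Mor_def)
  have ops: "fibre_add ?F = (\<lambda>v x y. x + y)" "fibre_scale ?F = (\<lambda>v c x. c \<cdot>\<^sub>v x)"
    "fibre_add ?G = (\<lambda>v x y. x + y)" "fibre_scale ?G = (\<lambda>v c x. c \<cdot>\<^sub>v x)"
    by (simp_all add: pullback_sub_def sum_line_bundles_def)
  obtain \<psi> where bij: "\<And>U. P1_open U \<Longrightarrow> bij_betw (\<psi> U) (sections ?F U) (sections ?G U)"
    and add: "\<And>U \<sigma> \<tau>. P1_open U \<Longrightarrow> \<sigma> \<in> sections ?F U \<Longrightarrow> \<tau> \<in> sections ?F U \<Longrightarrow>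
        \<psi> U (\<lambda>v\<in>U. \<sigma> v + \<tau> v) = (\<lambda>v\<in>U. \<psi> U \<sigma> v + \<psi> U \<tau> v)"
    and scale: "\<And>U c \<sigma>. P1_open U \<Longrightarrow> c \<in> line_bundle_sections 0 U \<Longrightarrow> \<sigma> \<in> sections ?F U \<Longrightarrow>
        \<psi> U (\<lambda>v\<in>U. c v \<cdot>\<^sub>v \<sigma> v) = (\<lambda>v\<in>U. c v \<cdot>\<^sub>v \<psi> U \<sigma> v)"
    and res: "\<And>U V \<sigma>. P1_open U \<Longrightarrow> P1_open V \<Longrightarrow> V \<subseteq> U \<Longrightarrow> \<sigma> \<in> sections ?F U \<Longrightarrow>
        \<psi> V (restrict \<sigma> V) = restrict (\<psi> U \<sigma>) V"
    using sheaf_isoE[OF iso] unfolding ops by blast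
  note Fiff = pullback_sub_sections_iff[OF Mor]
  have Giff: "\<tau> \<in> sections ?G U \<longleftrightarrow> \<tau> \<in> extensional U \<and> (\<forall>v\<in>U. \<tau> v \<in> carrier_vec r) \<and>
      (\<forall>j<r. regular (- int (a ! j)) U (\<lambda>v. \<tau> v $ j))" for \<tau> U
    using r by (simp add: sum_sections_iff)
  have Fres: "restrict \<sigma> V \<in> sections ?F V" if "\<sigma> \<in> sections ?F U" "V \<subseteq> U" "U \<subseteq> P1" for \<sigma> U V
  proof -
    have "regular 0 V (\<lambda>v. restrict \<sigma> V v $ i)" if "i < n" for i
      using regular_subset[of 0 U "\<lambda>v. \<sigma> v $ i" V] \<open>\<sigma> \<in> sections ?F U\<close> \<open>V \<subseteq> U\<close> \<open>U \<subseteq> P1\<close> that Fiff[of U \<sigma>]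
        regular_cong[of V "\<lambda>v. restrict \<sigma> V v $ i" "\<lambda>v. \<sigma> v $ i"] by auto
    then show ?thesis using that Fiff[of U \<sigma>] Fiff[of V "restrict \<sigma> V"] by auto
  qed
  define U where "U q = {v \<in> P1. q v \<noteq> 0}" for q :: "'k \<times> 'k \<Rightarrow> 'k"
  define \<epsilon> where "\<epsilon> q j = (\<lambda>v\<in>U q. vec r (\<lambda>i. if i = j then 1 / q v ^ (a ! j) else 0))" for q :: "'k \<times> 'k \<Rightarrow> 'k" and j
  have U: "P1_open (U q)" "U q \<subseteq> P1" if "binary_form 1 q" for q using P1_open_basic[OF that] by (auto simp: U_def)
  have \<epsilon>: "\<epsilon> q j \<in> sections ?G (U q)" if q: "binary_form 1 q" for q j
    unfolding Giff
  proof (intro conjI ballI allI impI)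
    interpret reg: graded_functions "\<lambda>d. regular d (U q)" by (rule regular_graded[OF U(2)[OF q]])
    fix i assume i: "i < r"
    have "regular (0 - int (a ! j)) (U q) (\<lambda>v. 1 / q v ^ (a ! j))"
      using form_power[OF q, of "a ! j"] by (intro regular_divide reg.one regular_form) (auto simp: U_def)
    then have "regular (- int (a ! i)) (U q) (\<lambda>v. if i = j then 1 / q v ^ (a ! j) else 0)"
      using reg.zero by (cases "i = j") simp_all
    then show "regular (- int (a ! i)) (U q) (\<lambda>v. \<epsilon> q j v $ i)"
      using i by (subst regular_cong[of "U q" _ "\<lambda>v. if i = j then 1 / q v ^ (a ! j) else 0"]) (auto simp: \<epsilon>_def)
  qed (auto simp: \<epsilon>_def)
  define \<sigma> where "\<sigma> q j = inv_into (sections ?F (U q)) (\<psi> (U q)) (\<epsilon> q j)" for q j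
  have \<sigma>: "\<sigma> q j \<in> sections ?F (U q)" "\<psi> (U q) (\<sigma> q j) = \<epsilon> q j" if q: "binary_form 1 q" for q j
    using bij[OF U(1)[OF q]] \<epsilon>[OF q, of j] unfolding \<sigma>_def
    by (auto simp: bij_betw_def inv_into_into f_inv_into_f)
  \<comment> \<open>the two local generators differ by the transition function of the line bundle\<close>
  have transition: "\<sigma> snd j v $ k = (fst v / snd v) ^ (a ! j) * \<sigma> fst j v $ k"
    if v: "v \<in> P1" "fst v \<noteq> 0" "snd v \<noteq> 0" and k: "k < n" for v j k
  proof -
    define W where "W = {v \<in> P1. fst v * snd v \<noteq> (0::'k)}"
    have W: "P1_open W" "W \<subseteq> U fst" "W \<subseteq> U snd" "W \<subseteq> P1"
      using P1_open_basic[OF form.mult[OF form_fst form_snd]] by (auto simp: W_def U_def)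
    define c where "c = (\<lambda>v\<in>W. (fst v / snd v) ^ (a ! j))"
    have "regular (int (a ! j) - int (a ! j)) W (\<lambda>v. fst v ^ (a ! j) / snd v ^ (a ! j))"
      by (intro regular_divide regular_form form_fst_power form_snd_power) (auto simp: W_def)
    then have c: "c \<in> line_bundle_sections 0 W"
      unfolding line_bundle_sections_iff c_def
      by (subst regular_cong[of W _ "\<lambda>v. fst v ^ (a ! j) / snd v ^ (a ! j)"]) (auto simp: power_divide)
    let ?s = "restrict (\<sigma> fst j) W" and ?t = "restrict (\<sigma> snd j) W"
    have s: "?s \<in> sections ?F W" and t: "?t \<in> sections ?F W"
      using Fres[OF \<sigma>(1)[OF form_fst] W(2) U(2)[OF form_fst]] Fres[OF \<sigma>(1)[OF form_snd] W(3) U(2)[OF form_snd]] by auto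
    have cs: "(\<lambda>v\<in>W. vec n (\<lambda>k. \<Sum>i<(1::nat). c v * ?s v $ k)) \<in> sections ?F W \<and>
      \<psi> W (\<lambda>v\<in>W. vec n (\<lambda>k. \<Sum>i<(1::nat). c v * ?s v $ k))
      = (\<lambda>v\<in>W. vec (length (map (\<lambda>i. - int i) a)) (\<lambda>k. \<Sum>i<(1::nat). c v * \<psi> W ?s v $ k))"
      using bij[OF W(1)] by (intro pullback_sub_combination[OF Mor W(1), where c = "\<lambda>_. c"] s c add[OF W(1)] scale[OF W(1)])
        (auto simp: bij_betw_def)
    have \<psi>st: "\<psi> W ?s = restrict (\<epsilon> fst j) W" "\<psi> W ?t = restrict (\<epsilon> snd j) W"
      using res[OF U(1)[OF form_fst] W(1,2) \<sigma>(1)[OF form_fst]] res[OF U(1)[OF form_snd] W(1,3) \<sigma>(1)[OF form_snd]]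
        \<sigma>(2)[OF form_fst] \<sigma>(2)[OF form_snd] by auto
    have "\<psi> W (\<lambda>v\<in>W. vec n (\<lambda>k. \<Sum>i<(1::nat). c v * ?s v $ k)) = \<psi> W ?t"
      unfolding conjunct2[OF cs] \<psi>st
    proof (rule restrict_ext)
      fix u assume u: "u \<in> W"
      then have u': "u \<in> U fst" "u \<in> U snd" "fst u \<noteq> 0" "snd u \<noteq> 0" using W by (auto simp: W_def)
      show "vec (length (map (\<lambda>i. - int i) a)) (\<lambda>k. \<Sum>i<(1::nat). c u * restrict (\<epsilon> fst j) W u $ k) = \<epsilon> snd j u"
        using u u' r by (intro eq_vecI) (simp_all add: \<epsilon>_def c_def power_divide)
    qed
    then have "(\<lambda>v\<in>W. vec n (\<lambda>k. \<Sum>i<(1::nat). c v * ?s v $ k)) = ?t"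
      using bij[OF W(1)] cs t unfolding bij_betw_def by (meson inj_onD)
    moreover have vW: "v \<in> W" using v by (simp add: W_def)
    ultimately have "?t v $ k = vec n (\<lambda>k. \<Sum>i<(1::nat). c v * ?s v $ k) $ k"
      by (metis (no_types, lifting) restrict_apply')
    then show ?thesis using k vW by (simp add: c_def)
  qed
  define A0 where "A0 j k v = (if fst v \<noteq> 0 then fst v ^ (a ! j) * \<sigma> fst j v $ k else snd v ^ (a ! j) * \<sigma> snd j v $ k)" for j k v
  have A0: "A0 j k v = q v ^ (a ! j) * \<sigma> q j v $ k"
    if "q = fst \<or> q = snd" "v \<in> P1" "q v \<noteq> 0" "k < n" for q j k v
    using that transition[of v k j] by (auto simp: A0_def power_divide)
  have regA0: "regular (int (a ! j)) P1 (A0 j k)" if k: "k < n" for j k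
  proof (rule regular_local)
    fix v :: "'k \<times> 'k" assume "v \<in> P1"
    then obtain q where q: "q = fst \<or> q = snd" "q v \<noteq> 0" "binary_form 1 q" by (rule P1_chart)
    interpret reg: graded_functions "\<lambda>d. regular d (U q)" by (rule regular_graded[OF U(2)[OF q(3)]])
    have "regular (int (a ! j) + 0) (U q) (\<lambda>v. q v ^ (a ! j) * \<sigma> q j v $ k)"
      using form_power[OF q(3), of "a ! j"] \<sigma>(1)[OF q(3), of j] Fiff[OF U(2)[OF q(3)]] k
      by (intro reg.mult regular_form) auto
    then have "regular (int (a ! j)) {u \<in> P1. q u \<noteq> 0} (A0 j k)"
      using A0[OF q(1) _ _ k] by (subst regular_cong[of _ _ "\<lambda>v. q v ^ (a ! j) * \<sigma> q j v $ k"]) (auto simp: U_def)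
    then show "\<exists>l h. binary_form l h \<and> h v \<noteq> 0 \<and> regular (int (a ! j)) {u \<in> P1. h u \<noteq> 0} (A0 j k)"
      using q by blast
  qed
  define h where "h j k = global_form (a ! j) (A0 j k)" for j k
  have h: "\<And>j k. k < n \<Longrightarrow> binary_form (a ! j) (h j k)" "\<And>j k v. k < n \<Longrightarrow> v \<in> P1 \<Longrightarrow> A0 j k v = h j k v"
    using global_form[OF regA0] by (auto simp: h_def)
  define A where "A v = mat n r (\<lambda>(k, j). h j k v)" for v
  have A: "A v \<in> carrier_mat n r" for v by (simp add: A_def)
  have Aq: "A v $$ (k, j) = q v ^ (a ! j) * \<sigma> q j v $ k"
    if "q = fst \<or> q = snd" "v \<in> P1" "q v \<noteq> 0" "k < n" "j < r" for q j k v
    using A0[OF that(1-4)] h(2)[OF that(4,2)] that(4,5) by (simp add: A_def)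
  \<comment> \<open>the columns are in the fibre by construction; for the converse a vector of the fibre is extended to a
    local section, and the coordinates of its image under the isomorphism are the coefficients\<close>
  have image: "f v = mat_image (A v)" if v: "v \<in> P1" for v
  proof -
    obtain q where q: "q = fst \<or> q = snd" "q v \<noteq> 0" "binary_form 1 q" using P1_chart[OF v] by blast
    obtain A' where A': "A' \<in> carrier_mat n r" "mat_image A' = f v" using Mor_fibre[OF Mor v] by blast
    have "col (A v) j \<in> mat_image A'" if j: "j < r" for j
    proof -
      have "v \<in> U q" using v q(2) by (simp add: U_def)
      then have "\<sigma> q j v \<in> f v" using iffD1[OF Fiff[OF U(2)[OF q(3)]] \<sigma>(1)[OF q(3), of j]] by blast
      then have s: "\<sigma> q j v \<in> mat_image A'" by (simp add: A')
      have "col (A v) j = q v ^ (a ! j) \<cdot>\<^sub>v \<sigma> q j v"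
        using Aq[OF q(1) v q(2)] j A mat_image_closed(1)[OF A'(1) s] by (intro eq_vecI) (auto simp: A_def)
      then show ?thesis using mat_image_closed(4)[OF A'(1) s] by simp
    qed
    then have "mat_image (A v) \<subseteq> f v" using mat_image_subset[OF A'(1) A] A'(2) by blast
    moreover have "x \<in> mat_image (A v)" if x: "x \<in> f v" for x
    proof -
      obtain d h \<rho> where h: "binary_form d h" "h v \<noteq> 0" "\<rho> v = x"
        "\<And>u. u \<in> P1 \<Longrightarrow> h u \<noteq> 0 \<Longrightarrow> \<rho> u \<in> f u"
        "\<And>k. k < n \<Longrightarrow> regular 0 {u \<in> P1. h u \<noteq> 0} (\<lambda>u. \<rho> u $ k)"
        using Mor_local_section[OF co v x] by blast
      define D where "D = {u \<in> P1. h u * q u \<noteq> 0}"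
      have D: "P1_open D" "D \<subseteq> U q" "D \<subseteq> P1" "D \<subseteq> {u \<in> P1. h u \<noteq> 0}"
        using P1_open_basic[OF form.mult[OF h(1) q(3)]] by (auto simp: D_def U_def)
      interpret reg: graded_functions "\<lambda>d. regular d D" by (rule regular_graded[OF D(3)])
      have \<rho>: "restrict \<rho> D \<in> sections ?F D"
        unfolding Fiff[OF D(3)]
      proof (intro conjI ballI allI impI)
        show "regular 0 D (\<lambda>u. restrict \<rho> D u $ k)" if "k < n" for k
          using regular_subset[OF h(5)[OF that] D(4)] regular_cong[of D "\<lambda>u. restrict \<rho> D u $ k" "\<lambda>u. \<rho> u $ k"] by simp
      qed (use h(4) in \<open>auto simp: D_def\<close>)
      define \<tau> where "\<tau> = \<psi> D (restrict \<rho> D)"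
      have \<tau>: "\<tau> \<in> sections ?G D" using bij[OF D(1)] \<rho> unfolding \<tau>_def bij_betw_def by blast
      define c where "c j = (\<lambda>u\<in>D. if j < r then q u ^ (a ! j) * \<tau> u $ j else 0)" for j
      have c: "c j \<in> line_bundle_sections 0 D" for j
      proof -
        have "regular 0 D (\<lambda>u. if j < r then q u ^ (a ! j) * \<tau> u $ j else 0)"
        proof (cases "j < r")
          case True
          have "regular (int (a ! j) + (- int (a ! j))) D (\<lambda>u. q u ^ (a ! j) * \<tau> u $ j)"
            using form_power[OF q(3), of "a ! j"] \<tau> True unfolding Giff by (intro reg.mult regular_form) auto
          then show ?thesis using True by simp
        qed (simp add: reg.zero)
        then show ?thesis unfolding line_bundle_sections_iff c_def
          using regular_cong[of D "\<lambda>u\<in>D. if j < r then q u ^ (a ! j) * \<tau> u $ j else 0"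
              "\<lambda>u. if j < r then q u ^ (a ! j) * \<tau> u $ j else 0"] by simp
      qed
      let ?s = "\<lambda>j. restrict (\<sigma> q j) D"
      have s: "?s j \<in> sections ?F D" for j by (rule Fres[OF \<sigma>(1)[OF q(3)] D(2) U(2)[OF q(3)]])
      have comb: "(\<lambda>u\<in>D. vec n (\<lambda>k. \<Sum>j<r. c j u * ?s j u $ k)) \<in> sections ?F D \<and>
        \<psi> D (\<lambda>u\<in>D. vec n (\<lambda>k. \<Sum>j<r. c j u * ?s j u $ k))
        = (\<lambda>u\<in>D. vec (length (map (\<lambda>i. - int i) a)) (\<lambda>k. \<Sum>j<r. c j u * \<psi> D (?s j) u $ k))"
        using bij[OF D(1)] r by (intro pullback_sub_combination[OF Mor D(1)] s c add[OF D(1)] scale[OF D(1)])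
          (auto simp: bij_betw_def)
      have \<psi>s: "\<psi> D (?s j) = restrict (\<epsilon> q j) D" for j
        using res[OF U(1)[OF q(3)] D(1,2) \<sigma>(1)[OF q(3)]] \<sigma>(2)[OF q(3)] by simp
      have "\<psi> D (\<lambda>u\<in>D. vec n (\<lambda>k. \<Sum>j<r. c j u * ?s j u $ k)) = \<tau>"
      proof (rule extensionalityI[of _ D])
        show "\<tau> \<in> extensional D" using \<tau> Giff by blast
        fix u assume u: "u \<in> D"
        show "\<psi> D (\<lambda>u\<in>D. vec n (\<lambda>k. \<Sum>j<r. c j u * ?s j u $ k)) u = \<tau> u"
        proof (rule eq_vecI)
          have "\<tau> u \<in> carrier_vec r" using \<tau> u Giff by blast
          then show dim: "dim_vec (\<psi> D (\<lambda>u\<in>D. vec n (\<lambda>k. \<Sum>j<r. c j u * ?s j u $ k)) u) = dim_vec (\<tau> u)"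
            unfolding conjunct2[OF comb] using u r by simp
          fix i assume "i < dim_vec (\<tau> u)"
          then have i: "i < r" using \<open>\<tau> u \<in> carrier_vec r\<close> by simp
          have "(\<Sum>j<r. c j u * \<psi> D (?s j) u $ i) = (\<Sum>j<r. if j = i then \<tau> u $ i else 0)"
            unfolding \<psi>s using u i D by (intro sum.cong) (auto simp: c_def \<epsilon>_def D_def U_def)
          then show "\<psi> D (\<lambda>u\<in>D. vec n (\<lambda>k. \<Sum>j<r. c j u * ?s j u $ k)) u $ i = \<tau> u $ i"
            unfolding conjunct2[OF comb] using u i r by simp
        qed
      qed (use comb in auto)
      then have "(\<lambda>u\<in>D. vec n (\<lambda>k. \<Sum>j<r. c j u * ?s j u $ k)) = restrict \<rho> D"
        using bij[OF D(1)] comb \<rho> unfolding bij_betw_def \<tau>_def by (meson inj_onD)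
      moreover have vD: "v \<in> D" using v h(2) q(2) by (simp add: D_def)
      ultimately have "x = vec n (\<lambda>k. \<Sum>j<r. c j v * ?s j v $ k)"
        using h(3) by (metis (no_types, lifting) restrict_apply')
      also have "\<dots> = A v *\<^sub>v vec r (\<lambda>j. \<tau> v $ j)"
      proof (rule eq_vecI)
        fix k assume "k < dim_vec (A v *\<^sub>v vec r (\<lambda>j. \<tau> v $ j))"
        then have k: "k < n" by (simp add: A_def)
        have "(A v *\<^sub>v vec r (\<lambda>j. \<tau> v $ j)) $ k = (\<Sum>j<r. A v $$ (k, j) * \<tau> v $ j)"
          using k A[of v] by (auto simp: scalar_prod_def atLeast0LessThan intro!: sum.cong)
        also have "\<dots> = (\<Sum>j<r. c j v * ?s j v $ k)"
          using Aq[OF q(1) v q(2) k] vD by (intro sum.cong) (auto simp: c_def)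
        finally show "vec n (\<lambda>k. \<Sum>j<r. c j v * ?s j v $ k) $ k = (A v *\<^sub>v vec r (\<lambda>j. \<tau> v $ j)) $ k"
          using k by simp
      qed (simp add: A_def)
      finally show ?thesis using mat_imageI[OF A, of "vec r (\<lambda>j. \<tau> v $ j)"] by simp
    qed
    ultimately show ?thesis by blast
  qed
  have "mat_injective (A v)" if v: "v \<in> P1" for v
    using Mor_fibre[OF Mor v] image[OF v] Grassmannian_mat_injective[OF A] by metis
  moreover have "form_matrix n r (\<lambda>k j. a ! j) A"
    unfolding form_matrix_def using h(1) by (auto simp: A_def)
  ultimately show thesis using that image by blast
qed

text \<open>
  The operations in the fibres of the quotient bundle, applied to cosets, are the operations on representatives.
\<close>

lemma vec_coset_operations:
  fixes A :: "'k::field mat"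
  assumes A: "A \<in> carrier_mat n r" and s: "s \<in> carrier_vec n" and t: "t \<in> carrier_vec n"
  shows "{x + y |x y. x \<in> vec_coset s (mat_image A) \<and> y \<in> vec_coset t (mat_image A)} = vec_coset (s + t) (mat_image A)"
    "{c \<cdot>\<^sub>v x + w |x w. x \<in> vec_coset s (mat_image A) \<and> w \<in> mat_image A} = vec_coset (c \<cdot>\<^sub>v s) (mat_image A)"
    "s \<in> mat_image A \<Longrightarrow> vec_coset s (mat_image A) = vec_coset (0\<^sub>v n) (mat_image A)"
proof -
  let ?W = "mat_image A"
  note W = mat_image_closed[OF A]
  show "{x + y |x y. x \<in> vec_coset s ?W \<and> y \<in> vec_coset t ?W} = vec_coset (s + t) ?W"
  proof (intro equalityI subsetI)
    fix z assume "z \<in> {x + y |x y. x \<in> vec_coset s ?W \<and> y \<in> vec_coset t ?W}"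
    then obtain v w where vw: "v \<in> ?W" "w \<in> ?W" "z = (s + v) + (t + w)" by (auto simp: vec_coset_def)
    have "z = (s + t) + (v + w)"
      unfolding vw(3) using W(1)[OF vw(1)] W(1)[OF vw(2)] s t by (intro eq_vecI) (simp_all add: algebra_simps)
    then show "z \<in> vec_coset (s + t) ?W" unfolding vec_coset_def using W(3)[OF vw(1,2)] by blast
  next
    fix z assume "z \<in> vec_coset (s + t) ?W"
    then obtain v where v: "v \<in> ?W" "z = (s + t) + v" by (auto simp: vec_coset_def)
    have "z = (s + v) + (t + 0\<^sub>v n)"
      unfolding v(2) using W(1)[OF v(1)] s t by (intro eq_vecI) (simp_all add: algebra_simps)
    then show "z \<in> {x + y |x y. x \<in> vec_coset s ?W \<and> y \<in> vec_coset t ?W}"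
      unfolding vec_coset_def using v(1) W(2) by blast
  qed
  show "{c \<cdot>\<^sub>v x + w |x w. x \<in> vec_coset s ?W \<and> w \<in> ?W} = vec_coset (c \<cdot>\<^sub>v s) ?W"
  proof (intro equalityI subsetI)
    fix z assume "z \<in> {c \<cdot>\<^sub>v x + w |x w. x \<in> vec_coset s ?W \<and> w \<in> ?W}"
    then obtain v w where vw: "v \<in> ?W" "w \<in> ?W" "z = c \<cdot>\<^sub>v (s + v) + w" by (auto simp: vec_coset_def)
    have "z = c \<cdot>\<^sub>v s + (c \<cdot>\<^sub>v v + w)"
      unfolding vw(3) using W(1)[OF vw(1)] W(1)[OF vw(2)] s by (intro eq_vecI) (simp_all add: algebra_simps)
    then show "z \<in> vec_coset (c \<cdot>\<^sub>v s) ?W"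
      unfolding vec_coset_def using W(3)[OF W(4)[OF vw(1), of c] vw(2)] by blast
  next
    fix z assume "z \<in> vec_coset (c \<cdot>\<^sub>v s) ?W"
    then obtain v where v: "v \<in> ?W" "z = c \<cdot>\<^sub>v s + v" by (auto simp: vec_coset_def)
    have "z = c \<cdot>\<^sub>v (s + 0\<^sub>v n) + v"
      unfolding v(2) using W(1)[OF v(1)] s by (intro eq_vecI) simp_all
    then show "z \<in> {c \<cdot>\<^sub>v x + w |x w. x \<in> vec_coset s ?W \<and> w \<in> ?W}"
      unfolding vec_coset_def using v(1) W(2) by blast
  qed
  show "vec_coset s ?W = vec_coset (0\<^sub>v n) ?W" if sW: "s \<in> ?W"
  proof (intro equalityI subsetI)
    fix z assume "z \<in> vec_coset s ?W"
    then obtain v where v: "v \<in> ?W" "z = s + v" by (auto simp: vec_coset_def)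
    have "z = 0\<^sub>v n + (s + v)" unfolding v(2) using W(1)[OF v(1)] s by (intro eq_vecI) simp_all
    then show "z \<in> vec_coset (0\<^sub>v n) ?W" unfolding vec_coset_def using W(3)[OF sW v(1)] by blast
  next
    fix z assume "z \<in> vec_coset (0\<^sub>v n) ?W"
    then obtain v where v: "v \<in> ?W" "z = 0\<^sub>v n + v" by (auto simp: vec_coset_def)
    have "z = s + ((-1) \<cdot>\<^sub>v s + v)" unfolding v(2) using W(1)[OF v(1)] s by (intro eq_vecI) simp_all
    then show "z \<in> vec_coset s ?W" unfolding vec_coset_def using W(3)[OF W(4)[OF sW, of "-1"] v(1)] by blast
  qed
qed

lemma pullback_quot_sectionI:
  assumes U: "P1_open U" and c: "\<And>k. k < n \<Longrightarrow> regular 0 U (\<lambda>v. c v $ k)" "\<And>v. v \<in> U \<Longrightarrow> c v \<in> carrier_vec n"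
  shows "(\<lambda>v\<in>U. vec_coset (c v) (f v)) \<in> sections (pullback_quot n f) U"
proof -
  have "regular 0 U (\<lambda>v. restrict c U v $ k)" if "k < n" for k
    using c(1)[OF that] regular_cong[of U "\<lambda>v. restrict c U v $ k" "\<lambda>v. c v $ k"] by simp
  then have "restrict c U \<in> sections (trivial_bundle n) U" using c(2) unfolding trivial_sections_iff by auto
  moreover have "\<forall>u\<in>U. (\<lambda>v\<in>U. vec_coset (c v) (f v)) u = vec_coset (restrict c U u) (f u)" by simp
  ultimately have "\<exists>V. P1_open V \<and> v \<in> V \<and> V \<subseteq> U \<and> (\<exists>\<sigma>\<in>sections (trivial_bundle n) V.
      \<forall>u\<in>V. (\<lambda>v\<in>U. vec_coset (c v) (f v)) u = vec_coset (\<sigma> u) (f u))" if "v \<in> U" for v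
    using U that by (intro exI[of _ U] conjI bexI[of _ "restrict c U"]) auto
  then show ?thesis unfolding pullback_quot_def by simp
qed

text \<open>
  Column \<open>k\<close> of \<open>B\<close> is the image of the class of the \<open>k\<close>-th unit vector. Since the isomorphism is linear over local functions,
  it maps the class of any local section \<open>c\<close> of the trivial bundle to \<open>B c\<close>. A section of \<open>f\<close> has class zero,
  whence \<open>B\<close> kills \<open>f v\<close>; and every vector is the value of a local section of the target, so \<open>B v\<close> is onto.
\<close>

lemma locus_quot_matrix:
  fixes f :: "'k::{alg_closed_field, field_char_0} grass_map"
  assumes f: "f \<in> locus_quot e r n b" and m: "length b = m" and n: "n > 0"
  obtains B where "form_matrix m n (\<lambda>i k. b ! i) B"
    "\<And>v x. v \<in> P1 \<Longrightarrow> x \<in> f v \<Longrightarrow> B v *\<^sub>v x = 0\<^sub>v m"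
    "\<And>v. v \<in> P1 \<Longrightarrow> \<exists>R\<in>carrier_mat n m. B v * R = 1\<^sub>m m"
proof -
  let ?F = "pullback_quot n f" and ?G = "sum_line_bundles (map int b) :: ('k, 'k vec) sheaf_of_modules"
  have Mor: "f \<in> Mor e r n" and iso: "sheaf_iso ?F ?G" using f by (auto simp: locus_quot_def)
  obtain P where co: "coordinates e r n f P" using Mor by (auto simp: Mor_def)
  have ops: "fibre_add ?F = (\<lambda>v X Y. {x + y |x y. x \<in> X \<and> y \<in> Y})"
    "fibre_scale ?F = (\<lambda>v c X. {c \<cdot>\<^sub>v x + w |x w. x \<in> X \<and> w \<in> f v})"
    "fibre_add ?G = (\<lambda>v x y. x + y)" "fibre_scale ?G = (\<lambda>v c x. c \<cdot>\<^sub>v x)"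
    by (simp_all add: pullback_quot_def sum_line_bundles_def)
  obtain \<psi> where bij: "\<And>U. P1_open U \<Longrightarrow> bij_betw (\<psi> U) (sections ?F U) (sections ?G U)"
    and add: "\<And>U \<sigma> \<tau>. P1_open U \<Longrightarrow> \<sigma> \<in> sections ?F U \<Longrightarrow> \<tau> \<in> sections ?F U \<Longrightarrow>
        \<psi> U (\<lambda>v\<in>U. fibre_add ?F v (\<sigma> v) (\<tau> v)) = (\<lambda>v\<in>U. \<psi> U \<sigma> v + \<psi> U \<tau> v)"
    and scale: "\<And>U c \<sigma>. P1_open U \<Longrightarrow> c \<in> line_bundle_sections 0 U \<Longrightarrow> \<sigma> \<in> sections ?F U \<Longrightarrow>
        \<psi> U (\<lambda>v\<in>U. fibre_scale ?F v (c v) (\<sigma> v)) = (\<lambda>v\<in>U. c v \<cdot>\<^sub>v \<psi> U \<sigma> v)"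
    and res: "\<And>U V \<sigma>. P1_open U \<Longrightarrow> P1_open V \<Longrightarrow> V \<subseteq> U \<Longrightarrow> \<sigma> \<in> sections ?F U \<Longrightarrow>
        \<psi> V (restrict \<sigma> V) = restrict (\<psi> U \<sigma>) V"
    using sheaf_isoE[OF iso] unfolding ops(3,4) by blast
  have Giff: "\<tau> \<in> sections ?G U \<longleftrightarrow> \<tau> \<in> extensional U \<and> (\<forall>v\<in>U. \<tau> v \<in> carrier_vec m) \<and>
      (\<forall>i<m. regular (int (b ! i)) U (\<lambda>v. \<tau> v $ i))" for \<tau> U
    using m by (simp add: sum_sections_iff)
  define Q where "Q k = (\<lambda>v\<in>P1. vec_coset (unit_vec n k) (f v))" for k
  have Q: "Q k \<in> sections ?F P1" for k
    unfolding Q_def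
  proof (rule pullback_quot_sectionI[OF P1_open_P1])
    show "regular 0 P1 (\<lambda>v. unit_vec n k $ l)" for l using regular_form[OF form_const, of P1 "unit_vec n k $ l"] by simp
  qed simp
  define \<beta> where "\<beta> k = \<psi> P1 (Q k)" for k
  have \<beta>: "\<beta> k \<in> sections ?G P1" for k
    using bij[OF P1_open_P1] Q unfolding \<beta>_def bij_betw_def by blast
  have comb: "\<psi> U (\<lambda>v\<in>U. vec_coset (vec n (\<lambda>k. if k < N then c v $ k else 0)) (f v))
      = (\<lambda>v\<in>U. vec m (\<lambda>i. \<Sum>k<N. c v $ k * \<beta> k v $ i))"
    if U: "P1_open U" and c: "\<And>k. k < n \<Longrightarrow> regular 0 U (\<lambda>v. c v $ k)" and N: "N > 0" "N \<le> n" for U c N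
  proof -
    note UP = P1_open_subset[OF U]
    interpret reg: graded_functions "\<lambda>d. regular d U" by (rule regular_graded[OF UP])
    have \<beta>d: "dim_vec (\<beta> k v) = m" if "v \<in> U" for k v using \<beta>[of k] that UP unfolding Giff by auto
    have sQ: "restrict (Q k) U \<in> sections ?F U" and \<psi>Q: "\<psi> U (restrict (Q k) U) = restrict (\<beta> k) U" for k
    proof -
      have "restrict (Q k) U = (\<lambda>v\<in>U. vec_coset (unit_vec n k) (f v))"
        using UP by (intro restrict_ext) (auto simp: Q_def)
      moreover have "(\<lambda>v\<in>U. vec_coset (unit_vec n k) (f v)) \<in> sections ?F U"
      proof (rule pullback_quot_sectionI[OF U])
        show "regular 0 U (\<lambda>v. unit_vec n k $ l)" for l using regular_form[OF form_const, of U "unit_vec n k $ l"] by simp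
      qed simp
      ultimately show "restrict (Q k) U \<in> sections ?F U" by simp
      show "\<psi> U (restrict (Q k) U) = restrict (\<beta> k) U"
        unfolding \<beta>_def by (rule res[OF P1_open_P1 U UP Q])
    qed
    have cl: "restrict (\<lambda>v. c v $ k) U \<in> line_bundle_sections 0 U" if "k < n" for k
      unfolding line_bundle_sections_iff
      using c[OF that] regular_cong[of U "restrict (\<lambda>v. c v $ k) U" "\<lambda>v. c v $ k"] by simp
    have scaled: "(\<lambda>v\<in>U. vec_coset (c v $ k \<cdot>\<^sub>v unit_vec n k) (f v)) \<in> sections ?F U"
      and \<psi>scaled: "\<psi> U (\<lambda>v\<in>U. vec_coset (c v $ k \<cdot>\<^sub>v unit_vec n k) (f v)) = (\<lambda>v\<in>U. c v $ k \<cdot>\<^sub>v \<beta> k v)"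
      if k: "k < n" for k
    proof -
      show "(\<lambda>v\<in>U. vec_coset (c v $ k \<cdot>\<^sub>v unit_vec n k) (f v)) \<in> sections ?F U"
      proof (rule pullback_quot_sectionI[OF U])
        fix l assume l: "l < n"
        have "regular (0 + 0) U (\<lambda>v. c v $ k * unit_vec n k $ l)"
          using regular_form[OF form_const, of U "unit_vec n k $ l"] c[OF k] by (intro reg.mult) simp_all
        then show "regular 0 U (\<lambda>v. (c v $ k \<cdot>\<^sub>v unit_vec n k) $ l)" using l by simp
      qed simp
      have "(\<lambda>v\<in>U. vec_coset (c v $ k \<cdot>\<^sub>v unit_vec n k) (f v))
          = (\<lambda>v\<in>U. fibre_scale ?F v (restrict (\<lambda>v. c v $ k) U v) (restrict (Q k) U v))"
      proof (rule restrict_ext)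
        fix v assume v: "v \<in> U"
        then have "v \<in> P1" using UP by blast
        then obtain A where A: "A \<in> carrier_mat n r" "mat_image A = f v" by (rule Mor_fibre[OF Mor])
        show "vec_coset (c v $ k \<cdot>\<^sub>v unit_vec n k) (f v)
          = fibre_scale ?F v (restrict (\<lambda>v. c v $ k) U v) (restrict (Q k) U v)"
          unfolding ops restrict_apply'[OF v] Q_def restrict_apply'[OF \<open>v \<in> P1\<close>] A(2)[symmetric]
          by (rule vec_coset_operations(2)[symmetric, OF A(1) unit_vec_carrier unit_vec_carrier])
      qed
      then have "\<psi> U (\<lambda>v\<in>U. vec_coset (c v $ k \<cdot>\<^sub>v unit_vec n k) (f v))
          = (\<lambda>v\<in>U. restrict (\<lambda>v. c v $ k) U v \<cdot>\<^sub>v \<psi> U (restrict (Q k) U) v)"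
        using scale[OF U cl[OF k] sQ] by simp
      also have "\<dots> = (\<lambda>v\<in>U. c v $ k \<cdot>\<^sub>v \<beta> k v)" unfolding \<psi>Q by (intro restrict_ext) simp
      finally show "\<psi> U (\<lambda>v\<in>U. vec_coset (c v $ k \<cdot>\<^sub>v unit_vec n k) (f v)) = (\<lambda>v\<in>U. c v $ k \<cdot>\<^sub>v \<beta> k v)" .
    qed
    show ?thesis using N
    proof (induction N rule: nat_induct_non_zero)
      case 1
      have "(\<lambda>v\<in>U. vec_coset (vec n (\<lambda>k. if k < 1 then c v $ k else 0)) (f v))
          = (\<lambda>v\<in>U. vec_coset (c v $ 0 \<cdot>\<^sub>v unit_vec n 0) (f v))"
        by (intro restrict_ext arg_cong2[where f = vec_coset] eq_vecI refl) auto
      moreover have "(\<lambda>v\<in>U. c v $ 0 \<cdot>\<^sub>v \<beta> 0 v) = (\<lambda>v\<in>U. vec m (\<lambda>i. \<Sum>k<1. c v $ k * \<beta> k v $ i))"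
        using \<beta>d by (intro restrict_ext eq_vecI) auto
      ultimately show ?case using \<psi>scaled[OF n] by metis
    next
      case (Suc N)
      let ?S = "\<lambda>v\<in>U. vec_coset (vec n (\<lambda>k. if k < N then c v $ k else 0)) (f v)"
      let ?T = "\<lambda>v\<in>U. vec_coset (c v $ N \<cdot>\<^sub>v unit_vec n N) (f v)"
      have N: "N < n" using Suc.prems by simp
      have S: "?S \<in> sections ?F U"
      proof (rule pullback_quot_sectionI[OF U])
        fix l assume l: "l < n"
        then show "regular 0 U (\<lambda>v. vec n (\<lambda>k. if k < N then c v $ k else 0) $ l)"
          using c[OF l] reg.zero by (cases "l < N") simp_all
      qed simp
      have "(\<lambda>v\<in>U. vec_coset (vec n (\<lambda>k. if k < Suc N then c v $ k else 0)) (f v))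
          = (\<lambda>v\<in>U. fibre_add ?F v (?S v) (?T v))"
      proof (rule restrict_ext)
        fix v assume v: "v \<in> U"
        then have "v \<in> P1" using UP by blast
        then obtain A where A: "A \<in> carrier_mat n r" "mat_image A = f v" by (rule Mor_fibre[OF Mor])
        have split: "vec n (\<lambda>k. if k < Suc N then c v $ k else 0)
          = vec n (\<lambda>k. if k < N then c v $ k else 0) + c v $ N \<cdot>\<^sub>v unit_vec n N"
          using N by (intro eq_vecI) (auto simp: less_Suc_eq)
        show "vec_coset (vec n (\<lambda>k. if k < Suc N then c v $ k else 0)) (f v) = fibre_add ?F v (?S v) (?T v)"
          unfolding ops restrict_apply'[OF v] A(2)[symmetric] split
          by (rule vec_coset_operations(1)[symmetric, OF A(1)]) simp_all
      qed
      then have "\<psi> U (\<lambda>v\<in>U. vec_coset (vec n (\<lambda>k. if k < Suc N then c v $ k else 0)) (f v))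
          = (\<lambda>v\<in>U. \<psi> U ?S v + \<psi> U ?T v)"
        using add[OF U S scaled[OF N]] by simp
      also have "\<dots> = (\<lambda>v\<in>U. vec m (\<lambda>i. \<Sum>k<Suc N. c v $ k * \<beta> k v $ i))"
        unfolding Suc.IH[OF less_imp_le[OF N]] \<psi>scaled[OF N] using \<beta>d by (intro restrict_ext eq_vecI) auto
      finally show ?case .
    qed
  qed
  define B where "B v = mat m n (\<lambda>(i, k). global_form (b ! i) (\<lambda>v. \<beta> k v $ i) v)" for v
  have B: "B v \<in> carrier_mat m n" for v by (simp add: B_def)
  have reg\<beta>: "regular (int (b ! i)) P1 (\<lambda>v. \<beta> k v $ i)" if "i < m" for i k using \<beta>[of k] that unfolding Giff by blast
  have B\<beta>: "B v $$ (i, k) = \<beta> k v $ i" if "v \<in> P1" "i < m" "k < n" for v i k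
    using global_form(2)[OF reg\<beta>] that by (simp add: B_def)
  have Bmult: "B v *\<^sub>v x = vec m (\<lambda>i. \<Sum>k<n. x $ k * \<beta> k v $ i)" if v: "v \<in> P1" and x: "x \<in> carrier_vec n" for v x
  proof (rule eq_vecI)
    fix i assume "i < dim_vec (vec m (\<lambda>i. \<Sum>k<n. x $ k * \<beta> k v $ i))"
    then have i: "i < m" by simp
    have "(B v *\<^sub>v x) $ i = (\<Sum>k<n. B v $$ (i, k) * x $ k)"
      using i B[of v] x by (simp add: scalar_prod_def atLeast0LessThan)
    then show "(B v *\<^sub>v x) $ i = vec m (\<lambda>i. \<Sum>k<n. x $ k * \<beta> k v $ i) $ i"
      using B\<beta>[OF v i] i by (simp add: mult.commute)
  qed (simp add: B_def)
  have comb_all: "\<psi> U (\<lambda>v\<in>U. vec_coset (c v) (f v)) v = B v *\<^sub>v c v"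
    if U: "P1_open U" and c: "\<And>k. k < n \<Longrightarrow> regular 0 U (\<lambda>v. c v $ k)" "\<And>u. u \<in> U \<Longrightarrow> c u \<in> carrier_vec n"
      and v: "v \<in> U" for U c v
  proof -
    have "(\<lambda>v\<in>U. vec_coset (c v) (f v)) = (\<lambda>v\<in>U. vec_coset (vec n (\<lambda>k. if k < n then c v $ k else 0)) (f v))"
      by (intro restrict_ext arg_cong2[where f = vec_coset] eq_vecI refl) (use c(2) in auto)
    then have "\<psi> U (\<lambda>v\<in>U. vec_coset (c v) (f v)) v = vec m (\<lambda>i. \<Sum>k<n. c v $ k * \<beta> k v $ i)"
      using comb[OF U c(1) n] v by simp
    moreover have "v \<in> P1" using v P1_open_subset[OF U] by blast
    ultimately show ?thesis using Bmult c(2)[OF v] by simp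
  qed
  show thesis
  proof (rule that)
    show "form_matrix m n (\<lambda>i k. b ! i) B"
      unfolding form_matrix_def using global_form(1)[OF reg\<beta>] by (auto simp: B_def)
    show "B v *\<^sub>v x = 0\<^sub>v m" if v: "v \<in> P1" and x: "x \<in> f v" for v x
    proof -
      obtain d h \<rho> where h: "binary_form d h" "h v \<noteq> 0" "\<rho> v = x"
        "\<And>u. u \<in> P1 \<Longrightarrow> h u \<noteq> 0 \<Longrightarrow> \<rho> u \<in> f u"
        "\<And>k. k < n \<Longrightarrow> regular 0 {u \<in> P1. h u \<noteq> 0} (\<lambda>u. \<rho> u $ k)"
        using Mor_local_section[OF co v x] by blast
      let ?D = "{u \<in> P1. h u \<noteq> 0}"
      have D: "P1_open ?D" by (rule P1_open_basic[OF h(1)])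
      have vD: "v \<in> ?D" using v h(2) by simp
      have fib: "\<rho> u \<in> carrier_vec n" "vec_coset (\<rho> u) (f u) = vec_coset (0\<^sub>v n) (f u)" if u: "u \<in> ?D" for u
      proof -
        have "u \<in> P1" and \<rho>u: "\<rho> u \<in> f u" using u h(4) by auto
        from Mor_fibre[OF Mor \<open>u \<in> P1\<close>] obtain A where A: "A \<in> carrier_mat n r" "mat_image A = f u" by metis
        show "\<rho> u \<in> carrier_vec n" using mat_image_closed(1)[OF A(1)] \<rho>u A(2) by simp
        then show "vec_coset (\<rho> u) (f u) = vec_coset (0\<^sub>v n) (f u)"
          using vec_coset_operations(3)[OF A(1), of "\<rho> u" "\<rho> u"] \<rho>u A(2) by simp
      qed
      have "(\<lambda>u\<in>?D. vec_coset (\<rho> u) (f u)) = (\<lambda>u\<in>?D. vec_coset (0\<^sub>v n) (f u))"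
        using fib(2) by (intro restrict_ext)
      moreover have "\<psi> ?D (\<lambda>u\<in>?D. vec_coset (\<rho> u) (f u)) v = B v *\<^sub>v \<rho> v"
        using h(5) fib(1) vD by (intro comb_all[OF D])
      moreover have "\<psi> ?D (\<lambda>u\<in>?D. vec_coset (0\<^sub>v n) (f u)) v = B v *\<^sub>v 0\<^sub>v n"
        using regular_form[OF form_const, of ?D "0::'k"] vD by (intro comb_all[OF D]) simp_all
      ultimately show ?thesis using h(3) mat_mult_zero_vec[OF B] by simp
    qed
    show "\<exists>R\<in>carrier_mat n m. B v * R = 1\<^sub>m m" if v: "v \<in> P1" for v
    proof -
      have surj: "y \<in> mat_image (B v)" if y: "y \<in> carrier_vec m" for y
      proof -
        obtain q where q: "q = fst \<or> q = snd" "q v \<noteq> 0" "binary_form 1 q" using P1_chart[OF v] by blast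
        let ?U = "{u \<in> P1. q u \<noteq> 0}"
        have U: "P1_open ?U" and vU: "v \<in> ?U" using P1_open_basic[OF q(3)] v q by auto
        define \<tau> where "\<tau> = (\<lambda>u\<in>?U. vec m (\<lambda>i. (y $ i / q v ^ (b ! i)) * q u ^ (b ! i)))"
        have \<tau>: "\<tau> \<in> sections ?G ?U" unfolding Giff
        proof (intro conjI ballI allI impI)
          fix i assume i: "i < m"
          have "binary_form (b ! i) (\<lambda>u. q u ^ (b ! i))" using form_power[OF q(3), of "b ! i"] by simp
          then have "regular (int (b ! i)) ?U (\<lambda>u. (y $ i / q v ^ (b ! i)) * q u ^ (b ! i))"
            by (intro regular_form form_cmult)
          then show "regular (int (b ! i)) ?U (\<lambda>u. \<tau> u $ i)"
            using i by (subst regular_cong[of ?U _ "\<lambda>u. (y $ i / q v ^ (b ! i)) * q u ^ (b ! i)"]) (auto simp: \<tau>_def)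
        qed (auto simp: \<tau>_def)
        define s where "s = inv_into (sections ?F ?U) (\<psi> ?U) \<tau>"
        have s: "s \<in> sections ?F ?U" "\<psi> ?U s = \<tau>"
          using bij[OF U] \<tau> unfolding s_def by (simp_all add: bij_betw_def inv_into_into f_inv_into_f)
        have "\<forall>v\<in>?U. \<exists>V. P1_open V \<and> v \<in> V \<and> V \<subseteq> ?U \<and>
            (\<exists>\<sigma>\<in>sections (trivial_bundle n) V. \<forall>u\<in>V. s u = vec_coset (\<sigma> u) (f u))"
          using s(1) unfolding pullback_quot_def by simp
        from bspec[OF this vU] obtain V \<sigma> where V: "P1_open V" "v \<in> V" "V \<subseteq> ?U" "\<sigma> \<in> sections (trivial_bundle n) V"
          "\<forall>u\<in>V. s u = vec_coset (\<sigma> u) (f u)"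
          by (elim exE conjE bexE)
        have "restrict s V = (\<lambda>u\<in>V. vec_coset (\<sigma> u) (f u))" using V(5) by (intro restrict_ext) simp
        moreover have "\<psi> V (restrict s V) = restrict \<tau> V" using res[OF U V(1,3) s(1)] s(2) by simp
        moreover have "\<psi> V (\<lambda>u\<in>V. vec_coset (\<sigma> u) (f u)) v = B v *\<^sub>v \<sigma> v"
          using V(4) by (intro comb_all[OF V(1)] V(2)) (auto simp: trivial_sections_iff)
        ultimately have "\<tau> v = B v *\<^sub>v \<sigma> v" using V(2) by simp
        moreover have "\<tau> v = y" using vU q(2) y unfolding \<tau>_def by (intro eq_vecI) auto
        moreover have "\<sigma> v \<in> carrier_vec n" using V(2,4) by (auto simp: trivial_sections_iff)
        ultimately show ?thesis using mat_imageI[OF B, of "\<sigma> v" v] by simp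
      qed
      obtain G where "G \<in> carrier_mat n m" "1\<^sub>m m = B v * G"
        using mat_factor[OF B, of "1\<^sub>m m" m v] surj by auto
      then show ?thesis by (intro bexI[of _ G]) simp_all
    qed
  qed
qed

section \<open>Morphisms defined by matrices of forms\<close>

context graded_functions
begin

lemma minor:
  assumes A: "\<And>v. A v \<in> carrier_mat n r" and \<kappa>: "\<And>i. i < r \<Longrightarrow> \<kappa> i < n"
    and deg: "\<And>k j. k < n \<Longrightarrow> j < r \<Longrightarrow> P (g j) (\<lambda>v. A v $$ (k, j))"
  shows "P (\<Sum>j<r. g j) (\<lambda>v. minor r (A v) \<kappa>)"
proof -
  have "P ((\<Sum>i<r. 0) + (\<Sum>j<r. g j)) (\<lambda>v. det (mat r r (\<lambda>(i, j). A v $$ (\<kappa> i, j))))"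
    by (rule det) (simp_all add: deg \<kappa>)
  then show ?thesis by (simp add: minor_def)
qed

lemma dual_minor:
  assumes B: "\<And>v. B v \<in> carrier_mat m (m + r)"
    and deg: "\<And>i k. i < m \<Longrightarrow> k < m + r \<Longrightarrow> P (d i) (\<lambda>v. B v $$ (i, k))"
  shows "P (\<Sum>i<m. d i) (\<lambda>v. dual_minor r (B v) \<kappa>)"
proof -
  let ?d = "\<lambda>i. if i < m then d i else 0"
  have "P ((\<Sum>i<m + r. ?d i) + (\<Sum>j<m + r. 0)) (\<lambda>v. det (over (B v) (coordinate_rows r (dim_col (B v)) \<kappa>)))"
  proof (rule det)
    show "over (B v) (coordinate_rows r (dim_col (B v)) \<kappa>) \<in> carrier_mat (m + r) (m + r)" for v
      using B[of v] by (auto simp: over_def coordinate_rows_def)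
    show "P (?d i + 0) (\<lambda>v. over (B v) (coordinate_rows r (dim_col (B v)) \<kappa>) $$ (i, k))"
      if ik: "i < m + r" "k < m + r" for i k
    proof (cases "i < m")
      case True
      then have "over (B v) (coordinate_rows r (dim_col (B v)) \<kappa>) $$ (i, k) = B v $$ (i, k)" for v
        using B[of v] ik by (simp add: over_def coordinate_rows_def)
      then show ?thesis using deg[OF True ik(2)] True by simp
    next
      case False
      then have "over (B v) (coordinate_rows r (dim_col (B v)) \<kappa>) $$ (i, k) = (if k = \<kappa> (i - m) then 1 else 0)" for v
        using B[of v] ik by (simp add: over_def coordinate_rows_def)
      then show ?thesis using zero one False by simp
    qed
  qed
  moreover have "(\<Sum>i<m + r. ?d i) = (\<Sum>i<m. d i)"
    by (rule sum.mono_neutral_cong_right) auto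
  ultimately show ?thesis by (simp add: dual_minor_def)
qed

end

lemma tuple_of_forms:
  assumes "\<And>I. I \<in> pluecker_indices r n \<Longrightarrow> binary_form e (h I)"
  obtains P where "\<And>x. x \<notin> pluecker_indices r n \<times> {..e} \<Longrightarrow> P x = 0"
    "\<And>I v. I \<in> pluecker_indices r n \<Longrightarrow> eval_forms e P v I = h I v"
proof -
  define c where "c I = (SOME c. h I = (\<lambda>(s, t). \<Sum>k\<le>e. c k * s ^ k * t ^ (e - k)))" for I
  have c: "h I = (\<lambda>(s, t). \<Sum>k\<le>e. c I k * s ^ k * t ^ (e - k))" if "I \<in> pluecker_indices r n" for I
    using someI_ex[OF assms[OF that, unfolded binary_form_def]] by (simp add: c_def)
  define P where "P x = (if x \<in> pluecker_indices r n \<times> {..e} then c (fst x) (snd x) else 0)" for x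
  show thesis
  proof (rule that[of P])
    show "P x = 0" if "x \<notin> pluecker_indices r n \<times> {..e}" for x using that by (simp add: P_def)
    show "eval_forms e P v I = h I v" if I: "I \<in> pluecker_indices r n" for I v
      unfolding c[OF I] eval_forms_def using I by (auto simp: P_def split: prod.split intro!: sum.cong)
  qed
qed

lemma coordinates_mat_image:
  assumes A: "\<And>v. v \<in> P1 \<Longrightarrow> A v \<in> carrier_mat n r" and inj: "\<And>v. v \<in> P1 \<Longrightarrow> mat_injective (A v)"
    and f: "\<And>v. v \<in> P1 \<Longrightarrow> f v = mat_image (A v)"
    and supp: "\<And>x. x \<notin> pluecker_indices r n \<times> {..e} \<Longrightarrow> P x = 0"
    and P: "\<And>v I. v \<in> P1 \<Longrightarrow> I \<in> pluecker_indices r n \<Longrightarrow> eval_forms e P v I = minor r (A v) (pick I)"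
  shows "coordinates e r n f P"
  unfolding coordinates_def
proof (intro conjI allI impI ballI)
  fix v :: "'a \<times> 'a" assume v: "v \<in> P1"
  show "f v \<in> Grassmannian r n" unfolding f[OF v] by (rule mat_image_Grassmannian[OF A[OF v] inj[OF v]])
  show "pluecker r n (f v) (eval_forms e P v)" unfolding f[OF v] by (rule pluecker_mat_image[OF A[OF v] P[OF v]])
qed (rule supp)

text \<open>
  The dual minors of \<open>B\<close> are only proportional to the minors of a basis of the kernel, with a ratio depending on \<open>v\<close>. This is
  harmless as \<open>coordinates\<close> is a condition at each point, and Pluecker coordinates may be scaled there.
\<close>

lemma coordinates_kernel:
  assumes B: "\<And>v. v \<in> P1 \<Longrightarrow> \<exists>A. split_exact n m r (B v) A" and r: "r > 0"
    and f: "\<And>v. v \<in> P1 \<Longrightarrow> f v = {x \<in> carrier_vec n. B v *\<^sub>v x = 0\<^sub>v m}"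
    and supp: "\<And>x. x \<notin> pluecker_indices r n \<times> {..e} \<Longrightarrow> P x = 0"
    and P: "\<And>v I. v \<in> P1 \<Longrightarrow> I \<in> pluecker_indices r n \<Longrightarrow> eval_forms e P v I = dual_minor r (B v) (pick I)"
  shows "coordinates e r n f P"
  unfolding coordinates_def
proof (intro conjI allI impI ballI)
  fix v :: "'a \<times> 'a" assume v: "v \<in> P1"
  obtain A where A: "split_exact n m r (B v) A" using B[OF v] ..
  have Ac: "A \<in> carrier_mat n r" using A unfolding split_exact_def by blast
  have fA: "f v = mat_image A" using f[OF v] split_exact_kernel[OF A] by simp
  show "f v \<in> Grassmannian r n" unfolding fA by (rule mat_image_Grassmannian[OF Ac split_exact_mat_injective[OF A]])
  obtain c where c: "c \<noteq> 0" "\<And>\<kappa>. (\<And>i. i < r \<Longrightarrow> \<kappa> i < n) \<Longrightarrow> minor r A \<kappa> = c * dual_minor r (B v) \<kappa>"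
    using split_exact_dual_minor[OF A] by metis
  have "pluecker r n (mat_image A) (\<lambda>I. c * eval_forms e P v I)"
    using c(2) P[OF v] pluecker_indices_pick(4) by (intro pluecker_mat_image[OF Ac]) metis
  then have "pluecker r n (f v) (\<lambda>I. inverse c * (c * eval_forms e P v I))"
    unfolding fA by (rule pluecker_scale) (use c(1) r in simp_all)
  moreover have "inverse c * (c * x) = x" for x using c(1) by simp
  ultimately show "pluecker r n (f v) (eval_forms e P v)" by simp
qed (rule supp)

lemma sheaf_isoI:
  assumes "\<And>U. P1_open U \<Longrightarrow> bij_betw (\<psi> U) (sections F U) (sections G U)"
    "\<And>U \<sigma> \<tau>. P1_open U \<Longrightarrow> \<sigma> \<in> sections F U \<Longrightarrow> \<tau> \<in> sections F U \<Longrightarrow>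
        \<psi> U (\<lambda>v\<in>U. fibre_add F v (\<sigma> v) (\<tau> v)) = (\<lambda>v\<in>U. fibre_add G v (\<psi> U \<sigma> v) (\<psi> U \<tau> v))"
    "\<And>U c \<sigma>. P1_open U \<Longrightarrow> c \<in> line_bundle_sections 0 U \<Longrightarrow> \<sigma> \<in> sections F U \<Longrightarrow>
        \<psi> U (\<lambda>v\<in>U. fibre_scale F v (c v) (\<sigma> v)) = (\<lambda>v\<in>U. fibre_scale G v (c v) (\<psi> U \<sigma> v))"
    "\<And>U V \<sigma>. P1_open U \<Longrightarrow> P1_open V \<Longrightarrow> V \<subseteq> U \<Longrightarrow> \<sigma> \<in> sections F U \<Longrightarrow>
        \<psi> V (restrict \<sigma> V) = restrict (\<psi> U \<sigma>) V"
  shows "sheaf_iso F G"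
  unfolding sheaf_iso_def
  by (rule exI[of _ \<psi>], intro allI impI conjI ballI) (erule (3) assms | erule (2) assms | erule assms)+

lemma sum_list_eq_sum: "sum_list xs = (\<Sum>i<length xs. xs ! i)"
  by (simp add: sum_list_sum_nth atLeast0LessThan)

text \<open>
  \<open>\<tau> \<mapsto> A \<tau>\<close> maps local sections of the sum of line bundles to local sections of the subbundle. For the
  inverse, the coordinates of a section with respect to the columns of \<open>A\<close> are computed by Cramer's rule in places where a
  minor does not vanish, so they are regular of the right degree.
\<close>

lemma locus_subI:
  fixes A :: "'k::field \<times> 'k \<Rightarrow> 'k mat"
  assumes A: "form_matrix n r (\<lambda>k j. a ! j) A" and inj: "\<And>v. v \<in> P1 \<Longrightarrow> mat_injective (A v)"
    and a: "length a = r" "sum_list a = e"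
  shows "(\<lambda>v\<in>P1. mat_image (A v)) \<in> locus_sub e r n a"
proof -
  define f where "f = (\<lambda>v\<in>P1. mat_image (A v))"
  note Ac = form_matrixD(1)[OF A] and Af = form_matrixD(2)[OF A]
  have fA: "f v = mat_image (A v)" if "v \<in> P1" for v using that by (simp add: f_def)
  have sum_a: "(\<Sum>j<r. a ! j) = e" using sum_list_eq_sum[of a] a by simp
  have minor: "binary_form e (\<lambda>v. minor r (A v) \<kappa>)" if "\<And>i. i < r \<Longrightarrow> \<kappa> i < n" for \<kappa>
    using form.minor[OF Ac that Af] sum_a by simp
  obtain P where P: "\<And>x. x \<notin> pluecker_indices r n \<times> {..e} \<Longrightarrow> P x = 0"
    "\<And>I v. I \<in> pluecker_indices r n \<Longrightarrow> eval_forms e P v I = minor r (A v) (pick I)"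
    using tuple_of_forms[of r n e "\<lambda>I v. minor r (A v) (pick I)"] minor pluecker_indices_pick(4) by metis
  have "coordinates e r n f P" by (rule coordinates_mat_image[OF Ac inj fA P])
  then have Mor: "f \<in> Mor e r n" by (auto simp: Mor_def f_def)
  let ?F = "pullback_sub n f" and ?G = "sum_line_bundles (map (\<lambda>i. - int i) a) :: ('k, 'k vec) sheaf_of_modules"
  have ops: "fibre_add ?F = (\<lambda>v x y. x + y)" "fibre_scale ?F = (\<lambda>v c x. c \<cdot>\<^sub>v x)"
    "fibre_add ?G = (\<lambda>v x y. x + y)" "fibre_scale ?G = (\<lambda>v c x. c \<cdot>\<^sub>v x)"
    by (simp_all add: pullback_sub_def sum_line_bundles_def)
  note Fiff = pullback_sub_sections_iff[OF Mor]
  have Giff: "\<tau> \<in> sections ?G U \<longleftrightarrow> \<tau> \<in> extensional U \<and> (\<forall>v\<in>U. \<tau> v \<in> carrier_vec r) \<and>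
      (\<forall>j<r. regular (- int (a ! j)) U (\<lambda>v. \<tau> v $ j))" for \<tau> U
    using a by (simp add: sum_sections_iff)
  define sol where "sol v x = (SOME y. y \<in> carrier_vec r \<and> A v *\<^sub>v y = x)" for v x
  have sol: "sol v x \<in> carrier_vec r" "A v *\<^sub>v sol v x = x" if v: "v \<in> P1" and x: "x \<in> f v" for v x
  proof -
    have "x \<in> mat_image (A v)" using fA[OF v] x by simp
    then obtain y where "y \<in> carrier_vec r" "x = A v *\<^sub>v y" using Ac[of v] by (rule mat_imageE)
    then have "\<exists>y. y \<in> carrier_vec r \<and> A v *\<^sub>v y = x" by (intro exI[of _ y]) simp
    from someI_ex[OF this] show "sol v x \<in> carrier_vec r" "A v *\<^sub>v sol v x = x" by (simp_all add: sol_def)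
  qed
  have unique: "y = z" if v: "v \<in> P1" and yz: "y \<in> carrier_vec r" "z \<in> carrier_vec r" "A v *\<^sub>v y = A v *\<^sub>v z" for v y z
  proof -
    have "A v *\<^sub>v (y - z) = A v *\<^sub>v y - A v *\<^sub>v z" by (rule mult_minus_distrib_mat_vec[OF Ac yz(1,2)])
    also have "\<dots> = 0\<^sub>v n" using yz(3) mult_mat_vec_carrier[OF Ac[of v] yz(2)] by simp
    finally have "y - z = 0\<^sub>v r" by (intro mat_injectiveD[OF inj[OF v] Ac]) (simp_all add: yz)
    then have "(y - z) $ i = 0" if "i < r" for i using that by simp
    then show ?thesis using yz(1,2) by (intro eq_vecI) auto
  qed
  have sol_image: "sol v (A v *\<^sub>v y) = y" if v: "v \<in> P1" and y: "y \<in> carrier_vec r" for v y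
  proof -
    have im: "A v *\<^sub>v y \<in> f v" using mat_imageI[OF Ac y] fA[OF v] by simp
    show ?thesis by (rule unique[OF v sol(1)[OF v im] y sol(2)[OF v im]])
  qed
  define \<psi> where "\<psi> U \<sigma> = (\<lambda>v\<in>U. sol v (\<sigma> v))" for U \<sigma>
  have \<psi>_sec: "\<psi> U \<sigma> \<in> sections ?G U" if U: "P1_open U" and \<sigma>: "\<sigma> \<in> sections ?F U" for U \<sigma>
  proof -
    note UP = P1_open_subset[OF U]
    have \<sigma>f: "\<sigma> v \<in> f v" if "v \<in> U" for v using iffD1[OF Fiff[OF UP] \<sigma>] that by blast
    have \<sigma>r: "regular 0 U (\<lambda>v. \<sigma> v $ k)" if "k < n" for k using iffD1[OF Fiff[OF UP] \<sigma>] that by blast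
    have "regular (- int (a ! i)) U (\<lambda>v. sol v (\<sigma> v) $ i)" if i: "i < r" for i
    proof (rule regular_local)
      fix v assume v: "v \<in> U"
      then have vP: "v \<in> P1" using UP by blast
      obtain \<kappa> where \<kappa>: "\<And>i. i < r \<Longrightarrow> \<kappa> i < n" "minor r (A v) \<kappa> \<noteq> 0"
        using mat_injective_minor[OF Ac inj[OF vP]] by metis
      let ?V = "{u \<in> U. minor r (A u) \<kappa> \<noteq> 0}"
      have VP: "?V \<subseteq> P1" using UP by blast
      interpret reg: graded_functions "\<lambda>d. regular d ?V" by (rule regular_graded[OF VP])
      let ?T = "\<lambda>u. mat r r (\<lambda>(l, j). A u $$ (\<kappa> l, j))"
      let ?M = "\<lambda>u. mat r r (\<lambda>(l, j). if j = i then \<sigma> u $ \<kappa> l else A u $$ (\<kappa> l, j))"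
      have cramer: "sol u (\<sigma> u) $ i = det (?M u) / minor r (A u) \<kappa>" if u: "u \<in> ?V" for u
      proof -
        have uP: "u \<in> P1" "\<sigma> u \<in> f u" using u UP \<sigma>f by auto
        note s = sol[OF uP]
        have "replace_col (?T u) (?T u *\<^sub>v sol u (\<sigma> u)) i = ?M u"
        proof (rule eq_matI)
          fix l j assume "l < dim_row (?M u)" "j < dim_col (?M u)"
          then have lj: "l < r" "j < r" by auto
          have "row (A u) (\<kappa> l) = row (?T u) l" using lj \<kappa>(1) Ac[of u] by (intro eq_vecI) auto
          then have "(?T u *\<^sub>v sol u (\<sigma> u)) $ l = (A u *\<^sub>v sol u (\<sigma> u)) $ \<kappa> l"
            using lj \<kappa>(1) Ac[of u] by simp
          then have "(?T u *\<^sub>v sol u (\<sigma> u)) $ l = \<sigma> u $ \<kappa> l" by (simp only: s(2))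
          then show "replace_col (?T u) (?T u *\<^sub>v sol u (\<sigma> u)) i $$ (l, j) = ?M u $$ (l, j)"
            using lj by (simp add: replace_col_def)
        qed (simp_all add: replace_col_def)
        then have "det (?M u) = sol u (\<sigma> u) $ i * minor r (A u) \<kappa>"
          using cramer_lemma_mat[of "?T u" r "sol u (\<sigma> u)" i] s(1) i by (simp add: minor_def)
        then show ?thesis using u by simp
      qed
      have "regular ((\<Sum>l<r. 0) + (\<Sum>j<r. if j = i then 0 else int (a ! j))) ?V (\<lambda>u. det (?M u))"
      proof (rule reg.det)
        fix l j assume lj: "l < r" "j < r"
        show "regular (0 + (if j = i then 0 else int (a ! j))) ?V (\<lambda>u. ?M u $$ (l, j))"
          using lj regular_subset[OF \<sigma>r[OF \<kappa>(1)[OF lj(1)]], of ?V] regular_form[OF Af[OF \<kappa>(1)[OF lj(1)] lj(2)], of ?V]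
          by (cases "j = i") auto
      qed simp
      moreover have "(\<Sum>j<r. if j = i then 0 else int (a ! j)) = int e - int (a ! i)"
      proof -
        have "int e = int (a ! i) + (\<Sum>j\<in>{..<r} - {i}. int (a ! j))"
          unfolding sum_a[symmetric] of_nat_sum using i by (subst sum.remove[of _ i]) auto
        moreover have "(\<Sum>j<r. if j = i then 0 else int (a ! j)) = (\<Sum>j\<in>{..<r} - {i}. int (a ! j))"
          by (rule sum.mono_neutral_cong_right) (use i in auto)
        ultimately show ?thesis by simp
      qed
      ultimately have "regular (int e - int (a ! i)) ?V (\<lambda>u. det (?M u))" by simp
      then have "regular (int e - int (a ! i) - int e) ?V (\<lambda>u. det (?M u) / minor r (A u) \<kappa>)"
        by (rule regular_divide) (auto intro: regular_form minor[OF \<kappa>(1)])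
      then have "regular (- int (a ! i)) ?V (\<lambda>u. sol u (\<sigma> u) $ i)"
        using cramer by (subst regular_cong[of ?V _ "\<lambda>u. det (?M u) / minor r (A u) \<kappa>"]) simp_all
      then show "\<exists>l h. binary_form l h \<and> h v \<noteq> 0 \<and> regular (- int (a ! i)) {u \<in> U. h u \<noteq> 0} (\<lambda>v. sol v (\<sigma> v) $ i)"
        using minor[OF \<kappa>(1)] \<kappa>(2) by (intro exI[of _ e] exI[of _ "\<lambda>u. minor r (A u) \<kappa>"]) simp
    qed
    then have "regular (- int (a ! i)) U (\<lambda>v. \<psi> U \<sigma> v $ i)" if "i < r" for i
      using that regular_cong[of U "\<lambda>v. \<psi> U \<sigma> v $ i" "\<lambda>v. sol v (\<sigma> v) $ i"] by (simp add: \<psi>_def)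
    moreover have "\<psi> U \<sigma> v \<in> carrier_vec r" if "v \<in> U" for v
      using sol(1)[OF subsetD[OF UP that] \<sigma>f[OF that]] that by (simp add: \<psi>_def)
    moreover have "\<psi> U \<sigma> \<in> extensional U" by (simp add: \<psi>_def)
    ultimately show ?thesis unfolding Giff by blast
  qed
  have preimage_sec: "(\<lambda>v\<in>U. A v *\<^sub>v \<tau> v) \<in> sections ?F U" if U: "P1_open U" and \<tau>: "\<tau> \<in> sections ?G U" for U \<tau>
  proof -
    note UP = P1_open_subset[OF U]
    interpret reg: graded_functions "\<lambda>d. regular d U" by (rule regular_graded[OF UP])
    have \<tau>c: "\<tau> v \<in> carrier_vec r" if "v \<in> U" for v using \<tau> that Giff by blast
    have \<tau>r: "regular (- int (a ! j)) U (\<lambda>v. \<tau> v $ j)" if "j < r" for j using \<tau> that Giff by blast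
    have "regular 0 U (\<lambda>v. (\<lambda>v\<in>U. A v *\<^sub>v \<tau> v) v $ k)" if k: "k < n" for k
    proof -
      have "regular 0 U (\<lambda>v. \<Sum>j<r. A v $$ (k, j) * \<tau> v $ j)"
      proof (rule reg.sum)
        fix j assume "j \<in> {..<r}"
        then have j: "j < r" by simp
        have "regular (int (a ! j) + - int (a ! j)) U (\<lambda>v. A v $$ (k, j) * \<tau> v $ j)"
          by (rule reg.mult[OF regular_form[OF Af[OF k j]] \<tau>r[OF j]])
        then show "regular 0 U (\<lambda>v. A v $$ (k, j) * \<tau> v $ j)" by simp
      qed
      moreover have "(\<lambda>v\<in>U. A v *\<^sub>v \<tau> v) v $ k = (\<Sum>j<r. A v $$ (k, j) * \<tau> v $ j)" if "v \<in> U" for v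
        using that k Ac[of v] \<tau>c[OF that] by (simp add: scalar_prod_def atLeast0LessThan)
      ultimately show ?thesis by (subst regular_cong[of U _ "\<lambda>v. \<Sum>j<r. A v $$ (k, j) * \<tau> v $ j"])
    qed
    moreover have "(\<lambda>v\<in>U. A v *\<^sub>v \<tau> v) v \<in> f v" if "v \<in> U" for v
      using that mat_imageI[OF Ac \<tau>c[OF that]] fA[OF subsetD[OF UP that]] by simp
    moreover have "(\<lambda>v\<in>U. A v *\<^sub>v \<tau> v) \<in> extensional U" by simp
    ultimately show ?thesis unfolding Fiff[OF UP] by blast
  qed
  have "sheaf_iso ?F ?G"
  proof (rule sheaf_isoI[of \<psi>])
    fix U :: "('k \<times> 'k) set" assume U: "P1_open U"
    note UP = P1_open_subset[OF U]
    have \<sigma>f: "\<sigma> v \<in> f v" "v \<in> P1" if "\<sigma> \<in> sections ?F U" "v \<in> U" for \<sigma> v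
      using iffD1[OF Fiff[OF UP] that(1)] that(2) UP by blast+
    show "bij_betw (\<psi> U) (sections ?F U) (sections ?G U)"
    proof (rule bij_betwI[where g = "\<lambda>\<tau>. \<lambda>v\<in>U. A v *\<^sub>v \<tau> v"])
      show "\<psi> U \<in> sections ?F U \<rightarrow> sections ?G U" using \<psi>_sec[OF U] by (intro funcsetI)
      show "(\<lambda>\<tau>. \<lambda>v\<in>U. A v *\<^sub>v \<tau> v) \<in> sections ?G U \<rightarrow> sections ?F U" using preimage_sec[OF U] by (intro funcsetI)
      show "(\<lambda>v\<in>U. A v *\<^sub>v \<psi> U \<sigma> v) = \<sigma>" if \<sigma>: "\<sigma> \<in> sections ?F U" for \<sigma>
      proof (rule extensionalityI[of _ U])
        show "\<sigma> \<in> extensional U" using iffD1[OF Fiff[OF UP] \<sigma>] by blast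
        fix v assume v: "v \<in> U"
        show "(\<lambda>v\<in>U. A v *\<^sub>v \<psi> U \<sigma> v) v = \<sigma> v" using v sol(2)[OF \<sigma>f(2,1)[OF \<sigma> v]] by (simp add: \<psi>_def)
      qed simp
      show "\<psi> U (\<lambda>v\<in>U. A v *\<^sub>v \<tau> v) = \<tau>" if \<tau>: "\<tau> \<in> sections ?G U" for \<tau>
      proof (rule extensionalityI[of _ U])
        show "\<tau> \<in> extensional U" using \<tau> Giff by blast
        show "\<psi> U (\<lambda>v\<in>U. A v *\<^sub>v \<tau> v) \<in> extensional U" by (simp add: \<psi>_def)
        fix v assume v: "v \<in> U"
        have "\<tau> v \<in> carrier_vec r" using \<tau> v Giff by blast
        then show "\<psi> U (\<lambda>v\<in>U. A v *\<^sub>v \<tau> v) v = \<tau> v" using v sol_image[OF subsetD[OF UP v]] by (simp add: \<psi>_def)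
      qed
    qed
    show "\<psi> U (\<lambda>v\<in>U. fibre_add ?F v (\<sigma> v) (\<tau> v)) = (\<lambda>v\<in>U. fibre_add ?G v (\<psi> U \<sigma> v) (\<psi> U \<tau> v))"
      if \<sigma>: "\<sigma> \<in> sections ?F U" and \<tau>: "\<tau> \<in> sections ?F U" for \<sigma> \<tau>
      unfolding ops
    proof (rule extensionalityI[of _ U])
      fix v assume v: "v \<in> U"
      note s = sol[OF \<sigma>f(2,1)[OF \<sigma> v]] and t = sol[OF \<sigma>f(2,1)[OF \<tau> v]]
      have "A v *\<^sub>v (sol v (\<sigma> v) + sol v (\<tau> v)) = \<sigma> v + \<tau> v"
        unfolding mult_add_distrib_mat_vec[OF Ac s(1) t(1)] s(2) t(2) ..
      then have "sol v (\<sigma> v + \<tau> v) = sol v (\<sigma> v) + sol v (\<tau> v)"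
        using sol_image[OF \<sigma>f(2)[OF \<sigma> v] add_carrier_vec[OF s(1) t(1)]] by simp
      then show "\<psi> U (\<lambda>v\<in>U. \<sigma> v + \<tau> v) v = (\<lambda>v\<in>U. \<psi> U \<sigma> v + \<psi> U \<tau> v) v" using v by (simp add: \<psi>_def)
    qed (simp_all add: \<psi>_def)
    show "\<psi> U (\<lambda>v\<in>U. fibre_scale ?F v (c v) (\<sigma> v)) = (\<lambda>v\<in>U. fibre_scale ?G v (c v) (\<psi> U \<sigma> v))"
      if \<sigma>: "\<sigma> \<in> sections ?F U" for c \<sigma>
      unfolding ops
    proof (rule extensionalityI[of _ U])
      fix v assume v: "v \<in> U"
      note s = sol[OF \<sigma>f(2,1)[OF \<sigma> v]]
      have "A v *\<^sub>v (c v \<cdot>\<^sub>v sol v (\<sigma> v)) = c v \<cdot>\<^sub>v \<sigma> v" unfolding mult_mat_vec[OF Ac s(1)] s(2) ..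
      moreover have "c v \<cdot>\<^sub>v sol v (\<sigma> v) \<in> carrier_vec r" using s(1) by simp
      ultimately have "sol v (c v \<cdot>\<^sub>v \<sigma> v) = c v \<cdot>\<^sub>v sol v (\<sigma> v)"
        using sol_image[OF \<sigma>f(2)[OF \<sigma> v], of "c v \<cdot>\<^sub>v sol v (\<sigma> v)"] by simp
      then show "\<psi> U (\<lambda>v\<in>U. c v \<cdot>\<^sub>v \<sigma> v) v = (\<lambda>v\<in>U. c v \<cdot>\<^sub>v \<psi> U \<sigma> v) v" using v by (simp add: \<psi>_def)
    qed (simp_all add: \<psi>_def)
    show "\<psi> V (restrict \<sigma> V) = restrict (\<psi> U \<sigma>) V" if "V \<subseteq> U" for V \<sigma>
      by (rule extensionalityI[of _ V]) (use that in \<open>auto simp: \<psi>_def subset_iff\<close>)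
  qed
  then show ?thesis using Mor unfolding locus_sub_def f_def by blast
qed

text \<open>
  \<open>B\<close> maps cosets of its kernel to vectors. To lift sections near \<open>v\<close>, let \<open>R\<close> be a right inverse of \<open>B v\<close>; then
  \<open>B R\<close> is invertible near \<open>v\<close>, and Cramer's rule for it gives a right inverse of \<open>B\<close> with regular entries.
\<close>

lemma locus_quotI:
  fixes B :: "'k::field \<times> 'k \<Rightarrow> 'k mat"
  assumes B: "form_matrix m n (\<lambda>i k. b ! i) B" and ex: "\<And>v. v \<in> P1 \<Longrightarrow> \<exists>A. split_exact n m r (B v) A"
    and n: "n = m + r" "r > 0" and b: "length b = m" "sum_list b = e"
  shows "(\<lambda>v\<in>P1. {x \<in> carrier_vec n. B v *\<^sub>v x = 0\<^sub>v m}) \<in> locus_quot e r n b"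
proof -
  define f where "f = (\<lambda>v\<in>P1. {x \<in> carrier_vec n. B v *\<^sub>v x = 0\<^sub>v m})"
  note Bc = form_matrixD(1)[OF B] and Bf = form_matrixD(2)[OF B]
  have fB: "f v = {x \<in> carrier_vec n. B v *\<^sub>v x = 0\<^sub>v m}" if "v \<in> P1" for v using that by (simp add: f_def)
  have sum_b: "(\<Sum>i<m. b ! i) = e" using sum_list_eq_sum[of b] b by simp
  have dual: "binary_form e (\<lambda>v. dual_minor r (B v) \<kappa>)" for \<kappa>
    using form.dual_minor[of B m r "\<lambda>i. b ! i" \<kappa>] Bc Bf n sum_b by simp
  obtain P where P: "\<And>x. x \<notin> pluecker_indices r n \<times> {..e} \<Longrightarrow> P x = 0"
    "\<And>I v. I \<in> pluecker_indices r n \<Longrightarrow> eval_forms e P v I = dual_minor r (B v) (pick I)"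
    using tuple_of_forms[of r n e "\<lambda>I v. dual_minor r (B v) (pick I)"] dual by metis
  have "coordinates e r n f P" by (rule coordinates_kernel[OF ex n(2) fB P])
  then have Mor: "f \<in> Mor e r n" by (auto simp: Mor_def f_def)
  let ?F = "pullback_quot n f" and ?G = "sum_line_bundles (map int b) :: ('k, 'k vec) sheaf_of_modules"
  have ops: "fibre_add ?F = (\<lambda>v X Y. {x + y |x y. x \<in> X \<and> y \<in> Y})"
    "fibre_scale ?F = (\<lambda>v c X. {c \<cdot>\<^sub>v x + w |x w. x \<in> X \<and> w \<in> f v})"
    "fibre_add ?G = (\<lambda>v x y. x + y)" "fibre_scale ?G = (\<lambda>v c x. c \<cdot>\<^sub>v x)"
    by (simp_all add: pullback_quot_def sum_line_bundles_def)
  have Giff: "\<tau> \<in> sections ?G U \<longleftrightarrow> \<tau> \<in> extensional U \<and> (\<forall>v\<in>U. \<tau> v \<in> carrier_vec m) \<and>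
      (\<forall>i<m. regular (int (b ! i)) U (\<lambda>v. \<tau> v $ i))" for \<tau> U
    using b by (simp add: sum_sections_iff)
  have R: "\<exists>R\<in>carrier_mat n m. B v * R = 1\<^sub>m m" if "v \<in> P1" for v
    using ex[OF that] unfolding split_exact_def by blast
  \<comment> \<open>the fibre of the quotient, described by the value of \<open>B\<close>\<close>
  define fib where "fib v z = {x \<in> carrier_vec n. B v *\<^sub>v x = z}" for v z
  define val where "val v X = B v *\<^sub>v (SOME x. x \<in> X)" for v X
  have surj: "\<exists>x\<in>carrier_vec n. B v *\<^sub>v x = z" if v: "v \<in> P1" and z: "z \<in> carrier_vec m" for v z
  proof -
    obtain R where R: "R \<in> carrier_mat n m" "B v * R = 1\<^sub>m m" using R[OF v] by blast
    have "B v *\<^sub>v (R *\<^sub>v z) = z" using assoc_mult_mat_vec[OF Bc[of v] R(1) z] R(2) z by simp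
    then show ?thesis using mult_mat_vec_carrier[OF R(1) z] by (intro bexI[of _ "R *\<^sub>v z"])
  qed
  have val_fib: "val v (fib v z) = z" if v: "v \<in> P1" and z: "z \<in> carrier_vec m" for v z
  proof -
    have "\<exists>x. x \<in> fib v z" using surj[OF v z] unfolding fib_def by blast
    from someI_ex[OF this] show ?thesis unfolding val_def by (simp add: fib_def)
  qed
  have Badd: "B v *\<^sub>v (x + y) = B v *\<^sub>v x + B v *\<^sub>v y" if "x \<in> carrier_vec n" "y \<in> carrier_vec n" for v x y
    by (rule mult_add_distrib_mat_vec[OF Bc that])
  have Bcar: "B v *\<^sub>v x \<in> carrier_vec m" if "x \<in> carrier_vec n" for v x by (rule mult_mat_vec_carrier[OF Bc that])
  have Bminus: "B v *\<^sub>v (x - y) = B v *\<^sub>v x - B v *\<^sub>v y" if "x \<in> carrier_vec n" "y \<in> carrier_vec n" for v x y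
    by (rule mult_minus_distrib_mat_vec[OF Bc that])
  have coset_fib: "vec_coset x (f v) = fib v (B v *\<^sub>v x)" if v: "v \<in> P1" and x: "x \<in> carrier_vec n" for v x
  proof (intro equalityI subsetI)
    fix y assume "y \<in> vec_coset x (f v)"
    then obtain w where w: "w \<in> carrier_vec n" "B v *\<^sub>v w = 0\<^sub>v m" "y = x + w"
      unfolding vec_coset_def fB[OF v] by blast
    have "B v *\<^sub>v y = B v *\<^sub>v x" unfolding w(3) Badd[OF x w(1)] w(2) using Bcar[OF x] by simp
    then show "y \<in> fib v (B v *\<^sub>v x)" unfolding fib_def using w x by simp
  next
    fix y assume "y \<in> fib v (B v *\<^sub>v x)"
    then have y: "y \<in> carrier_vec n" "B v *\<^sub>v y = B v *\<^sub>v x" unfolding fib_def by auto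
    have "B v *\<^sub>v (y - x) = 0\<^sub>v m" unfolding Bminus[OF y(1) x] y(2) using Bcar[OF x] by simp
    then have "y - x \<in> f v" unfolding fB[OF v] using y(1) x by simp
    moreover have "y = x + (y - x)" using x y(1) by (intro eq_vecI) auto
    ultimately show "y \<in> vec_coset x (f v)" unfolding vec_coset_def by blast
  qed
  have fib_add: "{x + y |x y. x \<in> fib v z \<and> y \<in> fib v z'} = fib v (z + z')"
    if v: "v \<in> P1" and z: "z \<in> carrier_vec m" "z' \<in> carrier_vec m" for v z z'
  proof (intro equalityI subsetI)
    fix x assume "x \<in> {x + y |x y. x \<in> fib v z \<and> y \<in> fib v z'}"
    then obtain y w where yw: "y \<in> carrier_vec n" "B v *\<^sub>v y = z" "w \<in> carrier_vec n" "B v *\<^sub>v w = z'" "x = y + w"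
      unfolding fib_def by blast
    have "B v *\<^sub>v x = z + z'" unfolding yw(5) Badd[OF yw(1,3)] yw(2,4) ..
    then show "x \<in> fib v (z + z')" unfolding fib_def using yw by simp
  next
    fix x assume "x \<in> fib v (z + z')"
    then have x: "x \<in> carrier_vec n" "B v *\<^sub>v x = z + z'" unfolding fib_def by auto
    obtain y where y: "y \<in> carrier_vec n" "B v *\<^sub>v y = z" using surj[OF v z(1)] by blast
    have "B v *\<^sub>v (x - y) = z'" unfolding Bminus[OF x(1) y(1)] x(2) y(2) using z by (intro eq_vecI) auto
    then have "y \<in> fib v z" "x - y \<in> fib v z'" using x y unfolding fib_def by auto
    moreover have "x = y + (x - y)" using x(1) y(1) by (intro eq_vecI) auto
    ultimately show "x \<in> {x + y |x y. x \<in> fib v z \<and> y \<in> fib v z'}" by blast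
  qed
  have fib_scale: "{c \<cdot>\<^sub>v x + w |x w. x \<in> fib v z \<and> w \<in> f v} = fib v (c \<cdot>\<^sub>v z)"
    if v: "v \<in> P1" and z: "z \<in> carrier_vec m" for v z c
  proof (intro equalityI subsetI)
    fix y assume "y \<in> {c \<cdot>\<^sub>v x + w |x w. x \<in> fib v z \<and> w \<in> f v}"
    then obtain x w where xw: "x \<in> carrier_vec n" "B v *\<^sub>v x = z" "w \<in> carrier_vec n" "B v *\<^sub>v w = 0\<^sub>v m"
      "y = c \<cdot>\<^sub>v x + w" unfolding fB[OF v] fib_def by blast
    have "B v *\<^sub>v y = B v *\<^sub>v (c \<cdot>\<^sub>v x) + B v *\<^sub>v w" unfolding xw(5) using xw by (intro Badd) simp_all
    also have "\<dots> = c \<cdot>\<^sub>v z" unfolding xw(4) mult_mat_vec[OF Bc xw(1)] xw(2) using z by simp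
    finally show "y \<in> fib v (c \<cdot>\<^sub>v z)" unfolding fib_def using xw by simp
  next
    fix y assume "y \<in> fib v (c \<cdot>\<^sub>v z)"
    then have y: "y \<in> carrier_vec n" "B v *\<^sub>v y = c \<cdot>\<^sub>v z" unfolding fib_def by auto
    obtain x where x: "x \<in> carrier_vec n" "B v *\<^sub>v x = z" using surj[OF v z] by blast
    have cx: "c \<cdot>\<^sub>v x \<in> carrier_vec n" using x(1) by simp
    have "B v *\<^sub>v (y - c \<cdot>\<^sub>v x) = 0\<^sub>v m"
      unfolding Bminus[OF y(1) cx] mult_mat_vec[OF Bc x(1)] x(2) y(2) using z by simp
    then have "y - c \<cdot>\<^sub>v x \<in> f v" unfolding fB[OF v] using y(1) cx by simp
    moreover have "x \<in> fib v z" using x unfolding fib_def by simp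
    moreover have "y = c \<cdot>\<^sub>v x + (y - c \<cdot>\<^sub>v x)" using x(1) y(1) by (intro eq_vecI) auto
    ultimately show "y \<in> {c \<cdot>\<^sub>v x + w |x w. x \<in> fib v z \<and> w \<in> f v}" by blast
  qed
  define \<psi> where "\<psi> U q = (\<lambda>v\<in>U. val v (q v))" for U and q :: "'k \<times> 'k \<Rightarrow> 'k vec set"
  have lift: "\<exists>V \<sigma>. P1_open V \<and> v \<in> V \<and> V \<subseteq> U \<and> \<sigma> \<in> sections (trivial_bundle n) V \<and>
      (\<forall>u\<in>V. q u = vec_coset (\<sigma> u) (f u))" if "q \<in> sections ?F U" "v \<in> U" for q U v
    using that unfolding pullback_quot_def by (simp add: Bex_def)
  have q_fib: "q v = fib v (\<psi> U q v)" "\<psi> U q v \<in> carrier_vec m"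
    if U: "P1_open U" and q: "q \<in> sections ?F U" and v: "v \<in> U" for U q v
  proof -
    obtain V \<sigma> where V: "P1_open V" "v \<in> V" "V \<subseteq> U" "\<sigma> \<in> sections (trivial_bundle n) V"
      "\<forall>u\<in>V. q u = vec_coset (\<sigma> u) (f u)" using lift[OF q v] by (elim exE conjE)
    have vP: "v \<in> P1" using P1_open_subset[OF U] v by blast
    have \<sigma>: "\<sigma> v \<in> carrier_vec n" using V(2,4) by (auto simp: trivial_sections_iff)
    have qv: "q v = fib v (B v *\<^sub>v \<sigma> v)" using V(2,5) coset_fib[OF vP \<sigma>] by simp
    have "\<psi> U q v = B v *\<^sub>v \<sigma> v" using v val_fib[OF vP Bcar[OF \<sigma>]] qv by (simp add: \<psi>_def)
    then show "q v = fib v (\<psi> U q v)" "\<psi> U q v \<in> carrier_vec m" using qv Bcar[OF \<sigma>] by simp_all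
  qed
  have \<psi>_sec: "\<psi> U q \<in> sections ?G U" if U: "P1_open U" and q: "q \<in> sections ?F U" for U q
    unfolding Giff
  proof (intro conjI ballI allI impI)
    show "\<psi> U q \<in> extensional U" by (simp add: \<psi>_def)
    show "\<psi> U q v \<in> carrier_vec m" if "v \<in> U" for v by (rule q_fib(2)[OF U q that])
    fix i assume i: "i < m"
    show "regular (int (b ! i)) U (\<lambda>v. \<psi> U q v $ i)"
    proof (rule regular_open_local[OF P1_open_subset[OF U]])
      fix v assume v: "v \<in> U"
      obtain V \<sigma> where V: "P1_open V" "v \<in> V" "V \<subseteq> U" "\<sigma> \<in> sections (trivial_bundle n) V"
        "\<forall>u\<in>V. q u = vec_coset (\<sigma> u) (f u)" using lift[OF q v] by (elim exE conjE)
      note VP = P1_open_subset[OF V(1)]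
      interpret reg: graded_functions "\<lambda>d. regular d V" by (rule regular_graded[OF VP])
      have \<sigma>c: "\<sigma> u \<in> carrier_vec n" if "u \<in> V" for u using that V(4) by (simp add: trivial_sections_iff)
      have eq: "\<psi> U q u $ i = (\<Sum>k<n. B u $$ (i, k) * \<sigma> u $ k)" if u: "u \<in> V" for u
      proof -
        have uP: "u \<in> P1" using u VP by blast
        have "q u = fib u (B u *\<^sub>v \<sigma> u)" using u V(5) coset_fib[OF uP \<sigma>c[OF u]] by simp
        then have "\<psi> U q u = B u *\<^sub>v \<sigma> u" using subsetD[OF V(3) u] val_fib[OF uP Bcar[OF \<sigma>c[OF u]]] by (simp add: \<psi>_def)
        then show ?thesis using i Bc[of u] \<sigma>c[OF u] by (simp add: scalar_prod_def atLeast0LessThan)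
      qed
      have "regular (int (b ! i)) V (\<lambda>u. \<Sum>k<n. B u $$ (i, k) * \<sigma> u $ k)"
      proof (rule reg.sum)
        fix k assume "k \<in> {..<n}"
        then have k: "k < n" by simp
        have "regular (int (b ! i) + 0) V (\<lambda>u. B u $$ (i, k) * \<sigma> u $ k)"
          using V(4) k unfolding trivial_sections_iff by (intro reg.mult regular_form[OF Bf[OF i k]]) blast
        then show "regular (int (b ! i)) V (\<lambda>u. B u $$ (i, k) * \<sigma> u $ k)" by simp
      qed
      then have "regular (int (b ! i)) V (\<lambda>u. \<psi> U q u $ i)"
        using eq by (subst regular_cong[of V _ "\<lambda>u. \<Sum>k<n. B u $$ (i, k) * \<sigma> u $ k"]) simp_all
      then show "\<exists>V. P1_open V \<and> v \<in> V \<and> regular (int (b ! i)) V (\<lambda>v. \<psi> U q v $ i)" using V(1,2) by blast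
    qed
  qed
  have preimage_sec: "(\<lambda>v\<in>U. fib v (\<tau> v)) \<in> sections ?F U" if U: "P1_open U" and \<tau>: "\<tau> \<in> sections ?G U" for U \<tau>
  proof -
    note UP = P1_open_subset[OF U]
    have \<tau>c: "\<tau> v \<in> carrier_vec m" if "v \<in> U" for v using \<tau> that Giff by blast
    have \<tau>r: "regular (int (b ! i)) U (\<lambda>v. \<tau> v $ i)" if "i < m" for i using \<tau> that Giff by blast
    have "\<exists>V. P1_open V \<and> v \<in> V \<and> V \<subseteq> U \<and> (\<exists>\<sigma>\<in>sections (trivial_bundle n) V.
        \<forall>u\<in>V. (\<lambda>v\<in>U. fib v (\<tau> v)) u = vec_coset (\<sigma> u) (f u))" if v: "v \<in> U" for v
    proof -
      have vP: "v \<in> P1" using v UP by blast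
      obtain R where R: "R \<in> carrier_mat n m" "B v * R = 1\<^sub>m m" using R[OF vP] by blast
      define T where "T u = B u * R" for u
      have T: "T u \<in> carrier_mat m m" for u using Bc[of u] R(1) by (simp add: T_def)
      have Tf: "binary_form (b ! i) (\<lambda>u. T u $$ (i, j))" if ij: "i < m" "j < m" for i j
      proof -
        have "T u $$ (i, j) = (\<Sum>k<n. R $$ (k, j) * B u $$ (i, k))" for u
          using ij Bc[of u] R(1) by (simp add: T_def scalar_prod_def atLeast0LessThan mult.commute)
        moreover have "binary_form (b ! i) (\<lambda>u. \<Sum>k<n. R $$ (k, j) * B u $$ (i, k))"
          using ij by (intro form.sum form_cmult Bf) auto
        ultimately show ?thesis by simp
      qed
      have detT: "binary_form e (\<lambda>u. det (T u))"
        using form.det[of T m "\<lambda>i. b ! i" "\<lambda>_. 0"] T Tf sum_b by simp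
      have "det (T v) \<noteq> 0" using R(2) by (simp add: T_def)
      obtain d h where h: "binary_form d h" "h v \<noteq> 0" "{u \<in> P1. h u \<noteq> 0} \<subseteq> U" using P1_openE[OF U v] .
      define V where "V = {u \<in> P1. h u * det (T u) \<noteq> 0}"
      have V: "P1_open V" "v \<in> V" "V \<subseteq> U" "V \<subseteq> P1"
        using P1_open_basic[OF form.mult[OF h(1) detT]] vP h \<open>det (T v) \<noteq> 0\<close> by (auto simp: V_def)
      interpret reg: graded_functions "\<lambda>d. regular d V" by (rule regular_graded[OF V(4)])
      let ?M = "\<lambda>i u. mat m m (\<lambda>(l, j). if j = i then \<tau> u $ l else T u $$ (l, j))"
      define y where "y u = vec m (\<lambda>i. det (?M i u) / det (T u))" for u
      have Ty: "T u *\<^sub>v y u = \<tau> u" if u: "u \<in> V" for u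
      proof -
        have nz: "det (T u) \<noteq> 0" and uU: "u \<in> U" using u V by (auto simp: V_def)
        obtain S where S: "S \<in> carrier_mat m m" "T u * S = 1\<^sub>m m"
          using det_non_zero_imp_unit[OF T nz, of "()"] unfolding Units_def by (auto simp: ring_mat_simps)
        have x: "S *\<^sub>v \<tau> u \<in> carrier_vec m" by (rule mult_mat_vec_carrier[OF S(1) \<tau>c[OF uU]])
        have Tx: "T u *\<^sub>v (S *\<^sub>v \<tau> u) = \<tau> u" using assoc_mult_mat_vec[OF T S(1) \<tau>c[OF uU], symmetric] S(2) \<tau>c[OF uU] by simp
        have "(S *\<^sub>v \<tau> u) $ i = y u $ i" if i: "i < m" for i
        proof -
          have "replace_col (T u) (T u *\<^sub>v (S *\<^sub>v \<tau> u)) i = ?M i u"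
            unfolding Tx using T[of u] by (intro eq_matI) (auto simp: replace_col_def)
          then have "det (?M i u) = (S *\<^sub>v \<tau> u) $ i * det (T u)" using cramer_lemma_mat[OF T[of u] x i] by simp
          then show ?thesis using nz i by (simp add: y_def)
        qed
        then have "S *\<^sub>v \<tau> u = y u" using S(1) by (intro eq_vecI) (simp_all add: y_def)
        then show ?thesis using Tx by simp
      qed
      have yr: "regular 0 V (\<lambda>u. y u $ i)" if i: "i < m" for i
      proof -
        have "regular ((\<Sum>l<m. int (b ! l)) + (\<Sum>j<m. 0)) V (\<lambda>u. det (?M i u))"
        proof (rule reg.det)
          fix l j assume lj: "l < m" "j < m"
          show "regular (int (b ! l) + 0) V (\<lambda>u. ?M i u $$ (l, j))"
            using lj regular_subset[OF \<tau>r[OF lj(1)] V(3)] regular_form[OF Tf[OF lj], of V] by (cases "j = i") simp_all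
        qed simp
        then have "regular (int e - int e) V (\<lambda>u. det (?M i u) / det (T u))"
          using sum_b by (intro regular_divide regular_form[OF detT]) (auto simp: V_def simp flip: of_nat_sum)
        then show ?thesis using i by (simp add: y_def)
      qed
      define \<sigma> where "\<sigma> = (\<lambda>u\<in>V. R *\<^sub>v y u)"
      have yc: "y u \<in> carrier_vec m" for u by (simp add: y_def)
      have \<sigma>c: "R *\<^sub>v y u \<in> carrier_vec n" for u by (rule mult_mat_vec_carrier[OF R(1) yc])
      have "\<sigma> \<in> sections (trivial_bundle n) V" unfolding trivial_sections_iff
      proof (intro conjI ballI allI impI)
        fix k assume k: "k < n"
        have "regular 0 V (\<lambda>u. \<Sum>i<m. R $$ (k, i) * y u $ i)"
        proof (rule reg.sum)
          fix i assume "i \<in> {..<m}"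
          then have "regular (int 0 + 0) V (\<lambda>u. R $$ (k, i) * y u $ i)"
            by (intro reg.mult regular_form form_const yr) simp
          then show "regular 0 V (\<lambda>u. R $$ (k, i) * y u $ i)" by simp
        qed
        moreover have "\<sigma> u $ k = (\<Sum>i<m. R $$ (k, i) * y u $ i)" if "u \<in> V" for u
          using that k R(1) yc[of u] by (simp add: \<sigma>_def scalar_prod_def atLeast0LessThan)
        ultimately show "regular 0 V (\<lambda>u. \<sigma> u $ k)"
          by (subst regular_cong[of V _ "\<lambda>u. \<Sum>i<m. R $$ (k, i) * y u $ i"]) simp_all
      qed (use \<sigma>c in \<open>simp_all add: \<sigma>_def\<close>)
      moreover have "\<forall>u\<in>V. (\<lambda>v\<in>U. fib v (\<tau> v)) u = vec_coset (\<sigma> u) (f u)"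
      proof
        fix u assume u: "u \<in> V"
        then have uU: "u \<in> U" and uP: "u \<in> P1" using V by auto
        have "B u *\<^sub>v (R *\<^sub>v y u) = \<tau> u"
          using assoc_mult_mat_vec[OF Bc[of u] R(1) yc[of u]] Ty[OF u] by (simp add: T_def)
        then show "(\<lambda>v\<in>U. fib v (\<tau> v)) u = vec_coset (\<sigma> u) (f u)"
          using coset_fib[OF uP \<sigma>c[of u]] u uU by (simp add: \<sigma>_def)
      qed
      ultimately show ?thesis using V(1,2,3) by blast
    qed
    then show ?thesis unfolding pullback_quot_def by simp
  qed
  have "sheaf_iso ?F ?G"
  proof (rule sheaf_isoI[of \<psi>])
    fix U :: "('k \<times> 'k) set" assume U: "P1_open U"
    note UP = P1_open_subset[OF U]
    show "bij_betw (\<psi> U) (sections ?F U) (sections ?G U)"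
    proof (rule bij_betwI[where g = "\<lambda>\<tau>. \<lambda>v\<in>U. fib v (\<tau> v)"])
      show "\<psi> U \<in> sections ?F U \<rightarrow> sections ?G U" using \<psi>_sec[OF U] by (intro funcsetI)
      show "(\<lambda>\<tau>. \<lambda>v\<in>U. fib v (\<tau> v)) \<in> sections ?G U \<rightarrow> sections ?F U" using preimage_sec[OF U] by (intro funcsetI)
      show "(\<lambda>v\<in>U. fib v (\<psi> U q v)) = q" if q: "q \<in> sections ?F U" for q
      proof (rule extensionalityI[of _ U])
        show "q \<in> extensional U" using q unfolding pullback_quot_def by simp
        show "(\<lambda>v\<in>U. fib v (\<psi> U q v)) v = q v" if "v \<in> U" for v using that q_fib(1)[OF U q that] by simp
      qed simp
      show "\<psi> U (\<lambda>v\<in>U. fib v (\<tau> v)) = \<tau>" if \<tau>: "\<tau> \<in> sections ?G U" for \<tau>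
      proof (rule extensionalityI[of _ U])
        show "\<tau> \<in> extensional U" using \<tau> Giff by blast
        show "\<psi> U (\<lambda>v\<in>U. fib v (\<tau> v)) \<in> extensional U" by (simp add: \<psi>_def)
        fix v assume v: "v \<in> U"
        have "\<tau> v \<in> carrier_vec m" using \<tau> v Giff by blast
        then show "\<psi> U (\<lambda>v\<in>U. fib v (\<tau> v)) v = \<tau> v" using v val_fib[OF subsetD[OF UP v]] by (simp add: \<psi>_def)
      qed
    qed
    show "\<psi> U (\<lambda>v\<in>U. fibre_add ?F v (\<sigma> v) (\<tau> v)) = (\<lambda>v\<in>U. fibre_add ?G v (\<psi> U \<sigma> v) (\<psi> U \<tau> v))"
      if \<sigma>: "\<sigma> \<in> sections ?F U" and \<tau>: "\<tau> \<in> sections ?F U" for \<sigma> \<tau>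
      unfolding ops
    proof (rule extensionalityI[of _ U])
      fix v assume v: "v \<in> U"
      note vP = subsetD[OF UP v]
      note s = q_fib[OF U \<sigma> v] and t = q_fib[OF U \<tau> v]
      have "{x + y |x y. x \<in> \<sigma> v \<and> y \<in> \<tau> v} = fib v (\<psi> U \<sigma> v + \<psi> U \<tau> v)"
        using fib_add[OF vP s(2) t(2)] s(1) t(1) by simp
      then show "\<psi> U (\<lambda>v\<in>U. {x + y |x y. x \<in> \<sigma> v \<and> y \<in> \<tau> v}) v = (\<lambda>v\<in>U. \<psi> U \<sigma> v + \<psi> U \<tau> v) v"
        using v val_fib[OF vP add_carrier_vec[OF s(2) t(2)]] by (simp add: \<psi>_def[of _ "\<lambda>v\<in>U. _ v"])
    qed (simp_all add: \<psi>_def)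
    show "\<psi> U (\<lambda>v\<in>U. fibre_scale ?F v (c v) (\<sigma> v)) = (\<lambda>v\<in>U. fibre_scale ?G v (c v) (\<psi> U \<sigma> v))"
      if \<sigma>: "\<sigma> \<in> sections ?F U" for c \<sigma>
      unfolding ops
    proof (rule extensionalityI[of _ U])
      fix v assume v: "v \<in> U"
      note vP = subsetD[OF UP v]
      note s = q_fib[OF U \<sigma> v]
      have "{c v \<cdot>\<^sub>v x + w |x w. x \<in> \<sigma> v \<and> w \<in> f v} = fib v (c v \<cdot>\<^sub>v \<psi> U \<sigma> v)"
        using fib_scale[OF vP s(2), of "c v"] s(1) by simp
      moreover have "c v \<cdot>\<^sub>v \<psi> U \<sigma> v \<in> carrier_vec m" using s(2) by simp
      ultimately show "\<psi> U (\<lambda>v\<in>U. {c v \<cdot>\<^sub>v x + w |x w. x \<in> \<sigma> v \<and> w \<in> f v}) v = (\<lambda>v\<in>U. c v \<cdot>\<^sub>v \<psi> U \<sigma> v) v"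
        using v val_fib[OF vP, of "c v \<cdot>\<^sub>v \<psi> U \<sigma> v"] by (simp add: \<psi>_def[of _ "\<lambda>v\<in>U. _ v"])
    qed (simp_all add: \<psi>_def)
    show "\<psi> V (restrict \<sigma> V) = restrict (\<psi> U \<sigma>) V" if "V \<subseteq> U" for V \<sigma>
      by (rule extensionalityI[of _ V]) (use that in \<open>auto simp: \<psi>_def subset_iff\<close>)
  qed
  then show ?thesis using Mor unfolding locus_quot_def f_def by blast
qed

section \<open>Tangent spaces through first order deformations\<close>

lemma coeff_mult_1: "poly.coeff (p * q) 1 = poly.coeff p 0 * poly.coeff q 1 + poly.coeff p 1 * poly.coeff q (0::nat)"
  by (simp add: coeff_mult)

lemma coeff_mult_0': "poly.coeff (p * q) 0 = poly.coeff p 0 * poly.coeff q 0"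
  by (simp add: coeff_mult)

lemma coeff_power_0: "poly.coeff (p ^ k) 0 = poly.coeff p 0 ^ k"
  by (induction k) (simp_all add: coeff_mult_0')

lemma coeff_prod_0: "poly.coeff (\<Prod>x\<in>S. q x) 0 = (\<Prod>x\<in>S. poly.coeff (q x) 0)"
  by (induction S rule: infinite_finite_induct) (simp_all add: coeff_mult_0')

lemma coeff_power_1:
  "poly.coeff (p ^ k) 1 = of_nat k * poly.coeff p 0 ^ (k - 1) * poly.coeff (p::'a::comm_ring_1 poly) 1"
proof (induction k)
  case (Suc k)
  have "poly.coeff (p ^ Suc k) 1 = poly.coeff p 0 * (of_nat k * poly.coeff p 0 ^ (k - 1) * poly.coeff p 1)
      + poly.coeff p 1 * poly.coeff p 0 ^ k"
    unfolding power_Suc coeff_mult_1 Suc.IH coeff_power_0 ..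
  also have "\<dots> = of_nat (Suc k) * poly.coeff p 0 ^ k * poly.coeff p 1"
    by (cases k) (simp_all add: algebra_simps)
  finally show ?case by simp
qed simp

lemma coeff_prod_1:
  assumes "finite S"
  shows "poly.coeff (\<Prod>x\<in>S. q x) 1
    = (\<Sum>x\<in>S. poly.coeff (q x :: 'a::comm_ring_1 poly) 1 * (\<Prod>y\<in>S - {x}. poly.coeff (q y) 0))"
  using assms
proof (induction S rule: finite_induct)
  case (insert z S)
  have "(\<Prod>y\<in>insert z S - {x}. poly.coeff (q y) 0) = poly.coeff (q z) 0 * (\<Prod>y\<in>S - {x}. poly.coeff (q y) 0)"
    if "x \<in> S" for x
  proof -
    have "insert z S - {x} = insert z (S - {x})" using that insert.hyps by auto
    then show ?thesis using insert.hyps by simp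
  qed
  then have "(\<Sum>x\<in>S. poly.coeff (q x) 1 * (\<Prod>y\<in>insert z S - {x}. poly.coeff (q y) 0))
      = poly.coeff (q z) 0 * (\<Sum>x\<in>S. poly.coeff (q x) 1 * (\<Prod>y\<in>S - {x}. poly.coeff (q y) 0))"
    by (simp add: sum_distrib_left mult_ac)
  moreover have "insert z S - {z} = S" using insert.hyps by auto
  ultimately show ?case using insert by (simp add: coeff_mult_1[simplified] coeff_prod_0)
qed simp

subsection \<open>Polynomial functions\<close>

abbreviation const_poly :: "'a::zero \<Rightarrow> 'a poly" where "const_poly c \<equiv> [:c:]"

lemma const_poly_hom: "comm_ring_hom (\<lambda>c. [:c:] :: 'a::comm_ring_1 poly)"
  by unfold_locales (simp_all add: one_pCons)

lemma coeff_0_hom: "comm_ring_hom (\<lambda>p. poly.coeff (p :: 'a::comm_ring_1 poly) 0)"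
  by unfold_locales (simp_all add: coeff_mult_0')

definition monomial_value :: "('x \<Rightarrow> 'b::comm_semiring_1) \<Rightarrow> ('x \<Rightarrow>\<^sub>0 nat) \<Rightarrow> 'b" where
  "monomial_value g m = (\<Prod>x\<in>Poly_Mapping.keys m. g x ^ Poly_Mapping.lookup m x)"

lemma monomial_value_superset:
  assumes "finite S" "Poly_Mapping.keys m \<subseteq> S"
  shows "monomial_value g m = (\<Prod>x\<in>S. g x ^ Poly_Mapping.lookup m x)"
  unfolding monomial_value_def using assms by (intro prod.mono_neutral_left) (auto simp: in_keys_iff)

lemma monomial_value_add: "monomial_value g (m + m') = monomial_value g m * monomial_value g m'"
proof -
  let ?S = "Poly_Mapping.keys m \<union> Poly_Mapping.keys m'"
  have "monomial_value g (m + m') = (\<Prod>x\<in>?S. g x ^ Poly_Mapping.lookup (m + m') x)"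
    by (rule monomial_value_superset) (simp, rule keys_add)
  also have "\<dots> = (\<Prod>x\<in>?S. g x ^ Poly_Mapping.lookup m x) * (\<Prod>x\<in>?S. g x ^ Poly_Mapping.lookup m' x)"
    by (simp add: lookup_add power_add prod.distrib)
  also have "\<dots> = monomial_value g m * monomial_value g m'"
    by (subst (1 2) monomial_value_superset[of ?S]) auto
  finally show ?thesis .
qed

lemma mpoly_eval_superset:
  assumes "finite S" "Poly_Mapping.keys F \<subseteq> S" "\<iota> 0 = 0"
  shows "mpoly_eval \<iota> F g = (\<Sum>m\<in>S. \<iota> (Poly_Mapping.lookup F m) * monomial_value g m)"
  unfolding mpoly_eval_def monomial_value_def
  using assms by (intro sum.mono_neutral_left) (auto simp: in_keys_iff)

lemma mpoly_eval_monomials: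
  "mpoly_eval \<iota> F g = (\<Sum>m\<in>Poly_Mapping.keys F. \<iota> (Poly_Mapping.lookup F m) * monomial_value g m)"
  unfolding mpoly_eval_def monomial_value_def ..

lemma mpoly_eval_single:
  assumes "\<iota> 0 = 0" shows "mpoly_eval \<iota> (Poly_Mapping.single m c) g = \<iota> c * monomial_value g m"
  by (subst mpoly_eval_superset[of "{m}"]) (use assms in auto)

lemma mpoly_eval_add:
  assumes "\<iota> 0 = 0" "\<And>a b. \<iota> (a + b) = \<iota> a + \<iota> b"
  shows "mpoly_eval \<iota> (F + G) g = mpoly_eval \<iota> F g + mpoly_eval \<iota> G g"
proof -
  let ?S = "Poly_Mapping.keys F \<union> Poly_Mapping.keys G"
  have "mpoly_eval \<iota> (F + G) g = (\<Sum>m\<in>?S. \<iota> (Poly_Mapping.lookup (F + G) m) * monomial_value g m)"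
    by (rule mpoly_eval_superset) (use assms(1) keys_add[of F G] in simp_all)
  also have "\<dots> = (\<Sum>m\<in>?S. \<iota> (Poly_Mapping.lookup F m) * monomial_value g m)
      + (\<Sum>m\<in>?S. \<iota> (Poly_Mapping.lookup G m) * monomial_value g m)"
    by (simp add: lookup_add assms distrib_right sum.distrib)
  also have "\<dots> = mpoly_eval \<iota> F g + mpoly_eval \<iota> G g"
    by (subst (1 2) mpoly_eval_superset[of ?S]) (use assms in auto)
  finally show ?thesis .
qed

lemma mpoly_eval_sum:
  assumes "\<iota> 0 = 0" "\<And>a b. \<iota> (a + b) = \<iota> a + \<iota> b"
  shows "mpoly_eval \<iota> (\<Sum>a\<in>S. F a) g = (\<Sum>a\<in>S. mpoly_eval \<iota> (F a) g)"
proof (induction S rule: infinite_finite_induct)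
  case (insert x S)
  then show ?case by (simp add: mpoly_eval_add[OF assms])
qed (simp_all add: mpoly_eval_def)

text \<open>
  The pair of the function defined by a polynomial in finitely many of the variables and of its evaluation over \<open>\<K>[T]\<close>. The
  tangent space is defined through formal polynomials; the closure properties below turn expressions into such polynomials.
\<close>

definition polynomial_function ::
  "(('x \<Rightarrow> 'k::field) \<Rightarrow> 'k) \<Rightarrow> (('x \<Rightarrow> 'k poly) \<Rightarrow> 'k poly) \<Rightarrow> bool" where
  "polynomial_function \<Phi> \<Psi> \<longleftrightarrow>
     (\<exists>F. (\<forall>g. mpoly_eval (\<lambda>c. c) F g = \<Phi> g) \<and> (\<forall>g. mpoly_eval const_poly F g = \<Psi> g))"

lemma polynomial_function_const: "polynomial_function (\<lambda>g. c) (\<lambda>g. [:c:])"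
  unfolding polynomial_function_def
  by (intro exI[of _ "Poly_Mapping.single 0 c"]) (simp add: mpoly_eval_single monomial_value_def)

lemma polynomial_function_var: "polynomial_function (\<lambda>g. g x) (\<lambda>g. g x)"
  unfolding polynomial_function_def
  by (intro exI[of _ "Poly_Mapping.single (Poly_Mapping.single x 1) 1"])
    (simp add: mpoly_eval_single monomial_value_def one_pCons[symmetric])

lemma polynomial_function_add:
  assumes "polynomial_function \<Phi> \<Psi>" "polynomial_function \<Phi>' \<Psi>'"
  shows "polynomial_function (\<lambda>g. \<Phi> g + \<Phi>' g) (\<lambda>g. \<Psi> g + \<Psi>' g)"
proof -
  obtain F F' where F: "\<And>g. mpoly_eval (\<lambda>c. c) F g = \<Phi> g" "\<And>g. mpoly_eval const_poly F g = \<Psi> g"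
    and F': "\<And>g. mpoly_eval (\<lambda>c. c) F' g = \<Phi>' g" "\<And>g. mpoly_eval const_poly F' g = \<Psi>' g"
    using assms unfolding polynomial_function_def by auto
  show ?thesis unfolding polynomial_function_def
    by (intro exI[of _ "F + F'"]) (simp add: mpoly_eval_add F F')
qed

lemma polynomial_function_mult:
  assumes "polynomial_function \<Phi> \<Psi>" "polynomial_function \<Phi>' \<Psi>'"
  shows "polynomial_function (\<lambda>g. \<Phi> g * \<Phi>' g) (\<lambda>g. \<Psi> g * \<Psi>' g)"
proof -
  obtain F F' where F: "\<And>g. mpoly_eval (\<lambda>c. c) F g = \<Phi> g" "\<And>g. mpoly_eval const_poly F g = \<Psi> g"
    and F': "\<And>g. mpoly_eval (\<lambda>c. c) F' g = \<Phi>' g" "\<And>g. mpoly_eval const_poly F' g = \<Psi>' g"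
    using assms unfolding polynomial_function_def by auto
  let ?K = "Poly_Mapping.keys F" and ?K' = "Poly_Mapping.keys F'"
  define H where "H = (\<Sum>m\<in>?K. \<Sum>m'\<in>?K'. Poly_Mapping.single (m + m') (Poly_Mapping.lookup F m * Poly_Mapping.lookup F' m'))"
  have "mpoly_eval \<iota> H g = mpoly_eval \<iota> F g * mpoly_eval \<iota> F' g"
    if \<iota>: "\<iota> 0 = 0" "\<And>a b. \<iota> (a + b) = \<iota> a + \<iota> b" "\<And>a b. \<iota> (a * b) = \<iota> a * \<iota> b" for \<iota> :: "'b \<Rightarrow> 'c::comm_semiring_1" and g
    unfolding H_def mpoly_eval_sum[OF \<iota>(1,2)] mpoly_eval_single[of \<iota>, OF \<iota>(1)] monomial_value_add \<iota>(3)
      mpoly_eval_monomials[of \<iota> F] mpoly_eval_monomials[of \<iota> F'] sum_product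
    by (intro sum.cong refl) (simp add: mult_ac)
  from this[of "\<lambda>c. c"] this[of const_poly]
  show ?thesis unfolding polynomial_function_def by (intro exI[of _ H]) (simp add: F F')
qed

lemma polynomial_function_cmult:
  assumes "polynomial_function \<Phi> \<Psi>" shows "polynomial_function (\<lambda>g. c * \<Phi> g) (\<lambda>g. [:c:] * \<Psi> g)"
  by (rule polynomial_function_mult[OF polynomial_function_const assms])

lemma polynomial_function_sum:
  assumes "\<And>a. a \<in> S \<Longrightarrow> polynomial_function (\<Phi> a) (\<Psi> a)"
  shows "polynomial_function (\<lambda>g. \<Sum>a\<in>S. \<Phi> a g) (\<lambda>g. \<Sum>a\<in>S. \<Psi> a g)"
  using assms
proof (induction S rule: infinite_finite_induct)
  case (insert x S)
  then show ?case using polynomial_function_add[of "\<Phi> x" "\<Psi> x"] by simp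
qed (use polynomial_function_const[of 0] in simp_all)

lemma polynomial_function_prod:
  assumes "\<And>a. a \<in> S \<Longrightarrow> polynomial_function (\<Phi> a) (\<Psi> a)"
  shows "polynomial_function (\<lambda>g. \<Prod>a\<in>S. \<Phi> a g) (\<lambda>g. \<Prod>a\<in>S. \<Psi> a g)"
  using assms
proof (induction S rule: infinite_finite_induct)
  case (insert x S)
  then show ?case using polynomial_function_mult[of "\<Phi> x" "\<Psi> x"] by simp
qed (use polynomial_function_const[of 1] in \<open>simp_all add: one_pCons\<close>)

lemma det_mat_expand:
  "det (mat N N (\<lambda>(i, j). M i j)) = (\<Sum>p | p permutes {0..<N}. of_int (sign p) * (\<Prod>i = 0..<N. M i (p i)))"
  for M :: "nat \<Rightarrow> nat \<Rightarrow> 'd::comm_ring_1"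
  by (subst det_def'[of _ N]) (auto intro!: sum.cong prod.cong dest: permutes_in_image)

lemma polynomial_function_det:
  assumes "\<And>i j. i < N \<Longrightarrow> j < N \<Longrightarrow> polynomial_function (\<Phi> i j) (\<Psi> i j)"
  shows "polynomial_function (\<lambda>g. det (mat N N (\<lambda>(i, j). \<Phi> i j g))) (\<lambda>g. det (mat N N (\<lambda>(i, j). \<Psi> i j g)))"
proof -
  have "polynomial_function
      (\<lambda>g. \<Sum>p | p permutes {0..<N}. of_int (sign p) * (\<Prod>i = 0..<N. \<Phi> i (p i) g))
      (\<lambda>g. \<Sum>p | p permutes {0..<N}. [:of_int (sign p):] * (\<Prod>i = 0..<N. \<Psi> i (p i) g))"
    by (intro polynomial_function_sum polynomial_function_cmult polynomial_function_prod assms)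
      (auto dest: permutes_in_image)
  then show ?thesis unfolding det_mat_expand by (simp add: of_int_poly)
qed

subsection \<open>Tangent vectors\<close>

lemma directional_deriv_formula:
  "directional_deriv F p w = (\<Sum>m\<in>Poly_Mapping.keys F. Poly_Mapping.lookup F m *
     (\<Sum>x\<in>Poly_Mapping.keys m. of_nat (Poly_Mapping.lookup m x) * p x ^ (Poly_Mapping.lookup m x - 1) * w x *
        (\<Prod>y\<in>Poly_Mapping.keys m - {x}. p y ^ Poly_Mapping.lookup m y)))"
  unfolding directional_deriv_def mpoly_eval_def
  by (simp add: coeff_sum coeff_prod_1[simplified] coeff_power_0 coeff_power_1[simplified])

lemma mpoly_eval_first_order:
  "poly.coeff (mpoly_eval const_poly F g) 1 = directional_deriv F (\<lambda>x. poly.coeff (g x) 0) (\<lambda>x. poly.coeff (g x) 1)"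
  unfolding directional_deriv_formula mpoly_eval_def
  by (simp add: coeff_sum coeff_prod_1[simplified] coeff_power_0 coeff_power_1[simplified])

lemma poly_mpoly_eval:
  "poly (mpoly_eval const_poly F g) t = mpoly_eval (\<lambda>c. c) F (\<lambda>x. poly (g x) t)"
  by (simp add: mpoly_eval_def poly_sum poly_prod)

lemma tangent_space_add:
  assumes "u \<in> tangent_space e r n Z P" "w \<in> tangent_space e r n Z P"
  shows "(\<lambda>x. u x + w x) \<in> tangent_space e r n Z P"
proof -
  have "directional_deriv F P (\<lambda>x. u x + w x) = directional_deriv F P u + directional_deriv F P w" for F
    unfolding directional_deriv_formula by (simp add: distrib_left distrib_right sum.distrib)
  then show ?thesis using assms unfolding tangent_space_def by simp
qed

lemma tangent_space_mono:
  assumes "Y \<subseteq> Z" shows "tangent_space e r n Y P \<subseteq> tangent_space e r n Z P"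
  using assms unfolding tangent_space_def by blast

text \<open>
  If the equation \<open>F\<close> vanishes at infinitely many points of a polynomial curve, then it vanishes on the curve, and
  so does the first order term, which is the derivative of \<open>F\<close> in the direction of the curve.
\<close>

lemma tangent_space_curve:
  fixes Q :: "nat set \<times> nat \<Rightarrow> 'k::field_char_0 poly"
  assumes inf: "infinite {t. \<exists>f\<in>Z. coordinates e r n f (\<lambda>x. poly (Q x) t)}"
  shows "(\<lambda>x. poly.coeff (Q x) 1) \<in> tangent_space e r n Z (\<lambda>x. poly.coeff (Q x) 0)"
  unfolding tangent_space_def
proof (intro CollectI allI impI)
  fix F assume F: "\<forall>f\<in>Z. \<forall>R. coordinates e r n f R \<longrightarrow> mpoly_eval (\<lambda>c. c) F R = 0"
  have "{t. \<exists>f\<in>Z. coordinates e r n f (\<lambda>x. poly (Q x) t)} \<subseteq> {t. poly (mpoly_eval const_poly F Q) t = 0}"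
  proof
    fix t assume "t \<in> {t. \<exists>f\<in>Z. coordinates e r n f (\<lambda>x. poly (Q x) t)}"
    then obtain f where "f \<in> Z" "coordinates e r n f (\<lambda>x. poly (Q x) t)" by auto
    then have "mpoly_eval (\<lambda>c. c) F (\<lambda>x. poly (Q x) t) = 0" using F by simp
    then show "t \<in> {t. poly (mpoly_eval const_poly F Q) t = 0}" by (simp add: poly_mpoly_eval)
  qed
  then have "infinite {t. poly (mpoly_eval const_poly F Q) t = 0}"
    using inf by (rule infinite_super)
  then have "mpoly_eval const_poly F Q = 0" using poly_roots_finite by blast
  then show "directional_deriv F (\<lambda>x. poly.coeff (Q x) 0) (\<lambda>x. poly.coeff (Q x) 1) = 0"
    using mpoly_eval_first_order[of F Q] by simp
qed

lemma tangent_spaceD: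
  assumes "polynomial_function \<Phi> \<Psi>" "w \<in> tangent_space e r n Z P"
    and "\<And>f R. f \<in> Z \<Longrightarrow> coordinates e r n f R \<Longrightarrow> \<Phi> R = 0"
  shows "poly.coeff (\<Psi> (\<lambda>x. [:P x, w x:])) 1 = 0"
proof -
  obtain F where F: "\<And>g. mpoly_eval (\<lambda>c. c) F g = \<Phi> g" "\<And>g. mpoly_eval const_poly F g = \<Psi> g"
    using assms(1) unfolding polynomial_function_def by auto
  then have "directional_deriv F P w = 0" using assms(2,3) unfolding tangent_space_def by simp
  then show ?thesis using F(2) by (simp add: directional_deriv_def)
qed

subsection \<open>Pluecker relations and tangent vectors to the cone over the Grassmannian\<close>

text \<open>
  A Pluecker relation in a form that involves only exchanges of single rows. By Cramer's rule the matrix of exchanged minors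
  is \<open>A\<close> times the adjugate of its \<open>\<kappa>0\<close>-rows; take the \<open>\<kappa>\<close>-minor of this product.
\<close>

lemma minor_relation:
  fixes A :: "'b::comm_ring_1 mat"
  assumes A: "A \<in> carrier_mat n r" and \<kappa>0: "\<And>i. i < r \<Longrightarrow> \<kappa>0 i < n" and \<kappa>: "\<And>i. i < r \<Longrightarrow> \<kappa> i < n"
  shows "minor r A \<kappa>0 * det (mat r r (\<lambda>(i, j). minor r A (\<kappa>0(j := \<kappa> i)))) = minor r A \<kappa>0 ^ r * minor r A \<kappa>"
proof -
  let ?T = "mat r r (\<lambda>(i, l). A $$ (\<kappa>0 i, l))"
  have T: "?T \<in> carrier_mat r r" by simp
  note adj = adj_mat[OF T]
  have "mat r r (\<lambda>(i, j). minor r A (\<kappa>0(j := \<kappa> i))) = mat r r (\<lambda>(i, j). (A * adj_mat ?T) $$ (\<kappa> i, j))"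
    using minor_replace[OF A] \<kappa> by (intro eq_matI) auto
  then have "det (mat r r (\<lambda>(i, j). minor r A (\<kappa>0(j := \<kappa> i)))) = minor r A \<kappa> * det (adj_mat ?T)"
    using minor_mult[OF A adj(1) \<kappa>] by (simp add: minor_def)
  moreover have "minor r A \<kappa>0 * det (adj_mat ?T) = minor r A \<kappa>0 ^ r"
  proof -
    have "det ?T * det (adj_mat ?T) = det (det ?T \<cdot>\<^sub>m 1\<^sub>m r)" using det_mult[OF T adj(1)] adj(2) by simp
    then show ?thesis by (simp add: minor_def)
  qed
  ultimately show ?thesis by (simp add: mult_ac)
qed

text \<open>
  \<open>A + T A'\<close> over \<open>\<K>[T]\<close>; terms of second order in \<open>T\<close> never matter.
\<close>

definition perturb :: "'k::comm_ring_1 mat \<Rightarrow> 'k mat \<Rightarrow> 'k poly mat" where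
  "perturb A A' = mat (dim_row A) (dim_col A) (\<lambda>(k, j). [:A $$ (k, j), A' $$ (k, j):])"

definition minor_deriv :: "nat \<Rightarrow> 'k::comm_ring_1 mat \<Rightarrow> 'k mat \<Rightarrow> (nat \<Rightarrow> nat) \<Rightarrow> 'k" where
  "minor_deriv r A A' \<kappa> = poly.coeff (minor r (perturb A A') \<kappa>) 1"

lemma minor_first_order:
  fixes X :: "'k::comm_ring_1 poly mat"
  shows "poly.coeff (minor r X \<kappa>) 0 = (\<Sum>p | p permutes {0..<r}. of_int (sign p) * (\<Prod>i = 0..<r. poly.coeff (X $$ (\<kappa> i, p i)) 0))"
    "poly.coeff (minor r X \<kappa>) 1 = (\<Sum>p | p permutes {0..<r}. of_int (sign p) *
       (\<Sum>i = 0..<r. poly.coeff (X $$ (\<kappa> i, p i)) 1 * (\<Prod>l\<in>{0..<r} - {i}. poly.coeff (X $$ (\<kappa> l, p l)) 0)))"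
proof -
  have minor: "minor r X \<kappa> = (\<Sum>p | p permutes {0..<r}. [:of_int (sign p):] * (\<Prod>i = 0..<r. X $$ (\<kappa> i, p i)))"
    unfolding minor_def
    by (subst det_def'[of _ r]) (auto intro!: sum.cong prod.cong dest: permutes_in_image simp: of_int_poly)
  show "poly.coeff (minor r X \<kappa>) 0 = (\<Sum>p | p permutes {0..<r}. of_int (sign p) * (\<Prod>i = 0..<r. poly.coeff (X $$ (\<kappa> i, p i)) 0))"
    unfolding minor by (simp add: coeff_sum coeff_prod_0)
  show "poly.coeff (minor r X \<kappa>) 1 = (\<Sum>p | p permutes {0..<r}. of_int (sign p) *
       (\<Sum>i = 0..<r. poly.coeff (X $$ (\<kappa> i, p i)) 1 * (\<Prod>l\<in>{0..<r} - {i}. poly.coeff (X $$ (\<kappa> l, p l)) 0)))"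
    unfolding minor by (simp add: coeff_sum coeff_prod_1[simplified])
qed

lemma minor_deriv_formula:
  assumes A: "A \<in> carrier_mat n r" and \<kappa>: "\<And>i. i < r \<Longrightarrow> \<kappa> i < n"
  shows "minor_deriv r A A' \<kappa> = (\<Sum>p | p permutes {0..<r}. of_int (sign p) *
       (\<Sum>i = 0..<r. A' $$ (\<kappa> i, p i) * (\<Prod>l\<in>{0..<r} - {i}. A $$ (\<kappa> l, p l))))"
  unfolding minor_deriv_def minor_first_order(2)
proof (intro sum.cong refl arg_cong2[where f = "(*)"] prod.cong)
  fix p i assume "p \<in> {p. p permutes {0..<r}}" "i \<in> {0..<r}"
  then have "p i < r" "i < r" using permutes_in_image[of p "{0..<r}" i] by auto
  then show "poly.coeff (perturb A A' $$ (\<kappa> i, p i)) 1 = A' $$ (\<kappa> i, p i)" using A \<kappa> by (simp add: perturb_def)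
next
  fix p i l assume "p \<in> {p. p permutes {0..<r}}" "l \<in> {0..<r} - {i}"
  then have "p l < r" "l < r" using permutes_in_image[of p "{0..<r}" l] by auto
  then show "poly.coeff (perturb A A' $$ (\<kappa> l, p l)) 0 = A $$ (\<kappa> l, p l)" using A \<kappa> by (simp add: perturb_def)
qed

lemma minor_coeffs:
  assumes A: "A \<in> carrier_mat n r" and \<kappa>: "\<And>i. i < r \<Longrightarrow> \<kappa> i < n"
    and X: "\<And>k j. k < n \<Longrightarrow> j < r \<Longrightarrow> poly.coeff (X $$ (k, j)) 0 = A $$ (k, j)"
      "\<And>k j. k < n \<Longrightarrow> j < r \<Longrightarrow> poly.coeff (X $$ (k, j)) 1 = A' $$ (k, j)"
  shows "poly.coeff (minor r X \<kappa>) 0 = minor r A \<kappa>" "poly.coeff (minor r X \<kappa>) 1 = minor_deriv r A A' \<kappa>"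
proof -
  have p: "p l < r" if "p permutes {0..<r}" "l < r" for p l using permutes_in_image[OF that(1), of l] that(2) by auto
  have "minor r A \<kappa> = (\<Sum>p | p permutes {0..<r}. of_int (sign p) * (\<Prod>i = 0..<r. A $$ (\<kappa> i, p i)))"
    unfolding minor_def by (subst det_def'[of _ r]) (auto intro!: sum.cong prod.cong simp: p)
  then show "poly.coeff (minor r X \<kappa>) 0 = minor r A \<kappa>"
    unfolding minor_first_order(1) by (auto intro!: sum.cong prod.cong arg_cong2[where f = "(*)"] simp: p \<kappa> X(1))
  show "poly.coeff (minor r X \<kappa>) 1 = minor_deriv r A A' \<kappa>"
    by (subst minor_deriv_formula[OF A], erule \<kappa>, unfold minor_first_order(2),
        intro sum.cong refl arg_cong2[where f = "(*)"] prod.cong) (auto simp: p \<kappa> X[simplified])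
qed

lemma minor_deriv_add:
  assumes A: "A \<in> carrier_mat n r" and \<kappa>: "\<And>i. i < r \<Longrightarrow> \<kappa> i < n"
    and X: "X \<in> carrier_mat n r" and Y: "Y \<in> carrier_mat n r"
  shows "minor_deriv r A (X + Y) \<kappa> = minor_deriv r A X \<kappa> + minor_deriv r A Y \<kappa>"
proof -
  have "(X + Y) $$ (\<kappa> i, p i) = X $$ (\<kappa> i, p i) + Y $$ (\<kappa> i, p i)" if "p permutes {0..<r}" "i \<in> {0..<r}" for p i
    using that permutes_in_image[OF that(1), of i] X Y \<kappa> by auto
  then have "minor_deriv r A (X + Y) \<kappa> = (\<Sum>p | p permutes {0..<r}. of_int (sign p) *
       (\<Sum>i = 0..<r. (X $$ (\<kappa> i, p i) + Y $$ (\<kappa> i, p i)) * (\<Prod>l\<in>{0..<r} - {i}. A $$ (\<kappa> l, p l))))"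
    by (subst minor_deriv_formula[of A n r \<kappa>, OF A \<kappa>]) (auto intro!: sum.cong arg_cong2[where f = "(*)"])
  then show ?thesis
    by (simp add: minor_deriv_formula[of A n r \<kappa> X, OF A \<kappa>] minor_deriv_formula[of A n r \<kappa> Y, OF A \<kappa>] distrib_left distrib_right sum.distrib)
qed

lemma minor_deriv_smult:
  assumes A: "A \<in> carrier_mat n r" and \<kappa>: "\<And>i. i < r \<Longrightarrow> \<kappa> i < n" and X: "X \<in> carrier_mat n r"
  shows "minor_deriv r A (c \<cdot>\<^sub>m X) \<kappa> = c * minor_deriv r A X \<kappa>"
proof -
  have "(c \<cdot>\<^sub>m X) $$ (\<kappa> i, p i) = c * X $$ (\<kappa> i, p i)" if "p permutes {0..<r}" "i \<in> {0..<r}" for p i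
    using that permutes_in_image[OF that(1), of i] X \<kappa> by auto
  then have "minor_deriv r A (c \<cdot>\<^sub>m X) \<kappa> = (\<Sum>p | p permutes {0..<r}. of_int (sign p) *
       (\<Sum>i = 0..<r. (c * X $$ (\<kappa> i, p i)) * (\<Prod>l\<in>{0..<r} - {i}. A $$ (\<kappa> l, p l))))"
    by (subst minor_deriv_formula[of A n r \<kappa>, OF A \<kappa>]) (auto intro!: sum.cong arg_cong2[where f = "(*)"])
  then show ?thesis by (simp add: minor_deriv_formula[of A n r \<kappa> X, OF A \<kappa>] sum_distrib_left mult_ac)
qed

lemma minor_map_const: "minor r (map_mat const_poly A) \<kappa> = [:minor r A \<kappa>:]"
  if "A \<in> carrier_mat n r" "\<And>i. i < r \<Longrightarrow> \<kappa> i < n" for A :: "'k::comm_ring_1 mat"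
proof -
  have "mat r r (\<lambda>(i, j). map_mat const_poly A $$ (\<kappa> i, j)) = map_mat const_poly (mat r r (\<lambda>(i, j). A $$ (\<kappa> i, j)))"
    using that by (intro eq_matI) auto
  then show ?thesis unfolding minor_def by (simp add: comm_ring_hom.hom_det[OF const_poly_hom])
qed

text \<open>
  Changes of \<open>A\<close> within its column space only change the basis, hence scale all minors alike.
\<close>

lemma minor_deriv_image:
  fixes A :: "'k::comm_ring_1 mat"
  assumes A: "A \<in> carrier_mat n r" and G: "G \<in> carrier_mat r r"
  shows "\<exists>c. \<forall>\<kappa>. (\<forall>i<r. \<kappa> i < n) \<longrightarrow> minor_deriv r A (A * G) \<kappa> = c * minor r A \<kappa>"
proof (intro exI allI impI)
  fix \<kappa> assume \<kappa>: "\<forall>i<r. \<kappa> i < n"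
  let ?A = "map_mat const_poly A" and ?G = "perturb (1\<^sub>m r) G"
  have AG: "?A \<in> carrier_mat n r" "?G \<in> carrier_mat r r" using A by (auto simp: perturb_def)
  have entry: "(?A * ?G) $$ (k, j) = (\<Sum>l<r. [:A $$ (k, l) * (if l = j then 1 else 0), A $$ (k, l) * G $$ (l, j):])"
    if "k < n" "j < r" for k j
    using that A G AG by (auto simp: perturb_def scalar_prod_def atLeast0LessThan intro!: sum.cong)
  have X: "poly.coeff ((?A * ?G) $$ (k, j)) 0 = A $$ (k, j)" "poly.coeff ((?A * ?G) $$ (k, j)) 1 = (A * G) $$ (k, j)"
    if "k < n" "j < r" for k j
    unfolding entry[OF that] coeff_sum using that A G
    by (simp_all add: scalar_prod_def atLeast0LessThan if_distrib[of "\<lambda>x. _ * x"] cong: if_cong)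
  have "minor_deriv r A (A * G) \<kappa> = poly.coeff (minor r (?A * ?G) \<kappa>) 1"
    by (rule minor_coeffs(2)[symmetric, OF A]) (use \<kappa> X in auto)
  also have "\<dots> = poly.coeff (det ?G) 1 * minor r A \<kappa>"
    using minor_mult[OF AG, of \<kappa>] minor_map_const[OF A, of \<kappa>] \<kappa> by (simp add: mult.commute)
  finally show "minor_deriv r A (A * G) \<kappa> = poly.coeff (det ?G) 1 * minor r A \<kappa>" .
qed

lemma alternating_pick:
  fixes p :: "nat set \<Rightarrow> 'b::comm_ring_1"
  assumes I: "I \<in> pluecker_indices r n" shows "alternating r p (pick I) = p I"
proof -
  note pick = pluecker_indices_pick[OF I]
  have im: "pick I ` {..<r} = I" using pick(5) by (simp add: bij_betw_def)
  let ?A = "mat n r (\<lambda>(k, j). if k = pick I j then 1 else 0) :: int mat"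
  have "mat r r (\<lambda>(i, j). ?A $$ (pick I i, j)) = 1\<^sub>m r"
    using pick(4,5) by (intro eq_matI) (auto simp: bij_betw_def inj_on_def)
  then have one: "minor r ?A (pick I) = 1" by (simp add: minor_def)
  have "minor r ?A (pick I) = of_int (sorting_sign r (pick I)) * minor r ?A (pick (pick I ` {..<r}))"
    by (rule minor_sort[of _ n]) (use pick(4) in auto)
  then have "sorting_sign r (pick I) = 1" unfolding im one by simp
  then show ?thesis by (simp add: alternating_def im)
qed

lemma alternating_cong:
  assumes "\<And>I. I \<in> pluecker_indices r n \<Longrightarrow> p I = q I" and \<kappa>: "\<And>i. i < r \<Longrightarrow> \<kappa> i < n"
  shows "alternating r p \<kappa> = alternating r q \<kappa>"
  using assms(1)[OF inj_image_pluecker_indices[OF _ \<kappa>]]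
  by (cases "inj_on \<kappa> {..<r}") (auto simp: alternating_def sorting_sign_def)

lemma alternating_minor_deriv:
  assumes A: "A \<in> carrier_mat n r" and \<kappa>: "\<And>i. i < r \<Longrightarrow> \<kappa> i < n"
    and w: "\<And>I. I \<in> pluecker_indices r n \<Longrightarrow> w I = c * minor_deriv r A A' (pick I) + l * minor r A (pick I)"
  shows "alternating r w \<kappa> = c * minor_deriv r A A' \<kappa> + l * minor r A \<kappa>"
proof -
  let ?s = "sorting_sign r \<kappa>" and ?I = "\<kappa> ` {..<r}"
  have "perturb A A' \<in> carrier_mat n r" using A by (simp add: perturb_def)
  then have "minor r (perturb A A') \<kappa> = of_int ?s * minor r (perturb A A') (pick ?I)" using \<kappa> by (rule minor_sort)
  then have "minor_deriv r A A' \<kappa> = of_int ?s * minor_deriv r A A' (pick ?I)"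
    by (simp add: minor_deriv_def of_int_poly)
  moreover have "minor r A \<kappa> = of_int ?s * minor r A (pick ?I)" using A \<kappa> by (rule minor_sort)
  moreover have "alternating r w \<kappa> = of_int ?s * (c * minor_deriv r A A' (pick ?I) + l * minor r A (pick ?I))"
    using alternating_cong[OF w \<kappa>] by (simp add: alternating_def)
  ultimately show ?thesis by (simp add: algebra_simps)
qed

lemma minor_deriv_scale:
  assumes A: "A \<in> carrier_mat n r" and Y: "Y \<in> carrier_mat n r" and \<kappa>: "\<And>i. i < r \<Longrightarrow> \<kappa> i < n"
  shows "minor_deriv r (s \<cdot>\<^sub>m A) (s \<cdot>\<^sub>m Y) \<kappa> = s ^ r * minor_deriv r A Y \<kappa>"
proof -
  have "mat r r (\<lambda>(i, j). perturb (s \<cdot>\<^sub>m A) (s \<cdot>\<^sub>m Y) $$ (\<kappa> i, j)) = [:s:] \<cdot>\<^sub>m mat r r (\<lambda>(i, j). perturb A Y $$ (\<kappa> i, j))"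
    using A Y \<kappa> by (intro eq_matI) (auto simp: perturb_def)
  then have "minor r (perturb (s \<cdot>\<^sub>m A) (s \<cdot>\<^sub>m Y)) \<kappa> = [:s:] ^ r * minor r (perturb A Y) \<kappa>"
    by (simp add: minor_def)
  moreover have "[:s:] ^ r = [:s ^ r:]" by (induction r) (simp_all add: one_pCons)
  ultimately show ?thesis by (simp add: minor_deriv_def)
qed

lemma sum_linear_polys: "(\<Sum>k\<in>S. [:f k, g k:]) = [:\<Sum>k\<in>S. f k, \<Sum>k\<in>S. g k:]"
  by (induction S rule: infinite_finite_induct) auto

lemma polynomial_function_power:
  assumes "polynomial_function \<Phi> \<Psi>" shows "polynomial_function (\<lambda>g. \<Phi> g ^ k) (\<lambda>g. \<Psi> g ^ k)"
  using polynomial_function_prod[of "{..<k}" "\<lambda>_. \<Phi>" "\<lambda>_. \<Psi>"] assms by simp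

text \<open>
  The relation \<open>minor_relation\<close> between Pluecker coordinates holds for every morphism at the point \<open>v\<close>, so its
  linearisation holds for tangent vectors.
\<close>

lemma tangent_Mor_pluecker_relation:
  fixes P w :: "'k::field form_tuple"
  assumes w: "w \<in> tangent_space e r n (Mor e r n) P" and v: "v \<in> P1"
    and \<nu>: "\<And>i. i < r \<Longrightarrow> \<nu> i < n" and \<kappa>: "\<And>i. i < r \<Longrightarrow> \<kappa> i < n"
  defines "\<alpha> \<equiv> \<lambda>\<kappa>. [:alternating r (eval_forms e P v) \<kappa>, alternating r (eval_forms e w v) \<kappa>:]"
  shows "poly.coeff (\<alpha> \<nu> * det (mat r r (\<lambda>(i, j). \<alpha> (\<nu>(j := \<kappa> i)))) - \<alpha> \<nu> ^ r * \<alpha> \<kappa>) 1 = 0"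
proof -
  obtain s t where st: "v = (s, t)" by (cases v)
  define ev where "ev Q I = (\<Sum>k\<le>e. [:s ^ k * t ^ (e - k):] * Q (I, k))" for Q :: "nat set \<times> nat \<Rightarrow> 'k poly" and I
  have ev: "polynomial_function (\<lambda>P. eval_forms e P v I) (\<lambda>Q. ev Q I)" for I
  proof -
    have "polynomial_function (\<lambda>P. \<Sum>k\<le>e. (s ^ k * t ^ (e - k)) * P (I, k)) (\<lambda>Q. ev Q I)"
      unfolding ev_def by (intro polynomial_function_sum polynomial_function_cmult polynomial_function_var)
    moreover have "(\<lambda>P. \<Sum>k\<le>e. (s ^ k * t ^ (e - k)) * P (I, k)) = (\<lambda>P. eval_forms e P v I)"
      unfolding eval_forms_def st by (auto simp: fun_eq_iff mult_ac intro!: sum.cong)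
    ultimately show ?thesis by simp
  qed
  have alt: "polynomial_function (\<lambda>P. alternating r (eval_forms e P v) \<kappa>) (\<lambda>Q. alternating r (ev Q) \<kappa>)" for \<kappa>
    using polynomial_function_cmult[OF ev, of "of_int (sorting_sign r \<kappa>)"] by (simp add: alternating_def of_int_poly)
  let ?\<Phi> = "\<lambda>P. alternating r (eval_forms e P v) \<nu> * det (mat r r (\<lambda>(i, j). alternating r (eval_forms e P v) (\<nu>(j := \<kappa> i))))
      + (- 1) * (alternating r (eval_forms e P v) \<nu> ^ r * alternating r (eval_forms e P v) \<kappa>)"
  let ?\<Psi> = "\<lambda>Q. alternating r (ev Q) \<nu> * det (mat r r (\<lambda>(i, j). alternating r (ev Q) (\<nu>(j := \<kappa> i))))
      + [:- 1:] * (alternating r (ev Q) \<nu> ^ r * alternating r (ev Q) \<kappa>)"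
  have "polynomial_function ?\<Phi> ?\<Psi>"
    by (intro polynomial_function_add polynomial_function_mult polynomial_function_cmult polynomial_function_det
        polynomial_function_power alt)
  then have "poly.coeff (?\<Psi> (\<lambda>x. [:P x, w x:])) 1 = 0"
    using w
  proof (rule tangent_spaceD)
    fix f :: "'k grass_map" and R assume co: "coordinates e r n f R"
    obtain A where A: "A \<in> carrier_mat n r" "\<And>I. I \<in> pluecker_indices r n \<Longrightarrow> eval_forms e R v I = minor r A (pick I)"
      using coordinates_matrix[OF co v] by metis
    have altA: "alternating r (eval_forms e R v) \<mu> = minor r A \<mu>" if "\<forall>i<r. \<mu> i < n" for \<mu>
      using alternating_minor[OF A(1) _ A(2)] that by blast
    have "mat r r (\<lambda>(i, j). alternating r (eval_forms e R v) (\<nu>(j := \<kappa> i))) = mat r r (\<lambda>(i, j). minor r A (\<nu>(j := \<kappa> i)))"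
      using \<nu> \<kappa> by (intro eq_matI) (auto intro!: altA)
    then show "?\<Phi> R = 0" using minor_relation[OF A(1) \<nu> \<kappa>] altA[of \<nu>] altA[of \<kappa>] \<nu> \<kappa> by simp
  qed
  moreover have "alternating r (ev (\<lambda>x. [:P x, w x:])) \<mu> = \<alpha> \<mu>" for \<mu>
  proof -
    have "ev (\<lambda>x. [:P x, w x:]) I = [:eval_forms e P v I, eval_forms e w v I:]" for I
      unfolding ev_def eval_forms_def st by (simp add: sum_linear_polys mult_ac)
    then show ?thesis by (simp add: alternating_def \<alpha>_def of_int_poly)
  qed
  ultimately show ?thesis by simp
qed

text \<open>
  At a single point a tangent vector of the space of morphisms is tangent to the cone over the Grassmannian. The change
  \<open>Y\<close> of \<open>A\<close> is read off from the coordinates of \<open>w\<close> with one index different from \<open>\<kappa>0\<close>; the linearised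
  relation determines all other coordinates of \<open>w\<close> from these.
\<close>

lemma tangent_Mor_representation:
  fixes P w :: "'k::field form_tuple"
  assumes w: "w \<in> tangent_space e r n (Mor e r n) P" and v: "v \<in> P1"
    and A: "A \<in> carrier_mat n r" and inj: "mat_injective A" and c: "c \<noteq> 0"
    and P: "\<And>I. I \<in> pluecker_indices r n \<Longrightarrow> eval_forms e P v I = c * minor r A (pick I)"
  shows "\<exists>A' l. A' \<in> carrier_mat n r \<and> (\<forall>I\<in>pluecker_indices r n.
    eval_forms e w v I = c * minor_deriv r A A' (pick I) + l * minor r A (pick I))"
proof -
  obtain \<kappa>0 where \<kappa>0: "\<And>i. i < r \<Longrightarrow> \<kappa>0 i < n" "minor r A \<kappa>0 \<noteq> 0" using mat_injective_minor[OF A inj] by metis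
  define p where "p \<kappa> = alternating r (eval_forms e P v) \<kappa>" for \<kappa>
  define \<omega> where "\<omega> \<kappa> = alternating r (eval_forms e w v) \<kappa>" for \<kappa>
  define u where "u = minor r A \<kappa>0"
  define s where "s = c * u"
  have s: "s \<noteq> 0" "u \<noteq> 0" using c \<kappa>0(2) by (simp_all add: s_def u_def)
  have p: "p \<kappa> = c * minor r A \<kappa>" if "\<And>i. i < r \<Longrightarrow> \<kappa> i < n" for \<kappa>
  proof -
    have "p \<kappa> = alternating r (\<lambda>I. c * minor r A (pick I)) \<kappa>" unfolding p_def using P that by (rule alternating_cong)
    also have "\<dots> = c * minor r A \<kappa>" using minor_sort[OF A that] by (simp add: alternating_def)
    finally show ?thesis .
  qed
  let ?T = "mat r r (\<lambda>(i, l). A $$ (\<kappa>0 i, l))"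
  have T: "?T \<in> carrier_mat r r" by simp
  define M where "M = mat n r (\<lambda>(k, j). [:p (\<kappa>0(j := k)), \<omega> (\<kappa>0(j := k)):])"
  \<comment> \<open>to first order in \<open>T\<close>, the matrix of exchanged coordinates times the selected rows of \<open>A\<close> is \<open>s (A + T Y)\<close>\<close>
  define Y where "Y = mat n r (\<lambda>(k, j). (1 / s) * (\<Sum>l<r. \<omega> (\<kappa>0(l := k)) * ?T $$ (l, j)))"
  have M: "M \<in> carrier_mat n r" and Y: "Y \<in> carrier_mat n r" by (simp_all add: M_def Y_def)
  let ?Tc = "map_mat const_poly ?T"
  have Tc: "?Tc \<in> carrier_mat r r" by simp
  have detTc: "det ?Tc = [:u:]" by (simp add: comm_ring_hom.hom_det[OF const_poly_hom] u_def minor_def)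
  have entry: "(M * ?Tc) $$ (k, j) = [:\<Sum>l<r. p (\<kappa>0(l := k)) * ?T $$ (l, j), \<Sum>l<r. \<omega> (\<kappa>0(l := k)) * ?T $$ (l, j):]"
    if kj: "k < n" "j < r" for k j
  proof -
    have "(M * ?Tc) $$ (k, j) = (\<Sum>l<r. [:p (\<kappa>0(l := k)) * ?T $$ (l, j), \<omega> (\<kappa>0(l := k)) * ?T $$ (l, j):])"
      using kj by (auto simp: M_def scalar_prod_def atLeast0LessThan mult.commute intro!: sum.cong)
    then show ?thesis by (simp only: sum_linear_polys)
  qed
  have X0: "poly.coeff ((M * ?Tc) $$ (k, j)) 0 = (s \<cdot>\<^sub>m A) $$ (k, j)" if kj: "k < n" "j < r" for k j
  proof -
    have "(\<Sum>l<r. p (\<kappa>0(l := k)) * ?T $$ (l, j)) = (\<Sum>l<r. c * ((A * adj_mat ?T) $$ (k, l) * ?T $$ (l, j)))"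
    proof (intro sum.cong refl)
      fix l assume "l \<in> {..<r}"
      then have "p (\<kappa>0(l := k)) = c * (A * adj_mat ?T) $$ (k, l)"
        using minor_replace[OF A kj(1), of l \<kappa>0] p[of "\<kappa>0(l := k)"] \<kappa>0(1) kj(1) by simp
      then show "p (\<kappa>0(l := k)) * ?T $$ (l, j) = c * ((A * adj_mat ?T) $$ (k, l) * ?T $$ (l, j))" by simp
    qed
    also have "\<dots> = c * ((A * adj_mat ?T) * ?T) $$ (k, j)"
      using kj A adj_mat(1)[OF T] by (simp add: scalar_prod_def atLeast0LessThan sum_distrib_left)
    also have "(A * adj_mat ?T) * ?T = A * (adj_mat ?T * ?T)" by (rule assoc_mult_mat[OF A adj_mat(1)[OF T] T])
    also have "\<dots> = u \<cdot>\<^sub>m A" unfolding adj_mat(3)[OF T] using A by (simp add: u_def minor_def mult_smult_distrib[OF A one_carrier_mat])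
    finally have "(\<Sum>l<r. p (\<kappa>0(l := k)) * ?T $$ (l, j)) = (s \<cdot>\<^sub>m A) $$ (k, j)" using kj A by (simp add: s_def del: fun_upd_apply)
    then show ?thesis unfolding entry[OF kj] by (simp only: coeff_pCons_0)
  qed
  have X1: "poly.coeff ((M * ?Tc) $$ (k, j)) 1 = (s \<cdot>\<^sub>m Y) $$ (k, j)" if kj: "k < n" "j < r" for k j
    using entry[OF kj] kj s by (simp add: Y_def)
  have main: "\<omega> \<kappa> = c * minor_deriv r A Y \<kappa> + ((1 - of_nat r) * \<omega> \<kappa>0 / u) * minor r A \<kappa>"
    if \<kappa>: "\<And>i. i < r \<Longrightarrow> \<kappa> i < n" for \<kappa>
  proof -
    let ?m = "minor r M \<kappa>" and ?a0 = "minor r A \<kappa>" and ?a1 = "minor_deriv r A Y \<kappa>"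
    have sA: "s \<cdot>\<^sub>m A \<in> carrier_mat n r" using A by simp
    have "minor r (M * ?Tc) \<kappa> = ?m * [:u:]" using minor_mult[OF M Tc \<kappa>] detTc by simp
    moreover have "poly.coeff (minor r (M * ?Tc) \<kappa>) 0 = s ^ r * ?a0"
    proof -
      have "poly.coeff (minor r (M * ?Tc) \<kappa>) 0 = minor r (s \<cdot>\<^sub>m A) \<kappa>"
        by (rule minor_coeffs(1)[OF sA \<kappa> X0 X1])
      also have "mat r r (\<lambda>(i, j). (s \<cdot>\<^sub>m A) $$ (\<kappa> i, j)) = s \<cdot>\<^sub>m mat r r (\<lambda>(i, j). A $$ (\<kappa> i, j))"
        using A \<kappa> by (intro eq_matI) auto
      then have "minor r (s \<cdot>\<^sub>m A) \<kappa> = s ^ r * ?a0" by (simp add: minor_def)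
      finally show ?thesis .
    qed
    moreover have "poly.coeff (minor r (M * ?Tc) \<kappa>) 1 = s ^ r * ?a1"
      using minor_coeffs(2)[OF sA \<kappa> X0 X1] minor_deriv_scale[OF A Y \<kappa>] by simp
    ultimately have m: "poly.coeff ?m 0 * u = s ^ r * ?a0" "poly.coeff ?m 1 * u = s ^ r * ?a1"
      by (simp_all add: mult.commute)
    have "det (mat r r (\<lambda>(i, j). [:p (\<kappa>0(j := \<kappa> i)), \<omega> (\<kappa>0(j := \<kappa> i)):])) = ?m"
      unfolding minor_def using \<kappa> by (intro arg_cong[where f = det] eq_matI) (auto simp: M_def)
    then have "poly.coeff ([:p \<kappa>0, \<omega> \<kappa>0:] * ?m - [:p \<kappa>0, \<omega> \<kappa>0:] ^ r * [:p \<kappa>, \<omega> \<kappa>:]) 1 = 0"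
      using tangent_Mor_pluecker_relation[where \<nu> = \<kappa>0 and \<kappa> = \<kappa>, OF w v \<kappa>0(1) \<kappa>] by (simp only: p_def \<omega>_def)
    then have "s * poly.coeff ?m 1 + \<omega> \<kappa>0 * poly.coeff ?m 0
        - (s ^ r * \<omega> \<kappa> + of_nat r * s ^ (r - 1) * \<omega> \<kappa>0 * (c * ?a0)) = 0"
      unfolding coeff_diff coeff_mult_1 coeff_power_0 coeff_power_1
      using p[OF \<kappa>0(1)] p[OF \<kappa>] by (simp add: s_def u_def)
    then have "u * (s * poly.coeff ?m 1 + \<omega> \<kappa>0 * poly.coeff ?m 0
        - (s ^ r * \<omega> \<kappa> + of_nat r * s ^ (r - 1) * \<omega> \<kappa>0 * (c * ?a0))) = 0" by simp
    then have "s * (poly.coeff ?m 1 * u) + \<omega> \<kappa>0 * (poly.coeff ?m 0 * u)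
        - (s ^ r * (u * \<omega> \<kappa>) + of_nat r * (s ^ (r - 1) * s) * \<omega> \<kappa>0 * ?a0) = 0"
      by (simp add: s_def algebra_simps)
    moreover have "of_nat r * (s ^ (r - 1) * s) = of_nat r * s ^ r" by (cases r) (simp_all add: mult.commute)
    ultimately have "s * (s ^ r * ?a1) + \<omega> \<kappa>0 * (s ^ r * ?a0)
        - (s ^ r * (u * \<omega> \<kappa>) + of_nat r * s ^ r * \<omega> \<kappa>0 * ?a0) = 0"
      unfolding m by (simp only:)
    then have "s ^ r * (s * ?a1 + \<omega> \<kappa>0 * ?a0 - u * \<omega> \<kappa> - of_nat r * \<omega> \<kappa>0 * ?a0) = 0"
      by (simp add: algebra_simps)
    then have "s * ?a1 + \<omega> \<kappa>0 * ?a0 - u * \<omega> \<kappa> - of_nat r * \<omega> \<kappa>0 * ?a0 = 0" using s by simp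
    then have "u * \<omega> \<kappa> = u * (c * ?a1) + (1 - of_nat r) * \<omega> \<kappa>0 * ?a0" by (simp add: s_def algebra_simps)
    then show ?thesis using s(2) by (simp add: field_simps)
  qed
  show ?thesis
  proof (intro exI conjI ballI)
    show "Y \<in> carrier_mat n r" by (rule Y)
    fix I assume I: "I \<in> pluecker_indices r n"
    show "eval_forms e w v I = c * minor_deriv r A Y (pick I) + ((1 - of_nat r) * \<omega> \<kappa>0 / u) * minor r A (pick I)"
      using main[OF pluecker_indices_pick(4)[OF I]] alternating_pick[OF I, of "eval_forms e w v"] by (simp add: \<omega>_def)
  qed
qed

text \<open>
  The matrix \<open>B A'\<close> can be recovered from the tangent vector \<open>w\<close> by an expression that is polynomial in \<open>A\<close>, \<open>B\<close> and \<open>w\<close>, up to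
  the factor \<open>c * minor r A \<kappa>0\<close>. Hence it does not depend on the choice of \<open>A'\<close>, and it varies regularly with the point.
\<close>

lemma normal_direction_formula:
  fixes B :: "'k::field mat"
  assumes B: "B \<in> carrier_mat m n" and A: "A \<in> carrier_mat n r" and A': "A' \<in> carrier_mat n r" and BA: "B * A = 0\<^sub>m m r"
    and w: "\<And>I. I \<in> pluecker_indices r n \<Longrightarrow> w I = c * minor_deriv r A A' (pick I) + l * minor r A (pick I)"
    and \<kappa>0: "\<And>i. i < r \<Longrightarrow> \<kappa>0 i < n" and ij: "i < m" "j < r"
  shows "(\<Sum>q<r. (\<Sum>k<n. B $$ (i, k) * alternating r w (\<kappa>0(q := k))) * A $$ (\<kappa>0 q, j)) = c * minor r A \<kappa>0 * (B * A') $$ (i, j)"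
proof -
  let ?T = "mat r r (\<lambda>(i, l). A $$ (\<kappa>0 i, l))" and ?A = "perturb A A'"
  let ?Tp = "mat r r (\<lambda>(i, l). ?A $$ (\<kappa>0 i, l))"
  have T: "?T \<in> carrier_mat r r" and Tp: "?Tp \<in> carrier_mat r r" by simp_all
  have Ap: "?A \<in> carrier_mat n r" using A by (simp add: perturb_def)
  note adj = adj_mat[OF T] and adjp = adj_mat[OF Tp]
  have adj0: "poly.coeff (adj_mat ?Tp $$ (p, q)) 0 = adj_mat ?T $$ (p, q)" if "p < r" "q < r" for p q
  proof -
    have "map_mat (\<lambda>p. poly.coeff p 0) (mat_delete ?Tp q p) = mat_delete ?T q p"
      using that A \<kappa>0 by (intro eq_matI) (auto simp: mat_delete_def perturb_def)
    then have "poly.coeff (det (mat_delete ?Tp q p)) 0 = det (mat_delete ?T q p)"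
      using comm_ring_hom.hom_det[OF coeff_0_hom, of "mat_delete ?Tp q p"] by simp
    moreover have "poly.coeff ((- 1) ^ k :: 'k poly) 0 = (- 1) ^ k" for k by (simp add: coeff_power_0)
    ultimately show ?thesis using that by (simp add: adj_mat_def cofactor_def coeff_mult_0')
  qed
  have BA0: "(\<Sum>k<n. B $$ (i, k) * A $$ (k, p)) = 0" if "p < r" for p
  proof -
    have "(B * A) $$ (i, p) = (\<Sum>k<n. B $$ (i, k) * A $$ (k, p))"
      using ij that A B by (simp add: scalar_prod_def atLeast0LessThan)
    then show ?thesis using BA ij that by simp
  qed
  have BA': "(B * A') $$ (i, p) = (\<Sum>k<n. B $$ (i, k) * A' $$ (k, p))" if "p < r" for p
    using ij that A' B by (simp add: scalar_prod_def atLeast0LessThan)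
  have deriv: "(\<Sum>k<n. B $$ (i, k) * minor_deriv r A A' (\<kappa>0(q := k))) = (\<Sum>p<r. (B * A') $$ (i, p) * adj_mat ?T $$ (p, q))"
    if q: "q < r" for q
  proof -
    have "(\<Sum>k<n. B $$ (i, k) * minor_deriv r A A' (\<kappa>0(q := k))) = poly.coeff (\<Sum>k<n. [:B $$ (i, k):] * minor r ?A (\<kappa>0(q := k))) 1"
      by (simp add: minor_deriv_def coeff_sum)
    also have "(\<Sum>k<n. [:B $$ (i, k):] * minor r ?A (\<kappa>0(q := k)))
        = (\<Sum>k<n. \<Sum>p<r. [:B $$ (i, k):] * (?A $$ (k, p) * adj_mat ?Tp $$ (p, q)))"
    proof (intro sum.cong refl)
      fix k assume "k \<in> {..<n}"
      then have k: "k < n" by simp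
      have "minor r ?A (\<kappa>0(q := k)) = (\<Sum>p<r. ?A $$ (k, p) * adj_mat ?Tp $$ (p, q))"
        using minor_replace[OF Ap k q, of \<kappa>0] k q Ap adjp(1) by (simp add: scalar_prod_def atLeast0LessThan)
      then show "[:B $$ (i, k):] * minor r ?A (\<kappa>0(q := k)) = (\<Sum>p<r. [:B $$ (i, k):] * (?A $$ (k, p) * adj_mat ?Tp $$ (p, q)))"
        by (simp only: sum_distrib_left)
    qed
    also have "\<dots> = (\<Sum>p<r. \<Sum>k<n. [:B $$ (i, k):] * (?A $$ (k, p) * adj_mat ?Tp $$ (p, q)))" by (rule sum.swap)
    also have "\<dots> = (\<Sum>p<r. (\<Sum>k<n. [:B $$ (i, k):] * ?A $$ (k, p)) * adj_mat ?Tp $$ (p, q))"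
      by (simp only: sum_distrib_right mult.assoc)
    also have "\<dots> = (\<Sum>p<r. [:0, (B * A') $$ (i, p):] * adj_mat ?Tp $$ (p, q))"
    proof (intro sum.cong refl)
      fix p assume "p \<in> {..<r}"
      then have p: "p < r" by simp
      have "(\<Sum>k<n. [:B $$ (i, k):] * ?A $$ (k, p)) = (\<Sum>k<n. [:B $$ (i, k) * A $$ (k, p), B $$ (i, k) * A' $$ (k, p):])"
        using p A by (intro sum.cong) (auto simp: perturb_def)
      then show "(\<Sum>k<n. [:B $$ (i, k):] * ?A $$ (k, p)) * adj_mat ?Tp $$ (p, q) = [:0, (B * A') $$ (i, p):] * adj_mat ?Tp $$ (p, q)"
        using BA0[OF p] BA'[OF p] by (simp only: sum_linear_polys)
    qed
    also have "poly.coeff \<dots> 1 = (\<Sum>p<r. (B * A') $$ (i, p) * adj_mat ?T $$ (p, q))"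
      unfolding coeff_sum coeff_mult_1 using adj0 q by (intro sum.cong) simp_all
    finally show ?thesis .
  qed
  have const: "(\<Sum>k<n. B $$ (i, k) * minor r A (\<kappa>0(q := k))) = 0" if q: "q < r" for q
  proof -
    have "(\<Sum>k<n. B $$ (i, k) * minor r A (\<kappa>0(q := k))) = (\<Sum>k<n. B $$ (i, k) * (A * adj_mat ?T) $$ (k, q))"
      using minor_replace[OF A _ q, of _ \<kappa>0] by (intro sum.cong) auto
    also have "\<dots> = (B * (A * adj_mat ?T)) $$ (i, q)"
      using ij q A B adj(1) by (simp add: scalar_prod_def atLeast0LessThan)
    also have "B * (A * adj_mat ?T) = (B * A) * adj_mat ?T" by (rule assoc_mult_mat[symmetric, OF B A adj(1)])
    finally show ?thesis using BA ij q adj(1) by (simp del: fun_upd_apply)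
  qed
  have inner: "(\<Sum>k<n. B $$ (i, k) * alternating r w (\<kappa>0(q := k))) = c * (\<Sum>p<r. (B * A') $$ (i, p) * adj_mat ?T $$ (p, q))"
    if q: "q < r" for q
  proof -
    have "(\<Sum>k<n. B $$ (i, k) * alternating r w (\<kappa>0(q := k)))
        = (\<Sum>k<n. c * (B $$ (i, k) * minor_deriv r A A' (\<kappa>0(q := k))) + l * (B $$ (i, k) * minor r A (\<kappa>0(q := k))))"
    proof (intro sum.cong refl)
      fix k assume "k \<in> {..<n}"
      then have "alternating r w (\<kappa>0(q := k)) = c * minor_deriv r A A' (\<kappa>0(q := k)) + l * minor r A (\<kappa>0(q := k))"
        using \<kappa>0 by (intro alternating_minor_deriv[OF A _ w]) auto
      then show "B $$ (i, k) * alternating r w (\<kappa>0(q := k))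
          = c * (B $$ (i, k) * minor_deriv r A A' (\<kappa>0(q := k))) + l * (B $$ (i, k) * minor r A (\<kappa>0(q := k)))"
        by (simp add: algebra_simps)
    qed
    also have "\<dots> = c * (\<Sum>k<n. B $$ (i, k) * minor_deriv r A A' (\<kappa>0(q := k))) + l * (\<Sum>k<n. B $$ (i, k) * minor r A (\<kappa>0(q := k)))"
      by (simp only: sum.distrib sum_distrib_left)
    finally show ?thesis using deriv[OF q] const[OF q] by simp
  qed
  have "(\<Sum>q<r. (\<Sum>k<n. B $$ (i, k) * alternating r w (\<kappa>0(q := k))) * A $$ (\<kappa>0 q, j))
      = (\<Sum>q<r. \<Sum>p<r. c * ((B * A') $$ (i, p) * (adj_mat ?T $$ (p, q) * ?T $$ (q, j))))"
    using inner ij by (intro sum.cong refl) (simp add: sum_distrib_left sum_distrib_right mult_ac)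
  also have "\<dots> = (\<Sum>p<r. \<Sum>q<r. c * ((B * A') $$ (i, p) * (adj_mat ?T $$ (p, q) * ?T $$ (q, j))))" by (rule sum.swap)
  also have "\<dots> = (\<Sum>p<r. c * ((B * A') $$ (i, p) * (adj_mat ?T * ?T) $$ (p, j)))"
    using ij adj(1) by (intro sum.cong refl) (simp add: scalar_prod_def atLeast0LessThan sum_distrib_left)
  also have "\<dots> = (\<Sum>p<r. if p = j then c * ((B * A') $$ (i, p) * minor r A \<kappa>0) else 0)"
    unfolding adj(3) using ij by (intro sum.cong refl) (simp add: minor_def)
  also have "\<dots> = c * minor r A \<kappa>0 * (B * A') $$ (i, j)" using ij by simp
  finally show ?thesis .
qed

text \<open>
  A first order change \<open>B'\<close> of \<open>B\<close> moves its kernel in the same way as a change \<open>A'\<close> of \<open>A\<close> with \<open>B A' + B' A = 0\<close>. To see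
  it without dividing, take for \<open>D\<close> the product of the perturbed \<open>B\<close> with a right inverse of \<open>B\<close>: the perturbed \<open>B\<close> kills
  \<open>X = det D A - R (adj D) (B + T B') A\<close> exactly, so its minors are proportional to the dual minors over \<open>\<K>[T]\<close>.
\<close>

lemma dual_minor_deriv:
  fixes B :: "'k::field mat"
  assumes split: "split_exact n m r B A" and B': "B' \<in> carrier_mat m n"
  obtains A' l \<nu> where "A' \<in> carrier_mat n r" "\<nu> \<noteq> 0"
    "\<And>i j. i < m \<Longrightarrow> j < r \<Longrightarrow> (B * A') $$ (i, j) = - (B' * A) $$ (i, j)"
    "\<And>\<kappa>. (\<And>i. i < r \<Longrightarrow> \<kappa> i < n) \<Longrightarrow> minor r A \<kappa> = \<nu> * dual_minor r B \<kappa>"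
    "\<And>\<kappa>. (\<And>i. i < r \<Longrightarrow> \<kappa> i < n) \<Longrightarrow>
       \<nu> * poly.coeff (dual_minor r (perturb B B') \<kappa>) 1 = minor_deriv r A A' \<kappa> + l * minor r A \<kappa>"
proof -
  obtain R \<nu> where R: "R \<in> carrier_mat n m" "B * R = 1\<^sub>m m" and \<nu>: "\<nu> = det (beside R A)" "\<nu> \<noteq> 0"
    "\<And>\<kappa>. (\<And>i. i < r \<Longrightarrow> \<kappa> i < n) \<Longrightarrow> minor r A \<kappa> = \<nu> * dual_minor r B \<kappa>"
    using split_exact_dual_minor[OF split] by metis
  have n: "n = m + r" and B: "B \<in> carrier_mat m n" and A: "A \<in> carrier_mat n r" and BA: "B * A = 0\<^sub>m m r"
    using split unfolding split_exact_def by blast+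
  let ?B = "perturb B B'" and ?R = "map_mat const_poly R" and ?A = "map_mat const_poly A"
  have Bp: "?B \<in> carrier_mat m n" and Rp: "?R \<in> carrier_mat n m" and Ap: "?A \<in> carrier_mat n r"
    using B R(1) A by (simp_all add: perturb_def)
  define D where "D = ?B * ?R"
  define Y where "Y = ?B * ?A"
  have D: "D \<in> carrier_mat m m" and Y: "Y \<in> carrier_mat m r" using Bp Rp Ap by (simp_all add: D_def Y_def)
  note adj = adj_mat[OF D]
  define W where "W = ?R * (adj_mat D * Y)"
  have W: "W \<in> carrier_mat n r" using Rp adj(1) Y by (simp add: W_def)
  define X where "X = det D \<cdot>\<^sub>m ?A - W"
  have X: "X \<in> carrier_mat n r" unfolding X_def by (rule minus_carrier_mat[OF W])
  have BX: "?B * X = 0\<^sub>m m r"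
  proof -
    have "?B * X = ?B * (det D \<cdot>\<^sub>m ?A) - ?B * W"
      unfolding X_def using Ap by (intro mult_minus_distrib_mat[OF Bp _ W]) simp
    also have "?B * (det D \<cdot>\<^sub>m ?A) = det D \<cdot>\<^sub>m Y" unfolding Y_def by (rule mult_smult_distrib[OF Bp Ap])
    also have "?B * W = D * (adj_mat D * Y)"
      unfolding W_def D_def by (rule assoc_mult_mat[symmetric, OF Bp Rp mult_carrier_mat[OF adj(1)[unfolded D_def] Y]])
    also have "\<dots> = (D * adj_mat D) * Y" by (rule assoc_mult_mat[symmetric, OF D adj(1) Y])
    also have "\<dots> = det D \<cdot>\<^sub>m Y" unfolding adj(2) using mult_smult_assoc_mat[OF one_carrier_mat Y] Y by simp
    finally show ?thesis using Y by simp
  qed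
  have Bc: "poly.coeff (?B $$ (i, k)) 0 = B $$ (i, k)" "poly.coeff (?B $$ (i, k)) 1 = B' $$ (i, k)" if "i < m" "k < n" for i k
    using that B by (simp_all add: perturb_def)
  have D0: "map_mat (\<lambda>p. poly.coeff p 0) D = 1\<^sub>m m"
  proof (rule eq_matI)
    fix i j assume "i < dim_row (1\<^sub>m m :: 'k mat)" "j < dim_col (1\<^sub>m m :: 'k mat)"
    then have ij: "i < m" "j < m" by simp_all
    have "poly.coeff (D $$ (i, j)) 0 = (\<Sum>k<n. B $$ (i, k) * R $$ (k, j))"
      using ij Bp Rp R(1) Bc(1)[OF ij(1)] by (simp add: D_def scalar_prod_def atLeast0LessThan coeff_sum coeff_mult_0' mult.commute)
    also have "\<dots> = (B * R) $$ (i, j)" using ij B R(1) by (simp add: scalar_prod_def atLeast0LessThan mult.commute)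
    finally show "map_mat (\<lambda>p. poly.coeff p 0) D $$ (i, j) = 1\<^sub>m m $$ (i, j)" using R(2) ij D by simp
  qed (use D in auto)
  have Y0: "poly.coeff (Y $$ (i, j)) 0 = 0" if ij: "i < m" "j < r" for i j
  proof -
    have "poly.coeff (Y $$ (i, j)) 0 = (\<Sum>k<n. B $$ (i, k) * A $$ (k, j))"
      using ij Bp Ap A Bc(1)[OF ij(1)] by (simp add: Y_def scalar_prod_def atLeast0LessThan coeff_sum coeff_mult_0' mult.commute)
    also have "\<dots> = (B * A) $$ (i, j)" using ij B A by (simp add: scalar_prod_def atLeast0LessThan mult.commute)
    finally show ?thesis using BA ij by simp
  qed
  have detD0: "poly.coeff (det D) 0 = 1"
    using comm_ring_hom.hom_det[OF coeff_0_hom, of D] D0 by simp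
  have W0: "poly.coeff (W $$ (k, j)) 0 = 0" if kj: "k < n" "j < r" for k j
  proof -
    have "W $$ (k, j) = (\<Sum>i<m. ?R $$ (k, i) * (\<Sum>q<m. adj_mat D $$ (i, q) * Y $$ (q, j)))"
      using kj Rp adj(1) Y by (simp add: W_def scalar_prod_def atLeast0LessThan)
    then show ?thesis using Y0 kj by (simp add: coeff_sum coeff_mult_0')
  qed
  have X0: "poly.coeff (X $$ (k, j)) 0 = A $$ (k, j)" if kj: "k < n" "j < r" for k j
    using kj W0[OF kj] detD0 W A by (simp add: X_def coeff_mult_0')
  define A' where "A' = mat n r (\<lambda>(k, j). poly.coeff (X $$ (k, j)) 1)"
  have X1: "poly.coeff (X $$ (k, j)) 1 = A' $$ (k, j)" if "k < n" "j < r" for k j using that by (simp add: A'_def)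
  have BA': "(B * A') $$ (i, j) = - (B' * A) $$ (i, j)" if ij: "i < m" "j < r" for i j
  proof -
    have "0 = poly.coeff ((?B * X) $$ (i, j)) 1" using BX ij by simp
    also have "(?B * X) $$ (i, j) = (\<Sum>k<n. ?B $$ (i, k) * X $$ (k, j))"
      using ij Bp X by (simp add: scalar_prod_def atLeast0LessThan)
    also have "poly.coeff \<dots> 1 = (\<Sum>k<n. B $$ (i, k) * A' $$ (k, j) + B' $$ (i, k) * A $$ (k, j))"
      unfolding coeff_sum coeff_mult_1 using ij Bc X0 X1 by (intro sum.cong) simp_all
    also have "\<dots> = (B * A') $$ (i, j) + (B' * A) $$ (i, j)"
      using ij B B' A by (simp add: scalar_prod_def atLeast0LessThan A'_def sum.distrib)
    finally show ?thesis by (simp add: eq_neg_iff_add_eq_0)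
  qed
  let ?N = "det (beside ?R X)"
  have N0: "poly.coeff ?N 0 = \<nu>"
  proof -
    have "map_mat (\<lambda>p. poly.coeff p 0) (beside ?R X) = beside R A"
      using R(1) A X X0 by (intro eq_matI) (auto simp: beside_def)
    then show ?thesis using comm_ring_hom.hom_det[OF coeff_0_hom, of "beside ?R X"] \<nu>(1) by simp
  qed
  define l where "l = poly.coeff (det D) 1 - poly.coeff ?N 1 / \<nu>"
  have "\<nu> * poly.coeff (dual_minor r ?B \<kappa>) 1 = minor_deriv r A A' \<kappa> + l * minor r A \<kappa>"
    if \<kappa>: "\<And>i. i < r \<Longrightarrow> \<kappa> i < n" for \<kappa>
  proof -
    let ?q = "dual_minor r ?B \<kappa>"
    have eq: "?q * ?N = det D * minor r X \<kappa>"
      using dual_minor_minor[of ?B m r ?R X \<kappa>] Bp Rp X BX \<kappa> unfolding n D_def by simp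
    have x: "poly.coeff (minor r X \<kappa>) 0 = minor r A \<kappa>" "poly.coeff (minor r X \<kappa>) 1 = minor_deriv r A A' \<kappa>"
      by (rule minor_coeffs[OF A \<kappa> X0 X1], assumption+)+
    have "poly.coeff (?q * ?N) 0 = poly.coeff (det D * minor r X \<kappa>) 0"
      "poly.coeff (?q * ?N) 1 = poly.coeff (det D * minor r X \<kappa>) 1" using eq by simp_all
    then have q: "poly.coeff ?q 0 * \<nu> = minor r A \<kappa>"
      "poly.coeff ?q 0 * poly.coeff ?N 1 + poly.coeff ?q 1 * \<nu> = minor_deriv r A A' \<kappa> + poly.coeff (det D) 1 * minor r A \<kappa>"
      unfolding coeff_mult_0' coeff_mult_1 N0 detD0 x by simp_all
    have "poly.coeff ?q 0 = minor r A \<kappa> / \<nu>" using q(1) \<nu>(2) by (simp add: field_simps)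
    then show ?thesis using q(2) by (simp add: l_def algebra_simps)
  qed
  moreover have "A' \<in> carrier_mat n r" by (simp add: A'_def)
  ultimately show thesis using that \<nu>(2,3) BA' by blast
qed

text \<open>
  If \<open>B A' = 0\<close>, then the columns of \<open>A'\<close> are in the kernel of \<open>B\<close>, which is the column space of \<open>A\<close>.
\<close>

lemma minor_deriv_trivial_normal:
  fixes B :: "'k::field mat"
  assumes split: "split_exact n m r B A" and A': "A' \<in> carrier_mat n r" and BA': "B * A' = 0\<^sub>m m r"
  shows "\<exists>c. \<forall>\<kappa>. (\<forall>i<r. \<kappa> i < n) \<longrightarrow> minor_deriv r A A' \<kappa> = c * minor r A \<kappa>"
proof -
  have B: "B \<in> carrier_mat m n" and A: "A \<in> carrier_mat n r" using split unfolding split_exact_def by blast+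
  have "col A' j \<in> mat_image A" if j: "j < r" for j
  proof -
    have "B *\<^sub>v col A' j = col (B * A') j" by (rule col_mult2[symmetric, OF B A' j])
    also have "\<dots> = 0\<^sub>v m" unfolding BA' using j by (intro eq_vecI) simp_all
    moreover have "col A' j \<in> carrier_vec n" by (rule carrier_vecI) (use A' in simp)
    ultimately show ?thesis unfolding split_exact_kernel[OF split] by simp
  qed
  then obtain G where "G \<in> carrier_mat r r" "A' = A * G" using mat_factor[OF A A'] by metis
  then show ?thesis using minor_deriv_image[OF A] by blast
qed

section \<open>Deformations inside the splitting loci\<close>

lemma form_eqI:
  fixes f g :: "'k::field_char_0 \<times> 'k \<Rightarrow> 'k"
  assumes "binary_form d f" "binary_form d g" "\<And>x. f (x, 1) = g (x, 1)"
  shows "f = g"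
proof -
  obtain c c' where c: "f = (\<lambda>(s, t). \<Sum>k\<le>d. c k * s ^ k * t ^ (d - k))" "g = (\<lambda>(s, t). \<Sum>k\<le>d. c' k * s ^ k * t ^ (d - k))"
    using assms(1,2) unfolding binary_form_def by blast
  have "c k = c' k" if "k \<le> d" for k
    using form_coefficients_unique[where d = d and c = c and c' = c' and k = k] assms(3) that by (simp add: c)
  then show ?thesis unfolding c by (auto simp: fun_eq_iff intro!: sum.cong)
qed

lemma form_tuple_eqI:
  fixes P Q :: "'k::field_char_0 form_tuple"
  assumes "\<And>x. x \<notin> pluecker_indices r n \<times> {..e} \<Longrightarrow> P x = 0" "\<And>x. x \<notin> pluecker_indices r n \<times> {..e} \<Longrightarrow> Q x = 0"
    and eq: "\<And>v I. v \<in> P1 \<Longrightarrow> I \<in> pluecker_indices r n \<Longrightarrow> eval_forms e P v I = eval_forms e Q v I"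
  shows "P = Q"
proof
  fix x
  show "P x = Q x"
  proof (cases "x \<in> pluecker_indices r n \<times> {..e}")
    case True
    then obtain I k where x: "x = (I, k)" "I \<in> pluecker_indices r n" "k \<le> e" by auto
    have "(\<Sum>k\<le>e. P (I, k) * y ^ k * 1 ^ (e - k)) = (\<Sum>k\<le>e. Q (I, k) * y ^ k * 1 ^ (e - k))" for y
      using eq[of "(y, 1)" I] x by (simp add: eval_forms_def P1_iff)
    then show ?thesis unfolding x(1) by (rule form_coefficients_unique) (rule x(3))
  qed (use assms in simp)
qed

text \<open>
  The pointwise ratio is a section of \<open>\<O>(0)\<close> because a denominator is available near each point, and global functions
  on the projective line are constant.
\<close>

lemma constant_ratio:
  fixes F G :: "'i \<Rightarrow> 'k::{alg_closed_field, field_char_0} \<times> 'k \<Rightarrow> 'k"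
  assumes F: "\<And>I. I \<in> J \<Longrightarrow> binary_form e (F I)" and G: "\<And>I. I \<in> J \<Longrightarrow> binary_form e (G I)"
    and ratio: "\<And>v. v \<in> P1 \<Longrightarrow> \<exists>c. \<forall>I\<in>J. F I v = c * G I v"
    and nz: "\<And>v. v \<in> P1 \<Longrightarrow> \<exists>I\<in>J. G I v \<noteq> 0"
  obtains c where "\<And>v I. v \<in> P1 \<Longrightarrow> I \<in> J \<Longrightarrow> F I v = c * G I v"
proof -
  define \<phi> where "\<phi> v = (SOME c. \<forall>I\<in>J. F I v = c * G I v)" for v
  have \<phi>: "F I v = \<phi> v * G I v" if "v \<in> P1" "I \<in> J" for v I
    using someI_ex[OF ratio[OF that(1)]] that(2) unfolding \<phi>_def by blast
  have "regular (int 0) P1 \<phi>"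
  proof (rule regularI)
    fix v :: "'k \<times> 'k" assume v: "v \<in> P1"
    then obtain I where I: "I \<in> J" "G I v \<noteq> 0" using nz by blast
    show "\<exists>i j g h. binary_form i g \<and> binary_form j h \<and> int i - int j = int 0 \<and>
       h v \<noteq> 0 \<and> (\<forall>u\<in>P1. h u \<noteq> 0 \<longrightarrow> \<phi> u = g u / h u)"
      using \<phi>[OF _ I(1)] by (intro fractionI[OF F[OF I(1)] G[OF I(1)] _ I(2)]) simp_all
  qed
  then obtain h where h: "binary_form 0 h" "\<And>v. v \<in> P1 \<Longrightarrow> \<phi> v = h v" using regular_imp_form by blast
  obtain c :: "nat \<Rightarrow> 'k" where "h = (\<lambda>(s, t). \<Sum>k\<le>0. c k * s ^ k * t ^ (0 - k))"
    using h(1) unfolding binary_form_def by blast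
  then have "h v = c 0" for v by (simp add: case_prod_beta)
  then show thesis using that[of "c 0"] \<phi> h(2) by metis
qed

text \<open>
  The projective Nullstellensatz in one chart: dehomogenised at \<open>t = 1\<close> the forms generate the unit ideal, and
  homogenising an expression of \<open>1\<close> in sufficiently large degree gives a power of \<open>t\<close>.
\<close>

lemma snd_power_in_ideal:
  fixes h :: "'i \<Rightarrow> 'k::{alg_closed_field, field_char_0} \<times> 'k \<Rightarrow> 'k"
  assumes J: "finite J" and h: "\<And>I. I \<in> J \<Longrightarrow> binary_form e (h I)"
    and nz: "\<And>v. v \<in> P1 \<Longrightarrow> \<exists>I\<in>J. h I v \<noteq> 0"
  shows "\<exists>N0. \<forall>N\<ge>N0. \<exists>\<gamma>. (\<forall>I\<in>J. binary_form N (\<gamma> I)) \<and> (\<forall>v. (\<Sum>I\<in>J. \<gamma> I v * h I v) = snd v ^ (N + e))"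
proof -
  have "\<exists>p. degree p \<le> e \<and> h I = homogenize e p" if "I \<in> J" for I
    using form_dehomogenize[OF h[OF that]] by metis
  then obtain p where p: "\<And>I. I \<in> J \<Longrightarrow> degree (p I) \<le> e \<and> h I = homogenize e (p I)" by metis
  have hp: "h I (x, 1) = poly (p I) x" if "I \<in> J" for I x
    using p[OF that] homogenize_affine[of "p I" e x] by simp
  define X where "X = {q. \<exists>g. q = (\<Sum>I\<in>J. g I * p I)}"
  have "1 \<in> X"
  proof (rule poly_ideal_without_zeros)
    fix q q' assume "q \<in> X" "q' \<in> X"
    then obtain g g' where "q = (\<Sum>I\<in>J. g I * p I)" "q' = (\<Sum>I\<in>J. g' I * p I)" unfolding X_def by blast
    then have "q + q' = (\<Sum>I\<in>J. (g I + g' I) * p I)" by (simp add: sum.distrib distrib_right)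
    then show "q + q' \<in> X" unfolding X_def by (intro CollectI exI[of _ "\<lambda>I. g I + g' I"])
  next
    fix l q assume "q \<in> X"
    then obtain g where "q = (\<Sum>I\<in>J. g I * p I)" unfolding X_def by blast
    then have "l * q = (\<Sum>I\<in>J. (l * g I) * p I)" by (simp add: sum_distrib_left mult.assoc)
    then show "l * q \<in> X" unfolding X_def by (intro CollectI exI[of _ "\<lambda>I. l * g I"])
  next
    fix x
    obtain I where I: "I \<in> J" "h I (x, 1) \<noteq> 0" using nz[of "(x, 1)"] by (auto simp: P1_iff)
    have "p I = (\<Sum>I'\<in>J. (if I' = I then 1 else 0) * p I')"
      using I J by (simp add: if_distrib[of "\<lambda>a. a * _"] sum.If_cases Int_absorb1 cong: if_cong)
    then have "p I \<in> X" unfolding X_def by (intro CollectI exI[of _ "\<lambda>I'. if I' = I then 1 else 0"])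
    then show "\<exists>p\<in>X. poly p x \<noteq> 0" using I hp by (intro bexI[of _ "p I"]) simp_all
  qed
  then obtain g where g: "1 = (\<Sum>I\<in>J. g I * p I)" unfolding X_def by blast
  show ?thesis
  proof (intro exI[of _ "\<Sum>I\<in>J. degree (g I)"] allI impI)
    fix N assume N: "N \<ge> (\<Sum>I\<in>J. degree (g I))"
    have deg: "degree (g I) \<le> N" if "I \<in> J" for I
      using member_le_sum[of I J "\<lambda>I. degree (g I)"] that J N by simp
    define \<gamma> where "\<gamma> I = homogenize N (g I)" for I
    have \<gamma>: "binary_form N (\<gamma> I)" for I unfolding \<gamma>_def by (rule homogenize_form)
    have "(\<lambda>v. \<Sum>I\<in>J. \<gamma> I v * h I v) = (\<lambda>v. snd v ^ (N + e))"
    proof (rule form_eqI)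
      show "binary_form (N + e) (\<lambda>v. \<Sum>I\<in>J. \<gamma> I v * h I v)" by (intro form.sum form.mult \<gamma> h)
      show "binary_form (N + e) (\<lambda>v :: 'k \<times> 'k. snd v ^ (N + e))" by (rule form_snd_power)
      fix x
      have "(\<Sum>I\<in>J. \<gamma> I (x, 1) * h I (x, 1)) = (\<Sum>I\<in>J. poly (g I * p I) x)"
        using deg hp by (intro sum.cong) (simp_all add: \<gamma>_def homogenize_affine)
      also have "\<dots> = poly (\<Sum>I\<in>J. g I * p I) x" by (simp add: poly_sum)
      finally show "(\<Sum>I\<in>J. \<gamma> I (x, 1) * h I (x, 1)) = snd (x, 1) ^ (N + e)" unfolding g[symmetric] by simp
    qed
    then show "\<exists>\<gamma>. (\<forall>I\<in>J. binary_form N (\<gamma> I)) \<and> (\<forall>v. (\<Sum>I\<in>J. \<gamma> I v * h I v) = snd v ^ (N + e))"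
      using \<gamma> by (intro exI[of _ \<gamma>] conjI ballI) (simp_all add: fun_eq_iff)
  qed
qed

text \<open>
  Powers \<open>s ^ L\<close> and \<open>t ^ L\<close> are in the ideal, and each monomial of degree \<open>2 L\<close> is divisible by one of them.
\<close>

lemma all_monomials_in_ideal:
  fixes h :: "'i \<Rightarrow> 'k::{alg_closed_field, field_char_0} \<times> 'k \<Rightarrow> 'k"
  assumes J: "finite J" and h: "\<And>I. I \<in> J \<Longrightarrow> binary_form e (h I)"
    and nz: "\<And>v. v \<in> P1 \<Longrightarrow> \<exists>I\<in>J. h I v \<noteq> 0"
  shows "\<exists>M \<gamma>. (\<forall>k\<le>M + e. \<forall>I\<in>J. binary_form M (\<gamma> k I)) \<and>
    (\<forall>k\<le>M + e. \<forall>v. (\<Sum>I\<in>J. \<gamma> k I v * h I v) = fst v ^ k * snd v ^ (M + e - k))"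
proof -
  obtain N1 where N1: "\<And>N. N \<ge> N1 \<Longrightarrow> \<exists>\<gamma>. (\<forall>I\<in>J. binary_form N (\<gamma> I)) \<and> (\<forall>v. (\<Sum>I\<in>J. \<gamma> I v * h I v) = snd v ^ (N + e))"
    using snd_power_in_ideal[OF J h nz] by blast
  have "\<exists>N0. \<forall>N\<ge>N0. \<exists>\<gamma>. (\<forall>I\<in>J. binary_form N (\<gamma> I)) \<and> (\<forall>v. (\<Sum>I\<in>J. \<gamma> I v * h I (prod.swap v)) = snd v ^ (N + e))"
  proof (rule snd_power_in_ideal[OF J])
    fix v :: "'k \<times> 'k" assume "v \<in> P1"
    then have "prod.swap v \<in> P1" by (cases v) (auto simp: P1_iff)
    then show "\<exists>I\<in>J. h I (prod.swap v) \<noteq> 0" by (rule nz)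
  qed (use form_swap h in blast)
  then obtain N2 where N2: "\<And>N. N \<ge> N2 \<Longrightarrow> \<exists>\<gamma>. (\<forall>I\<in>J. binary_form N (\<gamma> I)) \<and> (\<forall>v. (\<Sum>I\<in>J. \<gamma> I v * h I (prod.swap v)) = snd v ^ (N + e))"
    by blast
  define N where "N = max N1 N2"
  obtain \<gamma>1 where \<gamma>1: "\<And>I. I \<in> J \<Longrightarrow> binary_form N (\<gamma>1 I)" "\<And>v. (\<Sum>I\<in>J. \<gamma>1 I v * h I v) = snd v ^ (N + e)"
    using N1[of N] unfolding N_def by (metis max.cobounded1)
  obtain \<gamma>2 where \<gamma>2: "\<And>I. I \<in> J \<Longrightarrow> binary_form N (\<gamma>2 I)" "\<And>v. (\<Sum>I\<in>J. \<gamma>2 I v * h I (prod.swap v)) = snd v ^ (N + e)"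
    using N2[of N] unfolding N_def by (metis max.cobounded2)
  define L where "L = N + e"
  define \<gamma> where "\<gamma> k I v = (if L \<le> k then (fst v ^ (k - L) * snd v ^ (2 * L - k)) * \<gamma>2 I (prod.swap v)
      else (fst v ^ k * snd v ^ (L - k)) * \<gamma>1 I v)" for k I and v :: "'k \<times> 'k"
  have 2: "(\<Sum>I\<in>J. \<gamma>2 I (prod.swap v) * h I v) = fst v ^ L" for v
    using \<gamma>2(2)[of "prod.swap v"] by (simp add: L_def)
  show ?thesis
  proof (intro exI[of _ "L + N"] exI[of _ \<gamma>] conjI allI impI ballI)
    fix k I assume k: "k \<le> L + N + e" and I: "I \<in> J"
    show "binary_form (L + N) (\<gamma> k I)"
    proof (cases "L \<le> k")
      case True
      have "binary_form ((k - L) + (2 * L - k) + N) (\<lambda>v. (fst v ^ (k - L) * snd v ^ (2 * L - k)) * \<gamma>2 I (prod.swap v))"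
        by (intro form.mult form_fst_power form_snd_power form_swap \<gamma>2 I)
      moreover have "(k - L) + (2 * L - k) + N = L + N" using True k by (simp add: L_def)
      ultimately show ?thesis using True by (simp add: \<gamma>_def[abs_def])
    next
      case False
      have "binary_form (k + (L - k) + N) (\<lambda>v. (fst v ^ k * snd v ^ (L - k)) * \<gamma>1 I v)"
        by (intro form.mult form_fst_power form_snd_power \<gamma>1 I)
      moreover have "k + (L - k) + N = L + N" using False by simp
      ultimately show ?thesis using False by (simp add: \<gamma>_def[abs_def])
    qed
  next
    fix k v assume k: "k \<le> L + N + e"
    show "(\<Sum>I\<in>J. \<gamma> k I v * h I v) = fst v ^ k * snd v ^ (L + N + e - k)"
    proof (cases "L \<le> k")
      case True
      then have "(\<Sum>I\<in>J. \<gamma> k I v * h I v) = (fst v ^ (k - L) * snd v ^ (2 * L - k)) * (\<Sum>I\<in>J. \<gamma>2 I (prod.swap v) * h I v)"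
        by (simp add: \<gamma>_def sum_distrib_left mult.assoc)
      also have "\<dots> = (fst v ^ (k - L) * fst v ^ L) * snd v ^ (2 * L - k)" unfolding 2 by (simp add: mult_ac)
      also have "\<dots> = fst v ^ k * snd v ^ (2 * L - k)" unfolding power_add[symmetric] using True by simp
      also have "2 * L - k = L + N + e - k" by (simp add: L_def)
      finally show ?thesis .
    next
      case False
      then have "(\<Sum>I\<in>J. \<gamma> k I v * h I v) = (fst v ^ k * snd v ^ (L - k)) * (\<Sum>I\<in>J. \<gamma>1 I v * h I v)"
        by (simp add: \<gamma>_def sum_distrib_left mult.assoc)
      also have "\<dots> = fst v ^ k * snd v ^ (L - k + (N + e))" unfolding \<gamma>1(2) power_add by (simp only: mult_ac)
      also have "L - k + (N + e) = L + N + e - k" using False by simp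
      finally show ?thesis .
    qed
  qed
qed

lemma const_poly_sum: "[:\<Sum>k\<in>S. f k:] = (\<Sum>k\<in>S. [:f k :: 'a::comm_ring_1:])"
proof -
  interpret comm_ring_hom "\<lambda>c. [:c:] :: 'a poly" by (rule const_poly_hom)
  show ?thesis by (rule hom_sum)
qed

lemma form_over_const_poly:
  assumes "binary_form d h" shows "form_over const_poly d (\<lambda>v. [:h v:])"
proof -
  obtain c where c: "h = (\<lambda>(s, t). \<Sum>k\<le>d. c k * s ^ k * t ^ (d - k))" using assms unfolding binary_form_def by blast
  show ?thesis unfolding form_over_def
    by (intro exI[of _ "\<lambda>k. [:c k:]"]) (simp add: c fun_eq_iff mult_ac const_poly_sum)
qed

lemma form_over_linear:
  assumes "binary_form d h" "binary_form d h'" shows "form_over const_poly d (\<lambda>v. [:h v, h' v:])"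
proof -
  have "form_over const_poly d (\<lambda>v. [:h v:] + [:0, 1:] * [:h' v:])"
    by (intro form_over_add form_over_cmult form_over_const_poly assms)
  then show ?thesis by simp
qed

text \<open>
  In degree \<open>D\<close> the ideal of the forms at \<open>T = 0\<close> contains all monomials. Lifting such expressions to \<open>\<K>[T]\<close> gives forms of
  degree \<open>D\<close> in the ideal whose coefficient matrix \<open>G\<close> is the identity at \<open>T = 0\<close>. If \<open>det G\<close> does not vanish at
  \<open>x\<close>, then a common zero of the forms at \<open>T = x\<close> is a zero of all monomials, which is impossible; and \<open>det G\<close> has finitely
  many roots.
\<close>

lemma no_common_zero_open:
  fixes H :: "'i \<Rightarrow> 'k::{alg_closed_field, field_char_0} \<times> 'k \<Rightarrow> 'k poly"
  assumes J: "finite J" and H: "\<And>I. I \<in> J \<Longrightarrow> form_over const_poly e (H I)"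
    and nz: "\<And>v. v \<in> P1 \<Longrightarrow> \<exists>I\<in>J. poly (H I v) 0 \<noteq> 0"
  shows "finite {t. \<not> (\<forall>v\<in>P1. \<exists>I\<in>J. poly (H I v) t \<noteq> 0)}"
proof -
  have h0: "binary_form e (\<lambda>v. poly (H I v) 0)" if I: "I \<in> J" for I
  proof -
    obtain c where c: "H I = (\<lambda>(s, t). \<Sum>k\<le>e. c k * [:s ^ k * t ^ (e - k):])" using H[OF I] unfolding form_over_def by blast
    show ?thesis unfolding binary_form_def
      by (intro exI[of _ "\<lambda>k. poly (c k) 0"]) (simp add: c fun_eq_iff poly_sum mult_ac)
  qed
  obtain M \<gamma> where \<gamma>: "\<And>k I. k \<le> M + e \<Longrightarrow> I \<in> J \<Longrightarrow> binary_form M (\<gamma> k I)"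
    "\<And>k v. k \<le> M + e \<Longrightarrow> (\<Sum>I\<in>J. \<gamma> k I v * poly (H I v) 0) = fst v ^ k * snd v ^ (M + e - k)"
    using all_monomials_in_ideal[of J e "\<lambda>I v. poly (H I v) 0", OF J h0 nz] by blast
  define D where "D = M + e"
  have ex: "\<exists>g. (\<lambda>v. \<Sum>I\<in>J. [:\<gamma> k I v:] * H I v) = (\<lambda>(s, t). \<Sum>l\<le>D. g l * [:s ^ l * t ^ (D - l):])" if k: "k \<le> D" for k
  proof -
    have "form_over const_poly D (\<lambda>v. \<Sum>I\<in>J. [:\<gamma> k I v:] * H I v)"
      unfolding D_def using k by (intro form_over_sum form_over_mult form_over_const_poly \<gamma>(1) H) (simp_all add: D_def)
    then show ?thesis unfolding form_over_def .
  qed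
  have "\<forall>k. \<exists>g. k \<le> D \<longrightarrow> (\<lambda>v. \<Sum>I\<in>J. [:\<gamma> k I v:] * H I v) = (\<lambda>(s, t). \<Sum>l\<le>D. g l * [:s ^ l * t ^ (D - l):])"
  proof
    fix k show "\<exists>g. k \<le> D \<longrightarrow> (\<lambda>v. \<Sum>I\<in>J. [:\<gamma> k I v:] * H I v) = (\<lambda>(s, t). \<Sum>l\<le>D. g l * [:s ^ l * t ^ (D - l):])"
      using ex[of k] by (cases "k \<le> D") simp_all
  qed
  from choice[OF this] obtain g where g: "\<forall>k. k \<le> D \<longrightarrow> (\<lambda>v. \<Sum>I\<in>J. [:\<gamma> k I v:] * H I v) = (\<lambda>(s, t). \<Sum>l\<le>D. g k l * [:s ^ l * t ^ (D - l):])" ..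
  have gsum: "(\<Sum>l\<le>D. poly (g k l) x * (s ^ l * t ^ (D - l))) = (\<Sum>I\<in>J. \<gamma> k I (s, t) * poly (H I (s, t)) x)"
    if k: "k \<le> D" for k x s t
  proof -
    have "(\<Sum>I\<in>J. [:\<gamma> k I (s, t):] * H I (s, t)) = (\<Sum>l\<le>D. g k l * [:s ^ l * t ^ (D - l):])"
      using fun_cong[OF g[rule_format, OF k], of "(s, t)"] by simp
    from arg_cong[OF this, of "\<lambda>p. poly p x"] show ?thesis by (simp add: poly_sum mult.commute)
  qed
  have g0: "poly (g k l) 0 = (if l = k then 1 else 0)" if kl: "k \<le> D" "l \<le> D" for k l
  proof (rule form_coefficients_unique[where d = D and c = "\<lambda>l. poly (g k l) 0" and c' = "\<lambda>l. if l = k then 1 else 0"])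
    fix x :: 'k
    have "(\<Sum>l\<le>D. poly (g k l) 0 * x ^ l * 1 ^ (D - l)) = x ^ k"
      using gsum[OF kl(1), of 0 x 1] \<gamma>(2)[of k "(x, 1)"] kl by (simp add: D_def mult.assoc)
    also have "\<dots> = (\<Sum>l\<le>D. (if l = k then 1 else 0) * x ^ l * 1 ^ (D - l))"
    proof -
      have "(\<Sum>l\<le>D. (if l = k then 1 else 0) * x ^ l * 1 ^ (D - l)) = (\<Sum>l\<le>D. if l = k then x ^ l else 0)"
        by (intro sum.cong) auto
      then show ?thesis using kl by simp
    qed
    finally show "(\<Sum>l\<le>D. poly (g k l) 0 * x ^ l * 1 ^ (D - l)) = (\<Sum>l\<le>D. (if l = k then 1 else 0) * x ^ l * 1 ^ (D - l))" .
  qed (rule kl(2))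
  define G where "G = mat (Suc D) (Suc D) (\<lambda>(k, l). g k l)"
  have ev: "poly (det G) x = det (mat (Suc D) (Suc D) (\<lambda>(k, l). poly (g k l) x))" for x
  proof -
    have "comm_ring_hom (\<lambda>p. poly p x)" by standard simp_all
    from comm_ring_hom.hom_det[OF this, of G]
    have "poly (det G) x = det (map_mat (\<lambda>p. poly p x) G)" by simp
    also have "map_mat (\<lambda>p. poly p x) G = mat (Suc D) (Suc D) (\<lambda>(k, l). poly (g k l) x)"
      by (rule eq_matI) (auto simp: G_def)
    finally show ?thesis .
  qed
  have "mat (Suc D) (Suc D) (\<lambda>(k, l). poly (g k l) 0) = 1\<^sub>m (Suc D)" using g0 by (intro eq_matI) auto
  then have "poly (det G) 0 = 1" unfolding ev by simp
  then have "det G \<noteq> 0" by auto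
  then have fin: "finite {x. poly (det G) x = 0}" by (rule poly_roots_finite)
  have "{x. \<not> (\<forall>v\<in>P1. \<exists>I\<in>J. poly (H I v) x \<noteq> 0)} \<subseteq> {x. poly (det G) x = 0}"
  proof
    fix x assume "x \<in> {x. \<not> (\<forall>v\<in>P1. \<exists>I\<in>J. poly (H I v) x \<noteq> 0)}"
    then obtain s t where v: "(s, t) \<in> P1" "\<And>I. I \<in> J \<Longrightarrow> poly (H I (s, t)) x = 0" by auto
    let ?G = "mat (Suc D) (Suc D) (\<lambda>(k, l). poly (g k l) x)" and ?y = "vec (Suc D) (\<lambda>l. s ^ l * t ^ (D - l))"
    have "?G *\<^sub>v ?y = 0\<^sub>v (Suc D)"
    proof (rule eq_vecI)
      fix k assume "k < dim_vec (0\<^sub>v (Suc D) :: 'k vec)"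
      then have k: "k \<le> D" by simp
      have "(?G *\<^sub>v ?y) $ k = (\<Sum>l<Suc D. poly (g k l) x * (s ^ l * t ^ (D - l)))"
        using k by (simp add: scalar_prod_def atLeast0LessThan del: sum.lessThan_Suc)
      also have "\<dots> = (\<Sum>l\<le>D. poly (g k l) x * (s ^ l * t ^ (D - l)))" unfolding lessThan_Suc_atMost ..
      also have "\<dots> = 0" using gsum[OF k, of x s t] v(2) by simp
      finally show "(?G *\<^sub>v ?y) $ k = 0\<^sub>v (Suc D) $ k" using k by simp
    qed simp
    moreover have "?y \<noteq> 0\<^sub>v (Suc D)"
    proof
      assume y: "?y = 0\<^sub>v (Suc D)"
      have "s ^ l * t ^ (D - l) = 0" if "l \<le> D" for l
        using arg_cong[OF y, of "\<lambda>y. y $ l"] that by simp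
      from this[of 0] this[of D] show False using v(1) by (auto simp: P1_iff)
    qed
    ultimately have "det ?G = 0" by (intro iffD2[OF det_0_iff_vec_prod_zero_field[of ?G "Suc D"]] exI[of _ ?y] conjI) simp_all
    then show "x \<in> {x. poly (det G) x = 0}" by (simp add: ev)
  qed
  then show ?thesis by (rule finite_subset[OF _ fin])
qed

lemma tuple_of_poly_forms:
  fixes H :: "nat set \<Rightarrow> 'k::field \<times> 'k \<Rightarrow> 'k poly"
  assumes H: "\<And>I. I \<in> pluecker_indices r n \<Longrightarrow> form_over const_poly e (H I)"
  obtains Q where "\<And>x. x \<notin> pluecker_indices r n \<times> {..e} \<Longrightarrow> Q x = 0"
    "\<And>I v t. I \<in> pluecker_indices r n \<Longrightarrow> eval_forms e (\<lambda>x. poly (Q x) t) v I = poly (H I v) t"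
    "\<And>I v i. I \<in> pluecker_indices r n \<Longrightarrow> eval_forms e (\<lambda>x. poly.coeff (Q x) i) v I = poly.coeff (H I v) i"
proof -
  have "\<forall>I\<in>pluecker_indices r n. \<exists>c. H I = (\<lambda>(s, t). \<Sum>k\<le>e. c k * [:s ^ k * t ^ (e - k):])"
    using H unfolding form_over_def by blast
  from bchoice[OF this] obtain c where c: "\<forall>I\<in>pluecker_indices r n. H I = (\<lambda>(s, t). \<Sum>k\<le>e. c I k * [:s ^ k * t ^ (e - k):])" ..
  define Q where "Q x = (if x \<in> pluecker_indices r n \<times> {..e} then c (fst x) (snd x) else 0)" for x
  show thesis
  proof (rule that[of Q])
    show "Q x = 0" if "x \<notin> pluecker_indices r n \<times> {..e}" for x using that by (simp add: Q_def)
  next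
    fix I v t assume I: "I \<in> pluecker_indices r n"
    then show "eval_forms e (\<lambda>x. poly (Q x) t) v I = poly (H I v) t"
      by (cases v) (simp add: c Q_def eval_forms_def poly_sum mult_ac)
  next
    fix I v i assume I: "I \<in> pluecker_indices r n"
    have "poly.coeff (p * [:a:]) i = poly.coeff p i * a" for p :: "'k poly" and a
      by (simp add: mult.commute[of p])
    then show "eval_forms e (\<lambda>x. poly.coeff (Q x) i) v I = poly.coeff (H I v) i"
      using I by (cases v) (simp add: c Q_def eval_forms_def coeff_sum mult.assoc del: mult_pCons_right)
  qed
qed

lemma finite_pluecker_indices: "finite (pluecker_indices r n)"
  unfolding pluecker_indices_def by (rule finite_subset[of _ "Pow {..<n}"]) auto

text \<open>
  A curve of tuples of forms that starts at \<open>P\<close> is a curve in the cone over \<open>Z\<close> as soon as tuples without common zeros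
  in it belong to \<open>Z\<close>, by openness of the absence of common zeros.
\<close>

lemma tangent_space_curve_of_forms:
  fixes H :: "nat set \<Rightarrow> 'k::{alg_closed_field, field_char_0} \<times> 'k \<Rightarrow> 'k poly"
  assumes H: "\<And>I. I \<in> pluecker_indices r n \<Longrightarrow> form_over const_poly e (H I)"
    and nz: "\<And>v. v \<in> P1 \<Longrightarrow> \<exists>I\<in>pluecker_indices r n. poly (H I v) 0 \<noteq> 0"
    and Z: "\<And>t R. \<lbrakk>\<And>v. v \<in> P1 \<Longrightarrow> \<exists>I\<in>pluecker_indices r n. poly (H I v) t \<noteq> 0;
        \<And>x. x \<notin> pluecker_indices r n \<times> {..e} \<Longrightarrow> R x = 0;
        \<And>v I. v \<in> P1 \<Longrightarrow> I \<in> pluecker_indices r n \<Longrightarrow> eval_forms e R v I = poly (H I v) t\<rbrakk>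
      \<Longrightarrow> \<exists>f\<in>Z. coordinates e r n f R"
    and P: "\<And>x. x \<notin> pluecker_indices r n \<times> {..e} \<Longrightarrow> P x = 0"
      "\<And>v I. v \<in> P1 \<Longrightarrow> I \<in> pluecker_indices r n \<Longrightarrow> eval_forms e P v I = poly.coeff (H I v) 0"
  obtains w where "w \<in> tangent_space e r n Z P" "\<And>x. x \<notin> pluecker_indices r n \<times> {..e} \<Longrightarrow> w x = 0"
    "\<And>v I. I \<in> pluecker_indices r n \<Longrightarrow> eval_forms e w v I = poly.coeff (H I v) 1"
proof -
  obtain Q where Q: "\<And>x. x \<notin> pluecker_indices r n \<times> {..e} \<Longrightarrow> Q x = 0"
    "\<And>I v t. I \<in> pluecker_indices r n \<Longrightarrow> eval_forms e (\<lambda>x. poly (Q x) t) v I = poly (H I v) t"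
    "\<And>I v i. I \<in> pluecker_indices r n \<Longrightarrow> eval_forms e (\<lambda>x. poly.coeff (Q x) i) v I = poly.coeff (H I v) i"
    using tuple_of_poly_forms[of r n e H, OF H] by metis
  have P': "P = (\<lambda>x. poly.coeff (Q x) 0)"
    using P Q(1,3) by (intro form_tuple_eqI[of r n e]) simp_all
  let ?bad = "{t. \<not> (\<forall>v\<in>P1. \<exists>I\<in>pluecker_indices r n. poly (H I v) t \<noteq> 0)}"
  have "finite ?bad" by (rule no_common_zero_open[OF finite_pluecker_indices H nz])
  then have "infinite (UNIV - ?bad)" by (intro Diff_infinite_finite infinite_UNIV_char_0)
  moreover have "UNIV - ?bad \<subseteq> {t. \<exists>f\<in>Z. coordinates e r n f (\<lambda>x. poly (Q x) t)}"
    using Q(1,2) by (auto intro!: Z)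
  ultimately have "infinite {t. \<exists>f\<in>Z. coordinates e r n f (\<lambda>x. poly (Q x) t)}" using infinite_super by blast
  from tangent_space_curve[OF this] show thesis
    using Q(1,3) P' by (intro that[of "\<lambda>x. poly.coeff (Q x) 1"]) simp_all
qed

lemma coordinates_scale:
  assumes co: "coordinates e r n f P" and r: "r > 0" and c: "c \<noteq> 0"
  shows "coordinates e r n f (\<lambda>x. c * P x)"
proof -
  have "eval_forms e (\<lambda>x. c * P x) v = (\<lambda>I. c * eval_forms e P v I)" for v
    by (cases v) (simp add: eval_forms_def fun_eq_iff sum_distrib_left mult_ac)
  then show ?thesis using co pluecker_scale[OF _ r c] unfolding coordinates_def by auto
qed

text \<open>
  The tangent space is that of the cone, so it contains the line through the vertex; the curve is \<open>(1 + c T) P\<close>.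
\<close>

lemma tangent_space_radial:
  fixes P :: "'k::field_char_0 form_tuple"
  assumes co: "coordinates e r n f P" and f: "f \<in> Z" and r: "r > 0"
  shows "(\<lambda>x. c * P x) \<in> tangent_space e r n Z P"
proof -
  have "UNIV - {- (1 / c)} \<subseteq> {t. \<exists>f\<in>Z. coordinates e r n f (\<lambda>x. poly [:P x, c * P x:] t)}"
  proof
    fix t assume t: "t \<in> UNIV - {- (1 / c)}"
    have "1 + c * t \<noteq> 0"
    proof
      assume "1 + c * t = 0"
      then have "c \<noteq> 0" "c * t = - 1" by (auto simp: add_eq_0_iff)
      then show False using t by (simp add: field_simps)
    qed
    from coordinates_scale[OF co r this] have "coordinates e r n f (\<lambda>x. poly [:P x, c * P x:] t)" by (simp add: algebra_simps)
    then show "t \<in> {t. \<exists>f\<in>Z. coordinates e r n f (\<lambda>x. poly [:P x, c * P x:] t)}" using f by blast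
  qed
  moreover have "infinite (UNIV - {- (1 / c)})" by (intro Diff_infinite_finite infinite_UNIV_char_0) simp
  ultimately have "infinite {t. \<exists>f\<in>Z. coordinates e r n f (\<lambda>x. poly [:P x, c * P x:] t)}" using infinite_super by blast
  from tangent_space_curve[OF this] show ?thesis by simp
qed

text \<open>
  Coordinates outside of the index set vanish on all morphisms, and the equation expressing this is linear.
\<close>

lemma tangent_Mor_support:
  fixes P :: "'k::field form_tuple"
  assumes w: "w \<in> tangent_space e r n (Mor e r n) P" and x: "x \<notin> pluecker_indices r n \<times> {..e}"
  shows "w x = 0"
proof -
  have "poly.coeff ((\<lambda>Q. Q x) (\<lambda>x. [:P x, w x:])) 1 = 0"
    by (rule tangent_spaceD[OF polynomial_function_var w]) (use x in \<open>unfold coordinates_def, blast\<close>)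
  then show ?thesis by simp
qed

lemma perturb_carrier: "A \<in> carrier_mat n r \<Longrightarrow> perturb A A' \<in> carrier_mat n r"
  by (simp add: perturb_def)

lemma minor_poly_eval:
  fixes X :: "'k::comm_ring_1 poly mat"
  assumes X: "X \<in> carrier_mat n r" and \<kappa>: "\<And>i. i < r \<Longrightarrow> \<kappa> i < n"
  shows "poly (minor r X \<kappa>) t = minor r (map_mat (\<lambda>p. poly p t) X) \<kappa>"
proof -
  have "comm_ring_hom (\<lambda>p. poly p t)" by standard simp_all
  from comm_ring_hom.hom_det[OF this, of "mat r r (\<lambda>(i, j). X $$ (\<kappa> i, j))"]
  have "poly (minor r X \<kappa>) t = det (map_mat (\<lambda>p. poly p t) (mat r r (\<lambda>(i, j). X $$ (\<kappa> i, j))))"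
    by (simp add: minor_def)
  also have "map_mat (\<lambda>p. poly p t) (mat r r (\<lambda>(i, j). X $$ (\<kappa> i, j))) = mat r r (\<lambda>(i, j). map_mat (\<lambda>p. poly p t) X $$ (\<kappa> i, j))"
    using X \<kappa> by (intro eq_matI) auto
  finally show ?thesis by (simp add: minor_def)
qed

lemma dual_minor_poly_eval:
  fixes X :: "'k::comm_ring_1 poly mat"
  shows "poly (dual_minor r X \<kappa>) t = dual_minor r (map_mat (\<lambda>p. poly p t) X) \<kappa>"
proof -
  have "comm_ring_hom (\<lambda>p. poly p t)" by standard simp_all
  from comm_ring_hom.hom_det[OF this, of "over X (coordinate_rows r (dim_col X) \<kappa>)"]
  have "poly (dual_minor r X \<kappa>) t = det (map_mat (\<lambda>p. poly p t) (over X (coordinate_rows r (dim_col X) \<kappa>)))"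
    by (simp add: dual_minor_def)
  also have "map_mat (\<lambda>p. poly p t) (over X (coordinate_rows r (dim_col X) \<kappa>))
      = over (map_mat (\<lambda>p. poly p t) X) (coordinate_rows r (dim_col X) \<kappa>)"
    by (intro eq_matI) (auto simp: over_def coordinate_rows_def)
  finally show ?thesis by (simp add: dual_minor_def)
qed

lemma map_poly_eval_perturb:
  assumes "A \<in> carrier_mat n r" "A' \<in> carrier_mat n r"
  shows "map_mat (\<lambda>p. poly p t) (perturb A A') = A + t \<cdot>\<^sub>m A'"
  using assms by (intro eq_matI) (auto simp: perturb_def)

lemma form_matrix_perturb:
  assumes "form_matrix n r deg A" "form_matrix n r deg A'"
  shows "form_matrix n r deg (\<lambda>v. A v + t \<cdot>\<^sub>m A' v)"
proof -
  note A = form_matrixD[OF assms(1)] and A' = form_matrixD[OF assms(2)]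
  have "binary_form (deg k j) (\<lambda>v. (A v + t \<cdot>\<^sub>m A' v) $$ (k, j))" if "k < n" "j < r" for k j
  proof -
    have "binary_form (deg k j) (\<lambda>v. A v $$ (k, j) + t * A' v $$ (k, j))"
      using A(2) A'(2) that by (intro form.add form_cmult)
    moreover have "(A v + t \<cdot>\<^sub>m A' v) $$ (k, j) = A v $$ (k, j) + t * A' v $$ (k, j)" for v
      using that A(1)[of v] A'(1)[of v] by simp
    ultimately show ?thesis by simp
  qed
  then show ?thesis using A(1) A'(1) by (simp add: form_matrix_def)
qed

lemma const_poly_form_graded: "graded_functions (form_over (const_poly :: 'k::field \<Rightarrow> 'k poly))"
  by (rule form_over_graded) simp_all

text \<open>
  The curve is given by the minors of \<open>A + T A'\<close>. If these have no common zero at the value \<open>t\<close> of \<open>T\<close>, then \<open>A + t A'\<close> is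
  injective at every point and defines a morphism of the same type.
\<close>

lemma tangent_locus_sub:
  fixes A :: "'k::{alg_closed_field, field_char_0} \<times> 'k \<Rightarrow> 'k mat"
  assumes A: "form_matrix n r (\<lambda>k j. a ! j) A" and inj: "\<And>v. v \<in> P1 \<Longrightarrow> mat_injective (A v)"
    and A': "form_matrix n r (\<lambda>k j. a ! j) A'" and a: "length a = r" "sum_list a = e" and r: "r > 0"
    and P: "\<And>x. x \<notin> pluecker_indices r n \<times> {..e} \<Longrightarrow> P x = 0"
      "\<And>v I. v \<in> P1 \<Longrightarrow> I \<in> pluecker_indices r n \<Longrightarrow> eval_forms e P v I = c * minor r (A v) (pick I)"
    and c: "c \<noteq> 0"
  obtains w where "w \<in> tangent_space e r n (locus_sub e r n a) P" "\<And>x. x \<notin> pluecker_indices r n \<times> {..e} \<Longrightarrow> w x = 0"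
    "\<And>v I. I \<in> pluecker_indices r n \<Longrightarrow> eval_forms e w v I = c * minor_deriv r (A v) (A' v) (pick I)"
proof -
  note AD = form_matrixD[OF A] and A'D = form_matrixD[OF A'] and pick = pluecker_indices_pick(4)
  define H where "H I v = [:c:] * minor r (perturb (A v) (A' v)) (pick I)" for I v
  have H: "form_over const_poly e (H I)" if I: "I \<in> pluecker_indices r n" for I
  proof -
    have "form_over const_poly (\<Sum>j<r. a ! j) (\<lambda>v. minor r (perturb (A v) (A' v)) (pick I))"
    proof (rule graded_functions.minor[OF const_poly_form_graded perturb_carrier[OF AD(1)] pick[OF I]])
      fix k j assume kj: "k < n" "j < r"
      have "perturb (A v) (A' v) $$ (k, j) = [:A v $$ (k, j), A' v $$ (k, j):]" for v
        using kj AD(1)[of v] by (simp add: perturb_def)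
      then show "form_over const_poly (a ! j) (\<lambda>v. perturb (A v) (A' v) $$ (k, j))"
        using form_over_linear[OF AD(2)[OF kj] A'D(2)[OF kj]] by simp
    qed
    moreover have "(\<Sum>j<r. a ! j) = e" using a by (simp add: sum_list_eq_sum)
    ultimately show ?thesis unfolding H_def[abs_def] using form_over_cmult by metis
  qed
  have eval: "poly (H I v) t = c * minor r (A v + t \<cdot>\<^sub>m A' v) (pick I)" if I: "I \<in> pluecker_indices r n" for I v t
    using minor_poly_eval[OF perturb_carrier[OF AD(1)] pick[OF I], where t = t] map_poly_eval_perturb[OF AD(1) A'D(1)]
    by (simp add: H_def)
  have eval0: "poly.coeff (H I v) 0 = c * minor r (A v) (pick I)" if I: "I \<in> pluecker_indices r n" for I v
  proof -
    have "poly.coeff (minor r (perturb (A v) (A' v)) (pick I)) 0 = minor r (A v) (pick I)"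
      using AD(1)[of v] by (intro minor_coeffs(1)[OF AD(1)[of v], where A' = "A' v"] pick[OF I]) (simp_all add: perturb_def)
    then show ?thesis by (simp add: H_def)
  qed
  show thesis
  proof (rule tangent_space_curve_of_forms[of r n e H "locus_sub e r n a" P])
    fix v :: "'k \<times> 'k" assume v: "v \<in> P1"
    obtain \<kappa> where "\<And>i. i < r \<Longrightarrow> \<kappa> i < n" "minor r (A v) \<kappa> \<noteq> 0" using mat_injective_minor[OF AD(1) inj[OF v]] by metis
    then obtain I where "I \<in> pluecker_indices r n" "minor r (A v) (pick I) \<noteq> 0" using minor_pick_nonzero[OF AD(1)] by blast
    then show "\<exists>I\<in>pluecker_indices r n. poly (H I v) 0 \<noteq> 0" using eval0 c by (intro bexI[of _ I]) (simp_all add: poly_0_coeff_0)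
  next
    fix t R
    assume nz: "\<And>v. v \<in> P1 \<Longrightarrow> \<exists>I\<in>pluecker_indices r n. poly (H I v) t \<noteq> 0"
      and supp: "\<And>x. x \<notin> pluecker_indices r n \<times> {..e} \<Longrightarrow> R x = 0"
      and R: "\<And>v I. v \<in> P1 \<Longrightarrow> I \<in> pluecker_indices r n \<Longrightarrow> eval_forms e R v I = poly (H I v) t"
    note At = form_matrix_perturb[OF A A', of t]
    have injt: "mat_injective (A v + t \<cdot>\<^sub>m A' v)" if v: "v \<in> P1" for v
    proof -
      obtain I where I: "I \<in> pluecker_indices r n" "poly (H I v) t \<noteq> 0" using nz[OF v] by blast
      then have "minor r (A v + t \<cdot>\<^sub>m A' v) (pick I) \<noteq> 0" using eval by auto
      with pick[OF I(1)] show ?thesis by (rule minor_mat_injective[OF form_matrixD(1)[OF At], where \<kappa> = "pick I"])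
    qed
    let ?f = "\<lambda>v\<in>P1. mat_image (A v + t \<cdot>\<^sub>m A' v)"
    have "coordinates e r n ?f (\<lambda>x. (1 / c) * R x)"
    proof (rule coordinates_mat_image[OF form_matrixD(1)[OF At] injt])
      fix v :: "'k \<times> 'k" and I assume v: "v \<in> P1" and I: "I \<in> pluecker_indices r n"
      have "eval_forms e (\<lambda>x. (1 / c) * R x) v I = (1 / c) * eval_forms e R v I"
        by (cases v) (simp add: eval_forms_def sum_divide_distrib)
      then show "eval_forms e (\<lambda>x. (1 / c) * R x) v I = minor r (A v + t \<cdot>\<^sub>m A' v) (pick I)"
        using R[OF v I] eval[OF I] c by simp
    qed (use supp in simp_all)
    from coordinates_scale[OF this r c] have "coordinates e r n ?f R" using c by simp
    moreover have "?f \<in> locus_sub e r n a" by (rule locus_subI[OF At injt a])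
    ultimately show "\<exists>f\<in>locus_sub e r n a. coordinates e r n f R" by blast
  next
    fix w assume "w \<in> tangent_space e r n (locus_sub e r n a) P" "\<And>x. x \<notin> pluecker_indices r n \<times> {..e} \<Longrightarrow> w x = 0"
      "\<And>v I. I \<in> pluecker_indices r n \<Longrightarrow> eval_forms e w v I = poly.coeff (H I v) 1"
    then show thesis by (intro that[of w]) (simp_all add: H_def minor_deriv_def)
  qed (use H P eval0 in simp_all)
qed

text \<open>
  The counterpart of \<open>tangent_locus_sub\<close> for the kernels of \<open>B + T B'\<close>, in terms of dual minors.
\<close>

lemma tangent_locus_quot:
  fixes B :: "'k::{alg_closed_field, field_char_0} \<times> 'k \<Rightarrow> 'k mat"
  assumes B: "form_matrix m n (\<lambda>i k. b ! i) B" and ex: "\<And>v. v \<in> P1 \<Longrightarrow> \<exists>A. split_exact n m r (B v) A"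
    and B': "form_matrix m n (\<lambda>i k. b ! i) B'" and b: "length b = m" "sum_list b = e" and n: "n = m + r" and r: "r > 0"
    and P: "\<And>x. x \<notin> pluecker_indices r n \<times> {..e} \<Longrightarrow> P x = 0"
      "\<And>v I. v \<in> P1 \<Longrightarrow> I \<in> pluecker_indices r n \<Longrightarrow> eval_forms e P v I = c * dual_minor r (B v) (pick I)"
    and c: "c \<noteq> 0"
  obtains w where "w \<in> tangent_space e r n (locus_quot e r n b) P" "\<And>x. x \<notin> pluecker_indices r n \<times> {..e} \<Longrightarrow> w x = 0"
    "\<And>v I. I \<in> pluecker_indices r n \<Longrightarrow>
       eval_forms e w v I = c * poly.coeff (dual_minor r (perturb (B v) (B' v)) (pick I)) 1"
proof -
  note BD = form_matrixD[OF B] and B'D = form_matrixD[OF B'] and pick = pluecker_indices_pick(4)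
  define H where "H I v = [:c:] * dual_minor r (perturb (B v) (B' v)) (pick I)" for I v
  have H: "form_over const_poly e (H I)" if I: "I \<in> pluecker_indices r n" for I
  proof -
    have "form_over const_poly (\<Sum>i<m. b ! i) (\<lambda>v. dual_minor r (perturb (B v) (B' v)) (pick I))"
    proof (rule graded_functions.dual_minor[OF const_poly_form_graded perturb_carrier[OF BD(1)[unfolded n]]])
      fix i k assume ik: "i < m" "k < m + r"
      have "perturb (B v) (B' v) $$ (i, k) = [:B v $$ (i, k), B' v $$ (i, k):]" for v
        using ik BD(1)[of v] by (simp add: perturb_def n)
      then show "form_over const_poly (b ! i) (\<lambda>v. perturb (B v) (B' v) $$ (i, k))"
        using form_over_linear[OF BD(2)[OF ik[folded n]] B'D(2)[OF ik[folded n]]] by simp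
    qed
    moreover have "(\<Sum>i<m. b ! i) = e" using b by (simp add: sum_list_eq_sum)
    ultimately show ?thesis unfolding H_def[abs_def] using form_over_cmult by metis
  qed
  have eval: "poly (H I v) t = c * dual_minor r (B v + t \<cdot>\<^sub>m B' v) (pick I)" for I v t
    using dual_minor_poly_eval[of r "perturb (B v) (B' v)" "pick I" t] map_poly_eval_perturb[OF BD(1) B'D(1)]
    by (simp add: H_def)
  have eval0: "poly (H I v) 0 = c * dual_minor r (B v) (pick I)" for I v
  proof -
    have "B v + 0 \<cdot>\<^sub>m B' v = B v" using BD(1)[of v] B'D(1)[of v] by (intro eq_matI) auto
    then show ?thesis using eval[of I v 0] by simp
  qed
  have nz: "\<exists>I\<in>pluecker_indices r n. minor r A (pick I) \<noteq> 0" if split: "split_exact n m r X A" for X A :: "'k mat"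
  proof -
    have A: "A \<in> carrier_mat n r" using split unfolding split_exact_def by (elim conjE)
    obtain \<kappa> where "\<And>i. i < r \<Longrightarrow> \<kappa> i < n" "minor r A \<kappa> \<noteq> 0"
      using mat_injective_minor[OF A split_exact_mat_injective[OF split]] by metis
    then show ?thesis by (rule minor_pick_nonzero[OF A])
  qed
  show thesis
  proof (rule tangent_space_curve_of_forms[of r n e H "locus_quot e r n b" P])
    fix v :: "'k \<times> 'k" assume v: "v \<in> P1"
    obtain A where A: "split_exact n m r (B v) A" using ex[OF v] by blast
    obtain I where I: "I \<in> pluecker_indices r n" "minor r A (pick I) \<noteq> 0" using nz[OF A] by blast
    obtain l where "minor r A (pick I) = l * dual_minor r (B v) (pick I)"
      using split_exact_dual_minor[OF A] pick[OF I(1)] by metis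
    then have "dual_minor r (B v) (pick I) \<noteq> 0" using I(2) by auto
    then show "\<exists>I\<in>pluecker_indices r n. poly (H I v) 0 \<noteq> 0" using eval0 c I(1) by (intro bexI[of _ I]) simp_all
  next
    fix t R
    assume nzt: "\<And>v. v \<in> P1 \<Longrightarrow> \<exists>I\<in>pluecker_indices r n. poly (H I v) t \<noteq> 0"
      and supp: "\<And>x. x \<notin> pluecker_indices r n \<times> {..e} \<Longrightarrow> R x = 0"
      and R: "\<And>v I. v \<in> P1 \<Longrightarrow> I \<in> pluecker_indices r n \<Longrightarrow> eval_forms e R v I = poly (H I v) t"
    note Bt = form_matrix_perturb[OF B B', of t]
    have ext: "\<exists>A. split_exact n m r (B v + t \<cdot>\<^sub>m B' v) A" if v: "v \<in> P1" for v
    proof -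
      obtain I where I: "I \<in> pluecker_indices r n" "poly (H I v) t \<noteq> 0" using nzt[OF v] by blast
      then have "dual_minor r (B v + t \<cdot>\<^sub>m B' v) (pick I) \<noteq> 0" using eval by auto
      from dual_minor_split_exact[OF form_matrixD(1)[OF Bt] n pick[OF I(1)] this] show ?thesis by metis
    qed
    let ?f = "\<lambda>v\<in>P1. {x \<in> carrier_vec n. (B v + t \<cdot>\<^sub>m B' v) *\<^sub>v x = 0\<^sub>v m}"
    have "coordinates e r n ?f (\<lambda>x. (1 / c) * R x)"
    proof (rule coordinates_kernel[OF ext r])
      fix v :: "'k \<times> 'k" and I assume v: "v \<in> P1" and I: "I \<in> pluecker_indices r n"
      have "eval_forms e (\<lambda>x. (1 / c) * R x) v I = (1 / c) * eval_forms e R v I"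
        by (cases v) (simp add: eval_forms_def sum_divide_distrib)
      then show "eval_forms e (\<lambda>x. (1 / c) * R x) v I = dual_minor r (B v + t \<cdot>\<^sub>m B' v) (pick I)"
        using R[OF v I] eval c by simp
    qed (use supp in simp_all)
    from coordinates_scale[OF this r c] have "coordinates e r n ?f R" using c by simp
    moreover have "?f \<in> locus_quot e r n b" by (rule locus_quotI[OF Bt ext n r b])
    ultimately show "\<exists>f\<in>locus_quot e r n b. coordinates e r n f R" by blast
  next
    fix w assume "w \<in> tangent_space e r n (locus_quot e r n b) P" "\<And>x. x \<notin> pluecker_indices r n \<times> {..e} \<Longrightarrow> w x = 0"
      "\<And>v I. I \<in> pluecker_indices r n \<Longrightarrow> eval_forms e w v I = poly.coeff (H I v) 1"
    then show thesis by (intro that[of w]) (simp_all add: H_def)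
  qed (use H P eval0 in \<open>simp_all add: poly_0_coeff_0\<close>)
qed

section \<open>A criterion for transversality\<close>

lemma eval_forms_add: "eval_forms e (\<lambda>x. u x + w x) v I = eval_forms e u v I + eval_forms e w v I"
  by (cases v) (simp add: eval_forms_def sum.distrib distrib_right)

lemma eval_forms_cmult: "eval_forms e (\<lambda>x. c * w x) v I = c * eval_forms e w v I"
  by (cases v) (simp add: eval_forms_def sum_distrib_left mult_ac)

lemma split_exactD:
  assumes "split_exact n m r B A"
  shows "n = m + r" "B \<in> carrier_mat m n" "A \<in> carrier_mat n r" "B * A = 0\<^sub>m m r"
  using assms unfolding split_exact_def by auto

lemma split_exact_minor:
  assumes "split_exact n m r B A"
  obtains I where "I \<in> pluecker_indices r n" "minor r A (pick I) \<noteq> 0"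
proof -
  note A = split_exactD(3)[OF assms]
  obtain \<kappa> where "\<And>i. i < r \<Longrightarrow> \<kappa> i < n" "minor r A \<kappa> \<noteq> 0"
    using mat_injective_minor[OF A split_exact_mat_injective[OF assms]] by metis
  then have "\<exists>I\<in>pluecker_indices r n. minor r A (pick I) \<noteq> 0" by (rule minor_pick_nonzero[OF A])
  then show thesis using that by blast
qed

lemma form_minor:
  assumes A: "form_matrix n r (\<lambda>k j. a ! j) A" and a: "length a = r" "sum_list a = e" and \<kappa>: "\<And>i. i < r \<Longrightarrow> \<kappa> i < n"
  shows "binary_form e (\<lambda>v. minor r (A v) \<kappa>)"
proof -
  have "binary_form (\<Sum>j<r. a ! j) (\<lambda>v. minor r (A v) \<kappa>)"
    by (rule form.minor[OF form_matrixD(1)[OF A] \<kappa>]) (use form_matrixD(2)[OF A] in simp_all)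
  then show ?thesis using a by (simp add: sum_list_eq_sum)
qed

lemma form_dual_minor:
  assumes B: "form_matrix m n (\<lambda>i k. b ! i) B" and b: "length b = m" "sum_list b = e" and n: "n = m + r"
  shows "binary_form e (\<lambda>v. dual_minor r (B v) \<kappa>)"
proof -
  have "binary_form (\<Sum>i<m. b ! i) (\<lambda>v. dual_minor r (B v) \<kappa>)"
    by (rule form.dual_minor[OF form_matrixD(1)[OF B, unfolded n]]) (use form_matrixD(2)[OF B] n in simp_all)
  then show ?thesis using b by (simp add: sum_list_eq_sum)
qed

lemma P1_nonempty: "(1, 0) \<in> P1" by (simp add: P1_iff)

text \<open>
  Both sides are Pluecker coordinates of \<open>f v\<close> and forms of the same degree, so the ratio is a constant.
\<close>

lemma coordinates_minor:
  fixes A :: "'k::{alg_closed_field, field_char_0} \<times> 'k \<Rightarrow> 'k mat"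
  assumes co: "coordinates e r n f P"
    and A: "form_matrix n r (\<lambda>k j. a ! j) A" and a: "length a = r" "sum_list a = e"
    and inj: "\<And>v. v \<in> P1 \<Longrightarrow> mat_injective (A v)" and f: "\<And>v. v \<in> P1 \<Longrightarrow> f v = mat_image (A v)"
  obtains c where "c \<noteq> 0" "\<And>v I. v \<in> P1 \<Longrightarrow> I \<in> pluecker_indices r n \<Longrightarrow> eval_forms e P v I = c * minor r (A v) (pick I)"
proof -
  note AD = form_matrixD[OF A] and pick = pluecker_indices_pick(4)
  have ratio: "\<exists>c. c \<noteq> 0 \<and> (\<forall>I\<in>pluecker_indices r n. eval_forms e P v I = c * minor r (A v) (pick I))" if v: "v \<in> P1" for v
  proof -
    obtain X where X: "X \<in> carrier_mat n r" "mat_image X = f v" "mat_injective X"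
      "\<And>I. I \<in> pluecker_indices r n \<Longrightarrow> eval_forms e P v I = minor r X (pick I)"
      using coordinates_matrix[OF co v] by metis
    obtain c where c: "c \<noteq> 0" "\<And>\<kappa>. (\<And>i. i < r \<Longrightarrow> \<kappa> i < n) \<Longrightarrow> minor r X \<kappa> = c * minor r (A v) \<kappa>"
      using mat_image_same_minors[OF AD(1) X(1,3), of v] X(2) f[OF v] by metis
    then show ?thesis using X(4) pick by (intro exI[of _ c]) simp
  qed
  have nz: "\<exists>I\<in>pluecker_indices r n. minor r (A v) (pick I) \<noteq> 0" if v: "v \<in> P1" for v
  proof -
    obtain \<kappa> where "\<And>i. i < r \<Longrightarrow> \<kappa> i < n" "minor r (A v) \<kappa> \<noteq> 0" using mat_injective_minor[OF AD(1) inj[OF v]] by metis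
    then show ?thesis by (rule minor_pick_nonzero[OF AD(1)])
  qed
  have "\<exists>c. \<forall>I\<in>pluecker_indices r n. eval_forms e P v I = c * minor r (A v) (pick I)" if "v \<in> P1" for v
    using ratio[OF that] by blast
  note pointwise = this
  have "\<exists>c. \<forall>v\<in>P1. \<forall>I\<in>pluecker_indices r n. eval_forms e P v I = c * minor r (A v) (pick I)"
  proof (rule constant_ratio[of "pluecker_indices r n" e "\<lambda>I v. eval_forms e P v I" "\<lambda>I v. minor r (A v) (pick I)"])
    show "binary_form e (\<lambda>v. minor r (A v) (pick I))" if "I \<in> pluecker_indices r n" for I
      by (rule form_minor[OF A a pick[OF that]])
    fix c assume "\<And>v I. v \<in> P1 \<Longrightarrow> I \<in> pluecker_indices r n \<Longrightarrow> eval_forms e P v I = c * minor r (A v) (pick I)"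
    then show ?thesis by blast
  qed (use eval_forms_binary_form pointwise nz in simp_all)
  then obtain c where c: "\<And>v I. v \<in> P1 \<Longrightarrow> I \<in> pluecker_indices r n \<Longrightarrow> eval_forms e P v I = c * minor r (A v) (pick I)"
    by blast
  have "c \<noteq> 0"
    using ratio[OF P1_nonempty] nz[OF P1_nonempty] c[OF P1_nonempty] by force
  then show thesis using c by (rule that)
qed

text \<open>
  Given a tangent vector \<open>w\<close> of the space of morphisms, the matrix \<open>C = B A1\<close> of its normal directions is a matrix of forms. From
  \<open>C = B A2 + B2 A\<close> one obtains a tangent vector \<open>u1\<close> of the locus of type \<open>a\<close>, moving \<open>A\<close> by \<open>A2\<close>, and a tangent
  vector \<open>u2\<close> of the locus of type \<open>b\<close>, moving \<open>B\<close> by \<open>- B2\<close>. What remains of \<open>w\<close> has no normal part, so it is proportional to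
  \<open>P\<close> at every point, and then with a constant factor.
\<close>

lemma transverse_at_criterion:
  fixes A B :: "'k::{alg_closed_field, field_char_0} \<times> 'k \<Rightarrow> 'k mat"
  assumes a: "length a = r" "sum_list a = e" and b: "length b = m" "sum_list b = e" and r: "r > 0"
    and A: "form_matrix n r (\<lambda>k j. a ! j) A" and B: "form_matrix m n (\<lambda>i k. b ! i) B"
    and split: "\<And>v. v \<in> P1 \<Longrightarrow> split_exact n m r (B v) (A v)"
    and f: "\<And>v. v \<in> P1 \<Longrightarrow> f v = mat_image (A v)" "f \<in> locus_quot e r n b" "f \<in> locus_sub e r n a"
    and decomposition: "\<And>C. form_matrix m r (\<lambda>i j. b ! i + a ! j) C \<Longrightarrow>
      \<exists>A' B'. form_matrix n r (\<lambda>k j. a ! j) A' \<and> form_matrix m n (\<lambda>i k. b ! i) B' \<and>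
        (\<forall>v\<in>P1. C v = B v * A' v + B' v * A v)"
  shows "transverse_at e r n (locus_quot e r n b) (locus_sub e r n a) f"
  unfolding transverse_at_def
proof (intro allI impI equalityI subsetI)
  fix P w :: "'k form_tuple"
  assume "w \<in> {(\<lambda>x. u x + w x) |u w. u \<in> tangent_space e r n (locus_quot e r n b) P \<and> w \<in> tangent_space e r n (locus_sub e r n a) P}"
  moreover have "locus_quot e r n b \<subseteq> (Mor e r n :: 'k grass_map set)" "locus_sub e r n a \<subseteq> (Mor e r n :: 'k grass_map set)"
    by (auto simp: locus_quot_def locus_sub_def)
  ultimately show "w \<in> tangent_space e r n (Mor e r n) P"
    by (auto intro!: tangent_space_add elim: subsetD[OF tangent_space_mono])
next
  fix P w :: "'k form_tuple"
  assume co: "coordinates e r n f P" and w: "w \<in> tangent_space e r n (Mor e r n) P"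
  note AD = form_matrixD[OF A] and BD = form_matrixD[OF B] and pick = pluecker_indices_pick(4)
  let ?J = "pluecker_indices r n"
  have n: "n = m + r" using split_exactD(1)[OF split[OF P1_nonempty]] .
  have inj: "mat_injective (A v)" if "v \<in> P1" for v by (rule split_exact_mat_injective[OF split[OF that]])
  have BA: "B v * A v = 0\<^sub>m m r" if "v \<in> P1" for v by (rule split_exactD(4)[OF split[OF that]])
  have suppP: "P x = 0" if "x \<notin> ?J \<times> {..e}" for x using co that unfolding coordinates_def by blast
  have suppw: "w x = 0" if "x \<notin> ?J \<times> {..e}" for x by (rule tangent_Mor_support[OF w that])
  obtain c where c: "c \<noteq> 0" "\<And>v I. v \<in> P1 \<Longrightarrow> I \<in> ?J \<Longrightarrow> eval_forms e P v I = c * minor r (A v) (pick I)"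
    using coordinates_minor[OF co A a inj f(1)] by metis
  have nzP: "\<exists>I\<in>?J. eval_forms e P v I \<noteq> 0" if v: "v \<in> P1" for v
    using split_exact_minor[OF split[OF v]] c(1) c(2)[OF v] by (metis mult_eq_0_iff)
  have dual: "\<exists>\<nu>. \<nu> \<noteq> 0 \<and> (\<forall>I\<in>?J. minor r (A v) (pick I) = \<nu> * dual_minor r (B v) (pick I))" if v: "v \<in> P1" for v
  proof -
    obtain \<nu> where "\<nu> \<noteq> 0" "\<And>\<kappa>. (\<And>i. i < r \<Longrightarrow> \<kappa> i < n) \<Longrightarrow> minor r (A v) \<kappa> = \<nu> * dual_minor r (B v) \<kappa>"
      using split_exact_dual_minor[OF split[OF v]] by metis
    then show ?thesis using pick by (intro exI[of _ \<nu>]) simp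
  qed
  have nzdual: "\<exists>I\<in>?J. dual_minor r (B v) (pick I) \<noteq> 0" if v: "v \<in> P1" for v
  proof -
    obtain I where "I \<in> ?J" "minor r (A v) (pick I) \<noteq> 0" using split_exact_minor[OF split[OF v]] by blast
    then show ?thesis using dual[OF v] by (intro bexI[of _ I]) auto
  qed
  have "\<exists>c'. \<forall>v\<in>P1. \<forall>I\<in>?J. eval_forms e P v I = c' * dual_minor r (B v) (pick I)"
  proof (rule constant_ratio[of ?J e "\<lambda>I v. eval_forms e P v I" "\<lambda>I v. dual_minor r (B v) (pick I)"])
    fix v :: "'k \<times> 'k" assume v: "v \<in> P1"
    obtain \<nu> where "\<forall>I\<in>?J. minor r (A v) (pick I) = \<nu> * dual_minor r (B v) (pick I)" using dual[OF v] by blast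
    then show "\<exists>c'. \<forall>I\<in>?J. eval_forms e P v I = c' * dual_minor r (B v) (pick I)"
      using c(2)[OF v] by (intro exI[of _ "c * \<nu>"]) simp
  next
    fix c' assume "\<And>v I. v \<in> P1 \<Longrightarrow> I \<in> ?J \<Longrightarrow> eval_forms e P v I = c' * dual_minor r (B v) (pick I)"
    then show ?thesis by blast
  qed (use eval_forms_binary_form form_dual_minor[OF B b n] nzdual in simp_all)
  then obtain c' where c': "\<And>v I. v \<in> P1 \<Longrightarrow> I \<in> ?J \<Longrightarrow> eval_forms e P v I = c' * dual_minor r (B v) (pick I)"
    by blast
  have c'0: "c' \<noteq> 0" using nzP[OF P1_nonempty] c'[OF P1_nonempty] by auto
  have "\<forall>v\<in>P1. \<exists>X. fst X \<in> carrier_mat n r \<and> (\<forall>I\<in>?J. eval_forms e w v I = c * minor_deriv r (A v) (fst X) (pick I) + snd X * minor r (A v) (pick I))"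
    using tangent_Mor_representation[OF w _ AD(1) inj c(1) c(2)] by (metis fst_conv snd_conv)
  from bchoice[OF this] obtain X where X: "\<forall>v\<in>P1. fst (X v) \<in> carrier_mat n r \<and>
      (\<forall>I\<in>?J. eval_forms e w v I = c * minor_deriv r (A v) (fst (X v)) (pick I) + snd (X v) * minor r (A v) (pick I))" ..
  define A1 l1 where "A1 v = fst (X v)" and "l1 v = snd (X v)" for v
  have A1: "A1 v \<in> carrier_mat n r" "I \<in> ?J \<Longrightarrow> eval_forms e w v I = c * minor_deriv r (A v) (A1 v) (pick I) + l1 v * minor r (A v) (pick I)"
    if "v \<in> P1" for v I using X that by (auto simp: A1_def l1_def)
  \<comment> \<open>although \<open>A1\<close> is chosen independently at each point, \<open>B A1\<close> is regular\<close>
  have reg: "regular (int (b ! i + a ! j)) P1 (\<lambda>v. (B v * A1 v) $$ (i, j))" if ij: "i < m" "j < r" for i j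
  proof (rule regularI)
    fix v :: "'k \<times> 'k" assume v: "v \<in> P1"
    obtain \<kappa> where \<kappa>: "\<And>i. i < r \<Longrightarrow> \<kappa> i < n" "minor r (A v) \<kappa> \<noteq> 0" using mat_injective_minor[OF AD(1) inj[OF v]] by metis
    define N where "N u = (\<Sum>q<r. (\<Sum>k<n. B u $$ (i, k) * alternating r (eval_forms e w u) (\<kappa>(q := k))) * A u $$ (\<kappa> q, j))" for u
    have "binary_form (b ! i + e + a ! j) N"
      unfolding N_def[abs_def] alternating_def using ij \<kappa>(1)
      by (intro form.sum form.mult BD(2) AD(2) form_cmult eval_forms_binary_form) simp_all
    moreover have "binary_form e (\<lambda>u. c * minor r (A u) \<kappa>)" by (intro form_cmult form_minor[OF A a] \<kappa>(1))
    moreover have "int (b ! i + e + a ! j) - int e = int (b ! i + a ! j)" by simp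
    moreover have "c * minor r (A v) \<kappa> \<noteq> 0" using c(1) \<kappa>(2) by simp
    moreover have "(B u * A1 u) $$ (i, j) = N u / (c * minor r (A u) \<kappa>)" if "u \<in> P1" "c * minor r (A u) \<kappa> \<noteq> 0" for u
    proof -
      have "N u = c * minor r (A u) \<kappa> * (B u * A1 u) $$ (i, j)"
        unfolding N_def by (rule normal_direction_formula[OF BD(1) AD(1) A1(1) BA A1(2) \<kappa>(1) ij]) (use that in simp_all)
      then show ?thesis using that(2) by simp
    qed
    ultimately show "\<exists>i' j' g h. binary_form i' g \<and> binary_form j' h \<and> int i' - int j' = int (b ! i + a ! j) \<and>
       h v \<noteq> 0 \<and> (\<forall>u\<in>P1. h u \<noteq> 0 \<longrightarrow> (B u * A1 u) $$ (i, j) = g u / h u)"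
      by (rule fractionI)
  qed
  define C where "C v = mat m r (\<lambda>(i, j). global_form (b ! i + a ! j) (\<lambda>v. (B v * A1 v) $$ (i, j)) v)" for v
  have "form_matrix m r (\<lambda>i j. b ! i + a ! j) C"
    unfolding form_matrix_def C_def using global_form(1)[OF reg] by simp
  then obtain A2 B2 where A2: "form_matrix n r (\<lambda>k j. a ! j) A2" and B2: "form_matrix m n (\<lambda>i k. b ! i) B2"
    and dec: "\<And>v. v \<in> P1 \<Longrightarrow> C v = B v * A2 v + B2 v * A v" using decomposition by metis
  note A2D = form_matrixD[OF A2] and B2D = form_matrixD[OF B2]
  have C: "C v = B v * A1 v" if v: "v \<in> P1" for v
    using global_form(2)[OF reg v] BD(1)[of v] A1(1)[OF v] by (intro eq_matI) (auto simp: C_def)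
  have B3: "form_matrix m n (\<lambda>i k. b ! i) (\<lambda>v. - B2 v)"
  proof -
    have "binary_form (b ! i) (\<lambda>v. (- B2 v) $$ (i, k))" if "i < m" "k < n" for i k
    proof -
      have "(- B2 v) $$ (i, k) = - B2 v $$ (i, k)" for v using B2D(1)[of v] that by simp
      then show ?thesis using form.uminus[OF B2D(2)[OF that]] by simp
    qed
    then show ?thesis using B2D(1) by (simp add: form_matrix_def)
  qed
  obtain u1 where u1: "u1 \<in> tangent_space e r n (locus_sub e r n a) P" "\<And>x. x \<notin> ?J \<times> {..e} \<Longrightarrow> u1 x = 0"
    "\<And>v I. I \<in> ?J \<Longrightarrow> eval_forms e u1 v I = c * minor_deriv r (A v) (A2 v) (pick I)"
  proof (rule tangent_locus_sub[OF A inj A2 a r suppP c(2) c(1)])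
    fix u1 assume "u1 \<in> tangent_space e r n (locus_sub e r n a) P" "\<And>x. x \<notin> ?J \<times> {..e} \<Longrightarrow> u1 x = 0"
      "\<And>v I. I \<in> ?J \<Longrightarrow> eval_forms e u1 v I = c * minor_deriv r (A v) (A2 v) (pick I)"
    then show thesis by (rule that)
  qed
  have ex: "\<exists>A. split_exact n m r (B v) A" if "v \<in> P1" for v using split[OF that] by blast
  obtain u2 where u2: "u2 \<in> tangent_space e r n (locus_quot e r n b) P" "\<And>x. x \<notin> ?J \<times> {..e} \<Longrightarrow> u2 x = 0"
    "\<And>v I. I \<in> ?J \<Longrightarrow> eval_forms e u2 v I = c' * poly.coeff (dual_minor r (perturb (B v) (- B2 v)) (pick I)) 1"
  proof (rule tangent_locus_quot[OF B ex B3 b n r suppP c' c'0])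
    fix u2 assume "u2 \<in> tangent_space e r n (locus_quot e r n b) P" "\<And>x. x \<notin> ?J \<times> {..e} \<Longrightarrow> u2 x = 0"
      "\<And>v I. I \<in> ?J \<Longrightarrow> eval_forms e u2 v I = c' * poly.coeff (dual_minor r (perturb (B v) (- B2 v)) (pick I)) 1"
    then show thesis by (rule that)
  qed
  define D where "D x = w x + (- 1) * (u1 x + u2 x)" for x
  have eD: "eval_forms e D v I = eval_forms e w v I - eval_forms e u1 v I - eval_forms e u2 v I" for v I
    unfolding D_def[abs_def] eval_forms_add eval_forms_cmult by simp
  have ratioD: "\<exists>d. \<forall>I\<in>?J. eval_forms e D v I = d * eval_forms e P v I" if v: "v \<in> P1" for v
  proof -
    obtain A3 l3 \<nu> where A3: "A3 \<in> carrier_mat n r" "\<nu> \<noteq> 0"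
      "\<And>i j. i < m \<Longrightarrow> j < r \<Longrightarrow> (B v * A3) $$ (i, j) = - (- B2 v * A v) $$ (i, j)"
      "\<And>\<kappa>. (\<And>i. i < r \<Longrightarrow> \<kappa> i < n) \<Longrightarrow> minor r (A v) \<kappa> = \<nu> * dual_minor r (B v) \<kappa>"
      "\<And>\<kappa>. (\<And>i. i < r \<Longrightarrow> \<kappa> i < n) \<Longrightarrow>
         \<nu> * poly.coeff (dual_minor r (perturb (B v) (- B2 v)) \<kappa>) 1 = minor_deriv r (A v) A3 \<kappa> + l3 * minor r (A v) \<kappa>"
    proof (rule dual_minor_deriv[OF split[OF v] form_matrixD(1)[OF B3, of v]])
      fix A3 l3 \<nu> assume "A3 \<in> carrier_mat n r" "\<nu> \<noteq> 0"
        "\<And>i j. i < m \<Longrightarrow> j < r \<Longrightarrow> (B v * A3) $$ (i, j) = - (- B2 v * A v) $$ (i, j)"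
        "\<And>\<kappa>. (\<And>i. i < r \<Longrightarrow> \<kappa> i < n) \<Longrightarrow> minor r (A v) \<kappa> = \<nu> * dual_minor r (B v) \<kappa>"
        "\<And>\<kappa>. (\<And>i. i < r \<Longrightarrow> \<kappa> i < n) \<Longrightarrow>
           \<nu> * poly.coeff (dual_minor r (perturb (B v) (- B2 v)) \<kappa>) 1 = minor_deriv r (A v) A3 \<kappa> + l3 * minor r (A v) \<kappa>"
      then show thesis by (rule that)
    qed
    have "c' = c * \<nu>"
    proof -
      obtain I where I: "I \<in> ?J" "dual_minor r (B v) (pick I) \<noteq> 0" using nzdual[OF v] by blast
      have "c' * dual_minor r (B v) (pick I) = (c * \<nu>) * dual_minor r (B v) (pick I)"
        using c(2)[OF v I(1)] c'[OF v I(1)] A3(4)[OF pick[OF I(1)]] by simp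
      then show ?thesis using I(2) by simp
    qed
    then have e2: "eval_forms e u2 v I = c * (minor_deriv r (A v) A3 (pick I) + l3 * minor r (A v) (pick I))" if "I \<in> ?J" for I
      using u2(3)[OF that, of v] A3(5)[OF pick[OF that]] by (simp add: mult.assoc)
    have BA3: "B v * A3 = B2 v * A v"
      using A3(1,3) BD(1)[of v] B2D(1)[of v] AD(1)[of v] by (intro eq_matI) auto
    \<comment> \<open>the kernel of \<open>B\<close> perturbed by \<open>- B2\<close> moves like the image of \<open>A\<close> perturbed by \<open>A3\<close>, and \<open>B A3 = B2 A\<close>\<close>
    define Y where "Y = A1 v + (- 1) \<cdot>\<^sub>m (A2 v + A3)"
    have car: "A1 v \<in> carrier_mat n r" "A2 v + A3 \<in> carrier_mat n r" "(- 1) \<cdot>\<^sub>m (A2 v + A3) \<in> carrier_mat n r" "Y \<in> carrier_mat n r"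
      using A1(1)[OF v] A2D(1)[of v] A3(1) by (simp_all add: Y_def)
    have "B v * Y = B v * A1 v + B v * ((- 1) \<cdot>\<^sub>m (A2 v + A3))"
      unfolding Y_def by (rule mult_add_distrib_mat[OF BD(1) car(1,3)])
    also have "B v * ((- 1) \<cdot>\<^sub>m (A2 v + A3)) = (- 1) \<cdot>\<^sub>m (B v * (A2 v + A3))"
      by (rule mult_smult_distrib[OF BD(1) car(2)])
    also have "B v * (A2 v + A3) = B v * A1 v"
      unfolding mult_add_distrib_mat[OF BD(1) A2D(1) A3(1)] BA3 using C[OF v] dec[OF v] by simp
    finally have "B v * Y = 0\<^sub>m m r" using BD(1)[of v] car(1) by (intro eq_matI) auto
    from minor_deriv_trivial_normal[OF split[OF v] car(4) this] obtain y where
      y: "\<And>\<kappa>. (\<forall>i<r. \<kappa> i < n) \<Longrightarrow> minor_deriv r (A v) Y \<kappa> = y * minor r (A v) \<kappa>" by blast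
    show ?thesis
    proof (intro exI ballI)
      fix I assume I: "I \<in> ?J"
      let ?\<delta> = "\<lambda>X. minor_deriv r (A v) X (pick I)"
      have pI: "\<And>i. i < r \<Longrightarrow> pick I i < n" by (rule pick[OF I])
      have "?\<delta> Y = ?\<delta> (A1 v) - ?\<delta> (A2 v) - ?\<delta> A3"
        using minor_deriv_add[where \<kappa> = "pick I", OF AD(1) pI car(1,3)]
          minor_deriv_smult[where \<kappa> = "pick I", OF AD(1) pI car(2), of v "- 1"]
          minor_deriv_add[where \<kappa> = "pick I", OF AD(1) pI A2D(1) A3(1), of v v] by (simp add: Y_def)
      moreover have "?\<delta> Y = y * minor r (A v) (pick I)" using y pI by blast
      ultimately have "?\<delta> (A1 v) - ?\<delta> (A2 v) - ?\<delta> A3 = y * minor r (A v) (pick I)" by simp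
      then have "c * (?\<delta> (A1 v) - ?\<delta> (A2 v) - ?\<delta> A3) = y * (c * minor r (A v) (pick I))" by simp
      then show "eval_forms e D v I = (y + l1 v / c - l3) * eval_forms e P v I"
        unfolding eD A1(2)[OF v I] u1(3)[OF I] e2[OF I] c(2)[OF v I] using c(1) by (simp add: algebra_simps)
    qed
  qed
  obtain d where d: "\<And>v I. v \<in> P1 \<Longrightarrow> I \<in> ?J \<Longrightarrow> eval_forms e D v I = d * eval_forms e P v I"
  proof (rule constant_ratio[of ?J e "\<lambda>I v. eval_forms e D v I" "\<lambda>I v. eval_forms e P v I",
        OF eval_forms_binary_form eval_forms_binary_form ratioD nzP])
    fix d assume "\<And>v I. v \<in> P1 \<Longrightarrow> I \<in> ?J \<Longrightarrow> eval_forms e D v I = d * eval_forms e P v I"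
    then show thesis by (rule that)
  qed
  have "D = (\<lambda>x. d * P x)"
  proof (rule form_tuple_eqI[of r n e])
    show "D x = 0" if "x \<notin> ?J \<times> {..e}" for x using suppw u1(2) u2(2) that by (simp add: D_def)
    show "d * P x = 0" if "x \<notin> ?J \<times> {..e}" for x using suppP that by simp
    show "eval_forms e D v I = eval_forms e (\<lambda>x. d * P x) v I" if "v \<in> P1" "I \<in> ?J" for v I
      unfolding eval_forms_cmult using d that by simp
  qed
  then have "D x = d * P x" for x by simp
  then have "w = (\<lambda>x. u2 x + (u1 x + d * P x))" by (auto simp: D_def fun_eq_iff algebra_simps)
  moreover have "(\<lambda>x. u1 x + d * P x) \<in> tangent_space e r n (locus_sub e r n a) P"
    by (rule tangent_space_add[OF u1(1) tangent_space_radial[OF co f(3) r]])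
  ultimately show "w \<in> {(\<lambda>x. u x + w x) |u w. u \<in> tangent_space e r n (locus_quot e r n b) P \<and> w \<in> tangent_space e r n (locus_sub e r n a) P}"
    using u2(1) by (intro CollectI exI[of _ u2] exI[of _ "\<lambda>x. u1 x + d * P x"] conjI)
qed

section \<open>Balanced splitting types\<close>

lemma coeff_mult_top:
  fixes p q :: "'a::comm_semiring_1 poly"
  assumes "degree p \<le> k" "degree q \<le> l" shows "poly.coeff (p * q) (k + l) = poly.coeff p k * poly.coeff q l"
proof -
  have "poly.coeff p i * poly.coeff q (k + l - i) = (if i = k then poly.coeff p k * poly.coeff q l else 0)" if "i \<le> k + l" for i
  proof (cases i k rule: linorder_cases)
    case less
    then have "poly.coeff q (k + l - i) = 0" using assms by (intro coeff_eq_0) simp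
    then show ?thesis using less by simp
  next
    case greater
    then have "poly.coeff p i = 0" using assms by (intro coeff_eq_0) simp
    then show ?thesis using greater by simp
  qed simp
  then have "poly.coeff (p * q) (k + l) = (\<Sum>i\<le>k + l. if i = k then poly.coeff p k * poly.coeff q l else 0)"
    unfolding coeff_mult by (intro sum.cong) simp_all
  then show ?thesis by simp
qed

lemma split_exact_right_inverse:
  assumes "split_exact n m r B A" obtains R where "R \<in> carrier_mat n m" "B * R = 1\<^sub>m m"
  using assms unfolding split_exact_def by blast

lemma form_matrix_dehomogenize:
  assumes A: "form_matrix n r deg A"
  shows "\<exists>Ap\<in>carrier_mat n r. \<forall>k<n. \<forall>j<r. degree (Ap $$ (k, j)) \<le> deg k j \<and>
    (\<forall>v. A v $$ (k, j) = homogenize (deg k j) (Ap $$ (k, j)) v)"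
proof -
  have "\<exists>p. degree p \<le> deg k j \<and> (\<lambda>v. A v $$ (k, j)) = homogenize (deg k j) p" if "k < n" "j < r" for k j
    using form_dehomogenize[OF form_matrixD(2)[OF A that]] by metis
  then have ex: "\<exists>p. k < n \<longrightarrow> j < r \<longrightarrow> degree p \<le> deg k j \<and> (\<lambda>v. A v $$ (k, j)) = homogenize (deg k j) p" for k j
    by (cases "k < n \<and> j < r") auto
  define p where "p k j = (SOME p. k < n \<longrightarrow> j < r \<longrightarrow> degree p \<le> deg k j \<and> (\<lambda>v. A v $$ (k, j)) = homogenize (deg k j) p)" for k j
  have p: "degree (p k j) \<le> deg k j" "A v $$ (k, j) = homogenize (deg k j) (p k j) v" if "k < n" "j < r" for k j v
    using someI_ex[OF ex[of k j]] that unfolding p_def[symmetric] by (simp_all add: fun_eq_iff del: split_paired_All)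
  show ?thesis by (intro bexI[of _ "mat n r (\<lambda>(k, j). p k j)"]) (use p in simp_all)
qed

lemma mat_vec_smult:
  fixes B :: "'b::comm_ring_1 mat"
  assumes "B \<in> carrier_mat m n" "y \<in> carrier_vec n"
  shows "B *\<^sub>v (k \<cdot>\<^sub>v y) = k \<cdot>\<^sub>v (B *\<^sub>v y)" "(k \<cdot>\<^sub>m B) *\<^sub>v y = k \<cdot>\<^sub>v (B *\<^sub>v y)"
  using assms by (auto simp: scalar_prod_def sum_distrib_left mult_ac intro!: eq_vecI)

text \<open>
  The multipliers \<open>h\<close> for which \<open>h c\<close> is in the image form an ideal. It has no zeros: completing \<open>Bp\<close> by a right inverse at
  \<open>x\<close> to a square matrix \<open>D\<close>, the adjugate shows that \<open>det D\<close> is in the ideal.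
\<close>

lemma polynomial_solution:
  fixes Bp :: "'k::alg_closed_field poly mat"
  assumes B: "Bp \<in> carrier_mat m n" and c: "c \<in> carrier_vec m"
    and R: "\<And>x. \<exists>R\<in>carrier_mat n m. map_mat (\<lambda>p. poly p x) Bp * R = 1\<^sub>m m"
  obtains y where "y \<in> carrier_vec n" "Bp *\<^sub>v y = c"
proof -
  define X where "X = {h. \<exists>y\<in>carrier_vec n. Bp *\<^sub>v y = h \<cdot>\<^sub>v c}"
  have "1 \<in> X"
  proof (rule poly_ideal_without_zeros)
    fix h h' assume "h \<in> X" "h' \<in> X"
    then obtain y y' where y: "y \<in> carrier_vec n" "Bp *\<^sub>v y = h \<cdot>\<^sub>v c" "y' \<in> carrier_vec n" "Bp *\<^sub>v y' = h' \<cdot>\<^sub>v c"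
      unfolding X_def by auto
    then have "Bp *\<^sub>v (y + y') = (h + h') \<cdot>\<^sub>v c"
      by (simp add: mult_add_distrib_mat_vec[OF B] add_smult_distrib_vec)
    then show "h + h' \<in> X" using y unfolding X_def by (intro CollectI bexI[of _ "y + y'"]) simp_all
  next
    fix l h assume "h \<in> X"
    then obtain y where y: "y \<in> carrier_vec n" "Bp *\<^sub>v y = h \<cdot>\<^sub>v c" unfolding X_def by auto
    then have "Bp *\<^sub>v (l \<cdot>\<^sub>v y) = (l * h) \<cdot>\<^sub>v c" using B by (simp add: mat_vec_smult(1)[OF B] smult_smult_assoc)
    then show "l * h \<in> X" using y unfolding X_def by (intro CollectI bexI[of _ "l \<cdot>\<^sub>v y"]) simp_all
  next
    fix x
    obtain R0 where R0: "R0 \<in> carrier_mat n m" "map_mat (\<lambda>p. poly p x) Bp * R0 = 1\<^sub>m m" using R by blast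
    define R' where "R' = map_mat const_poly R0"
    define D where "D = Bp * R'"
    have R': "R' \<in> carrier_mat n m" and D: "D \<in> carrier_mat m m" using R0(1) B by (simp_all add: R'_def D_def)
    note adj = adj_mat[OF D]
    interpret ev: comm_ring_hom "\<lambda>p. poly p x" by standard simp_all
    have "map_mat (\<lambda>p. poly p x) D = map_mat (\<lambda>p. poly p x) Bp * map_mat (\<lambda>p. poly p x) R'"
      unfolding D_def by (rule ev.mat_hom_mult[OF B R'])
    also have "map_mat (\<lambda>p. poly p x) R' = R0" using R0(1) by (intro eq_matI) (auto simp: R'_def)
    finally have "poly (det D) x = 1" using ev.hom_det[of D] R0(2) by simp
    moreover have "Bp *\<^sub>v (R' *\<^sub>v (adj_mat D *\<^sub>v c)) = det D \<cdot>\<^sub>v c"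
    proof -
      have ac: "adj_mat D *\<^sub>v c \<in> carrier_vec m" using adj(1) c by simp
      have "Bp *\<^sub>v (R' *\<^sub>v (adj_mat D *\<^sub>v c)) = D *\<^sub>v (adj_mat D *\<^sub>v c)"
        unfolding D_def by (rule assoc_mult_mat_vec[symmetric, OF B R' ac[unfolded D_def]])
      also have "\<dots> = (D * adj_mat D) *\<^sub>v c" by (rule assoc_mult_mat_vec[symmetric, OF D adj(1) c])
      also have "\<dots> = det D \<cdot>\<^sub>v c" unfolding adj(2) mat_vec_smult(2)[OF one_carrier_mat c] using c by simp
      finally show ?thesis .
    qed
    moreover have "R' *\<^sub>v (adj_mat D *\<^sub>v c) \<in> carrier_vec n"
      by (rule mult_mat_vec_carrier[OF R' mult_mat_vec_carrier[OF adj(1) c]])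
    ultimately show "\<exists>h\<in>X. poly h x \<noteq> 0"
      unfolding X_def by (intro bexI[of _ "det D"]) (simp, blast)
  qed
  then obtain y where "y \<in> carrier_vec n" "Bp *\<^sub>v y = 1 \<cdot>\<^sub>v c" unfolding X_def by blast
  then show thesis using that c by simp
qed

text \<open>
  The vanishing of the first cohomology of the bundle \<open>\<O>(d - \<alpha>\<^sub>1) \<oplus> \<dots> \<oplus> \<O>(d - \<alpha>\<^sub>r)\<close>, made explicit. A polynomial
  solution \<open>y\<close> on the affine line has some degree \<open>M\<close>. If \<open>M > d\<close>, then comparing top coefficients shows that \<open>B\<close>
  at infinity kills the coefficient \<open>z\<close> of \<open>x ^ M\<close>, so that \<open>z = A u\<close> there; subtracting the combination of the columns of \<open>A\<close> with
  coefficients \<open>u\<^sub>j x ^ (M - \<alpha>\<^sub>j)\<close> lowers the degree. The exponents are not negative because \<open>\<alpha>\<^sub>j \<le> d + 1 \<le> M\<close>.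
\<close>

lemma solve_column:
  fixes A B :: "'k::{alg_closed_field, field_char_0} \<times> 'k \<Rightarrow> 'k mat"
  assumes A: "form_matrix n r (\<lambda>k j. \<alpha> j) A" and B: "form_matrix m n (\<lambda>i k. \<beta> i) B"
    and split: "\<And>v. v \<in> P1 \<Longrightarrow> split_exact n m r (B v) (A v)"
    and c: "\<And>i. i < m \<Longrightarrow> binary_form (\<beta> i + d) (c i)" and d: "\<And>j. j < r \<Longrightarrow> \<alpha> j \<le> d + 1"
  shows "\<exists>y. (\<forall>k<n. binary_form d (y k)) \<and> (\<forall>i<m. \<forall>v. (\<Sum>k<n. B v $$ (i, k) * y k v) = c i v)"
proof -
  note AD = form_matrixD[OF A] and BD = form_matrixD[OF B]
  obtain Ap where Ap: "Ap \<in> carrier_mat n r" "\<And>k j. k < n \<Longrightarrow> j < r \<Longrightarrow> degree (Ap $$ (k, j)) \<le> \<alpha> j"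
    "\<And>k j v. k < n \<Longrightarrow> j < r \<Longrightarrow> A v $$ (k, j) = homogenize (\<alpha> j) (Ap $$ (k, j)) v"
    using form_matrix_dehomogenize[OF A] by blast
  obtain Bp where Bp: "Bp \<in> carrier_mat m n" "\<And>i k. i < m \<Longrightarrow> k < n \<Longrightarrow> degree (Bp $$ (i, k)) \<le> \<beta> i"
    "\<And>i k v. i < m \<Longrightarrow> k < n \<Longrightarrow> B v $$ (i, k) = homogenize (\<beta> i) (Bp $$ (i, k)) v"
    using form_matrix_dehomogenize[OF B] by blast
  have "form_matrix m 1 (\<lambda>i j. \<beta> i + d) (\<lambda>v. mat m 1 (\<lambda>(i, j). c i v))"
    using c by (simp add: form_matrix_def)
  from form_matrix_dehomogenize[OF this] obtain Cp where Cp: "\<And>i j. i < m \<Longrightarrow> j < 1 \<Longrightarrow> degree (Cp $$ (i, j)) \<le> \<beta> i + d"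
    "\<And>i j v. i < m \<Longrightarrow> j < 1 \<Longrightarrow> mat m 1 (\<lambda>(i, j). c i v) $$ (i, j) = homogenize (\<beta> i + d) (Cp $$ (i, j)) v"
    by blast
  define cp where "cp = vec m (\<lambda>i. Cp $$ (i, 0))"
  have cp: "cp \<in> carrier_vec m" "\<And>i. i < m \<Longrightarrow> degree (cp $ i) \<le> \<beta> i + d" "\<And>i v. i < m \<Longrightarrow> c i v = homogenize (\<beta> i + d) (cp $ i) v"
    using Cp by (simp_all add: cp_def)
  have aff: "(x, 1) \<in> P1" for x :: 'k by (simp add: P1_iff)
  have evA: "poly (Ap $$ (k, j)) x = A (x, 1) $$ (k, j)" if "k < n" "j < r" for k j x
    using Ap(2,3)[OF that] by (simp add: homogenize_affine)
  have evB: "poly (Bp $$ (i, k)) x = B (x, 1) $$ (i, k)" if "i < m" "k < n" for i k x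
    using Bp(2,3)[OF that] by (simp add: homogenize_affine)
  have BA: "Bp * Ap = 0\<^sub>m m r"
  proof (rule eq_matI)
    fix i j assume "i < dim_row (0\<^sub>m m r :: 'k poly mat)" "j < dim_col (0\<^sub>m m r :: 'k poly mat)"
    then have ij: "i < m" "j < r" by simp_all
    have "poly ((Bp * Ap) $$ (i, j)) x = (B (x, 1) * A (x, 1)) $$ (i, j)" for x
      using ij Ap(1) Bp(1) AD(1)[of "(x, 1)"] BD(1)[of "(x, 1)"]
      by (simp add: scalar_prod_def poly_sum evA evB)
    also have "\<dots> x = 0" for x using split[OF aff, of x] ij unfolding split_exact_def by auto
    finally have "(Bp * Ap) $$ (i, j) = 0" by (simp add: poly_eq_poly_eq_iff[symmetric] fun_eq_iff)
    then show "(Bp * Ap) $$ (i, j) = 0\<^sub>m m r $$ (i, j)" using ij by simp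
  qed (use Ap(1) Bp(1) in auto)
  obtain y0 where y0: "y0 \<in> carrier_vec n" "Bp *\<^sub>v y0 = cp"
  proof (rule polynomial_solution[OF Bp(1) cp(1)])
    fix x
    obtain R where R: "R \<in> carrier_mat n m" "B (x, 1) * R = 1\<^sub>m m" using split_exact_right_inverse[OF split[OF aff]] by blast
    have "map_mat (\<lambda>p. poly p x) Bp = B (x, 1)" using Bp(1) BD(1)[of "(x, 1)"] by (intro eq_matI) (auto simp: evB)
    then show "\<exists>R\<in>carrier_mat n m. map_mat (\<lambda>p. poly p x) Bp * R = 1\<^sub>m m" using R by auto
  qed
  have reduce: "\<exists>y\<in>carrier_vec n. Bp *\<^sub>v y = cp \<and> (\<forall>k<n. degree (y $ k) \<le> d)"
    if "y \<in> carrier_vec n" "Bp *\<^sub>v y = cp" "\<forall>k<n. degree (y $ k) \<le> d + N" for y N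
    using that
  proof (induction N arbitrary: y)
    case 0
    then show ?case by auto
  next
    case (Suc N)
    define M where "M = d + Suc N"
    note y = Suc.prems[folded M_def]
    define z where "z = vec n (\<lambda>k. poly.coeff (y $ k) M)"
    have "B (1, 0) *\<^sub>v z = 0\<^sub>v m"
    proof (rule eq_vecI)
      fix i assume "i < dim_vec (0\<^sub>v m :: 'k vec)"
      then have i: "i < m" by simp
      have "(B (1, 0) *\<^sub>v z) $ i = (\<Sum>k<n. poly.coeff (Bp $$ (i, k)) (\<beta> i) * poly.coeff (y $ k) M)"
        using i BD(1)[of "(1, 0)"] Bp(3)[OF i] by (simp add: z_def scalar_prod_def atLeast0LessThan homogenize_infinity)
      also have "\<dots> = (\<Sum>k<n. poly.coeff (Bp $$ (i, k) * y $ k) (\<beta> i + M))"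
        using y(3) Bp(2)[OF i] by (intro sum.cong) (simp_all add: coeff_mult_top)
      also have "\<dots> = poly.coeff ((Bp *\<^sub>v y) $ i) (\<beta> i + M)"
        using i Bp(1) y(1) by (simp add: scalar_prod_def atLeast0LessThan coeff_sum)
      also have "\<dots> = 0" unfolding y(2) using cp(2)[OF i] by (intro coeff_eq_0) (simp add: M_def)
      finally show "(B (1, 0) *\<^sub>v z) $ i = 0\<^sub>v m $ i" using i by simp
    qed (use BD(1)[of "(1, 0)"] in simp)
    then have "z \<in> mat_image (A (1, 0))"
      using split_exact_kernel[OF split[of "(1, 0)"]] by (simp add: P1_iff z_def)
    then obtain u where u: "u \<in> carrier_vec r" "z = A (1, 0) *\<^sub>v u" using mat_imageE[OF _ AD(1)] by metis
    define w where "w = vec r (\<lambda>j. monom (u $ j) (M - \<alpha> j))"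
    have w: "w \<in> carrier_vec r" by (simp add: w_def)
    have aM: "\<alpha> j \<le> M" if "j < r" for j using d[OF that] by (simp add: M_def)
    define y' where "y' = y - Ap *\<^sub>v w"
    have Aw: "Ap *\<^sub>v w \<in> carrier_vec n" by (rule mult_mat_vec_carrier[OF Ap(1) w])
    have y': "y' \<in> carrier_vec n" using y(1) Aw by (simp add: y'_def)
    have "Bp *\<^sub>v y' = Bp *\<^sub>v y - Bp *\<^sub>v (Ap *\<^sub>v w)" unfolding y'_def by (rule mult_minus_distrib_mat_vec[OF Bp(1) y(1) Aw])
    also have "Bp *\<^sub>v (Ap *\<^sub>v w) = 0\<^sub>v m" by (rule mult_mat_vec_zero[OF Bp(1) Ap(1) BA w])
    finally have By': "Bp *\<^sub>v y' = cp" using y(2) cp(1) by simp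
    have "degree (y' $ k) \<le> d + N" if k: "k < n" for k
    proof -
      have e: "y' $ k = y $ k - (\<Sum>j<r. Ap $$ (k, j) * w $ j)"
        using k Ap(1) y(1) w by (simp add: y'_def scalar_prod_def atLeast0LessThan)
      have dw: "degree (w $ j) \<le> M - \<alpha> j" if "j < r" for j using that by (simp add: w_def degree_monom_le)
      have deg: "degree (Ap $$ (k, j) * w $ j) \<le> M" if j: "j < r" for j
        using degree_mult_le[of "Ap $$ (k, j)" "w $ j"] Ap(2)[OF k j] dw[OF j] aM[OF j] by linarith
      have le: "degree (y' $ k) \<le> M"
        unfolding e using y(3) k deg by (intro degree_diff_le degree_sum_le) auto
      have "poly.coeff (Ap $$ (k, j) * w $ j) M = A (1, 0) $$ (k, j) * u $ j" if j: "j < r" for j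
        using coeff_mult_top[OF Ap(2)[OF k j] dw[OF j]] aM[OF j] j Ap(3)[OF k j]
        by (simp add: w_def homogenize_infinity)
      then have "poly.coeff (y' $ k) M = z $ k - (A (1, 0) *\<^sub>v u) $ k"
        unfolding e using k AD(1)[of "(1, 0)"] u(1) by (simp add: coeff_sum z_def scalar_prod_def atLeast0LessThan)
      then have "poly.coeff (y' $ k) M = 0" using u(2) by simp
      then have "degree (y' $ k) \<noteq> M" unfolding M_def by (metis add_Suc_right degree_0 leading_coeff_0_iff nat.simps(3))
      then show ?thesis using le by (simp add: M_def)
    qed
    then show ?case using Suc.IH[OF y' By'] by blast
  qed
  have "degree (y0 $ k) \<le> d + (\<Sum>k<n. degree (y0 $ k))" if "k < n" for k
    using member_le_sum[of k "{..<n}" "\<lambda>k. degree (y0 $ k)"] that by simp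
  then obtain y where y: "y \<in> carrier_vec n" "Bp *\<^sub>v y = cp" "\<And>k. k < n \<Longrightarrow> degree (y $ k) \<le> d"
    using reduce[OF y0] by blast
  show ?thesis
  proof (intro exI[of _ "\<lambda>k. homogenize d (y $ k)"] conjI allI impI)
    show "binary_form d (homogenize d (y $ k))" for k by (rule homogenize_form)
    fix i v assume i: "i < m"
    have "(\<lambda>v. \<Sum>k<n. B v $$ (i, k) * homogenize d (y $ k) v) = c i"
    proof (rule form_eqI[of "\<beta> i + d"])
      show "binary_form (\<beta> i + d) (\<lambda>v. \<Sum>k<n. B v $$ (i, k) * homogenize d (y $ k) v)"
        using BD(2)[OF i] by (intro form.sum form.mult homogenize_form) simp
      fix x
      have "(\<Sum>k<n. B (x, 1) $$ (i, k) * homogenize d (y $ k) (x, 1)) = poly ((Bp *\<^sub>v y) $ i) x"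
        using i Bp(1) y(1,3) evB[OF i] by (simp add: scalar_prod_def atLeast0LessThan poly_sum homogenize_affine)
      then show "(\<Sum>k<n. B (x, 1) $$ (i, k) * homogenize d (y $ k) (x, 1)) = c i (x, 1)"
        using y(2) cp(2,3)[OF i] by (simp add: homogenize_affine)
    qed (rule c[OF i])
    then show "(\<Sum>k<n. B v $$ (i, k) * homogenize d (y $ k) v) = c i v" by (rule fun_cong)
  qed
qed

lemma decomposition_sub_balanced:
  fixes A B :: "'k::{alg_closed_field, field_char_0} \<times> 'k \<Rightarrow> 'k mat"
  assumes A: "form_matrix n r (\<lambda>k j. \<alpha> j) A" and B: "form_matrix m n (\<lambda>i k. \<beta> i) B"
    and split: "\<And>v. v \<in> P1 \<Longrightarrow> split_exact n m r (B v) (A v)"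
    and balanced: "\<And>j j'. j < r \<Longrightarrow> j' < r \<Longrightarrow> \<alpha> j \<le> \<alpha> j' + 1"
    and C: "form_matrix m r (\<lambda>i j. \<beta> i + \<alpha> j) C"
  shows "\<exists>A'. form_matrix n r (\<lambda>k j. \<alpha> j) A' \<and> (\<forall>v. C v = B v * A' v)"
proof -
  note BD = form_matrixD[OF B] and CD = form_matrixD[OF C]
  have "\<exists>y. (\<forall>k<n. binary_form (\<alpha> j) (y k)) \<and> (\<forall>i<m. \<forall>v. (\<Sum>k<n. B v $$ (i, k) * y k v) = C v $$ (i, j))" if j: "j < r" for j
    using CD(2) j balanced by (intro solve_column[OF A B split]) simp_all
  then have ex: "\<exists>y. j < r \<longrightarrow> (\<forall>k<n. binary_form (\<alpha> j) (y k)) \<and> (\<forall>i<m. \<forall>v. (\<Sum>k<n. B v $$ (i, k) * y k v) = C v $$ (i, j))" for j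
    by (cases "j < r") simp_all
  from choice[OF allI, OF ex] obtain y where y: "\<forall>j. j < r \<longrightarrow> (\<forall>k<n. binary_form (\<alpha> j) (y j k)) \<and>
      (\<forall>i<m. \<forall>v. (\<Sum>k<n. B v $$ (i, k) * y j k v) = C v $$ (i, j))" ..
  show ?thesis
  proof (intro exI[of _ "\<lambda>v. mat n r (\<lambda>(k, j). y j k v)"] conjI allI)
    show "form_matrix n r (\<lambda>k j. \<alpha> j) (\<lambda>v. mat n r (\<lambda>(k, j). y j k v))" using y by (simp add: form_matrix_def)
    show "C v = B v * mat n r (\<lambda>(k, j). y j k v)" for v
      using y BD(1)[of v] CD(1)[of v] by (intro eq_matI) (auto simp: scalar_prod_def atLeast0LessThan simp del: split_paired_All)
  qed
qed

text \<open>
  Transposition exchanges the roles of \<open>A\<close> and \<open>B\<close>.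
\<close>

lemma decomposition_quot_balanced:
  fixes A B :: "'k::{alg_closed_field, field_char_0} \<times> 'k \<Rightarrow> 'k mat"
  assumes A: "form_matrix n r (\<lambda>k j. \<alpha> j) A" and B: "form_matrix m n (\<lambda>i k. \<beta> i) B"
    and split: "\<And>v. v \<in> P1 \<Longrightarrow> split_exact n m r (B v) (A v)"
    and balanced: "\<And>i i'. i < m \<Longrightarrow> i' < m \<Longrightarrow> \<beta> i \<le> \<beta> i' + 1"
    and C: "form_matrix m r (\<lambda>i j. \<beta> i + \<alpha> j) C"
  shows "\<exists>B'. form_matrix m n (\<lambda>i k. \<beta> i) B' \<and> (\<forall>v. C v = B' v * A v)"
proof -
  note AD = form_matrixD[OF A] and BD = form_matrixD[OF B] and CD = form_matrixD[OF C]
  have transpose: "form_matrix q p (\<lambda>j i. deg i j) (\<lambda>v. (X v)\<^sup>T)" if "form_matrix p q deg X" for p q deg and X :: "'k \<times> 'k \<Rightarrow> 'k mat"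
  proof -
    have "(X v)\<^sup>T $$ (j, i) = X v $$ (i, j)" if "i < p" "j < q" for v i j
      using that form_matrixD(1)[OF \<open>form_matrix p q deg X\<close>, of v] by simp
    then show ?thesis using that by (simp add: form_matrix_def)
  qed
  have "\<exists>Y. form_matrix n m (\<lambda>k i. \<beta> i) Y \<and> (\<forall>v. (C v)\<^sup>T = (A v)\<^sup>T * Y v)"
  proof (rule decomposition_sub_balanced[OF transpose[OF B] transpose[OF A] _ balanced])
    show "split_exact n r m (A v)\<^sup>T (B v)\<^sup>T" if "v \<in> P1" for v by (rule split_exact_transpose[OF split[OF that]])
    show "form_matrix r m (\<lambda>i j. \<alpha> i + \<beta> j) (\<lambda>v. (C v)\<^sup>T)" using transpose[OF C] by (simp add: add.commute)
  qed
  then obtain Y where Y: "form_matrix n m (\<lambda>k i. \<beta> i) Y" "\<And>v. (C v)\<^sup>T = (A v)\<^sup>T * Y v" by blast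
  have "C v = (Y v)\<^sup>T * A v" for v
  proof -
    have "C v = ((A v)\<^sup>T * Y v)\<^sup>T" unfolding Y(2)[symmetric] by simp
    also have "\<dots> = (Y v)\<^sup>T * A v"
      using transpose_mult[of "(A v)\<^sup>T" r n "Y v" m] AD(1)[of v] form_matrixD(1)[OF Y(1), of v] by simp
    finally show ?thesis .
  qed
  then show ?thesis using transpose[OF Y(1)] by blast
qed

section \<open>A monomial point of the intersection\<close>

lemma mat_mult_entry:
  assumes "X \<in> carrier_mat m n" "Y \<in> carrier_mat n r" "i < m" "j < r"
  shows "(X * Y) $$ (i, j) = (\<Sum>k<n. X $$ (i, k) * Y $$ (k, j))"
  using assms by (simp add: scalar_prod_def atLeast0LessThan)

lemma form_matrix_add:
  assumes "form_matrix n r deg A" "form_matrix n r deg A'"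
  shows "form_matrix n r deg (\<lambda>v. A v + A' v)"
proof -
  note A = form_matrixD[OF assms(1)] and A' = form_matrixD[OF assms(2)]
  have "binary_form (deg k j) (\<lambda>v. (A v + A' v) $$ (k, j))" if "k < n" "j < r" for k j
  proof -
    have "(A v + A' v) $$ (k, j) = A v $$ (k, j) + A' v $$ (k, j)" for v using that A(1)[of v] A'(1)[of v] by simp
    then show ?thesis using form.add[OF A(2)[OF that] A'(2)[OF that]] by simp
  qed
  then show ?thesis using A(1) A'(1) by (simp add: form_matrix_def)
qed

lemma sum_lessThan_add: fixes d :: nat shows "(\<Sum>k<a + d. f k) = (\<Sum>k<a. f k) + (\<Sum>k<d. f (k + a) :: 'a::comm_monoid_add)"
  by (induction d) (simp_all add: add_ac)

text \<open>
  A monomial of degree \<open>b + a\<close> is divisible by \<open>s ^ a\<close> or by \<open>t ^ b\<close>.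
\<close>

lemma form_split:
  fixes c :: "'k::field \<times> 'k \<Rightarrow> 'k"
  assumes "binary_form (b + a) c"
  shows "\<exists>g h. binary_form a g \<and> binary_form b h \<and> (\<forall>v. c v = snd v ^ b * g v + fst v ^ a * h v)"
proof -
  obtain p where p: "c = (\<lambda>(s, t). \<Sum>k\<le>b + a. p k * s ^ k * t ^ (b + a - k))" using assms unfolding binary_form_def by blast
  define g where "g = (\<lambda>v :: 'k \<times> 'k. \<Sum>k<a. (\<lambda>(s, t). p k * (s ^ k * t ^ (a - k))) v)"
  define h where "h = (\<lambda>v :: 'k \<times> 'k. \<Sum>k\<le>b. (\<lambda>(s, t). p (k + a) * (s ^ k * t ^ (b - k))) v)"
  have "binary_form a g" unfolding g_def by (intro form.sum form_monomial) simp
  moreover have "binary_form b h" unfolding h_def by (intro form.sum form_monomial) simp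
  moreover have "c v = snd v ^ b * g v + fst v ^ a * h v" for v
  proof -
    obtain s t where v: "v = (s, t)" by (cases v)
    let ?f = "\<lambda>k. p k * s ^ k * t ^ (b + a - k)"
    have "c v = (\<Sum>k<a + Suc b. ?f k)" by (simp add: p v lessThan_Suc_atMost add.commute)
    also have "\<dots> = (\<Sum>k<a. ?f k) + (\<Sum>k<Suc b. ?f (k + a))"
      by (rule sum_lessThan_add)
    also have "(\<Sum>k<a. ?f k) = t ^ b * g v"
    proof -
      have "?f k = t ^ b * (p k * (s ^ k * t ^ (a - k)))" if "k < a" for k
      proof -
        have "b + a - k = b + (a - k)" using that by simp
        then show ?thesis by (simp add: power_add mult_ac)
      qed
      then have "(\<Sum>k<a. ?f k) = (\<Sum>k<a. t ^ b * (p k * (s ^ k * t ^ (a - k))))" by (intro sum.cong refl) (simp only: lessThan_iff)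
      then show ?thesis by (simp add: g_def v sum_distrib_left)
    qed
    also have "(\<Sum>k<Suc b. ?f (k + a)) = s ^ a * h v"
      unfolding lessThan_Suc_atMost by (simp add: h_def v sum_distrib_left power_add mult_ac)
    finally show ?thesis by (simp add: v)
  qed
  ultimately show ?thesis by blast
qed

text \<open>
  Elimination along antidiagonals, starting with the largest index sum. To clear the entry \<open>(i, j)\<close> of \<open>C\<close>, split it as
  \<open>t ^ \<beta>\<^sub>i g + s ^ \<alpha>\<^sub>j h\<close> and put \<open>g\<close> in place \<open>(\<sigma> i, j)\<close> of \<open>A'\<close> and \<open>h\<close> in place
  \<open>(i, \<tau> j)\<close> of \<open>B'\<close>. By the echelon shape the other entries affected by this have a smaller index sum.
\<close>

lemma decomposition_triangular:
  fixes A B :: "'k::field \<times> 'k \<Rightarrow> 'k mat"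
  assumes A: "form_matrix n r (\<lambda>k j. \<alpha> j) A" and B: "form_matrix m n (\<lambda>i k. \<beta> i) B"
    and \<sigma>: "\<And>i. i < m \<Longrightarrow> \<sigma> i < n" "\<And>i v. i < m \<Longrightarrow> B v $$ (i, \<sigma> i) = snd v ^ \<beta> i"
      "\<And>i i' v. i < i' \<Longrightarrow> i' < m \<Longrightarrow> B v $$ (i', \<sigma> i) = 0"
    and \<tau>: "\<And>j. j < r \<Longrightarrow> \<tau> j < n" "\<And>j v. j < r \<Longrightarrow> A v $$ (\<tau> j, j) = fst v ^ \<alpha> j"
      "\<And>j j' v. j < j' \<Longrightarrow> j' < r \<Longrightarrow> A v $$ (\<tau> j, j') = 0"
    and C: "form_matrix m r (\<lambda>i j. \<beta> i + \<alpha> j) C"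
  shows "\<exists>A' B'. form_matrix n r (\<lambda>k j. \<alpha> j) A' \<and> form_matrix m n (\<lambda>i k. \<beta> i) B' \<and> (\<forall>v. C v = B v * A' v + B' v * A v)"
proof -
  note AD = form_matrixD[OF A] and BD = form_matrixD[OF B]
  have "\<exists>A' B'. form_matrix n r (\<lambda>k j. \<alpha> j) A' \<and> form_matrix m n (\<lambda>i k. \<beta> i) B' \<and> (\<forall>v. C v = B v * A' v + B' v * A v)"
    if "form_matrix m r (\<lambda>i j. \<beta> i + \<alpha> j) C" "\<And>i j v. i < m \<Longrightarrow> j < r \<Longrightarrow> N \<le> i + j \<Longrightarrow> C v $$ (i, j) = 0" for C and N :: nat
    using that
  proof (induction N arbitrary: C)
    case 0
    have "C v = B v * 0\<^sub>m n r + 0\<^sub>m m n * A v" for v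
      using 0(2) form_matrixD(1)[OF 0(1), of v] AD(1)[of v] BD(1)[of v] by (intro eq_matI) auto
    moreover have "form_matrix n r (\<lambda>k j. \<alpha> j) (\<lambda>v :: 'k \<times> 'k. 0\<^sub>m n r)" "form_matrix m n (\<lambda>i k. \<beta> i) (\<lambda>v :: 'k \<times> 'k. 0\<^sub>m m n)"
      by (simp_all add: form_matrix_def form.zero)
    ultimately show ?case by (intro exI conjI allI)
  next
    case (Suc N)
    note CD = form_matrixD[OF Suc.prems(1)]
    have ex: "\<exists>gh. i < m \<longrightarrow> j < r \<longrightarrow> binary_form (\<alpha> j) (fst gh) \<and> binary_form (\<beta> i) (snd gh) \<and>
        (\<forall>v. C v $$ (i, j) = snd v ^ \<beta> i * fst gh v + fst v ^ \<alpha> j * snd gh v)" for i j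
    proof (cases "i < m \<and> j < r")
      case True
      then obtain g h where "binary_form (\<alpha> j) g \<and> binary_form (\<beta> i) h \<and> (\<forall>v. C v $$ (i, j) = snd v ^ \<beta> i * g v + fst v ^ \<alpha> j * h v)"
        using form_split[OF CD(2)] by blast
      then show ?thesis by (intro exI[of _ "(g, h)"]) (simp del: split_paired_All)
    qed auto
    define gh where "gh i j = (SOME gh. i < m \<longrightarrow> j < r \<longrightarrow> binary_form (\<alpha> j) (fst gh) \<and> binary_form (\<beta> i) (snd gh) \<and>
        (\<forall>v. C v $$ (i, j) = snd v ^ \<beta> i * fst gh v + fst v ^ \<alpha> j * snd gh v))" for i j
    define g h where "g i j = fst (gh i j)" and "h i j = snd (gh i j)" for i j
    have gh: "binary_form (\<alpha> j) (g i j)" "binary_form (\<beta> i) (h i j)"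
      "C v $$ (i, j) = snd v ^ \<beta> i * g i j v + fst v ^ \<alpha> j * h i j v" if "i < m" "j < r" for i j v
      using someI_ex[OF ex[of i j]] that unfolding gh_def[symmetric] g_def h_def by blast+
    define A1 where "A1 v = mat n r (\<lambda>(k, j). if j \<le> N \<and> N - j < m \<and> k = \<sigma> (N - j) then g (N - j) j v else 0)" for v
    define B1 where "B1 v = mat m n (\<lambda>(i, k). if i \<le> N \<and> N - i < r \<and> k = \<tau> (N - i) then h i (N - i) v else 0)" for v
    have A1: "form_matrix n r (\<lambda>k j. \<alpha> j) A1"
    proof -
      have "binary_form (\<alpha> j) (\<lambda>v. if j \<le> N \<and> N - j < m \<and> k = \<sigma> (N - j) then g (N - j) j v else 0)" if "j < r" for k j
        using gh(1)[of "N - j" j] that form.zero by (cases "j \<le> N \<and> N - j < m \<and> k = \<sigma> (N - j)") (simp_all del: de_Morgan_conj)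
      then show ?thesis by (simp add: form_matrix_def A1_def)
    qed
    have B1: "form_matrix m n (\<lambda>i k. \<beta> i) B1"
    proof -
      have "binary_form (\<beta> i) (\<lambda>v. if i \<le> N \<and> N - i < r \<and> k = \<tau> (N - i) then h i (N - i) v else 0)" if "i < m" for i k
        using gh(2)[of i "N - i"] that form.zero by (cases "i \<le> N \<and> N - i < r \<and> k = \<tau> (N - i)") (simp_all del: de_Morgan_conj)
      then show ?thesis by (simp add: form_matrix_def B1_def)
    qed
    note A1D = form_matrixD[OF A1] and B1D = form_matrixD[OF B1]
    have BA1: "(B v * A1 v) $$ (i, j) = (if j \<le> N \<and> N - j < m then B v $$ (i, \<sigma> (N - j)) * g (N - j) j v else 0)"
      if ij: "i < m" "j < r" for v i j
    proof -
      have "(B v * A1 v) $$ (i, j) = (\<Sum>k<n. if k = \<sigma> (N - j) then (if j \<le> N \<and> N - j < m then B v $$ (i, k) * g (N - j) j v else 0) else 0)"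
        unfolding mat_mult_entry[OF BD(1) A1D(1) ij] using ij by (intro sum.cong) (auto simp: A1_def)
      then show ?thesis using \<sigma>(1) by auto
    qed
    have B1A: "(B1 v * A v) $$ (i, j) = (if i \<le> N \<and> N - i < r then h i (N - i) v * A v $$ (\<tau> (N - i), j) else 0)"
      if ij: "i < m" "j < r" for v i j
    proof -
      have "(B1 v * A v) $$ (i, j) = (\<Sum>k<n. if k = \<tau> (N - i) then (if i \<le> N \<and> N - i < r then h i (N - i) v * A v $$ (k, j) else 0) else 0)"
        unfolding mat_mult_entry[OF B1D(1) AD(1) ij] using ij by (intro sum.cong) (auto simp: B1_def)
      then show ?thesis using \<tau>(1) by auto
    qed
    define C2 where "C2 v = mat m r (\<lambda>(i, j). C v $$ (i, j) + - ((\<Sum>k<n. B v $$ (i, k) * A1 v $$ (k, j)) + (\<Sum>k<n. B1 v $$ (i, k) * A v $$ (k, j))))" for v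
    have C2entry: "C2 v $$ (i, j) = C v $$ (i, j) - ((B v * A1 v) $$ (i, j) + (B1 v * A v) $$ (i, j))" if ij: "i < m" "j < r" for v i j
      unfolding mat_mult_entry[OF BD(1) A1D(1) ij] mat_mult_entry[OF B1D(1) AD(1) ij] using ij by (simp add: C2_def)
    have C2: "form_matrix m r (\<lambda>i j. \<beta> i + \<alpha> j) C2"
    proof -
      have "binary_form (\<beta> i + \<alpha> j) (\<lambda>v. C v $$ (i, j) + - ((\<Sum>k<n. B v $$ (i, k) * A1 v $$ (k, j)) + (\<Sum>k<n. B1 v $$ (i, k) * A v $$ (k, j))))"
        if "i < m" "j < r" for i j
        using that by (intro form.add form.uminus form.sum form.mult CD(2) BD(2) A1D(2) B1D(2) AD(2)) simp_all
      then show ?thesis by (simp add: form_matrix_def C2_def)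
    qed
    have "C2 v $$ (i, j) = 0" if ij: "i < m" "j < r" "N \<le> i + j" for i j v
    proof (cases "i + j = N")
      case True
      then have "j \<le> N" "N - j = i" "i \<le> N" "N - i = j" by auto
      then show ?thesis unfolding C2entry[OF ij(1,2)] BA1[OF ij(1,2)] B1A[OF ij(1,2)]
        using gh(3)[OF ij(1,2)] \<sigma>(2)[OF ij(1)] \<tau>(2)[OF ij(2)] ij(1,2) by (simp add: mult.commute)
    next
      case False
      then have lt: "j \<le> N \<Longrightarrow> N - j < i" "i \<le> N \<Longrightarrow> N - i < j" using ij(3) by auto
      have "C v $$ (i, j) = 0" using False ij by (intro Suc.prems(2)) simp_all
      then show ?thesis unfolding C2entry[OF ij(1,2)] BA1[OF ij(1,2)] B1A[OF ij(1,2)]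
        using \<sigma>(3)[OF lt(1) ij(1)] \<tau>(3)[OF lt(2) ij(2)] by simp
    qed
    then obtain A2 B2 where A2: "form_matrix n r (\<lambda>k j. \<alpha> j) A2" and B2: "form_matrix m n (\<lambda>i k. \<beta> i) B2"
      and C2eq: "\<And>v. C2 v = B v * A2 v + B2 v * A v" using Suc.IH[OF C2] by blast
    note A2D = form_matrixD[OF A2] and B2D = form_matrixD[OF B2]
    have "C v = B v * (A1 v + A2 v) + (B1 v + B2 v) * A v" for v
    proof (rule eq_matI)
      fix i j assume "i < dim_row (B v * (A1 v + A2 v) + (B1 v + B2 v) * A v)" "j < dim_col (B v * (A1 v + A2 v) + (B1 v + B2 v) * A v)"
      then have ij: "i < m" "j < r" using B1D(1)[of v] B2D(1)[of v] AD(1)[of v] by simp_all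
      have "(B v * A2 v + B2 v * A v) $$ (i, j) = (B v * A2 v) $$ (i, j) + (B2 v * A v) $$ (i, j)"
        using ij B2D(1)[of v] AD(1)[of v] by simp
      then have c: "C v $$ (i, j) = (B v * A1 v) $$ (i, j) + (B1 v * A v) $$ (i, j) + ((B v * A2 v) $$ (i, j) + (B2 v * A v) $$ (i, j))"
        using C2entry[OF ij, of v] C2eq[of v] by (simp add: algebra_simps)
      have "(B v * (A1 v + A2 v) + (B1 v + B2 v) * A v) $$ (i, j)
          = (B v * A1 v + B v * A2 v) $$ (i, j) + (B1 v * A v + B2 v * A v) $$ (i, j)"
        unfolding mult_add_distrib_mat[OF BD(1) A1D(1) A2D(1)] add_mult_distrib_mat[OF B1D(1) B2D(1) AD(1)]
        using ij B1D(1)[of v] B2D(1)[of v] AD(1)[of v] by simp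
      also have "\<dots> = C v $$ (i, j)"
        unfolding c using ij BD(1)[of v] B1D(1)[of v] B2D(1)[of v] AD(1)[of v] A1D(1)[of v] A2D(1)[of v] by simp
      finally show "C v $$ (i, j) = (B v * (A1 v + A2 v) + (B1 v + B2 v) * A v) $$ (i, j)" by simp
    qed (use CD(1)[of v] B1D(1)[of v] B2D(1)[of v] AD(1)[of v] in auto)
    then show ?case using form_matrix_add[OF A1 A2] form_matrix_add[OF B1 B2] by blast
  qed
  from this[OF C, of "m + r"] show ?thesis by simp
qed

text \<open>
  Column \<open>\<sigma> i\<close> of \<open>B\<close> has the pivot \<open>t ^ b\<^sub>i\<close> in row \<open>i\<close> and is zero below, and similarly for the rows
  \<open>\<tau> j\<close> of \<open>A\<close>. That the first pivots are in the corner is what makes the recursion step work.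
\<close>

definition special_pair ::
  "nat list \<Rightarrow> nat list \<Rightarrow> ('k::field \<times> 'k \<Rightarrow> 'k mat) \<Rightarrow> ('k \<times> 'k \<Rightarrow> 'k mat) \<Rightarrow> (nat \<Rightarrow> nat) \<Rightarrow> (nat \<Rightarrow> nat) \<Rightarrow> bool" where
  "special_pair a b A B \<sigma> \<tau> \<longleftrightarrow>
     form_matrix (length b + length a) (length a) (\<lambda>k j. a ! j) A \<and>
     form_matrix (length b) (length b + length a) (\<lambda>i k. b ! i) B \<and>
     (\<forall>v\<in>P1. split_exact (length b + length a) (length b) (length a) (B v) (A v)) \<and> \<sigma> 0 = 0 \<and> \<tau> 0 = 0 \<and>
     (\<forall>i<length b. \<sigma> i < length b + length a \<and> (\<forall>v. B v $$ (i, \<sigma> i) = snd v ^ (b ! i)) \<and>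
        (\<forall>i'>i. i' < length b \<longrightarrow> (\<forall>v. B v $$ (i', \<sigma> i) = 0))) \<and>
     (\<forall>j<length a. \<tau> j < length b + length a \<and> (\<forall>v. A v $$ (\<tau> j, j) = fst v ^ (a ! j)) \<and>
        (\<forall>j'>j. j' < length a \<longrightarrow> (\<forall>v. A v $$ (\<tau> j, j') = 0)))"

text \<open>
  Transposing both matrices also exchanges the pivots \<open>s ^ a\<^sub>j\<close> and \<open>t ^ b\<^sub>i\<close>, which is undone by
  exchanging the coordinates \<open>s\<close> and \<open>t\<close>.
\<close>

lemma special_pair_swap:
  assumes sp: "special_pair a b A B \<sigma> \<tau>"
  shows "special_pair b a (\<lambda>v. (B (prod.swap v))\<^sup>T) (\<lambda>v. (A (prod.swap v))\<^sup>T) \<tau> \<sigma>"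
proof -
  let ?n = "length a + length b"
  have A: "form_matrix ?n (length a) (\<lambda>k j. a ! j) A" and B: "form_matrix (length b) ?n (\<lambda>i k. b ! i) B"
    and split: "\<And>v. v \<in> P1 \<Longrightarrow> split_exact ?n (length b) (length a) (B v) (A v)"
    and 0: "\<sigma> 0 = 0" "\<tau> 0 = 0"
    and \<sigma>: "\<And>i. i < length b \<Longrightarrow> \<sigma> i < ?n" "\<And>i v. i < length b \<Longrightarrow> B v $$ (i, \<sigma> i) = snd v ^ (b ! i)"
      "\<And>i i' v. i < i' \<Longrightarrow> i' < length b \<Longrightarrow> B v $$ (i', \<sigma> i) = 0"
    and \<tau>: "\<And>j. j < length a \<Longrightarrow> \<tau> j < ?n" "\<And>j v. j < length a \<Longrightarrow> A v $$ (\<tau> j, j) = fst v ^ (a ! j)"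
      "\<And>j j' v. j < j' \<Longrightarrow> j' < length a \<Longrightarrow> A v $$ (\<tau> j, j') = 0"
    using sp unfolding special_pair_def by (auto simp: add.commute)
  note AD = form_matrixD[OF A] and BD = form_matrixD[OF B]
  have tA: "(A v)\<^sup>T $$ (j, k) = A v $$ (k, j)" if "k < ?n" "j < length a" for v j k using AD(1)[of v] that by simp
  have tB: "(B v)\<^sup>T $$ (k, i) = B v $$ (i, k)" if "k < ?n" "i < length b" for v i k using BD(1)[of v] that by simp
  have "form_matrix ?n (length b) (\<lambda>k i. b ! i) (\<lambda>v. (B (prod.swap v))\<^sup>T)"
    using BD(1) form_swap[OF BD(2)] by (simp add: form_matrix_def tB)
  moreover have "form_matrix (length a) ?n (\<lambda>j k. a ! j) (\<lambda>v. (A (prod.swap v))\<^sup>T)"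
    using AD(1) form_swap[OF AD(2)] by (simp add: form_matrix_def tA)
  moreover have "split_exact ?n (length a) (length b) (A (prod.swap v))\<^sup>T (B (prod.swap v))\<^sup>T" if "v \<in> P1" for v
    using that by (intro split_exact_transpose split) (cases v, auto simp: P1_iff)
  ultimately show ?thesis
    unfolding special_pair_def using 0 \<sigma> \<tau> by (auto simp: tA tB)
qed

text \<open>
  Without columns in \<open>A\<close> all degrees \<open>b\<^sub>i\<close> are zero, and \<open>B\<close> is the identity.
\<close>

lemma special_pair_base:
  assumes "sum_list b = 0"
  shows "special_pair [] b (\<lambda>v. mat (length b) 0 (\<lambda>_. 0)) (\<lambda>v. 1\<^sub>m (length b)) (\<lambda>i. i) (\<lambda>j. j)"
proof -
  let ?m = "length b"
  have b: "b ! i = 0" if "i < ?m" for i using assms that by (simp add: sum_list_eq_0_iff)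
  have "split_exact ?m ?m 0 (1\<^sub>m ?m) (mat ?m 0 (\<lambda>_. 0) :: 'a mat)"
  proof (rule split_exact_square)
    show "mat_injective (mat ?m 0 (\<lambda>_. 0) :: 'a mat)" by (rule mat_injectiveI[of _ ?m 0]) auto
    show "1\<^sub>m ?m * 1\<^sub>m ?m = (1\<^sub>m ?m :: 'a mat)" by simp
  qed auto
  then show ?thesis using b by (auto simp: special_pair_def form_matrix_def form_const)
qed

lemma P1_unit_combination:
  assumes "v \<in> P1" obtains p q where "snd v ^ k * p + fst v ^ l * q = (1 :: 'k::field)"
proof (cases "snd v = 0")
  case True
  then have "fst v \<noteq> 0" using assms by (cases v) (auto simp: P1_iff)
  then show thesis using that[of 0 "1 / fst v ^ l"] by simp
next
  case False
  then show thesis using that[of "1 / snd v ^ k" 0] by simp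
qed

text \<open>
  One step of the recursion. With \<open>e\<^sub>0\<close> the first unit vector, the new matrices are
  \<open>B = [t ^ y e\<^sub>0 | diag (s ^ x, 1, \<dots>, 1) B']\<close> and \<open>A\<close> with first column \<open>(s ^ x, - t ^ x e\<^sub>0)\<close> and the
  columns of \<open>A'\<close> extended by zero in the first place. The first column is a relation between the columns of \<open>B\<close> since
  \<open>B'\<close> starts with \<open>t ^ (y - x) e\<^sub>0\<close>. Exactness reduces to that of \<open>B'\<close> and \<open>A'\<close> because \<open>s\<close> and \<open>t\<close> have no common zero.
\<close>

lemma special_pair_step:
  fixes A' B' :: "'k::field \<times> 'k \<Rightarrow> 'k mat"
  assumes sp: "special_pair as ((y - x) # bs) A' B' \<sigma>' \<tau>'" and xy: "x \<le> y"
  shows "\<exists>A B \<sigma> \<tau>. special_pair (x # as) (y # bs) (A :: 'k \<times> 'k \<Rightarrow> 'k mat) B \<sigma> \<tau>"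
proof -
  let ?m = "Suc (length bs)" and ?r = "length as"
  define n where "n = ?m + ?r"
  have A': "form_matrix n ?r (\<lambda>k j. as ! j) A'" and B': "form_matrix ?m n (\<lambda>i k. ((y - x) # bs) ! i) B'"
    and split: "\<And>v. v \<in> P1 \<Longrightarrow> split_exact n ?m ?r (B' v) (A' v)" and 0: "\<sigma>' 0 = 0" "\<tau>' 0 = 0"
    and \<sigma>': "\<And>i. i < ?m \<Longrightarrow> \<sigma>' i < n" "\<And>i v. i < ?m \<Longrightarrow> B' v $$ (i, \<sigma>' i) = snd v ^ (((y - x) # bs) ! i)"
      "\<And>i i' v. i < i' \<Longrightarrow> i' < ?m \<Longrightarrow> B' v $$ (i', \<sigma>' i) = 0"
    and \<tau>': "\<And>j. j < ?r \<Longrightarrow> \<tau>' j < n" "\<And>j v. j < ?r \<Longrightarrow> A' v $$ (\<tau>' j, j) = fst v ^ (as ! j)"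
      "\<And>j j' v. j < j' \<Longrightarrow> j' < ?r \<Longrightarrow> A' v $$ (\<tau>' j, j') = 0"
    using sp unfolding special_pair_def by (auto simp: n_def)
  note AD = form_matrixD[OF A'] and BD = form_matrixD[OF B']
  have n0: "0 < n" by (simp add: n_def)
  have B'0: "B' v $$ (0, 0) = snd v ^ (y - x)" "0 < i \<Longrightarrow> i < ?m \<Longrightarrow> B' v $$ (i, 0) = 0" for i v
    using \<sigma>'(2)[of 0] \<sigma>'(3)[of 0 i] 0(1) by simp_all
  define S where "S v i = (if i = 0 then fst v ^ x else 1)" for v :: "'k \<times> 'k" and i :: nat
  define B where "B v = mat ?m (Suc n) (\<lambda>(i, k). if k = 0 then (if i = 0 then snd v ^ y else 0) else S v i * B' v $$ (i, k - 1))" for v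
  define A where "A v = mat (Suc n) (Suc ?r) (\<lambda>(k, j). if k = 0 then (if j = 0 then fst v ^ x else 0)
      else if j = 0 then (if k = 1 then - (snd v ^ x) else 0) else A' v $$ (k - 1, j - 1))" for v
  define \<sigma> where "\<sigma> i = (if i = 0 then 0 else Suc (\<sigma>' i))" for i
  define \<tau> where "\<tau> j = (if j = 0 then 0 else Suc (\<tau>' (j - 1)))" for j
  have B: "B v \<in> carrier_mat ?m (Suc n)" and A: "A v \<in> carrier_mat (Suc n) (Suc ?r)" for v by (simp_all add: A_def B_def)
  have B0: "B v $$ (i, 0) = (if i = 0 then snd v ^ y else 0)" and BS: "k < n \<Longrightarrow> B v $$ (i, Suc k) = S v i * B' v $$ (i, k)"
    if "i < ?m" for i k v using that by (simp_all add: B_def)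
  have A00: "A v $$ (0, j) = (if j = 0 then fst v ^ x else 0)" if "j < Suc ?r" for v j using that by (simp add: A_def)
  have AS: "A v $$ (Suc k, 0) = (if k = 0 then - (snd v ^ x) else 0)" "j < ?r \<Longrightarrow> A v $$ (Suc k, Suc j) = A' v $$ (k, j)"
    if "k < n" for k j v using that by (simp_all add: A_def)
  have formA: "form_matrix (Suc n) (Suc ?r) (\<lambda>k j. (x # as) ! j) A"
    unfolding form_matrix_def
  proof (intro conjI allI impI A)
    fix k j assume kj: "k < Suc n" "j < Suc ?r"
    show "binary_form ((x # as) ! j) (\<lambda>v. A v $$ (k, j))"
    proof (cases k)
      case 0
      then show ?thesis using kj A00 form_fst_power[of x] form.zero by (cases "j = 0") simp_all
    next
      case (Suc k')
      then have k': "k' < n" using kj by simp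
      show ?thesis
      proof (cases j)
        case 0
        then show ?thesis using AS(1)[OF k'] Suc form.uminus[OF form_snd_power[of x]] form.zero by (cases "k' = 0") simp_all
      next
        case (Suc j')
        then show ?thesis using AS(2)[OF k', of j'] \<open>k = Suc k'\<close> AD(2)[OF k', of j'] kj by simp
      qed
    qed
  qed
  have formB: "form_matrix ?m (Suc n) (\<lambda>i k. (y # bs) ! i) B"
    unfolding form_matrix_def
  proof (intro conjI allI impI B)
    fix i k assume ik: "i < ?m" "k < Suc n"
    show "binary_form ((y # bs) ! i) (\<lambda>v. B v $$ (i, k))"
    proof (cases k)
      case 0
      then show ?thesis using B0[OF ik(1)] form_snd_power[of y] form.zero by (cases "i = 0") simp_all
    next
      case (Suc k')
      then have k': "k' < n" using ik by simp
      show ?thesis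
      proof (cases i)
        case 0
        have "binary_form (x + (y - x)) (\<lambda>v. fst v ^ x * B' v $$ (0, k'))"
          using BD(2)[of 0 k'] k' by (intro form.mult form_fst_power) simp
        then show ?thesis using BS[OF ik(1) k'] Suc 0 xy by (simp add: S_def)
      next
        case (Suc i')
        then show ?thesis using BS[OF ik(1) k'] \<open>k = Suc k'\<close> BD(2)[OF ik(1) k'] by (simp add: S_def)
      qed
    qed
  qed
  have splitv: "split_exact (Suc n) ?m (Suc ?r) (B v) (A v)" if v: "v \<in> P1" for v
  proof -
    obtain R' where R': "R' \<in> carrier_mat n ?m" "B' v * R' = 1\<^sub>m ?m" using split[OF v] unfolding split_exact_def by blast
    have B'A': "B' v * A' v = 0\<^sub>m ?m ?r" using split[OF v] unfolding split_exact_def by blast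
    obtain p q where pq: "snd v ^ y * p + fst v ^ x * q = 1" by (rule P1_unit_combination[OF v])
    define R where "R = mat (Suc n) ?m (\<lambda>(k, j). if k = 0 then (if j = 0 then p else 0) else R' $$ (k - 1, j) * (if j = 0 then q else 1))"
    have R: "R \<in> carrier_mat (Suc n) ?m" by (simp add: R_def)
    have BR: "B v * R = 1\<^sub>m ?m"
    proof (rule eq_matI)
      fix i j assume "i < dim_row (1\<^sub>m ?m :: 'k mat)" "j < dim_col (1\<^sub>m ?m :: 'k mat)"
      then have ij: "i < ?m" "j < ?m" by simp_all
      have "(B v * R) $$ (i, j) = B v $$ (i, 0) * R $$ (0, j) + (\<Sum>k<n. B v $$ (i, Suc k) * R $$ (Suc k, j))"
        unfolding mat_mult_entry[OF B R ij] by (rule sum.lessThan_Suc_shift)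
      also have "(\<Sum>k<n. B v $$ (i, Suc k) * R $$ (Suc k, j)) = (\<Sum>k<n. S v i * (if j = 0 then q else 1) * (B' v $$ (i, k) * R' $$ (k, j)))"
        using ij by (intro sum.cong) (simp_all add: BS R_def)
      also have "\<dots> = S v i * (if j = 0 then q else 1) * (B' v * R') $$ (i, j)"
        unfolding mat_mult_entry[OF BD(1) R'(1) ij] sum_distrib_left ..
      finally show "(B v * R) $$ (i, j) = 1\<^sub>m ?m $$ (i, j)"
        using ij pq R'(2) by (auto simp: B0 R_def S_def)
    qed (use B[of v] R in auto)
    have inj: "mat_injective (A v)"
    proof (rule mat_injectiveI[OF A])
      fix z assume z: "z \<in> carrier_vec (Suc ?r)" and Az: "A v *\<^sub>v z = 0\<^sub>v (Suc n)"
      have row: "(\<Sum>j<Suc ?r. A v $$ (k, j) * z $ j) = 0" if "k < Suc n" for k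
        using arg_cong[OF Az, of "\<lambda>w. w $ k"] that A[of v] z by (simp add: scalar_prod_def atLeast0LessThan del: sum.lessThan_Suc)
      have row0: "fst v ^ x * z $ 0 = 0" using row[of 0] by (simp add: sum.lessThan_Suc_shift A00 del: sum.lessThan_Suc)
      define z' where "z' = vec ?r (\<lambda>j. z $ Suc j)"
      have z': "z' \<in> carrier_vec ?r" by (simp add: z'_def)
      have rows: "(A' v *\<^sub>v z') $ k = (if k = 0 then snd v ^ x * z $ 0 else 0)" if k: "k < n" for k
      proof -
        have "A v $$ (Suc k, 0) * z $ 0 + (\<Sum>j<?r. A' v $$ (k, j) * z $ Suc j) = 0"
          using row[of "Suc k"] k by (simp add: sum.lessThan_Suc_shift AS(2) del: sum.lessThan_Suc)
        moreover have "(A' v *\<^sub>v z') $ k = (\<Sum>j<?r. A' v $$ (k, j) * z $ Suc j)"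
          using k AD(1)[of v] by (simp add: z'_def scalar_prod_def atLeast0LessThan)
        ultimately have "(A' v *\<^sub>v z') $ k = - (A v $$ (Suc k, 0) * z $ 0)" by (metis add_eq_0_iff)
        then show ?thesis by (simp add: AS(1)[OF k])
      qed
      have "0 = (B' v *\<^sub>v (A' v *\<^sub>v z')) $ 0"
        using mult_mat_vec_zero[OF BD(1) AD(1) B'A' z'] by simp
      also have "\<dots> = (\<Sum>k<n. B' v $$ (0, k) * (A' v *\<^sub>v z') $ k)"
        using BD(1)[of v] AD(1)[of v] by (simp add: scalar_prod_def atLeast0LessThan)
      also have "\<dots> = (\<Sum>k<n. if k = 0 then B' v $$ (0, 0) * (snd v ^ x * z $ 0) else 0)"
        using rows by (intro sum.cong) auto
      also have "\<dots> = (snd v ^ (y - x) * snd v ^ x) * z $ 0" using n0 by (simp add: B'0(1))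
      also have "\<dots> = snd v ^ y * z $ 0" unfolding power_add[symmetric] using xy by simp
      finally have col0: "snd v ^ y * z $ 0 = 0" by simp
      have "z $ 0 = (snd v ^ y * p + fst v ^ x * q) * z $ 0" using pq by simp
      also have "\<dots> = p * (snd v ^ y * z $ 0) + q * (fst v ^ x * z $ 0)" by (simp add: algebra_simps)
      finally have z0: "z $ 0 = 0" using row0 col0 by simp
      have "A' v *\<^sub>v z' = 0\<^sub>v n" using rows z0 AD(1)[of v] by (intro eq_vecI) auto
      then have zero: "z' = 0\<^sub>v ?r" by (rule mat_injectiveD[OF split_exact_mat_injective[OF split[OF v]] AD(1) z'])
      have zS: "z $ Suc j = 0" if "j < ?r" for j using arg_cong[OF zero, of "\<lambda>w. w $ j"] that by (simp add: z'_def)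
      show "z = 0\<^sub>v (Suc ?r)"
      proof (rule eq_vecI)
        fix j assume "j < dim_vec (0\<^sub>v (Suc ?r) :: 'k vec)"
        then show "z $ j = 0\<^sub>v (Suc ?r) $ j" using z0 zS by (cases j) simp_all
      qed (use z in simp)
    qed
    have BA: "B v * A v = 0\<^sub>m ?m (Suc ?r)"
    proof (rule eq_matI)
      fix i j assume "i < dim_row (0\<^sub>m ?m (Suc ?r) :: 'k mat)" "j < dim_col (0\<^sub>m ?m (Suc ?r) :: 'k mat)"
      then have ij: "i < ?m" "j < Suc ?r" by simp_all
      have e: "(B v * A v) $$ (i, j) = B v $$ (i, 0) * A v $$ (0, j) + (\<Sum>k<n. B v $$ (i, Suc k) * A v $$ (Suc k, j))"
        unfolding mat_mult_entry[OF B A ij] by (rule sum.lessThan_Suc_shift)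
      show "(B v * A v) $$ (i, j) = 0\<^sub>m ?m (Suc ?r) $$ (i, j)"
      proof (cases j)
        case 0
        have "(\<Sum>k<n. B v $$ (i, Suc k) * A v $$ (Suc k, j)) = (\<Sum>k<n. if k = 0 then - (S v i * B' v $$ (i, 0) * snd v ^ x) else 0)"
          using ij 0 by (intro sum.cong) (auto simp: BS AS(1))
        also have "\<dots> = - (S v i * B' v $$ (i, 0) * snd v ^ x)" using n0 by simp
        finally have e0: "(B v * A v) $$ (i, j) = B v $$ (i, 0) * fst v ^ x - S v i * B' v $$ (i, 0) * snd v ^ x"
          unfolding e using 0 by (simp add: A00)
        have "snd v ^ (y - x) * snd v ^ x = snd v ^ y" unfolding power_add[symmetric] using xy by simp
        then show ?thesis using e0 ij B'0(1)[of v] B'0(2)[of i v] by (cases "i = 0") (simp_all add: B0 S_def mult_ac)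
      next
        case (Suc j')
        have "(\<Sum>k<n. B v $$ (i, Suc k) * A v $$ (Suc k, j)) = S v i * (B' v * A' v) $$ (i, j')"
          using ij Suc mat_mult_entry[OF BD(1) AD(1), of i j'] by (simp add: BS AS(2) sum_distrib_left mult.assoc)
        then show ?thesis unfolding e using ij Suc B'A' by (simp add: A00)
      qed
    qed (use A[of v] B[of v] in auto)
    show ?thesis by (rule split_exact_square[OF _ B A R BR inj BA]) (simp add: n_def)
  qed
  have "special_pair (x # as) (y # bs) A B \<sigma> \<tau>"
  proof -
    have N: "length (y # bs) + length (x # as) = Suc n" by (simp add: n_def)
    have "\<sigma> i < Suc n \<and> (\<forall>v. B v $$ (i, \<sigma> i) = snd v ^ ((y # bs) ! i)) \<and> (\<forall>i'>i. i' < ?m \<longrightarrow> (\<forall>v. B v $$ (i', \<sigma> i) = 0))"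
      if i: "i < ?m" for i
    proof (cases "i = 0")
      case True
      then show ?thesis by (simp add: \<sigma>_def B0)
    next
      case False
      then obtain i0 where i0: "i = Suc i0" by (cases i) auto
      show ?thesis using i \<sigma>'(1,2)[OF i] \<sigma>'(3)[of i] False by (auto simp: \<sigma>_def BS S_def i0)
    qed
    moreover have "\<tau> j < Suc n \<and> (\<forall>v. A v $$ (\<tau> j, j) = fst v ^ ((x # as) ! j)) \<and> (\<forall>j'>j. j' < Suc ?r \<longrightarrow> (\<forall>v. A v $$ (\<tau> j, j') = 0))"
      if j: "j < Suc ?r" for j
    proof (cases j)
      case 0
      then show ?thesis by (simp add: \<tau>_def A00)
    next
      case (Suc j0)
      then have j0: "j0 < ?r" using j by simp
      have "A v $$ (Suc (\<tau>' j0), j') = 0" if j': "Suc j0 < j'" "j' < Suc ?r" for j' v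
      proof -
        obtain j1 where j1: "j' = Suc j1" using j'(1) by (cases j') auto
        then show ?thesis using j' \<tau>'(1)[OF j0] \<tau>'(3)[of j0 j1] by (simp add: AS(2))
      qed
      then show ?thesis using Suc j0 \<tau>'(1,2)[OF j0] by (simp add: \<tau>_def AS(2))
    qed
    ultimately show ?thesis
      unfolding special_pair_def N using formA formB splitv by (simp add: \<sigma>_def \<tau>_def del: split_paired_All)
  qed
  then show ?thesis by blast
qed

text \<open>
  The smaller one of the two leading degrees is split off and subtracted from the other one, as in the Euclidean algorithm.
\<close>

lemma special_pair_exists:
  assumes "sum_list a = sum_list b"
  shows "\<exists>A B \<sigma> \<tau>. special_pair a b (A :: 'k::field \<times> 'k \<Rightarrow> 'k mat) B \<sigma> \<tau>"
  using assms
proof (induction "length a + length b" arbitrary: a b rule: less_induct)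
  case less
  show ?case
  proof (cases a)
    case Nil
    then show ?thesis using special_pair_base[of b] less.prems by (intro exI) simp
  next
    case (Cons x as)
    show ?thesis
    proof (cases b)
      case Nil
      then show ?thesis using special_pair_swap[OF special_pair_base[of a]] less.prems by (intro exI) simp
    next
      case b: (Cons y bs)
      show ?thesis
      proof (cases "x \<le> y")
        case True
        have "\<exists>A B \<sigma> \<tau>. special_pair as ((y - x) # bs) (A :: 'k \<times> 'k \<Rightarrow> 'k mat) B \<sigma> \<tau>"
          using less.prems True by (intro less.hyps) (simp_all add: Cons b)
        then show ?thesis unfolding Cons b using special_pair_step[OF _ True] by blast
      next
        case False
        then have le: "y \<le> x" by simp
        have "\<exists>A B \<sigma> \<tau>. special_pair bs ((x - y) # as) (A :: 'k \<times> 'k \<Rightarrow> 'k mat) B \<sigma> \<tau>"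
          using less.prems le by (intro less.hyps) (simp_all add: Cons b)
        then have "\<exists>A B \<sigma> \<tau>. special_pair (y # bs) (x # as) (A :: 'k \<times> 'k \<Rightarrow> 'k mat) B \<sigma> \<tau>"
          using special_pair_step[OF _ le] by blast
        then show ?thesis unfolding Cons b using special_pair_swap by blast
      qed
    qed
  qed
qed

section \<open>The intersection of the splitting loci\<close>

text \<open>
  The matrices of the two splittings are found independently. They fit into an exact sequence as \<open>B\<close> kills the image of \<open>A\<close>
  and the ranks add up to \<open>n\<close>.
\<close>

lemma loci_intersection_matrices:
  fixes f :: "'k::{alg_closed_field, field_char_0} grass_map"
  assumes f: "f \<in> locus_quot e r n b" "f \<in> locus_sub e r n a"
    and a: "length a = r" and b: "length b = m" and n: "n = m + r" and r: "r > 0"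
  shows "\<exists>A B. form_matrix n r (\<lambda>k j. a ! j) A \<and> form_matrix m n (\<lambda>i k. b ! i) B \<and>
    (\<forall>v\<in>P1. f v = mat_image (A v) \<and> split_exact n m r (B v) (A v))"
proof -
  obtain A where A: "form_matrix n r (\<lambda>k j. a ! j) A" "\<And>v. v \<in> P1 \<Longrightarrow> f v = mat_image (A v)"
    "\<And>v. v \<in> P1 \<Longrightarrow> mat_injective (A v)"
    using locus_sub_matrix[OF f(2) a r] by metis
  have n0: "n > 0" using n r by simp
  obtain B where B: "form_matrix m n (\<lambda>i k. b ! i) B" "\<And>v x. v \<in> P1 \<Longrightarrow> x \<in> f v \<Longrightarrow> B v *\<^sub>v x = 0\<^sub>v m"
    "\<And>v. v \<in> P1 \<Longrightarrow> \<exists>R\<in>carrier_mat n m. B v * R = 1\<^sub>m m"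
    using locus_quot_matrix[OF f(1) b n0] by metis
  note AD = form_matrixD(1)[OF A(1)] and BD = form_matrixD(1)[OF B(1)]
  have "split_exact n m r (B v) (A v)" if v: "v \<in> P1" for v
  proof -
    obtain R where R: "R \<in> carrier_mat n m" "B v * R = 1\<^sub>m m" using B(3)[OF v] by blast
    have "B v * A v = 0\<^sub>m m r"
    proof (rule eq_matI)
      fix i j assume "i < dim_row (0\<^sub>m m r :: 'k mat)" "j < dim_col (0\<^sub>m m r :: 'k mat)"
      then have ij: "i < m" "j < r" by simp_all
      have "A v *\<^sub>v unit_vec r j \<in> mat_image (A v)" by (rule mat_imageI[OF AD unit_vec_carrier])
      then have "B v *\<^sub>v col (A v) j = 0\<^sub>v m"
        using B(2)[OF v] A(2)[OF v] mat_mult_unit_vec[OF AD ij(2), of v] by simp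
      then have "(B v *\<^sub>v col (A v) j) $ i = 0" using ij by simp
      then show "(B v * A v) $$ (i, j) = 0\<^sub>m m r $$ (i, j)" using ij AD[of v] BD[of v] by simp
    qed (use AD[of v] BD[of v] in auto)
    then show ?thesis by (rule split_exact_square[OF n BD AD R A(3)[OF v]])
  qed
  then show ?thesis using A(1,2) B(1) by blast
qed

lemma special_point:
  fixes a b :: "nat list"
  assumes a: "length a = r" "sum_list a = e" and b: "length b = m" "sum_list b = e" and n: "n = m + r" and r: "r > 0"
  shows "\<exists>f \<in> (locus_quot e r n b \<inter> locus_sub e r n a :: 'k::{alg_closed_field, field_char_0} grass_map set).
    transverse_at e r n (locus_quot e r n b) (locus_sub e r n a) f"
proof -
  obtain A B :: "'k \<times> 'k \<Rightarrow> 'k mat" and \<sigma> \<tau> where sp: "special_pair a b A B \<sigma> \<tau>"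
    using special_pair_exists[of a b] a b by auto
  have A: "form_matrix n r (\<lambda>k j. a ! j) A" and B: "form_matrix m n (\<lambda>i k. b ! i) B"
    and split: "\<And>v. v \<in> P1 \<Longrightarrow> split_exact n m r (B v) (A v)"
    and \<sigma>: "\<And>i. i < m \<Longrightarrow> \<sigma> i < n" "\<And>i v. i < m \<Longrightarrow> B v $$ (i, \<sigma> i) = snd v ^ (b ! i)"
      "\<And>i i' v. i < i' \<Longrightarrow> i' < m \<Longrightarrow> B v $$ (i', \<sigma> i) = 0"
    and \<tau>: "\<And>j. j < r \<Longrightarrow> \<tau> j < n" "\<And>j v. j < r \<Longrightarrow> A v $$ (\<tau> j, j) = fst v ^ (a ! j)"
      "\<And>j j' v. j < j' \<Longrightarrow> j' < r \<Longrightarrow> A v $$ (\<tau> j, j') = 0"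
    using sp a(1) b(1) n unfolding special_pair_def by auto
  define f where "f = (\<lambda>v\<in>P1. mat_image (A v))"
  have inj: "mat_injective (A v)" if "v \<in> P1" for v by (rule split_exact_mat_injective[OF split[OF that]])
  have sub: "f \<in> locus_sub e r n a" unfolding f_def by (rule locus_subI[OF A inj a])
  have "f = (\<lambda>v\<in>P1. {x \<in> carrier_vec n. B v *\<^sub>v x = 0\<^sub>v m})"
    unfolding f_def using split_exact_kernel[OF split] by (intro restrict_ext) simp
  moreover have "(\<lambda>v\<in>P1. {x \<in> carrier_vec n. B v *\<^sub>v x = 0\<^sub>v m}) \<in> locus_quot e r n b"
    using split by (intro locus_quotI[OF B _ n r b]) blast
  ultimately have quot: "f \<in> locus_quot e r n b" by simp
  have "transverse_at e r n (locus_quot e r n b) (locus_sub e r n a) f"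
  proof (rule transverse_at_criterion[OF a b r A B split _ quot sub])
    show "f v = mat_image (A v)" if "v \<in> P1" for v using that by (simp add: f_def)
    fix C :: "'k \<times> 'k \<Rightarrow> 'k mat" assume "form_matrix m r (\<lambda>i j. b ! i + a ! j) C"
    from decomposition_triangular[OF A B \<sigma> \<tau> this]
    show "\<exists>A' B'. form_matrix n r (\<lambda>k j. a ! j) A' \<and> form_matrix m n (\<lambda>i k. b ! i) B' \<and>
        (\<forall>v\<in>P1. C v = B v * A' v + B' v * A v)" by blast
  qed
  then show ?thesis using sub quot by blast
qed

lemma transverse_at_balanced:
  fixes f :: "'k::{alg_closed_field, field_char_0} grass_map"
  assumes f: "f \<in> locus_quot e r n b" "f \<in> locus_sub e r n a"
    and a: "length a = r" "sum_list a = e" and b: "length b = m" "sum_list b = e" and n: "n = m + r" and r: "r > 0"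
    and balanced: "balanced a \<or> balanced b"
  shows "transverse_at e r n (locus_quot e r n b) (locus_sub e r n a) f"
proof -
  obtain A B where A: "form_matrix n r (\<lambda>k j. a ! j) A" and B: "form_matrix m n (\<lambda>i k. b ! i) B"
    and im: "\<And>v. v \<in> P1 \<Longrightarrow> f v = mat_image (A v)" and split: "\<And>v. v \<in> P1 \<Longrightarrow> split_exact n m r (B v) (A v)"
    using loci_intersection_matrices[OF f a(1) b(1) n r] by blast
  note AD = form_matrixD(1)[OF A] and BD = form_matrixD(1)[OF B]
  have le: "xs ! j \<le> xs ! j' + 1" if "balanced xs" "j < length xs" "j' < length xs" for xs j j'
    using that unfolding balanced_def by (metis diff_le_eq nth_mem of_nat_1 of_nat_add of_nat_le_iff add.commute)
  show ?thesis
  proof (rule transverse_at_criterion[OF a b r A B split im f])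
    fix C :: "'k \<times> 'k \<Rightarrow> 'k mat" assume C: "form_matrix m r (\<lambda>i j. b ! i + a ! j) C"
    have zero: "form_matrix p q deg (\<lambda>v :: 'k \<times> 'k. 0\<^sub>m p q)" for p q deg by (simp add: form_matrix_def form.zero)
    from balanced show "\<exists>A' B'. form_matrix n r (\<lambda>k j. a ! j) A' \<and> form_matrix m n (\<lambda>i k. b ! i) B' \<and>
        (\<forall>v\<in>P1. C v = B v * A' v + B' v * A v)"
    proof
      assume "balanced a"
      then have "\<And>j j'. j < r \<Longrightarrow> j' < r \<Longrightarrow> a ! j \<le> a ! j' + 1" using le a(1) by blast
      from decomposition_sub_balanced[where \<alpha> = "\<lambda>j. a ! j", OF A B split this C]
      obtain A' where A': "form_matrix n r (\<lambda>k j. a ! j) A'" "\<And>v. C v = B v * A' v" by blast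
      have "C v = B v * A' v + 0\<^sub>m m n * A v" for v
        unfolding A'(2) using AD[of v] BD[of v] form_matrixD(1)[OF A'(1), of v] by (intro eq_matI) auto
      then show ?thesis using A'(1) zero by (intro exI conjI ballI)
    next
      assume "balanced b"
      then have "\<And>i i'. i < m \<Longrightarrow> i' < m \<Longrightarrow> b ! i \<le> b ! i' + 1" using le b(1) by blast
      from decomposition_quot_balanced[where \<beta> = "\<lambda>i. b ! i", OF A B split this C]
      obtain B' where B': "form_matrix m n (\<lambda>i k. b ! i) B'" "\<And>v. C v = B' v * A v" by blast
      have "C v = B v * 0\<^sub>m n r + B' v * A v" for v
        unfolding B'(2) using AD[of v] BD[of v] form_matrixD(1)[OF B'(1), of v] by (intro eq_matI) auto
      then show ?thesis using B'(1) zero by (intro exI conjI ballI)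
    qed
  qed
qed

theorem theorem22:
  fixes n r e :: nat and a b :: "nat list"
  assumes "n \<ge> 4" and "2 \<le> r" and "r \<le> n - 2" and "e \<ge> 1"
    and "length a = r" and "sorted_wrt (\<ge>) a" and "sum_list a = e"
    and "length b = n - r" and "sorted_wrt (\<le>) b" and "sum_list b = e"
  shows "locus_quot e r n b \<inter> locus_sub e r n a
      \<noteq> ({} :: 'k::{alg_closed_field, field_char_0} grass_map set) \<and>
    generically_transverse e r n
      (locus_quot e r n b :: 'k grass_map set) (locus_sub e r n a) \<and>
    (balanced a \<or> balanced b \<longrightarrow>
      transverse e r n (locus_quot e r n b :: 'k grass_map set) (locus_sub e r n a))"
proof -
  have n: "n = (n - r) + r" and r: "r > 0" using assms(1-3) by auto
  obtain f where "f \<in> (locus_quot e r n b \<inter> locus_sub e r n a :: 'k grass_map set)"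
    "transverse_at e r n (locus_quot e r n b) (locus_sub e r n a) f"
    using special_point[OF assms(5,7,8,10) n r, where 'k = 'k] by blast
  moreover have "transverse e r n (locus_quot e r n b :: 'k grass_map set) (locus_sub e r n a)"
    if "balanced a \<or> balanced b"
    unfolding transverse_def using transverse_at_balanced[OF _ _ assms(5,7,8,10) n r that] by blast
  ultimately show ?thesis unfolding generically_transverse_def by blast
qed

end
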